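(* Let $C>0$ with $C\neq\pi/4$, and let $\alpha$ tend to zero along a sequence $(\alpha_k)$ with $r(\alpha_k)=C\alpha_k$. As $\alpha$ tends to zero, the time optimal synthesis associated to $(\Lambda)_\alpha$ inside $\sigma_\alpha$ is characterized by an overlap curve $(Seg)_C^\alpha$, converging to $(Seg)_C$ in the $C^0$ topology; above $(Seg)_C^\alpha$ the control $u$ takes the constant value $-1$ and below $(Seg)_C^\alpha$ it is equal to $1$. Moreover, there exist only two time optimal trajectories reaching the origin and, in the case $C<\pi/4$, these trajectories start from $D^{+}(\alpha)$ and $D^-(\alpha)$, the double points of $\mathcal L_\alpha$.
   Context: For $\alpha\in(0,\pi/4)$ set $$F=\begin{pmatrix}0&-\cos\alpha&0\\ \cos\alpha&0&0\\0&0&0\end{pmatrix},\quad G=\begin{pmatrix}0&0&0\\0&0&-\sin\alpha\\0&\sin\alpha&0\end{pmatrix},\quad X_\pm=F\pm G,\quad N=(0,0,1)^T,$$ and let $(\Sigma)_\alpha$ be the system $\dot x=(F+uG)x$ on $S^2$, $|u|\le1$. Put $k_M=[\pi/(2\alpha)]$ (integer part), $r(\alpha)=\pi/(2\alpha)-k_M$, $v(s)=\pi+2\arctan\frac{\sin s}{\cos s+\cot^2\alpha}$. Assume $k_M$ odd (the even case being analogous) and for $s\in[0,\pi]$ let $$\mathcal E^+(\alpha,s)=e^{(k_M\pi-(k_M-1)v(s)-s)X_-}\big(e^{v(s)X_+}e^{v(s)X_-}\big)^{(k_M-1)/2}e^{sX_+}N,\qquad \mathcal E^-(\alpha,s)=\mathrm{Diag}(-1,-1,1)\,\mathcal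 E^+(\alpha,s).$$ The union of these two curves is the extremal front at time $k_M\pi$ (points reached at time $k_M\pi$ by trajectories from $N$ satisfying the Pontryagin Maximum Principle). $N_\alpha:\mathbb R^3\to\mathbb R^2$ is $(x_1,x_2,x_3)\mapsto(x_1,x_2)$ followed by the dilation by $1/\alpha^2$. The curve $\mathcal L_\alpha:[0,2\pi]\to\mathbb R^2$ is $\mathcal L_\alpha(s)=N_\alpha\mathcal E^+(\alpha,s)$ for $s\in[0,\pi]$ and $\mathcal L_\alpha(s)=N_\alpha\mathcal E^-(\alpha,s-\pi)$ for $s\in[\pi,2\pi]$. As $\alpha\to0$ it converges to $$\mathcal L(s)=\Big(\cos s\,(-2C+\tfrac{\pi}{2}\sin^2 s),\ \sin s\,(\pi+2C-\tfrac{\pi}{2}\sin^2 s)\Big).$$ If $C<\pi/4$, let $\theta_d\in(0,\pi/2)$ with $\sin\theta_d=2\sqrt{C/\pi}$, $s_1^+=\theta_d$, $s_2^+=\pi-\theta_d$, $s_1^-=\pi+\theta_d$, $s_2^-=2\pi-\theta_d$; then $\mathcal L(s_1^\pm)=\mathcal L(s_2^\pm)$, and for $\alpha$ small $\mathcal L_\alpha$ has double points $D^\pm(\alpha)=\mathcal L_\alpha(s_1^\pm(\alpha))=\mathcal L_\alpha(s_2^\pm(\alpha))$ with $s_i^\pm(\alpha)\to s_i^\pm$. In this case $\sigma_\alpha$ is the closed curve obtained by restricting $\mathcal L_\alpha$ to $[0,s_1^+(\alpha)]\cup[s_2^+(\alpha),s_1^-(\alpha)]\cup[s_2^-(\alpha),2\pi]$.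 If $C>\pi/4$, $\sigma_\alpha=\mathcal L_\alpha$. $(\Lambda)_\alpha$ is the image of $(\Sigma)_\alpha$ (near the south pole) by $N_\alpha$: $$\dot z_1=-\cos(\alpha) z_2,\qquad \dot z_2=\cos(\alpha) z_1+u\frac{\sin\alpha}{\alpha^2}\sqrt{1-\alpha^4\|z\|^2},\quad |u|\le1.$$ The time optimal synthesis associated to $(\Lambda)_\alpha$ inside $\sigma_\alpha$ is the collection of time optimal trajectories of $(\Lambda)_\alpha$ starting from $\sigma_\alpha$ and reaching the points of the region enclosed by $\sigma_\alpha$. An overlap curve is a connected $C^1$ manifold contained in the set of points reached at the same time by two or more time optimal trajectories. $(Seg)_C$ is the segment of the $z_1$-axis between $(-2C,0)$ and $(2C,0)$. "Above"/"below" the overlap curve refers to the two connected components of the region enclosed by $\sigma_\alpha$ minus the overlap curve. *)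

theory Defs
  imports "HOL-Analysis.Analysis"
begin

section \<open>The rotation flows on the sphere\<close>

definition matF :: "real \<Rightarrow> real^3^3" where
  "matF \<alpha> = vector [vector [0, - cos \<alpha>, 0], vector [cos \<alpha>, 0, 0], vector [0, 0, 0]]"

definition matG :: "real \<Rightarrow> real^3^3" where
  "matG \<alpha> = vector [vector [0, 0, 0], vector [0, 0, - sin \<alpha>], vector [0, sin \<alpha>, 0]]"

definition Xplus :: "real \<Rightarrow> real^3^3" where
  "Xplus \<alpha> = matF \<alpha> + matG \<alpha>"

definition Xminus :: "real \<Rightarrow> real^3^3" where
  "Xminus \<alpha> = matF \<alpha> - matG \<alpha>"

definition north :: "real^3" where
  "north = vector [0, 0, 1]"

text \<open>Multiplication and powers in the type class sense are componentwise on \<open>real^'n^'n\<close>,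
  so matrix powers and the matrix exponential are spelled out with \<open>**\<close>.\<close>

definition matpow :: "real^'n^'n \<Rightarrow> nat \<Rightarrow> real^'n^'n" where
  "matpow A n = ((\<lambda>B. A ** B) ^^ n) (mat 1)"

definition matexp :: "real^'n^'n \<Rightarrow> real^'n^'n" where
  "matexp A = (\<Sum>n. (1 / fact n) *\<^sub>R matpow A n)"


section \<open>The extremal front\<close>

definition kM :: "real \<Rightarrow> nat" where
  "kM \<alpha> = nat \<lfloor>pi / (2 * \<alpha>)\<rfloor>"

definition r_frac :: "real \<Rightarrow> real" where
  "r_frac \<alpha> = pi / (2 * \<alpha>) - real (kM \<alpha>)"

definition vtime :: "real \<Rightarrow> real \<Rightarrow> real" where
  "vtime \<alpha> s = pi + 2 * arctan (sin s / (cos s + (cot \<alpha>)\<^sup>2))"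

text \<open>The formula is meant for odd \<open>kM \<alpha>\<close>.\<close>

definition Eplus :: "real \<Rightarrow> real \<Rightarrow> real^3" where
  "Eplus \<alpha> s =
     (matexp ((real (kM \<alpha>) * pi - (real (kM \<alpha>) - 1) * vtime \<alpha> s - s) *\<^sub>R Xminus \<alpha>)
      ** matpow (matexp (vtime \<alpha> s *\<^sub>R Xplus \<alpha>) ** matexp (vtime \<alpha> s *\<^sub>R Xminus \<alpha>))
           ((kM \<alpha> - 1) div 2)
      ** matexp (s *\<^sub>R Xplus \<alpha>)) *v north"

definition Eminus :: "real \<Rightarrow> real \<Rightarrow> real^3" where
  "Eminus \<alpha> s =
     (vector [vector [-1, 0, 0], vector [0, -1, 0], vector [0, 0, 1]] :: real^3^3) *v Eplus \<alpha> s"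

definition Nproj :: "real \<Rightarrow> real^3 \<Rightarrow> real^2" where
  "Nproj \<alpha> x = (1 / \<alpha>\<^sup>2) *\<^sub>R vector [x $ 1, x $ 2]"

text \<open>Parametrised by \<open>[0, 2\<pi>]\<close>; the two branches agree at \<open>s = \<pi>\<close>.\<close>

definition Lcurve :: "real \<Rightarrow> real \<Rightarrow> real^2" where
  "Lcurve \<alpha> s = (if s \<le> pi then Nproj \<alpha> (Eplus \<alpha> s) else Nproj \<alpha> (Eminus \<alpha> (s - pi)))"

definition theta_d :: "real \<Rightarrow> real" where
  "theta_d C = arcsin (2 * sqrt (C / pi))"

text \<open>The arguments \<open>s1p, s2p, s1m, s2m\<close> are the parameters of the double points of
  \<open>Lcurve \<alpha>\<close>; they are relevant only if \<open>C < \<pi>/4\<close>.\<close>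

definition sigma_curve :: "real \<Rightarrow> real \<Rightarrow> real \<Rightarrow> real \<Rightarrow> real \<Rightarrow> real \<Rightarrow> (real^2) set" where
  "sigma_curve C \<alpha> s1p s2p s1m s2m =
     Lcurve \<alpha> ` (if C < pi / 4 then {0..s1p} \<union> {s2p..s1m} \<union> {s2m..2 * pi} else {0..2 * pi})"


section \<open>Time optimal trajectories of the planar system\<close>

definition field_Lambda :: "real \<Rightarrow> real \<Rightarrow> real^2 \<Rightarrow> real^2" where
  "field_Lambda \<alpha> u z =
     vector [- cos \<alpha> * z $ 2,
             cos \<alpha> * z $ 1 + u * (sin \<alpha> / \<alpha>\<^sup>2) * sqrt (1 - \<alpha>^4 * (norm z)\<^sup>2)]"

text \<open>Caratheodory solutions on \<open>[0, T]\<close> for measurable controls with values in \<open>[-1, 1]\<close>,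
  in integral form. The state is confined to the image of the open southern hemisphere,
  where the field is smooth. Curves are normalised to be \<open>undefined\<close> outside \<open>[0, T]\<close>,
  so that distinct functions represent distinct trajectories.\<close>

definition trajectory :: "real \<Rightarrow> real \<Rightarrow> (real \<Rightarrow> real^2) \<Rightarrow> (real \<Rightarrow> real) \<Rightarrow> bool" where
  "trajectory \<alpha> T z u \<longleftrightarrow>
     0 \<le> T \<and> z \<in> extensional {0..T} \<and> u \<in> borel_measurable (lebesgue_on {0..T}) \<and>
     (\<forall>t\<in>{0..T}. \<bar>u t\<bar> \<le> 1 \<and> \<alpha>\<^sup>2 * norm (z t) < 1 \<and>
        ((\<lambda>\<tau>. field_Lambda \<alpha> (u \<tau>) (z \<tau>)) has_integral (z t - z 0)) {0..t})"

definition time_optimal ::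
  "real \<Rightarrow> (real^2) set \<Rightarrow> real^2 \<Rightarrow> real \<Rightarrow> (real \<Rightarrow> real^2) \<Rightarrow> (real \<Rightarrow> real) \<Rightarrow> bool" where
  "time_optimal \<alpha> S p T z u \<longleftrightarrow>
     trajectory \<alpha> T z u \<and> z 0 \<in> S \<and> z T = p \<and>
     (\<forall>T' z' u'. trajectory \<alpha> T' z' u' \<and> z' 0 \<in> S \<and> z' T' = p \<longrightarrow> T \<le> T')"

definition optimal_trajectories ::
  "real \<Rightarrow> (real^2) set \<Rightarrow> real^2 \<Rightarrow> (real \<times> (real \<Rightarrow> real^2)) set" where
  "optimal_trajectories \<alpha> S p = {(T, z). \<exists>u. time_optimal \<alpha> S p T z u}"


section \<open>Overlap curves\<close>

text \<open>One-dimensional embedded \<open>C\<^sup>1\<close> submanifolds of the plane, described by local regular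
  parametrisations.\<close>

definition C1_curve :: "(real^2) set \<Rightarrow> bool" where
  "C1_curve M \<longleftrightarrow>
     (\<forall>p\<in>M. \<exists>U a b \<phi> \<phi>' \<psi>. open U \<and> p \<in> U \<and> a < b \<and>
        homeomorphism {a<..<b :: real} (M \<inter> U) \<phi> \<psi> \<and>
        (\<forall>t\<in>{a<..<b}. (\<phi> has_vector_derivative \<phi>' t) (at t) \<and> \<phi>' t \<noteq> 0) \<and>
        continuous_on {a<..<b} \<phi>')"

text \<open>All time optimal trajectories reaching a point \<open>p\<close> do so at the same (minimal) time.\<close>

definition overlap_curve :: "real \<Rightarrow> (real^2) set \<Rightarrow> (real^2) set \<Rightarrow> bool" where
  "overlap_curve \<alpha> S M \<longleftrightarrow>
     connected M \<and> C1_curve M \<and>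
     M \<subseteq> {p \<in> inside S. \<exists>x\<in>optimal_trajectories \<alpha> S p. \<exists>y\<in>optimal_trajectories \<alpha> S p. x \<noteq> y}"

text \<open>\<open>C\<^sup>0\<close> convergence of arcs, that is, uniform convergence of suitable parametrisations.
  The arcs are without end points: overlap curves end on \<open>S\<close>, where the minimal time is \<open>0\<close>.\<close>

definition converges_C0 :: "(nat \<Rightarrow> (real^2) set) \<Rightarrow> (real \<Rightarrow> real^2) \<Rightarrow> bool" where
  "converges_C0 M \<gamma>0 \<longleftrightarrow>
     (\<exists>\<gamma>. (\<forall>\<^sub>F k in sequentially. continuous_on {-1<..<1} (\<gamma> k) \<and> inj_on (\<gamma> k) {-1<..<1} \<and>
                                   \<gamma> k ` {-1<..<1} = M k) \<and>
          uniform_limit {-1<..<1} \<gamma> \<gamma>0 sequentially)"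

definition seg_param :: "real \<Rightarrow> real \<Rightarrow> real^2" where
  "seg_param C t = vector [2 * C * t, 0]"

text \<open>\<open>A\<close> and \<open>B\<close> are the two connected components of the region enclosed by \<open>S\<close> minus the
  curve \<open>M\<close>; \<open>A\<close> is the upper one. It is identified by the points of the region whose
  second coordinate exceeds all those of the curve (and likewise for \<open>B\<close>).\<close>

definition above_below ::
  "(real^2) set \<Rightarrow> (real^2) set \<Rightarrow> (real^2) set \<Rightarrow> (real^2) set \<Rightarrow> bool" where
  "above_below S M A B \<longleftrightarrow>
     A \<noteq> B \<and> components (inside S - M) = {A, B} \<and>
     {p \<in> inside S. \<forall>q\<in>M. q $ 2 < p $ 2} \<noteq> {} \<and> {p \<in> inside S. \<forall>q\<in>M. q $ 2 < p $ 2} \<subseteq> A \<and>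
     {p \<in> inside S. \<forall>q\<in>M. p $ 2 < q $ 2} \<noteq> {} \<and> {p \<in> inside S. \<forall>q\<in>M. p $ 2 < q $ 2} \<subseteq> B"

end

theory Submission
  imports Defs "HOL-Real_Asymp.Real_Asymp"
begin

text \<open>For a constant control the motion on the sphere is a rotation. In the chart, the height \<open>Hf\<close> over
  the axis of the rotation for \<open>u = -1\<close> is a first integral of this control, and the polar angle
  \<open>thf\<close> around the axis is a clock. Hence \<open>u = -1\<close> takes a point of the upper half of \<open>\<sigma>\<close> to \<open>z\<close> in time
  \<open>V z = Th - thf z\<close>, where \<open>Th\<close> is the angle of the point of the half at the level of \<open>z\<close>.
  Along an arbitrary trajectory both the loss against the clock and the drift of the level are proportional
  to \<open>1 + u\<close>; as \<open>Th\<close> depends on the level with a small Lipschitz constant (after an arcsine change of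
  scale, which absorbs the two ends of the half), a trajectory from the upper half needs at least the
  time \<open>V z\<close>, and equality forces \<open>u = -1\<close>. By central symmetry, the lower half leads to \<open>V (- z)\<close> and
  \<open>u = 1\<close>. The sign of \<open>V z - V (- z)\<close> therefore decides on the synthesis. This difference is strictly
  decreasing in the second coordinate, so that it vanishes on a graph, the overlap curve. The curve is close
  to the axis since the upper half is nearly invariant under reflection, and it is \<open>C\<^sup>1\<close> at the origin
  because it is invariant under \<open>z \<mapsto> - z\<close>.

  The hypotheses on the shape of the front follow from its closed form and from expansions
  that are uniform up to \<open>O(\<alpha>)\<close>. Near the fold they also show that the double points are unique.\<close>

section \<open>The extremal front in closed form\<close>

text \<open>The proof rests on a comparison of orders in \<alpha>. The circles followed for
  \<open>u = -1\<close> are nearly vertical in the chart. Raising \<open>z\<close> by h moves the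
  clock by about \<alpha> h, whereas the level moves only by O(\<alpha> h) and \<open>Th\<close>
  turns this into O(\<alpha>^2 h): hence the strict monotonicity. The obstacle for
  \<open>C < pi/4\<close> is the corner of the upper half at the double point, where
  \<open>Th\<close> may have two slopes. The double point has exactly the level of the origin, and
  the overlap curve meets this level at the origin only; so each half of the curve sees smooth
  branches, and the optimal trajectories to the origin start at the double points. For
  \<open>C > pi/4\<close> the half is cut artificially at a point on this level, so that both cases
  share one argument. All constants independent of \<alpha> are powers of one number
  \<open>K\<close>. The smallness \<open>1000000 * (K^30 * \<alpha>) \<le> 1\<close> is the square
  of \<open>1000 * (K^15 * sqrt \<alpha>) \<le> 1\<close>, which keeps a curve of height
  \<open>1000 * K^9 * sqrt \<alpha>\<close> below the double point.\<close>

lemma matpow_0 [simp]: "matpow A 0 = mat 1"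
  and matpow_Suc: "matpow A (Suc n) = A ** matpow A n"
  by (simp_all add: matpow_def)

section \<open>Matrix algebra and the exponentials of the two rotation generators\<close>

lemma matrix_mul_scaleR_right: "A ** (k *\<^sub>R (B :: real^'n^'n)) = k *\<^sub>R (A ** B)"
  by (simp add: matrix_matrix_mult_def vec_eq_iff sum_distrib_left algebra_simps)

lemma matrix_mul_scaleR_left: "(k *\<^sub>R A) ** (B :: real^'n^'n) = k *\<^sub>R (A ** B)"
  by (simp add: matrix_matrix_mult_def vec_eq_iff sum_distrib_left algebra_simps)

lemma matrix_mul_diff_right: "A ** ((B :: real^'n^'n) - C) = A ** B - A ** C"
  by (simp add: matrix_matrix_mult_def vec_eq_iff sum_subtractf algebra_simps)

lemma matrix_mul_minus_right: "A ** (- (B :: real^'n^'n)) = - (A ** B)"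
  by (simp add: matrix_matrix_mult_def vec_eq_iff sum_negf)

lemma matrix_mul_add_left: "((A :: real^'n^'n) + B) ** C = A ** C + B ** C"
  by (simp add: matrix_matrix_mult_def vec_eq_iff sum.distrib algebra_simps)

lemma matrix_mul_diff_left: "((A :: real^'n^'n) - B) ** C = A ** C - B ** C"
  by (simp add: matrix_matrix_mult_def vec_eq_iff sum_subtractf algebra_simps)

text \<open>Rewrite rules that eliminate squares of sines; the second one catches them inside a
  right-nested product, the form in which \<open>algebra_simps\<close> leaves them.\<close>

lemma sin_mult_self: "sin a * sin a = 1 - cos a * cos (a :: real)"
  "sin a * (sin a * x) = x - cos a * (cos a * x)"
proof -
  show *: "sin a * sin a = 1 - cos a * cos a"
    using sin_cos_squared_add3[of a] by linarith
  then show "sin a * (sin a * x) = x - cos a * (cos a * x)"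
    by (simp add: left_diff_distrib flip: mult.assoc)
qed

lemma matpow_scaleR: "matpow (k *\<^sub>R A) n = k ^ n *\<^sub>R matpow (A :: real^'n^'n) n"
  by (induction n) (simp_all add: matpow_Suc matrix_mul_scaleR_left matrix_mul_scaleR_right)

text \<open>The powers run cyclically through \<open>A\<close>, \<open>A ** A\<close>,
  \<open>- A\<close>, \<open>- (A ** A)\<close>, which are the sign patterns of the sine and cosine
  series. Only the term of order zero does not fit: \<open>cos_coeff 0 = 1\<close> would give
  \<open>- (A ** A)\<close> instead of \<open>mat 1\<close>, hence the correction.\<close>

lemma matpow_cube:
  fixes A :: "real^'n^'n"
  assumes "A ** (A ** A) = - A"
  shows "(1 / fact n) *\<^sub>R matpow A n =
    (if n = 0 then mat 1 + A ** A else 0) + sin_coeff n *\<^sub>R A - cos_coeff n *\<^sub>R (A ** A)"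
proof (induction n)
  case 0
  then show ?case by simp
next
  case (Suc n)
  have "(1 / fact (Suc n)) *\<^sub>R matpow A (Suc n) = (1 / Suc n) *\<^sub>R (A ** ((1 / fact n) *\<^sub>R matpow A n))"
    by (simp add: matpow_Suc matrix_mul_scaleR_right field_simps)
  also have "\<dots> = (1 / Suc n) *\<^sub>R (sin_coeff n *\<^sub>R (A ** A) + cos_coeff n *\<^sub>R A)"
    unfolding Suc.IH using assms
    by (auto simp: matrix_add_ldistrib matrix_mul_diff_right matrix_mul_scaleR_right)
  finally show ?case
    by (simp add: sin_coeff_Suc cos_coeff_Suc scaleR_add_right)
qed

text \<open>Rodrigues' formula: the relation between the cube and \<open>- A\<close> is that of the
  generator of a rotation with unit speed.\<close>

lemma matexp_rodrigues:
  fixes A :: "real^'n^'n"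
  assumes "A ** (A ** A) = - A"
  shows "matexp (t *\<^sub>R A) = mat 1 + sin t *\<^sub>R A + (1 - cos t) *\<^sub>R (A ** A)"
proof -
  have "(\<lambda>n. (if n = 0 then mat 1 + A ** A else 0) + (sin_coeff n * t ^ n) *\<^sub>R A
           - (cos_coeff n * t ^ n) *\<^sub>R (A ** A))
        sums ((mat 1 + A ** A) + sin t *\<^sub>R A - cos t *\<^sub>R (A ** A))"
    using sin_converges[of t] cos_converges[of t] sums_single[of 0 "\<lambda>_. mat 1 + A ** A"]
    by (intro sums_add sums_diff sums_scaleR_left) (auto simp: if_distrib cong: if_cong)
  moreover have "(1 / fact n) *\<^sub>R matpow (t *\<^sub>R A) n = (if n = 0 then mat 1 + A ** A else 0)
      + (sin_coeff n * t ^ n) *\<^sub>R A - (cos_coeff n * t ^ n) *\<^sub>R (A ** A)" for n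
    using arg_cong[OF matpow_cube[OF assms, of n], of "\<lambda>B. t ^ n *\<^sub>R B"]
    by (auto simp: matpow_scaleR algebra_simps)
  ultimately have "(\<lambda>n. (1 / fact n) *\<^sub>R matpow (t *\<^sub>R A) n)
      sums ((mat 1 + A ** A) + sin t *\<^sub>R A - cos t *\<^sub>R (A ** A))"
    by simp
  from sums_unique[OF this] show ?thesis
    unfolding matexp_def by (simp add: algebra_simps)
qed

lemma vec3_eq: "v = (vector [v $ 1, v $ 2, v $ 3] :: real^3)"
  by (simp add: vec_eq_iff forall_3)

lemma Xplus_vec: "Xplus \<alpha> *v vector [p, q, r] =
    vector [- cos \<alpha> * q, cos \<alpha> * p - sin \<alpha> * r, sin \<alpha> * q]"
  by (simp add: Xplus_def matF_def matG_def vec_eq_iff forall_3 matrix_vector_mult_def sum_3)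

lemma Xminus_vec: "Xminus \<alpha> *v vector [p, q, r] =
    vector [- cos \<alpha> * q, cos \<alpha> * p + sin \<alpha> * r, - sin \<alpha> * q]"
  by (simp add: Xminus_def matF_def matG_def vec_eq_iff forall_3 matrix_vector_mult_def sum_3)

lemma matrix_eq_vec3: "(\<And>p q r. A *v vector [p, q, r] = B *v vector [p, q, r]) \<Longrightarrow> A = (B :: real^3^3)"
  using vec3_eq by (metis matrix_eq)

lemma matrix_vector_uminus_left: "(- A) *v x = - ((A :: real^'n^'n) *v x)"
  by (simp add: matrix_vector_mult_def vec_eq_iff sum_negf)


text \<open>The rotation axes are the unit vectors \<open>(sin \<alpha>, 0, cos \<alpha>)\<close>
  and \<open>(- sin \<alpha>, 0, cos \<alpha>)\<close>.\<close>

lemma Xplus_cube: "Xplus \<alpha> ** (Xplus \<alpha> ** Xplus \<alpha>) = - Xplus \<alpha>"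
  and Xminus_cube: "Xminus \<alpha> ** (Xminus \<alpha> ** Xminus \<alpha>) = - Xminus \<alpha>"
proof -
  show "Xplus \<alpha> ** (Xplus \<alpha> ** Xplus \<alpha>) = - Xplus \<alpha>"
    by (rule matrix_eq_vec3)
      (simp add: matrix_vector_mul_assoc[symmetric] Xplus_vec matrix_vector_uminus_left vec_eq_iff forall_3 algebra_simps sin_mult_self)
  show "Xminus \<alpha> ** (Xminus \<alpha> ** Xminus \<alpha>) = - Xminus \<alpha>"
    by (rule matrix_eq_vec3)
      (simp add: matrix_vector_mul_assoc[symmetric] Xminus_vec matrix_vector_uminus_left vec_eq_iff forall_3 algebra_simps sin_mult_self)
qed

lemma rot_plus: "matexp (t *\<^sub>R Xplus \<alpha>) *v vector [p, q, r] =
    vector [p - sin t * cos \<alpha> * q - (1 - cos t) * cos \<alpha> * (cos \<alpha> * p - sin \<alpha> * r),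
      cos t * q + sin t * (cos \<alpha> * p - sin \<alpha> * r),
      r + sin t * sin \<alpha> * q + (1 - cos t) * sin \<alpha> * (cos \<alpha> * p - sin \<alpha> * r)]"
proof -
  show ?thesis
    unfolding matexp_rodrigues[OF Xplus_cube]
    by (simp add: matrix_vector_mult_add_rdistrib scaleR_matrix_vector_assoc[symmetric]
      matrix_vector_mul_assoc[symmetric] Xplus_vec vec_eq_iff forall_3 algebra_simps sin_mult_self)
qed

lemma rot_minus: "matexp (t *\<^sub>R Xminus \<alpha>) *v vector [p, q, r] =
    vector [p - sin t * cos \<alpha> * q - (1 - cos t) * cos \<alpha> * (cos \<alpha> * p + sin \<alpha> * r),
      cos t * q + sin t * (cos \<alpha> * p + sin \<alpha> * r),
      r - sin t * sin \<alpha> * q - (1 - cos t) * sin \<alpha> * (cos \<alpha> * p + sin \<alpha> * r)]"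
proof -
  show ?thesis
    unfolding matexp_rodrigues[OF Xminus_cube]
    by (simp add: matrix_vector_mult_add_rdistrib scaleR_matrix_vector_assoc[symmetric]
      matrix_vector_mul_assoc[symmetric] Xminus_vec vec_eq_iff forall_3 algebra_simps sin_mult_self)
qed

text \<open>Lets the last bang of an extremal be split into a complete bang, a piece that undoes the
  first bang time, and a small remainder.\<close>

lemma rot_minus_add: "matexp ((s + t) *\<^sub>R Xminus \<alpha>) = matexp (s *\<^sub>R Xminus \<alpha>) ** matexp (t *\<^sub>R Xminus \<alpha>)"
proof -
  let ?A = "Xminus \<alpha>" and ?B = "Xminus \<alpha> ** Xminus \<alpha>"
  have *: "?A ** ?B = - ?A" "?B ** ?A = - ?A" "?B ** ?B = - ?B"
    using Xminus_cube[of \<alpha>] by (simp_all add: matrix_mul_assoc[symmetric] matrix_mul_minus_right)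
  show ?thesis
    unfolding matexp_rodrigues[OF Xminus_cube]
    by (simp add: matrix_add_ldistrib matrix_mul_add_left matrix_mul_diff_left matrix_mul_diff_right
        matrix_mul_scaleR_left matrix_mul_scaleR_right *
        sin_add cos_add algebra_simps)
qed


text \<open>The switching points of the extremals lie on the great circles \<open>turn \<epsilon> \<alpha>\<close> and its mirror image
  \<open>turn (-\<epsilon>) \<alpha>\<close>; each bang of duration \<open>\<pi> + 2\<epsilon>\<close> maps one of them to the other.\<close>

definition turn :: "real \<Rightarrow> real \<Rightarrow> real \<Rightarrow> real \<Rightarrow> real^3" where
  "turn \<alpha> \<beta> \<epsilon> \<eta> = vector [sin \<eta>, - sin \<epsilon> * cos \<eta> / sin \<beta>, cos \<epsilon> * sin \<alpha> * cos \<eta> / sin \<beta>]"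

text \<open>The hypothesis is the half-angle relation for the product of two rotations by
  \<open>pi + 2 * \<epsilon>\<close>. Each bang reflects the arc length \<eta> and shifts it by
  2\<beta>, so that a pair of bangs is a rotation by 4\<beta> along the great circle.\<close>

lemma bang_turn:
  assumes b: "cos \<beta> = cos \<alpha> * cos \<epsilon>" and "sin \<beta> \<noteq> 0"
  shows "matexp ((pi + 2 * \<epsilon>) *\<^sub>R Xminus \<alpha>) *v turn \<alpha> \<beta> \<epsilon> \<eta> = turn \<alpha> \<beta> (- \<epsilon>) (- \<eta> - 2 * \<beta>)"
    "matexp ((pi + 2 * \<epsilon>) *\<^sub>R Xplus \<alpha>) *v turn \<alpha> \<beta> (- \<epsilon>) \<eta> = turn \<alpha> \<beta> \<epsilon> (- \<eta> + 2 * \<beta>)"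
proof -
  \<comment> \<open>With \<open>cos \<eta>\<close> written as a multiple of
    \<open>sin \<beta>\<close> the claims become polynomial identities, which follow from the
    Pythagorean relations by \<open>algebra\<close>.\<close>
  define t where "t = cos \<eta> / sin \<beta>"
  have t: "cos \<eta> = t * sin \<beta>"
    using assms by (simp add: t_def)
  have b2: "(sin \<beta>)\<^sup>2 = 1 - (cos \<alpha> * cos \<epsilon>)\<^sup>2"
    using b by (simp add: sin_squared_eq)
  have se: "(sin \<epsilon>)\<^sup>2 = 1 - (cos \<epsilon>)\<^sup>2" and sa: "(sin \<alpha>)\<^sup>2 = 1 - (cos \<alpha>)\<^sup>2"
    by (simp_all add: sin_squared_eq)
  have cv: "cos (pi + 2 * \<epsilon>) = 1 - 2 * (cos \<epsilon>)\<^sup>2" "sin (pi + 2 * \<epsilon>) = - 2 * sin \<epsilon> * cos \<epsilon>"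
    by (simp_all add: sin_add cos_add cos_double_cos sin_double)
  have c2: "cos (2 * \<beta>) = 2 * (cos \<alpha> * cos \<epsilon>)\<^sup>2 - 1" "sin (2 * \<beta>) = 2 * sin \<beta> * (cos \<alpha> * cos \<epsilon>)"
    using b by (simp_all add: cos_double_cos sin_double)
  have m: "cos (- \<eta> - 2 * \<beta>) = t * sin \<beta> * cos (2*\<beta>) - sin \<eta> * sin (2*\<beta>)"
    "sin (- \<eta> - 2 * \<beta>) = - (sin \<eta> * cos (2*\<beta>) + t * sin \<beta> * sin (2*\<beta>))"
    "cos (- \<eta> + 2 * \<beta>) = t * sin \<beta> * cos (2*\<beta>) + sin \<eta> * sin (2*\<beta>)"
    "sin (- \<eta> + 2 * \<beta>) = t * sin \<beta> * sin (2*\<beta>) - sin \<eta> * cos (2*\<beta>)"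
    by (simp_all add: sin_add cos_add sin_diff cos_diff t)
  have turn: "turn \<alpha> \<beta> \<epsilon> \<eta> = vector [sin \<eta>, - sin \<epsilon> * t, cos \<epsilon> * sin \<alpha> * t]"
     "turn \<alpha> \<beta> (-\<epsilon>) \<eta> = vector [sin \<eta>, sin \<epsilon> * t, cos \<epsilon> * sin \<alpha> * t]"
    by (simp_all add: turn_def t_def)
  have turn': "turn \<alpha> \<beta> (-\<epsilon>) (- \<eta> - 2 * \<beta>) =
      vector [- (sin \<eta> * cos (2*\<beta>) + t * sin \<beta> * sin (2*\<beta>)),
        sin \<epsilon> * (t * cos (2*\<beta>) - sin \<eta> * (2 * (cos \<alpha> * cos \<epsilon>))),
        cos \<epsilon> * sin \<alpha> * (t * cos (2*\<beta>) - sin \<eta> * (2 * (cos \<alpha> * cos \<epsilon>)))]"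
      "turn \<alpha> \<beta> \<epsilon> (- \<eta> + 2 * \<beta>) =
      vector [t * sin \<beta> * sin (2*\<beta>) - sin \<eta> * cos (2*\<beta>),
        - sin \<epsilon> * (t * cos (2*\<beta>) + sin \<eta> * (2 * (cos \<alpha> * cos \<epsilon>))),
        cos \<epsilon> * sin \<alpha> * (t * cos (2*\<beta>) + sin \<eta> * (2 * (cos \<alpha> * cos \<epsilon>)))]"
    unfolding turn_def m c2(2) using assms(2) by (simp_all add: vec_eq_iff forall_3 field_simps)
  show "matexp ((pi + 2 * \<epsilon>) *\<^sub>R Xminus \<alpha>) *v turn \<alpha> \<beta> \<epsilon> \<eta> = turn \<alpha> \<beta> (- \<epsilon>) (- \<eta> - 2 * \<beta>)"
    unfolding turn turn' rot_minus cv c2 using se sa b2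
    by (simp add: vec_eq_iff forall_3; intro conjI; algebra)
  show "matexp ((pi + 2 * \<epsilon>) *\<^sub>R Xplus \<alpha>) *v turn \<alpha> \<beta> (- \<epsilon>) \<eta> = turn \<alpha> \<beta> \<epsilon> (- \<eta> + 2 * \<beta>)"
    unfolding turn turn' rot_plus cv c2 using se sa b2
    by (simp add: vec_eq_iff forall_3; intro conjI; algebra)
qed

lemma bangs_turn:
  assumes b: "cos \<beta> = cos \<alpha> * cos \<epsilon>" and "sin \<beta> \<noteq> 0"
  shows "matpow (matexp ((pi + 2 * \<epsilon>) *\<^sub>R Xplus \<alpha>) ** matexp ((pi + 2 * \<epsilon>) *\<^sub>R Xminus \<alpha>)) m *v turn \<alpha> \<beta> \<epsilon> \<eta>
    = turn \<alpha> \<beta> \<epsilon> (\<eta> + 4 * real m * \<beta>)"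
proof (induction m)
  case (Suc m)
  have e: "- (- (\<eta> + 4 * real m * \<beta>) - 2 * \<beta>) + 2 * \<beta> = \<eta> + 4 * real (Suc m) * \<beta>"
    by (simp add: algebra_simps)
  show ?case
    by (simp only: matpow_Suc matrix_vector_mul_assoc[symmetric] Suc bang_turn[OF assms] e)
qed simp


section \<open>The angle \<sigma> as the parameter of the front\<close>

definition eps :: "real \<Rightarrow> real \<Rightarrow> real" where
  "eps \<alpha> \<sigma> = arcsin ((tan \<alpha>)\<^sup>2 * sin \<sigma>)"

definition dil :: "real \<Rightarrow> real \<Rightarrow> real" where
  "dil \<alpha> \<sigma> = sqrt (1 + (tan \<alpha>)\<^sup>2 * (sin \<sigma>)\<^sup>2)"

text \<open>The angle with \<open>cos \<beta> = cos \<alpha> * cos \<epsilon>\<close> (see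
  \<open>cos_bet\<close>), as \<open>bang_turn\<close> requires: a pair of bangs advances by
  4\<beta>.\<close>

definition bet :: "real \<Rightarrow> real \<Rightarrow> real" where
  "bet \<alpha> \<sigma> = arcsin (sin \<alpha> * dil \<alpha> \<sigma>)"

text \<open>What \<open>n\<close> bangs, each worth 2\<beta>, lack to half a turn. Up to sign this
  is the angular distance from the south pole to the front before its final small rotation.\<close>

definition mu :: "real \<Rightarrow> real \<Rightarrow> real \<Rightarrow> real" where
  "mu n \<alpha> \<sigma> = pi - 2 * n * bet \<alpha> \<sigma>"

lemma tan_less_1: "0 < \<alpha> \<Longrightarrow> \<alpha> < pi / 4 \<Longrightarrow> 0 < tan \<alpha> \<and> tan \<alpha> < 1"
  using tan_monotone[of \<alpha> "pi/4"] tan_gt_zero[of \<alpha>] by (auto simp: tan_45)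

context
  fixes \<alpha> :: real
  assumes \<alpha>: "0 < \<alpha>" "\<alpha> < pi / 4"
begin

lemma sin_cos_pos: "0 < sin \<alpha>" "0 < cos \<alpha>"
  using \<alpha> by (auto intro!: sin_gt_zero cos_gt_zero)

lemma tan2_less_1: "(tan \<alpha>)\<^sup>2 < 1" "0 < (tan \<alpha>)\<^sup>2"
  using tan_less_1[OF \<alpha>] by (simp_all add: power_less_one_iff abs_square_less_1)

lemma abs_sin_eps: "\<bar>(tan \<alpha>)\<^sup>2 * sin \<sigma>\<bar> < 1"
proof -
  have "\<bar>(tan \<alpha>)\<^sup>2 * sin \<sigma>\<bar> \<le> (tan \<alpha>)\<^sup>2 * 1"
    unfolding abs_mult by (intro mult_mono) auto
  then show ?thesis using tan2_less_1 by linarith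
qed

lemma sin_eps: "sin (eps \<alpha> \<sigma>) = (tan \<alpha>)\<^sup>2 * sin \<sigma>"
  using abs_sin_eps[of \<sigma>] by (simp add: eps_def)

lemma eps_bounds: "- (pi / 2) < eps \<alpha> \<sigma>" "eps \<alpha> \<sigma> < pi / 2"
  using abs_sin_eps[of \<sigma>] arcsin_lt_bounded[of "(tan \<alpha>)\<^sup>2 * sin \<sigma>"] by (auto simp: eps_def)

lemma cos_eps_pos: "0 < cos (eps \<alpha> \<sigma>)"
  using eps_bounds cos_gt_zero_pi by auto

lemma dil_sq: "(dil \<alpha> \<sigma>)\<^sup>2 = 1 + (tan \<alpha>)\<^sup>2 * (sin \<sigma>)\<^sup>2"
  by (simp add: dil_def add_nonneg_nonneg)

lemma dil_ge_1: "1 \<le> dil \<alpha> \<sigma>"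
  by (simp add: dil_def)

lemma sin_bet_sq: "(sin \<alpha> * dil \<alpha> \<sigma>)\<^sup>2 = 1 - (cos \<alpha> * cos (eps \<alpha> \<sigma>))\<^sup>2"
proof -
  have "(cos \<alpha> * cos (eps \<alpha> \<sigma>))\<^sup>2 = (cos \<alpha>)\<^sup>2 * (1 - ((tan \<alpha>)\<^sup>2 * sin \<sigma>)\<^sup>2)"
    by (simp add: power_mult_distrib cos_squared_eq[of "eps \<alpha> \<sigma>"] sin_eps)
  moreover have "(cos \<alpha>)\<^sup>2 * (tan \<alpha>)\<^sup>2 = (sin \<alpha>)\<^sup>2"
    using sin_cos_pos by (simp add: tan_def field_simps)
  ultimately show ?thesis
    using sin_cos_squared_add[of \<alpha>] unfolding power_mult_distrib dil_sq by algebra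
qed

lemma sin_bet_less_1: "sin \<alpha> * dil \<alpha> \<sigma> < 1" "0 < sin \<alpha> * dil \<alpha> \<sigma>"
proof -
  have "(sin \<alpha> * dil \<alpha> \<sigma>)\<^sup>2 < 1"
    unfolding sin_bet_sq using sin_cos_pos cos_eps_pos[of \<sigma>] by (simp add: zero_less_power)
  then show "sin \<alpha> * dil \<alpha> \<sigma> < 1"
    by (metis abs_square_less_1 abs_less_iff)
  show "0 < sin \<alpha> * dil \<alpha> \<sigma>"
    using sin_cos_pos dil_ge_1[of \<sigma>] by simp
qed

lemma sin_bet: "sin (bet \<alpha> \<sigma>) = sin \<alpha> * dil \<alpha> \<sigma>"
  using sin_bet_less_1[of \<sigma>] by (simp add: bet_def)

lemma cos_bet: "cos (bet \<alpha> \<sigma>) = cos \<alpha> * cos (eps \<alpha> \<sigma>)"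
proof -
  have "cos (bet \<alpha> \<sigma>) = sqrt (1 - (sin \<alpha> * dil \<alpha> \<sigma>)\<^sup>2)"
    unfolding bet_def using sin_bet_less_1[of \<sigma>] by (subst cos_arcsin) auto
  also have "\<dots> = cos \<alpha> * cos (eps \<alpha> \<sigma>)"
    unfolding sin_bet_sq using sin_cos_pos cos_eps_pos[of \<sigma>] by simp
  finally show ?thesis .
qed

text \<open>Let \<open>s = \<sigma> + \<epsilon>\<close>. Expanding \<open>sin \<sigma>\<close> as
  the sine of \<open>s - \<epsilon>\<close> in the equation for \<open>sin \<epsilon>\<close> gives
  a linear equation for \<open>tan \<epsilon>\<close>; its solution is the argument of the
  arctangent in \<open>vtime\<close>.\<close>

lemma vtime_eps:
  assumes "0 \<le> \<sigma>" "\<sigma> \<le> pi"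
  shows "vtime \<alpha> (\<sigma> + eps \<alpha> \<sigma>) = pi + 2 * eps \<alpha> \<sigma>"
proof -
  let ?e = "eps \<alpha> \<sigma>" and ?s = "\<sigma> + eps \<alpha> \<sigma>"
  have cot: "cot \<alpha> > 1" 
    using tan_less_1[OF \<alpha>] sin_cos_pos by (simp add: cot_def tan_def field_simps)
  have cot': "(cot \<alpha>)\<^sup>2 * (tan \<alpha>)\<^sup>2 = 1"
    using sin_cos_pos by (simp add: cot_def tan_def field_simps)
  have pos: "cos ?s + (cot \<alpha>)\<^sup>2 > 0"
    using cos_ge_minus_one[of ?s] one_less_power[OF cot, of 2] by linarith
  have "sin \<sigma> = (cot \<alpha>)\<^sup>2 * sin ?e"
    using cot' by (simp add: sin_eps mult.assoc[symmetric])
  moreover have "sin \<sigma> = sin ?s * cos ?e - cos ?s * sin ?e"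
    by (simp flip: sin_diff)
  ultimately have "sin ?s * cos ?e = sin ?e * (cos ?s + (cot \<alpha>)\<^sup>2)"
    by (simp add: algebra_simps)
  then have "sin ?s / (cos ?s + (cot \<alpha>)\<^sup>2) = tan ?e"
    using pos cos_eps_pos[of \<sigma>] by (simp add: tan_def field_simps)
  then show ?thesis
    using eps_bounds[of \<sigma>] by (simp add: vtime_def arctan_tan)
qed

text \<open>The second claim is the end of the extremal read backwards: a rotation by the first bang
  time carries a point at angle \<open>m\<close> from the south pole to the great circle on which
  the complete bangs end. In this direction both claims are computations with the same
  coefficients.\<close>

lemma first_bang:
  defines "\<gamma> \<equiv> \<lambda>\<sigma>. arcsin (sin \<alpha> * cos \<sigma>)"
  shows "matexp ((\<sigma> + eps \<alpha> \<sigma>) *\<^sub>R Xplus \<alpha>) *v north = turn \<alpha> (bet \<alpha> \<sigma>) (eps \<alpha> \<sigma>) (bet \<alpha> \<sigma> - \<gamma> \<sigma>)" (is ?A)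
    and "matexp ((\<sigma> + eps \<alpha> \<sigma>) *\<^sub>R Xminus \<alpha>) *v
        vector [- cos \<sigma> * (sin m / dil \<alpha> \<sigma>), sin \<sigma> * (sin m / dil \<alpha> \<sigma>) / cos \<alpha>, - cos m]
      = turn \<alpha> (bet \<alpha> \<sigma>) (- eps \<alpha> \<sigma>) (- (bet \<alpha> \<sigma> - \<gamma> \<sigma>) - (pi - m))" (is ?B)
proof -
  let ?b = "bet \<alpha> \<sigma>"
  define e D where "e = eps \<alpha> \<sigma>" and "D = dil \<alpha> \<sigma>"
  have "\<bar>sin \<alpha> * cos \<sigma>\<bar> \<le> sin \<alpha> * 1"
    unfolding abs_mult using sin_cos_pos by (intro mult_mono) auto
  moreover have "sin \<alpha> < 1"
    using sin_bet_less_1[of 0] by (simp add: dil_def)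
  ultimately have sc: "\<bar>sin \<alpha> * cos \<sigma>\<bar> < 1"
    by linarith
  then have sg: "sin (\<gamma> \<sigma>) = sin \<alpha> * cos \<sigma>"
    by (simp add: \<gamma>_def)
  have D: "D > 0"
    using dil_ge_1[of \<sigma>] by (simp add: D_def)
  have D2: "D\<^sup>2 = 1 + sin \<sigma> * sin e"
    unfolding D_def dil_sq e_def sin_eps by (simp add: power2_eq_square)
  have D1: "(cos \<alpha>)\<^sup>2 * (D\<^sup>2) = (cos \<alpha>)\<^sup>2 + (sin \<alpha>)\<^sup>2 * (sin \<sigma>)\<^sup>2"
    unfolding D_def dil_sq using sin_cos_pos by (simp add: tan_def field_simps)
  have cg: "cos (\<gamma> \<sigma>) = cos \<alpha> * D"
  proof -
    have "cos (\<gamma> \<sigma>) = sqrt (1 - (sin \<alpha> * cos \<sigma>)\<^sup>2)"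
      unfolding \<gamma>_def using sc by (subst cos_arcsin) auto
    also have "1 - (sin \<alpha> * cos \<sigma>)\<^sup>2 = (cos \<alpha> * D)\<^sup>2"
      unfolding power_mult_distrib D1 by (simp add: cos_squared_eq right_diff_distrib)
    also have "sqrt \<dots> = cos \<alpha> * D"
      using D sin_cos_pos by simp
    finally show ?thesis .
  qed
  have sb: "sin ?b = sin \<alpha> * D" and cb: "cos ?b = cos \<alpha> * cos e"
    by (simp_all add: sin_bet cos_bet D_def e_def)
  have r1: "(cos \<alpha>)\<^sup>2 * sin e = (sin \<alpha>)\<^sup>2 * sin \<sigma>"
    unfolding e_def sin_eps tan_def power_divide using sin_cos_pos by simp
  have sa: "(sin \<alpha>)\<^sup>2 = 1 - (cos \<alpha>)\<^sup>2" and se: "(cos e)\<^sup>2 = 1 - (sin e)\<^sup>2" and ss: "(cos \<sigma>)\<^sup>2 = 1 - (sin \<sigma>)\<^sup>2"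
    by (rule sin_squared_eq cos_squared_eq)+
  define Y where "Y = (cos \<alpha>)\<^sup>2 * cos e + (sin \<alpha>)\<^sup>2 * cos \<sigma>"
  have X: "sin (?b - \<gamma> \<sigma>) = sin \<alpha> * cos \<alpha> * (D\<^sup>2 - cos e * cos \<sigma>)"
    and Y: "cos (?b - \<gamma> \<sigma>) = D * Y"
    by (simp_all add: sin_diff cos_diff sb cb sg cg power2_eq_square algebra_simps Y_def)
  have T: "turn \<alpha> ?b e (?b - \<gamma> \<sigma>) = vector [sin \<alpha> * cos \<alpha> * (D\<^sup>2 - cos e * cos \<sigma>), - sin e * Y / sin \<alpha>, cos e * Y]"
    using D sin_cos_pos by (simp add: turn_def X Y sb vec_eq_iff forall_3)
  have main2: "sin \<alpha> * sin (\<sigma> + e) = sin e * Y / sin \<alpha>"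
  proof -
    have "(sin \<alpha>)\<^sup>2 * sin (\<sigma> + e) = ((sin \<alpha>)\<^sup>2 * sin \<sigma>) * cos e + (sin \<alpha>)\<^sup>2 * (cos \<sigma> * sin e)"
      by (simp add: sin_add algebra_simps)
    also have "\<dots> = sin e * Y"
      unfolding r1[symmetric] Y_def by (simp add: algebra_simps)
    finally show ?thesis using sin_cos_pos by (simp add: field_simps power2_eq_square)
  qed
  have main1: "1 - cos (\<sigma> + e) = D\<^sup>2 - cos e * cos \<sigma>"
    by (simp add: D2 cos_add)
  have main3: "1 - (1 - cos (\<sigma> + e)) * sin \<alpha> * sin \<alpha> = cos e * Y"
    unfolding Y_def cos_add using r1 sa se ss by algebra
  show ?A
    unfolding north_def rot_plus e_def[symmetric] T
    by (simp add: vec_eq_iff forall_3 main2[symmetric] flip: main1 main3)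
  have "sin (- (?b - \<gamma> \<sigma>) - (pi - m)) = sin (?b - \<gamma> \<sigma> - m)" "cos (- (?b - \<gamma> \<sigma>) - (pi - m)) = - cos (?b - \<gamma> \<sigma> - m)"
    using sin_periodic_pi[of "- (?b - \<gamma> \<sigma>) - (pi - m)"] cos_periodic_pi[of "- (?b - \<gamma> \<sigma>) - (pi - m)"]
      sin_minus[of "?b - \<gamma> \<sigma> - m"] cos_minus[of "?b - \<gamma> \<sigma> - m"]
    by (simp_all add: algebra_simps)
  then have B: "sin (- (?b - \<gamma> \<sigma>) - (pi - m)) = sin \<alpha> * cos \<alpha> * (D\<^sup>2 - cos e * cos \<sigma>) * cos m - D * Y * sin m"
     "cos (- (?b - \<gamma> \<sigma>) - (pi - m)) = - D * (Y * cos m) - sin \<alpha> * cos \<alpha> * (D\<^sup>2 - cos e * cos \<sigma>) * sin m"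
    by (simp_all add: sin_diff[of "?b - \<gamma> \<sigma>"] cos_diff[of "?b - \<gamma> \<sigma>"] X Y)
  define Z where "Z = cos \<alpha> * (D\<^sup>2 - cos e * cos \<sigma>) / D"
  have T': "turn \<alpha> ?b (-e) (- (?b - \<gamma> \<sigma>) - (pi - m)) =
      vector [sin \<alpha> * cos \<alpha> * (D\<^sup>2 - cos e * cos \<sigma>) * cos m - D * Y * sin m,
        sin e * (- (Y * cos m) / sin \<alpha> - Z * sin m),
        cos e * (- (Y * cos m) - sin \<alpha> * Z * sin m)]"
    unfolding turn_def B sb using D sin_cos_pos by (simp add: vec_eq_iff forall_3 Z_def field_simps)
  \<comment> \<open>The components of the second claim are linear in \<open>sin m\<close> and
    \<open>cos m\<close>: \<open>u1\<close>, \<open>u2\<close>, \<open>u3\<close> supply the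
    coefficients of \<open>sin m\<close>, and \<open>main1\<close>, \<open>main2\<close>,
    \<open>main3\<close> those of \<open>cos m\<close>.\<close>
  have u1: "cos \<sigma> * (1 - (1 - cos (\<sigma> + e)) * cos \<alpha> * cos \<alpha>) + sin (\<sigma> + e) * sin \<sigma> = D\<^sup>2 * Y"
    unfolding D2 Y_def cos_add sin_add using r1 sa se ss by algebra
  have u2: "cos (\<sigma> + e) * sin \<sigma> / cos \<alpha> - sin (\<sigma> + e) * cos \<alpha> * cos \<sigma> = - sin e * cos \<alpha> * (D\<^sup>2 - cos e * cos \<sigma>)"
  proof -
    have "cos (\<sigma> + e) * sin \<sigma> - sin (\<sigma> + e) * (cos \<alpha>)\<^sup>2 * cos \<sigma> = - sin e * (cos \<alpha>)\<^sup>2 * (D\<^sup>2 - cos e * cos \<sigma>)"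
      unfolding D2 cos_add sin_add using r1 sa se ss by algebra
    then show ?thesis using sin_cos_pos by (simp add: field_simps power2_eq_square)
  qed
  have u3: "(1 - cos (\<sigma> + e)) * cos \<alpha> * cos \<sigma> - sin (\<sigma> + e) * sin \<sigma> / cos \<alpha> = - cos e * cos \<alpha> * (D\<^sup>2 - cos e * cos \<sigma>)"
  proof -
    have "(1 - cos (\<sigma> + e)) * (cos \<alpha>)\<^sup>2 * cos \<sigma> - sin (\<sigma> + e) * sin \<sigma> = - cos e * (cos \<alpha>)\<^sup>2 * (D\<^sup>2 - cos e * cos \<sigma>)"
      unfolding D2 cos_add sin_add using r1 sa se ss by algebra
    then show ?thesis using sin_cos_pos by (simp add: field_simps power2_eq_square)
  qed
  let ?Q1 = "- cos \<sigma> * (sin m / D)" and ?Q2 = "sin \<sigma> * (sin m / D) / cos \<alpha>" and ?Q3 = "- cos m"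
  let ?s = "\<sigma> + e"
  have "?Q1 - sin ?s * cos \<alpha> * ?Q2 - (1 - cos ?s) * cos \<alpha> * (cos \<alpha> * ?Q1 + sin \<alpha> * ?Q3)
     = - (sin m / D) * (cos \<sigma> * (1 - (1 - cos ?s) * cos \<alpha> * cos \<alpha>) + sin ?s * sin \<sigma>)
       + (1 - cos ?s) * cos \<alpha> * sin \<alpha> * cos m"
    using sin_cos_pos D by (simp add: field_simps)
  also have "\<dots> = sin \<alpha> * cos \<alpha> * (D\<^sup>2 - cos e * cos \<sigma>) * cos m - D * Y * sin m"
    unfolding u1 unfolding main1 using D by (simp add: power2_eq_square)
  finally have c1: "?Q1 - sin ?s * cos \<alpha> * ?Q2 - (1 - cos ?s) * cos \<alpha> * (cos \<alpha> * ?Q1 + sin \<alpha> * ?Q3) = \<dots>" .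
  have "cos ?s * ?Q2 + sin ?s * (cos \<alpha> * ?Q1 + sin \<alpha> * ?Q3)
    = (sin m / D) * (cos ?s * sin \<sigma> / cos \<alpha> - sin ?s * cos \<alpha> * cos \<sigma>) - (sin \<alpha> * sin ?s) * cos m"
    using sin_cos_pos D by (simp add: field_simps)
  also have "\<dots> = sin e * (- (Y * cos m) / sin \<alpha> - Z * sin m)"
    unfolding u2 main2 Z_def using D by (simp add: field_simps)
  finally have c2: "cos ?s * ?Q2 + sin ?s * (cos \<alpha> * ?Q1 + sin \<alpha> * ?Q3) = \<dots>" .
  have "?Q3 - sin ?s * sin \<alpha> * ?Q2 - (1 - cos ?s) * sin \<alpha> * (cos \<alpha> * ?Q1 + sin \<alpha> * ?Q3)
    = (sin m / D) * sin \<alpha> * ((1 - cos ?s) * cos \<alpha> * cos \<sigma> - sin ?s * sin \<sigma> / cos \<alpha>)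
      - cos m * (1 - (1 - cos ?s) * sin \<alpha> * sin \<alpha>)"
    using sin_cos_pos D by (simp add: field_simps)
  also have "\<dots> = cos e * (- (Y * cos m) - sin \<alpha> * Z * sin m)"
    unfolding u3 main3 Z_def using D by (simp add: field_simps)
  finally have c3: "?Q3 - sin ?s * sin \<alpha> * ?Q2 - (1 - cos ?s) * sin \<alpha> * (cos \<alpha> * ?Q1 + sin \<alpha> * ?Q3) = \<dots>" .
  show ?B
    unfolding e_def[symmetric] D_def[symmetric] rot_minus c1 c2 c3 T' ..
qed

text \<open>With \<open>n = kM \<alpha>\<close>, the duration of the last bang is a complete bang
  minus the first bang time, plus the small angle \<open>- 2 n \<epsilon>\<close>. The complete
  bangs and the subtraction lead to the point of \<open>first_bang\<close>, so that only the
  rotation by the small angle remains.\<close>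

lemma Eplus_closed_form:
  assumes n: "odd (kM \<alpha>)" and \<sigma>: "0 \<le> \<sigma>" "\<sigma> \<le> pi"
  defines "S \<equiv> sin (mu (kM \<alpha>) \<alpha> \<sigma>) / dil \<alpha> \<sigma>"
  shows "Eplus \<alpha> (\<sigma> + eps \<alpha> \<sigma>) = matexp ((- 2 * real (kM \<alpha>) * eps \<alpha> \<sigma>) *\<^sub>R Xminus \<alpha>) *v
      vector [- cos \<sigma> * S, sin \<sigma> * S / cos \<alpha>, - cos (mu (kM \<alpha>) \<alpha> \<sigma>)]"
proof -
  let ?e = "eps \<alpha> \<sigma>" and ?b = "bet \<alpha> \<sigma>" and ?n = "real (kM \<alpha>)"
  let ?g = "arcsin (sin \<alpha> * cos \<sigma>)"
  have nm: "?n = 2 * real ((kM \<alpha> - 1) div 2) + 1"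
    using n by (auto elim!: oddE)
  have cb: "cos ?b = cos \<alpha> * cos ?e" and sb: "sin ?b \<noteq> 0"
    using cos_bet sin_bet sin_bet_less_1[of \<sigma>] by auto
  have t: "?n * pi - (?n - 1) * (pi + 2 * ?e) - (\<sigma> + ?e) = (- 2 * ?n * ?e) + (- (\<sigma> + ?e) + (pi + 2 * ?e))"
    by (simp add: algebra_simps)
  \<comment> \<open>Here \<open>n = 2 m + 1\<close>: the \<open>m\<close> pairs advance by
    \<open>4 m \<beta>\<close> and the complete last bang by \<open>2 \<beta>\<close>, together
    \<open>2 n \<beta> = pi - mu\<close>.\<close>
  have a: "- (?b - ?g + 4 * real ((kM \<alpha> - 1) div 2) * ?b) - 2 * ?b = - (?b - ?g) - (pi - mu ?n \<alpha> \<sigma>)"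
    unfolding mu_def nm by (simp add: algebra_simps)
  define E where "E t = matexp (t *\<^sub>R Xminus \<alpha>)" for t
  define Q :: "real^3" where "Q = vector [- cos \<sigma> * S, sin \<sigma> * S / cos \<alpha>, - cos (mu (kM \<alpha>) \<alpha> \<sigma>)]"
  have E: "E (s + t) *v x = E s *v (E t *v x)" for s t x
    by (simp add: E_def rot_minus_add matrix_vector_mul_assoc)
  have inv: "E (- (\<sigma> + ?e)) *v (E (\<sigma> + ?e) *v x) = x" for x
    using matexp_rodrigues[OF Xminus_cube[of \<alpha>], of 0] E[of "- (\<sigma> + ?e)" "\<sigma> + ?e" x] by (simp add: E_def)
  let ?m = "(kM \<alpha> - 1) div 2"
  have "Eplus \<alpha> (\<sigma> + ?e) = E ((- 2 * ?n * ?e) + (- (\<sigma> + ?e) + (pi + 2 * ?e))) *v turn \<alpha> ?b ?e (?b - ?g + 4 * real ?m * ?b)"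
    by (simp only: Eplus_def vtime_eps[OF \<sigma>] matrix_vector_mul_assoc[symmetric] first_bang(1) bangs_turn[OF cb sb] t E_def)
  also have "\<dots> = E (- 2 * ?n * ?e) *v (E (- (\<sigma> + ?e)) *v (E (pi + 2 * ?e) *v turn \<alpha> ?b ?e (?b - ?g + 4 * real ?m * ?b)))"
    by (simp only: E)
  also have "E (pi + 2 * ?e) *v turn \<alpha> ?b ?e (?b - ?g + 4 * real ?m * ?b) = E (\<sigma> + ?e) *v Q"
    by (simp only: E_def bang_turn(1)[OF cb sb] a S_def Q_def first_bang(2))
  also have "E (- (\<sigma> + ?e)) *v \<dots> = Q"
    by (rule inv)
  finally show ?thesis
    by (simp only: E_def Q_def)
qed

end

text \<open>The front in the chart, parametrised by \<open>\<sigma> = s - \<epsilon>\<close>, for which \<open>sin \<epsilon> = tan\<^sup>2 \<alpha> sin \<sigma>\<close>.\<close>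

definition Sfac :: "real \<Rightarrow> real \<Rightarrow> real \<Rightarrow> real" where
  "Sfac n \<alpha> \<sigma> = sin (mu n \<alpha> \<sigma>) / dil \<alpha> \<sigma>"

definition psi :: "real \<Rightarrow> real \<Rightarrow> real \<Rightarrow> real" where
  "psi n \<alpha> \<sigma> = 2 * n * eps \<alpha> \<sigma>"

definition Wfac :: "real \<Rightarrow> real \<Rightarrow> real \<Rightarrow> real" where
  "Wfac n \<alpha> \<sigma> = cos \<alpha> * cos \<sigma> * Sfac n \<alpha> \<sigma> + sin \<alpha> * cos (mu n \<alpha> \<sigma>)"

definition topx :: "real \<Rightarrow> real \<Rightarrow> real \<Rightarrow> real" where
  "topx n \<alpha> \<sigma> = (- cos \<sigma> * Sfac n \<alpha> \<sigma> + sin (psi n \<alpha> \<sigma>) * (sin \<sigma> * Sfac n \<alpha> \<sigma>)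
     + (1 - cos (psi n \<alpha> \<sigma>)) * cos \<alpha> * Wfac n \<alpha> \<sigma>) / \<alpha>\<^sup>2"

definition topy :: "real \<Rightarrow> real \<Rightarrow> real \<Rightarrow> real" where
  "topy n \<alpha> \<sigma> = (cos (psi n \<alpha> \<sigma>) * (sin \<sigma> * Sfac n \<alpha> \<sigma>) / cos \<alpha>
     + sin (psi n \<alpha> \<sigma>) * Wfac n \<alpha> \<sigma>) / \<alpha>\<^sup>2"

lemma Nproj_Eplus:
  assumes "0 < \<alpha>" "\<alpha> < pi / 4" "odd (kM \<alpha>)" "0 \<le> \<sigma>" "\<sigma> \<le> pi"
  shows "Nproj \<alpha> (Eplus \<alpha> (\<sigma> + eps \<alpha> \<sigma>)) = vector [topx (kM \<alpha>) \<alpha> \<sigma>, topy (kM \<alpha>) \<alpha> \<sigma>]"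
proof -
  let ?S = "Sfac (kM \<alpha>) \<alpha> \<sigma>" and ?p = "psi (kM \<alpha>) \<alpha> \<sigma>" and ?m = "mu (kM \<alpha>) \<alpha> \<sigma>"
  have p: "sin (- 2 * real (kM \<alpha>) * eps \<alpha> \<sigma>) = - sin ?p" "cos (- 2 * real (kM \<alpha>) * eps \<alpha> \<sigma>) = cos ?p"
    by (simp_all add: psi_def)
  have e1: "- cos \<sigma> * ?S - - sin ?p * cos \<alpha> * (sin \<sigma> * ?S / cos \<alpha>)
      - (1 - cos ?p) * cos \<alpha> * (cos \<alpha> * (- cos \<sigma> * ?S) + sin \<alpha> * - cos ?m)
    = - cos \<sigma> * ?S + sin ?p * (sin \<sigma> * ?S) + (1 - cos ?p) * cos \<alpha> * Wfac (kM \<alpha>) \<alpha> \<sigma>"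
    using sin_cos_pos[OF assms(1,2)] by (simp add: Wfac_def algebra_simps)
  have e2: "cos ?p * (sin \<sigma> * ?S / cos \<alpha>) + - sin ?p * (cos \<alpha> * (- cos \<sigma> * ?S) + sin \<alpha> * - cos ?m)
    = cos ?p * (sin \<sigma> * ?S) / cos \<alpha> + sin ?p * Wfac (kM \<alpha>) \<alpha> \<sigma>"
    by (simp add: Wfac_def algebra_simps)
  show ?thesis
    unfolding Eplus_closed_form[OF assms] rot_minus Nproj_def topx_def topy_def Sfac_def[symmetric] p vector_3 e1 e2
    by (simp add: vec_eq_iff forall_2)
qed

section \<open>Derivatives of the front, with powers of \<alpha> and of \<open>sin \<sigma>\<close>
  split off\<close>

context
  fixes \<alpha> :: real
  assumes \<alpha>: "0 < \<alpha>" "\<alpha> < pi / 4"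
begin

lemma DERIV_eps: "(eps \<alpha> has_real_derivative (tan \<alpha>)\<^sup>2 * cos \<sigma> / cos (eps \<alpha> \<sigma>)) (at \<sigma>)"
proof -
  have "cos (eps \<alpha> \<sigma>) = sqrt (1 - ((tan \<alpha>)\<^sup>2 * sin \<sigma>)\<^sup>2)"
    unfolding eps_def using abs_sin_eps[OF \<alpha>, of \<sigma>] by (subst cos_arcsin) auto
  then show ?thesis
    unfolding eps_def[abs_def] using abs_sin_eps[OF \<alpha>, of \<sigma>]
    by (auto intro!: derivative_eq_intros simp: field_simps)
qed

lemma DERIV_dil: "(dil \<alpha> has_real_derivative (tan \<alpha>)\<^sup>2 * sin \<sigma> * cos \<sigma> / dil \<alpha> \<sigma>) (at \<sigma>)"
proof -
  have "1 + (tan \<alpha>)\<^sup>2 * (sin \<sigma>)\<^sup>2 > 0"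
    by (simp add: add_pos_nonneg)
  then show ?thesis
    unfolding dil_def[abs_def]
    by (auto intro!: derivative_eq_intros simp: field_simps)
qed

lemma DERIV_mu: "(mu n \<alpha> has_real_derivative
    - (2 * n * sin \<alpha> * (tan \<alpha>)\<^sup>2 * sin \<sigma> * cos \<sigma> / (dil \<alpha> \<sigma> * cos \<alpha> * cos (eps \<alpha> \<sigma>)))) (at \<sigma>)"
proof -
  have "cos (bet \<alpha> \<sigma>) = sqrt (1 - (sin \<alpha> * dil \<alpha> \<sigma>)\<^sup>2)"
    unfolding bet_def using sin_bet_less_1[OF \<alpha>, of \<sigma>] by (subst cos_arcsin) auto
  then have c: "sqrt (1 - (sin \<alpha> * dil \<alpha> \<sigma>)\<^sup>2) = cos \<alpha> * cos (eps \<alpha> \<sigma>)"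
    by (simp add: cos_bet[OF \<alpha>])
  show ?thesis
    unfolding mu_def[abs_def] bet_def
    using sin_bet_less_1[OF \<alpha>, of \<sigma>]
    by (auto intro!: derivative_eq_intros DERIV_dil simp: c) (simp add: field_simps)
qed

end

text \<open>The value of \<open>kM \<alpha>\<close> when
  \<open>r_frac \<alpha> = C * \<alpha>\<close> (see \<open>kM_eq\<close>). As a function of a real
  variable it admits expansions for all \<alpha> tending to 0, independently of the
  sequence.\<close>

definition Nfun :: "real \<Rightarrow> real \<Rightarrow> real" where
  "Nfun C \<alpha> = pi / (2 * \<alpha>) - C * \<alpha>"

context
  fixes C :: real
begin

text \<open>The prefix \<open>n\<close> marks quantities of the front that are divided by their order in \<open>\<alpha>\<close> and,
  where they vanish with \<open>sin \<sigma>\<close>, by \<open>sin \<sigma>\<close>, so that they are bounded as \<open>\<alpha> \<rightarrow> 0\<close>.\<close>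

definition nP :: "real \<Rightarrow> real \<Rightarrow> real" where
  "nP \<alpha> \<sigma> = (2 * Nfun C \<alpha> * \<alpha>) * (sin \<alpha> / \<alpha>) * ((tan \<alpha>)\<^sup>2 / \<alpha>\<^sup>2) * (1 / dil \<alpha> \<sigma>) * (1 / cos \<alpha>)
     * (1 / cos (eps \<alpha> \<sigma>))"

definition nQ :: "real \<Rightarrow> real \<Rightarrow> real" where
  "nQ \<alpha> \<sigma> = sin (mu (Nfun C \<alpha>) \<alpha> \<sigma>) / \<alpha>\<^sup>2"

definition nS :: "real \<Rightarrow> real \<Rightarrow> real" where
  "nS \<alpha> \<sigma> = nQ \<alpha> \<sigma> * (1 / dil \<alpha> \<sigma>)"

definition nSd :: "real \<Rightarrow> real \<Rightarrow> real" where
  "nSd \<alpha> \<sigma> = - (cos \<sigma> * (nP \<alpha> \<sigma> * cos (mu (Nfun C \<alpha>) \<alpha> \<sigma>) * (1 / dil \<alpha> \<sigma>)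
     + \<alpha> * (\<alpha> * (nQ \<alpha> \<sigma> * ((tan \<alpha>)\<^sup>2 / \<alpha>\<^sup>2) * ((1 / dil \<alpha> \<sigma>) * (1 / dil \<alpha> \<sigma>) * (1 / dil \<alpha> \<sigma>))))))"

definition nPd :: "real \<Rightarrow> real \<Rightarrow> real" where
  "nPd \<alpha> \<sigma> = (2 * Nfun C \<alpha> * \<alpha>) * ((tan \<alpha>)\<^sup>2 / \<alpha>\<^sup>2) * (1 / cos (eps \<alpha> \<sigma>)) * cos \<sigma>"

definition nZ :: "real \<Rightarrow> real \<Rightarrow> real" where
  "nZ \<alpha> \<sigma> = sin (psi (Nfun C \<alpha>) \<alpha> \<sigma>) / (\<alpha> * sin \<sigma>)"

definition nW :: "real \<Rightarrow> real \<Rightarrow> real" where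
  "nW \<alpha> \<sigma> = \<alpha> * (cos \<alpha> * cos \<sigma> * nS \<alpha> \<sigma>) + (sin \<alpha> / \<alpha>) * cos (mu (Nfun C \<alpha>) \<alpha> \<sigma>)"

definition nWd :: "real \<Rightarrow> real \<Rightarrow> real" where
  "nWd \<alpha> \<sigma> = cos \<alpha> * (cos \<sigma> * nSd \<alpha> \<sigma> - nS \<alpha> \<sigma>)
     + \<alpha> * (\<alpha> * (\<alpha> * ((sin \<alpha> / \<alpha>) * nQ \<alpha> \<sigma> * cos \<sigma> * nP \<alpha> \<sigma>)))"

definition nX :: "real \<Rightarrow> real \<Rightarrow> real" where
  "nX \<alpha> \<sigma> = nS \<alpha> \<sigma> - cos \<sigma> * nSd \<alpha> \<sigma>
     + \<alpha> * (cos (psi (Nfun C \<alpha>) \<alpha> \<sigma>) * nPd \<alpha> \<sigma> * nS \<alpha> \<sigma> + nZ \<alpha> \<sigma> * (cos \<sigma> * nS \<alpha> \<sigma>)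
       + nZ \<alpha> \<sigma> * (sin \<sigma> * (sin \<sigma> * nSd \<alpha> \<sigma>)) + nZ \<alpha> \<sigma> * (nPd \<alpha> \<sigma> * cos \<alpha> * nW \<alpha> \<sigma>))
     + (1 - cos (psi (Nfun C \<alpha>) \<alpha> \<sigma>)) * (cos \<alpha> * nWd \<alpha> \<sigma>)"

definition nY :: "real \<Rightarrow> real \<Rightarrow> real" where
  "nY \<alpha> \<sigma> = (1 / cos \<alpha>) * (cos (psi (Nfun C \<alpha>) \<alpha> \<sigma>) * (cos \<sigma> * nS \<alpha> \<sigma> + sin \<sigma> * (sin \<sigma> * nSd \<alpha> \<sigma>))
       - \<alpha> * (\<alpha> * (nZ \<alpha> \<sigma> * (nPd \<alpha> \<sigma> * (sin \<sigma> * (sin \<sigma> * nS \<alpha> \<sigma>))))))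
     + cos (psi (Nfun C \<alpha>) \<alpha> \<sigma>) * nPd \<alpha> \<sigma> * nW \<alpha> \<sigma>
     + \<alpha> * (nZ \<alpha> \<sigma> * (sin \<sigma> * (sin \<sigma> * nWd \<alpha> \<sigma>)))"

context
  fixes \<alpha> :: real
  assumes \<alpha>: "0 < \<alpha>" "\<alpha> < pi / 4"
begin

lemma DERIV_mu': "(mu (Nfun C \<alpha>) \<alpha> has_real_derivative - (\<alpha>\<^sup>2 * sin \<sigma> * cos \<sigma> * nP \<alpha> \<sigma>)) (at \<sigma>)"
  by (rule DERIV_cong[OF DERIV_mu[OF \<alpha>]]) (use \<alpha> in \<open>simp add: nP_def mult_ac\<close>)

lemma DERIV_psi: "(psi (Nfun C \<alpha>) \<alpha> has_real_derivative \<alpha> * nPd \<alpha> \<sigma>) (at \<sigma>)"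
  unfolding psi_def[abs_def] using \<alpha>
  by (auto intro!: derivative_eq_intros DERIV_eps[OF \<alpha>] simp: nPd_def power2_eq_square)

lemma Sfac_nS: "Sfac (Nfun C \<alpha>) \<alpha> \<sigma> = \<alpha>\<^sup>2 * nS \<alpha> \<sigma>"
  using \<alpha> by (simp add: Sfac_def nS_def nQ_def)

lemma DERIV_Sfac: "(Sfac (Nfun C \<alpha>) \<alpha> has_real_derivative \<alpha>\<^sup>2 * sin \<sigma> * nSd \<alpha> \<sigma>) (at \<sigma>)"
proof -
  have d: "dil \<alpha> \<sigma> \<noteq> 0"
    using dil_ge_1[OF \<alpha>, of \<sigma>] by auto
  show ?thesis
    unfolding Sfac_def[abs_def]
    apply (rule derivative_eq_intros DERIV_mu' DERIV_dil[OF \<alpha>] d refl)+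
    using d \<alpha> by (simp add: nSd_def nQ_def divide_simps) (simp add: algebra_simps power2_eq_square power4_eq_xxxx)
qed

lemma Wfac_nW: "Wfac (Nfun C \<alpha>) \<alpha> \<sigma> = \<alpha> * nW \<alpha> \<sigma>"
  using \<alpha> by (simp add: Wfac_def nW_def Sfac_nS algebra_simps power2_eq_square)

lemma DERIV_Wfac: "(Wfac (Nfun C \<alpha>) \<alpha> has_real_derivative \<alpha>\<^sup>2 * sin \<sigma> * nWd \<alpha> \<sigma>) (at \<sigma>)"
  unfolding Wfac_def[abs_def]
  apply (rule derivative_eq_intros DERIV_mu' DERIV_Sfac refl)+
  using \<alpha> by (simp add: nWd_def nQ_def Sfac_nS divide_simps) (simp add: algebra_simps power2_eq_square)

lemma sin_psi_nZ: "sin (psi (Nfun C \<alpha>) \<alpha> \<sigma>) = \<alpha> * sin \<sigma> * nZ \<alpha> \<sigma>"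
  using \<alpha> by (simp add: nZ_def psi_def eps_def)

text \<open>The factor \<open>sin \<sigma>\<close> is split off exactly, because near the ends of
  the front the speed must be known relative to \<open>sin \<sigma>\<close>, and an additive error
  would be useless there. Every term has this factor: the derivatives of \<open>mu\<close>,
  \<open>dil\<close> and \<open>cos \<sigma>\<close> contain it, and \<open>sin_psi_nZ\<close>
  supplies the rest.\<close>

lemma DERIV_topx: "(topx (Nfun C \<alpha>) \<alpha> has_real_derivative sin \<sigma> * nX \<alpha> \<sigma>) (at \<sigma>)"
proof -
  let ?S = "Sfac (Nfun C \<alpha>) \<alpha>" and ?p = "psi (Nfun C \<alpha>) \<alpha>" and ?W = "Wfac (Nfun C \<alpha>) \<alpha>"
  have "((\<lambda>\<sigma>. - cos \<sigma> * ?S \<sigma> + sin (?p \<sigma>) * (sin \<sigma> * ?S \<sigma>) + (1 - cos (?p \<sigma>)) * cos \<alpha> * ?W \<sigma>)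
    has_real_derivative \<alpha>\<^sup>2 * (sin \<sigma> * nX \<alpha> \<sigma>)) (at \<sigma>)"
    apply (rule derivative_eq_intros DERIV_psi DERIV_Sfac DERIV_Wfac refl)+
    unfolding sin_psi_nZ Sfac_nS Wfac_nW nX_def by (simp add: algebra_simps power2_eq_square)
  from DERIV_cdivide[OF this, of "\<alpha>\<^sup>2"] show ?thesis
    unfolding topx_def[abs_def] using \<alpha> by simp
qed

lemma DERIV_topy: "(topy (Nfun C \<alpha>) \<alpha> has_real_derivative nY \<alpha> \<sigma>) (at \<sigma>)"
proof -
  let ?S = "Sfac (Nfun C \<alpha>) \<alpha>" and ?p = "psi (Nfun C \<alpha>) \<alpha>" and ?W = "Wfac (Nfun C \<alpha>) \<alpha>"
  have "((\<lambda>\<sigma>. cos (?p \<sigma>) * (sin \<sigma> * ?S \<sigma>))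
    has_real_derivative \<alpha>\<^sup>2 * (cos (?p \<sigma>) * (cos \<sigma> * nS \<alpha> \<sigma> + sin \<sigma> * (sin \<sigma> * nSd \<alpha> \<sigma>))
       - \<alpha> * (\<alpha> * (nZ \<alpha> \<sigma> * (nPd \<alpha> \<sigma> * (sin \<sigma> * (sin \<sigma> * nS \<alpha> \<sigma>))))))) (at \<sigma>)"
    apply (rule derivative_eq_intros DERIV_psi DERIV_Sfac refl)+
    unfolding sin_psi_nZ Sfac_nS by (simp add: algebra_simps power2_eq_square)
  moreover have "((\<lambda>\<sigma>. sin (?p \<sigma>) * ?W \<sigma>) has_real_derivative \<alpha>\<^sup>2 * (cos (?p \<sigma>) * nPd \<alpha> \<sigma> * nW \<alpha> \<sigma>
     + \<alpha> * (nZ \<alpha> \<sigma> * (sin \<sigma> * (sin \<sigma> * nWd \<alpha> \<sigma>))))) (at \<sigma>)"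
    apply (rule derivative_eq_intros DERIV_psi DERIV_Wfac refl)+
    unfolding sin_psi_nZ Wfac_nW by (simp add: algebra_simps power2_eq_square)
  ultimately show ?thesis
    unfolding topy_def[abs_def]
    apply -
    apply (rule DERIV_cong)
     apply (rule DERIV_cdivide DERIV_add | assumption)+
    unfolding nY_def using \<alpha> by (simp add: add_divide_distrib diff_divide_distrib)
qed

end

end

section \<open>Uniform expansion of the front\<close>

definition bd :: "(real \<Rightarrow> real \<Rightarrow> real) \<Rightarrow> bool" where
  "bd f \<longleftrightarrow> (\<exists>K. \<forall>\<^sub>F \<alpha> in at_right 0. \<forall>\<sigma>\<in>{0..pi}. \<bar>f \<alpha> \<sigma>\<bar> \<le> K)"

text \<open>An expansion \<open>f = g + O(\<alpha>)\<close>, uniform in \<sigma>. The boundedness of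
  \<open>g\<close> is part of the notion so that it is preserved by products.\<close>

definition apx :: "(real \<Rightarrow> real \<Rightarrow> real) \<Rightarrow> (real \<Rightarrow> real \<Rightarrow> real) \<Rightarrow> bool" where
  "apx f g \<longleftrightarrow> bd g \<and> (\<exists>K. \<forall>\<^sub>F \<alpha> in at_right 0. \<forall>\<sigma>\<in>{0..pi}. \<bar>f \<alpha> \<sigma> - g \<alpha> \<sigma>\<bar> \<le> K * \<alpha>)"

lemma at_right_0_lt: "0 < c \<Longrightarrow> \<forall>\<^sub>F \<alpha> in at_right (0::real). 0 < \<alpha> \<and> \<alpha> < c"
  using eventually_at_right_less[of 0] eventually_at_right_field by auto

lemma pi_quarter: "0 < pi / 4"
  by simp

lemma bdE:
  assumes "bd f" obtains K where "K \<ge> 0" "\<forall>\<^sub>F \<alpha> in at_right 0. \<forall>\<sigma>\<in>{0..pi}. \<bar>f \<alpha> \<sigma>\<bar> \<le> K"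
proof -
  from assms obtain K where K: "\<forall>\<^sub>F \<alpha> in at_right 0. \<forall>\<sigma>\<in>{0..pi}. \<bar>f \<alpha> \<sigma>\<bar> \<le> K"
    by (auto simp: bd_def)
  have "\<forall>\<^sub>F \<alpha> in at_right 0. \<forall>\<sigma>\<in>{0..pi}. \<bar>f \<alpha> \<sigma>\<bar> \<le> \<bar>K\<bar>"
    using K by eventually_elim force
  then show ?thesis using that[of "\<bar>K\<bar>"] by simp
qed

lemma bdI: "(\<forall>\<^sub>F \<alpha> in at_right 0. \<forall>\<sigma>\<in>{0..pi}. \<bar>f \<alpha> \<sigma>\<bar> \<le> K) \<Longrightarrow> bd f"
  by (auto simp: bd_def)

lemma bd_add: "bd f \<Longrightarrow> bd g \<Longrightarrow> bd (\<lambda>\<alpha> \<sigma>. f \<alpha> \<sigma> + g \<alpha> \<sigma>)"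
proof -
  assume f: "bd f" and g: "bd g"
  from f obtain K where K: "\<forall>\<^sub>F \<alpha> in at_right 0. \<forall>\<sigma>\<in>{0..pi}. \<bar>f \<alpha> \<sigma>\<bar> \<le> K"
    by (rule bdE)
  from g obtain L where L: "\<forall>\<^sub>F \<alpha> in at_right 0. \<forall>\<sigma>\<in>{0..pi}. \<bar>g \<alpha> \<sigma>\<bar> \<le> L"
    by (rule bdE)
  from K L have "\<forall>\<^sub>F \<alpha> in at_right 0. \<forall>\<sigma>\<in>{0..pi}. \<bar>f \<alpha> \<sigma> + g \<alpha> \<sigma>\<bar> \<le> K + L"
    by eventually_elim (auto intro!: abs_triangle_ineq[THEN order_trans] add_mono)
  then show ?thesis by (rule bdI)
qed

lemma bd_mult: "bd f \<Longrightarrow> bd g \<Longrightarrow> bd (\<lambda>\<alpha> \<sigma>. f \<alpha> \<sigma> * g \<alpha> \<sigma>)"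
proof -
  assume f: "bd f" and g: "bd g"
  from f obtain K where K: "K \<ge> 0" and *: "\<forall>\<^sub>F \<alpha> in at_right 0. \<forall>\<sigma>\<in>{0..pi}. \<bar>f \<alpha> \<sigma>\<bar> \<le> K"
    by (rule bdE)
  from g obtain L where L: "\<forall>\<^sub>F \<alpha> in at_right 0. \<forall>\<sigma>\<in>{0..pi}. \<bar>g \<alpha> \<sigma>\<bar> \<le> L"
    by (rule bdE)
  from * L have "\<forall>\<^sub>F \<alpha> in at_right 0. \<forall>\<sigma>\<in>{0..pi}. \<bar>f \<alpha> \<sigma> * g \<alpha> \<sigma>\<bar> \<le> K * L"
    by eventually_elim (use K in \<open>auto simp: abs_mult intro!: mult_mono\<close>)
  then show ?thesis by (rule bdI)
qed

lemma bd_const: "bd (\<lambda>_ _. c)"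
  by (rule bdI[of _ "\<bar>c\<bar>"]) simp

lemma bd_minus: "bd f \<Longrightarrow> bd (\<lambda>\<alpha> \<sigma>. - f \<alpha> \<sigma>)"
  by (simp add: bd_def)

lemma bd_diff: "bd f \<Longrightarrow> bd g \<Longrightarrow> bd (\<lambda>\<alpha> \<sigma>. f \<alpha> \<sigma> - g \<alpha> \<sigma>)"
  using bd_add[of f "\<lambda>\<alpha> \<sigma>. - g \<alpha> \<sigma>"] bd_minus[of g] by simp

lemma bd_alpha: "bd (\<lambda>\<alpha> _. \<alpha>)"
  by (rule bdI[of _ 1]) (rule eventually_mono[OF at_right_0_lt[of 1]], auto)

lemma bd_sin_cos: "bd (\<lambda>_ \<sigma>. sin \<sigma>)" "bd (\<lambda>_ \<sigma>. cos \<sigma>)" "bd (\<lambda>\<alpha> \<sigma>. sin (f \<alpha> \<sigma>))" "bd (\<lambda>\<alpha> \<sigma>. cos (f \<alpha> \<sigma>))"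
  by (rule bdI[of _ 1], simp)+

lemma apx_bd: "apx f g \<Longrightarrow> bd f"
proof -
  assume a: "apx f g"
  then obtain K where K: "\<forall>\<^sub>F \<alpha> in at_right 0. \<forall>\<sigma>\<in>{0..pi}. \<bar>f \<alpha> \<sigma> - g \<alpha> \<sigma>\<bar> \<le> K * \<alpha>"
    by (auto simp: apx_def)
  have "\<forall>\<^sub>F \<alpha> in at_right 0. \<forall>\<sigma>\<in>{0..pi}. \<bar>f \<alpha> \<sigma> - g \<alpha> \<sigma>\<bar> \<le> \<bar>K\<bar>"
    using K at_right_0_lt[of 1, OF zero_less_one]
  proof eventually_elim
    case (elim \<alpha>)
    have "K * \<alpha> \<le> \<bar>K\<bar> * 1"
      using elim by (intro mult_mono) auto
    then show ?case using elim by force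
  qed
  then have "bd (\<lambda>\<alpha> \<sigma>. f \<alpha> \<sigma> - g \<alpha> \<sigma>)" by (rule bdI)
  from bd_add[OF this, of g] a show "bd f" by (simp add: apx_def)
qed

lemma apxE:
  assumes "apx f g" obtains K where "K \<ge> 0" "\<forall>\<^sub>F \<alpha> in at_right 0. \<forall>\<sigma>\<in>{0..pi}. \<bar>f \<alpha> \<sigma> - g \<alpha> \<sigma>\<bar> \<le> K * \<alpha>"
proof -
  from assms obtain K where K: "\<forall>\<^sub>F \<alpha> in at_right 0. \<forall>\<sigma>\<in>{0..pi}. \<bar>f \<alpha> \<sigma> - g \<alpha> \<sigma>\<bar> \<le> K * \<alpha>"
    by (auto simp: apx_def)
  have "\<forall>\<^sub>F \<alpha> in at_right 0. \<forall>\<sigma>\<in>{0..pi}. \<bar>f \<alpha> \<sigma> - g \<alpha> \<sigma>\<bar> \<le> \<bar>K\<bar> * \<alpha>"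
    using K at_right_0_lt[of 1, OF zero_less_one]
  proof eventually_elim
    case (elim \<alpha>)
    have "K * \<alpha> \<le> \<bar>K\<bar> * \<alpha>"
      using elim by (intro mult_right_mono) auto
    then show ?case using elim by (meson order_trans)
  qed
  then show ?thesis using that[of "\<bar>K\<bar>"] by simp
qed

lemma apxI: "bd g \<Longrightarrow> (\<forall>\<^sub>F \<alpha> in at_right 0. \<forall>\<sigma>\<in>{0..pi}. \<bar>f \<alpha> \<sigma> - g \<alpha> \<sigma>\<bar> \<le> K * \<alpha>) \<Longrightarrow> apx f g"
  by (auto simp: apx_def)

lemma apx_small: "bd f \<Longrightarrow> apx (\<lambda>\<alpha> \<sigma>. \<alpha> * f \<alpha> \<sigma>) (\<lambda>_ _. 0)"
proof -
  assume "bd f"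
  then obtain K where "\<forall>\<^sub>F \<alpha> in at_right 0. \<forall>\<sigma>\<in>{0..pi}. \<bar>f \<alpha> \<sigma>\<bar> \<le> K"
    by (rule bdE)
  then have "\<forall>\<^sub>F \<alpha> in at_right 0. \<forall>\<sigma>\<in>{0..pi}. \<bar>\<alpha> * f \<alpha> \<sigma> - 0\<bar> \<le> K * \<alpha>"
    using at_right_0_lt[of 1, OF zero_less_one]
    by eventually_elim (auto simp: abs_mult mult.commute)
  then show ?thesis by (rule apxI[OF bd_const])
qed

lemma apx_of_diff:
  assumes "bd g" "bd h" "\<And>\<alpha> \<sigma>. \<alpha> > 0 \<Longrightarrow> f \<alpha> \<sigma> - g \<alpha> \<sigma> = \<alpha> * h \<alpha> \<sigma>"
  shows "apx f g"
proof -
  from assms(2) obtain K where "\<forall>\<^sub>F \<alpha> in at_right 0. \<forall>\<sigma>\<in>{0..pi}. \<bar>h \<alpha> \<sigma>\<bar> \<le> K"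
    by (rule bdE)
  then have "\<forall>\<^sub>F \<alpha> in at_right 0. \<forall>\<sigma>\<in>{0..pi}. \<bar>f \<alpha> \<sigma> - g \<alpha> \<sigma>\<bar> \<le> K * \<alpha>"
    using at_right_0_lt[of 1, OF zero_less_one]
    by eventually_elim (auto simp: assms(3) abs_mult mult.commute)
  then show ?thesis using assms by (intro apxI)
qed

text \<open>Turns the error bound into boundedness of a quotient, so that the rules for sums and
  products of expansions follow from those for \<open>bd\<close>.\<close>

lemma apx_iff: "apx f g \<longleftrightarrow> bd g \<and> bd (\<lambda>\<alpha> \<sigma>. (f \<alpha> \<sigma> - g \<alpha> \<sigma>) / \<alpha>)"
proof
  assume a: "apx f g"
  then obtain K where "\<forall>\<^sub>F \<alpha> in at_right 0. \<forall>\<sigma>\<in>{0..pi}. \<bar>f \<alpha> \<sigma> - g \<alpha> \<sigma>\<bar> \<le> K * \<alpha>"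
    by (rule apxE)
  then have "\<forall>\<^sub>F \<alpha> in at_right 0. \<forall>\<sigma>\<in>{0..pi}. \<bar>(f \<alpha> \<sigma> - g \<alpha> \<sigma>) / \<alpha>\<bar> \<le> K"
    using at_right_0_lt[of 1, OF zero_less_one]
    by eventually_elim (auto simp: field_simps)
  then show "bd g \<and> bd (\<lambda>\<alpha> \<sigma>. (f \<alpha> \<sigma> - g \<alpha> \<sigma>) / \<alpha>)"
    using a by (auto simp: apx_def intro: bdI)
next
  assume "bd g \<and> bd (\<lambda>\<alpha> \<sigma>. (f \<alpha> \<sigma> - g \<alpha> \<sigma>) / \<alpha>)"
  then show "apx f g" by (auto intro: apx_of_diff)
qed

lemma apx_add:
  assumes "apx f f'" "apx g g'"
  shows "apx (\<lambda>\<alpha> \<sigma>. f \<alpha> \<sigma> + g \<alpha> \<sigma>) (\<lambda>\<alpha> \<sigma>. f' \<alpha> \<sigma> + g' \<alpha> \<sigma>)"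
proof (rule apx_of_diff)
  show "bd (\<lambda>\<alpha> \<sigma>. f' \<alpha> \<sigma> + g' \<alpha> \<sigma>)"
    using assms by (auto simp: apx_def intro!: bd_add)
  show "bd (\<lambda>\<alpha> \<sigma>. (f \<alpha> \<sigma> - f' \<alpha> \<sigma>) / \<alpha> + (g \<alpha> \<sigma> - g' \<alpha> \<sigma>) / \<alpha>)"
    using assms by (intro bd_add) (auto simp: apx_iff)
qed (simp add: field_simps)

lemma apx_minus:
  assumes "apx f f'" shows "apx (\<lambda>\<alpha> \<sigma>. - f \<alpha> \<sigma>) (\<lambda>\<alpha> \<sigma>. - f' \<alpha> \<sigma>)"
proof (rule apx_of_diff)
  show "bd (\<lambda>\<alpha> \<sigma>. - f' \<alpha> \<sigma>)"
    using assms by (auto simp: apx_def intro!: bd_minus)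
  show "bd (\<lambda>\<alpha> \<sigma>. - ((f \<alpha> \<sigma> - f' \<alpha> \<sigma>) / \<alpha>))"
    using assms by (intro bd_minus) (auto simp: apx_iff)
qed (simp add: field_simps)

lemma apx_diff: "apx f f' \<Longrightarrow> apx g g' \<Longrightarrow> apx (\<lambda>\<alpha> \<sigma>. f \<alpha> \<sigma> - g \<alpha> \<sigma>) (\<lambda>\<alpha> \<sigma>. f' \<alpha> \<sigma> - g' \<alpha> \<sigma>)"
  using apx_add[OF _ apx_minus, of f f' g g'] by simp

lemma apx_mult:
  assumes "apx f f'" "apx g g'"
  shows "apx (\<lambda>\<alpha> \<sigma>. f \<alpha> \<sigma> * g \<alpha> \<sigma>) (\<lambda>\<alpha> \<sigma>. f' \<alpha> \<sigma> * g' \<alpha> \<sigma>)"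
proof (rule apx_of_diff)
  show "bd (\<lambda>\<alpha> \<sigma>. f' \<alpha> \<sigma> * g' \<alpha> \<sigma>)"
    using assms by (auto simp: apx_def intro!: bd_mult)
  show "bd (\<lambda>\<alpha> \<sigma>. ((f \<alpha> \<sigma> - f' \<alpha> \<sigma>) / \<alpha>) * g \<alpha> \<sigma> + f' \<alpha> \<sigma> * ((g \<alpha> \<sigma> - g' \<alpha> \<sigma>) / \<alpha>))"
    using assms apx_bd[OF assms(2)] by (intro bd_add bd_mult) (auto simp: apx_iff)
qed (simp add: field_simps)

lemma apx_refl: "bd f \<Longrightarrow> apx f f"
  by (rule apx_of_diff[where h="\<lambda>_ _. 0"]) (auto intro: bd_const)

lemma apx_trans_eq: "apx f g \<Longrightarrow> (\<And>\<alpha> \<sigma>. g \<alpha> \<sigma> = h \<alpha> \<sigma>) \<Longrightarrow> apx f h"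
proof -
  assume "apx f g" "\<And>\<alpha> \<sigma>. g \<alpha> \<sigma> = h \<alpha> \<sigma>"
  moreover from this(2) have "g = h" by (intro ext)
  ultimately show ?thesis by simp
qed

text \<open>Entry point for the factors that do not involve \<sigma>: their expansions are
  statements about one variable, which \<open>real_asymp\<close> proves.\<close>

lemma apx_lift: "(\<lambda>x. f x - k) \<in> O[at_right 0](\<lambda>x. x) \<Longrightarrow> apx (\<lambda>\<alpha> _. f \<alpha>) (\<lambda>_ _. k)"
proof -
  assume "(\<lambda>x. f x - k) \<in> O[at_right 0](\<lambda>x. x)"
  then obtain K where "\<forall>\<^sub>F x in at_right 0. norm (f x - k) \<le> K * norm x"
    by (elim landau_o.bigE)
  then have "\<forall>\<^sub>F \<alpha> in at_right 0. \<forall>\<sigma>\<in>{0..pi}. \<bar>f \<alpha> - k\<bar> \<le> K * \<alpha>"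
    using at_right_0_lt[of 1, OF zero_less_one] by eventually_elim auto
  then show ?thesis by (rule apxI[OF bd_const])
qed

lemmas bd_intros = bd_add bd_mult bd_diff bd_minus bd_const bd_alpha bd_sin_cos
lemmas apx_intros = apx_add apx_diff apx_minus apx_mult

lemma apx_alpha:
  "apx (\<lambda>\<alpha> _. sin \<alpha> / \<alpha>) (\<lambda>_ _. 1)"
  "apx (\<lambda>\<alpha> _. (tan \<alpha>)\<^sup>2 / \<alpha>\<^sup>2) (\<lambda>_ _. 1)"
  "apx (\<lambda>\<alpha> _. cos \<alpha>) (\<lambda>_ _. 1)"
  "apx (\<lambda>\<alpha> _. 1 / cos \<alpha>) (\<lambda>_ _. 1)"
  "apx (\<lambda>\<alpha> _. 2 * Nfun C \<alpha> * \<alpha>) (\<lambda>_ _. pi)"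
  unfolding Nfun_def by (rule apx_lift; real_asymp)+

lemma sin_diff_self_le: "\<bar>sin x - x\<bar> \<le> x\<^sup>2 / 2" for x :: real
  using Maclaurin_sin_bound[of x 2] by (simp add: sin_coeff_def numeral_2_eq_2)

lemma cos_diff_one_le: "\<bar>cos x - 1\<bar> \<le> x\<^sup>2 / 2" for x :: real
proof -
  have "cos x = 1 - 2 * (sin (x/2))\<^sup>2"
    using cos_double_sin[of "x/2"] by simp
  moreover have "(sin (x/2))\<^sup>2 \<le> (x/2)\<^sup>2"
    using abs_sin_x_le_abs_x[of "x/2"] by (simp only: abs_le_square_iff)
  ultimately show ?thesis by (simp add: power_divide)
qed

text \<open>The estimates below hold for \<open>0 < \<alpha> < \<pi>/4\<close>; outside this range the functions are junk.\<close>

lemma apx_pointwise: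
  assumes "bd g" "bd b" "\<And>\<alpha> \<sigma>. 0 < \<alpha> \<Longrightarrow> \<alpha> < c \<Longrightarrow> 0 \<le> \<sigma> \<Longrightarrow> \<sigma> \<le> pi \<Longrightarrow> \<bar>f \<alpha> \<sigma> - g \<alpha> \<sigma>\<bar> \<le> \<alpha> * b \<alpha> \<sigma>"
    "0 < c"
  shows "apx f g"
proof -
  from assms(2) obtain K where "\<forall>\<^sub>F \<alpha> in at_right 0. \<forall>\<sigma>\<in>{0..pi}. \<bar>b \<alpha> \<sigma>\<bar> \<le> K"
    by (rule bdE)
  then have "\<forall>\<^sub>F \<alpha> in at_right 0. \<forall>\<sigma>\<in>{0..pi}. \<bar>f \<alpha> \<sigma> - g \<alpha> \<sigma>\<bar> \<le> K * \<alpha>"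
    using at_right_0_lt[OF assms(4)]
  proof eventually_elim
    case (elim \<alpha>)
    show ?case
    proof
      fix \<sigma> :: real assume s: "\<sigma> \<in> {0..pi}"
      have "\<bar>f \<alpha> \<sigma> - g \<alpha> \<sigma>\<bar> \<le> \<alpha> * b \<alpha> \<sigma>"
        using assms(3)[of \<alpha> \<sigma>] elim s by auto
      also have "\<dots> \<le> \<alpha> * K"
        using elim s by (intro mult_left_mono) (auto intro: abs_le_D1)
      finally show "\<bar>f \<alpha> \<sigma> - g \<alpha> \<sigma>\<bar> \<le> K * \<alpha>" by (simp add: mult.commute)
    qed
  qed
  then show ?thesis using assms by (intro apxI)
qed

lemma tan_small: "0 < \<alpha> \<Longrightarrow> \<alpha> < pi/4 \<Longrightarrow> (tan \<alpha>)\<^sup>2 = \<alpha> * (\<alpha> * ((tan \<alpha>)\<^sup>2 / \<alpha>\<^sup>2))"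
  by (simp add: power2_eq_square)

lemma apx_dil: "apx (\<lambda>\<alpha> \<sigma>. 1 / dil \<alpha> \<sigma>) (\<lambda>_ _. 1)"
proof (rule apx_pointwise[where c="pi/4" and b="\<lambda>\<alpha> \<sigma>. \<alpha> * ((tan \<alpha>)\<^sup>2 / \<alpha>\<^sup>2)"])
  fix \<alpha> \<sigma> :: real assume a: "0 < \<alpha>" "\<alpha> < pi / 4"
  note d = dil_ge_1[OF a, of \<sigma>] dil_sq[OF a, of \<sigma>]
  have "(dil \<alpha> \<sigma> - 1) * 1 \<le> (dil \<alpha> \<sigma> - 1) * (dil \<alpha> \<sigma> + 1)"
    using d by (intro mult_left_mono) auto
  also have "\<dots> = (tan \<alpha>)\<^sup>2 * (sin \<sigma>)\<^sup>2"
    using d by (simp add: power2_eq_square algebra_simps)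
  also have "\<dots> \<le> (tan \<alpha>)\<^sup>2 * 1"
    by (intro mult_left_mono) (auto simp: abs_square_le_1)
  finally have "dil \<alpha> \<sigma> - 1 \<le> (tan \<alpha>)\<^sup>2" by simp
  moreover have "\<bar>1 / dil \<alpha> \<sigma> - 1\<bar> \<le> dil \<alpha> \<sigma> - 1"
  proof -
    have "1 / dil \<alpha> \<sigma> \<le> 1" using d by simp
    moreover have "1 - 1 / dil \<alpha> \<sigma> = (dil \<alpha> \<sigma> - 1) / dil \<alpha> \<sigma>" using d by (simp add: field_simps)
    moreover have "\<dots> \<le> (dil \<alpha> \<sigma> - 1) / 1" using d by (intro divide_left_mono) auto
    ultimately show ?thesis by simp
  qed
  ultimately show "\<bar>1 / dil \<alpha> \<sigma> - 1\<bar> \<le> \<alpha> * (\<alpha> * ((tan \<alpha>)\<^sup>2 / \<alpha>\<^sup>2))"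
    using tan_small[OF a] by simp
qed (intro bd_intros apx_alpha[THEN apx_bd] | simp)+

lemma tan_sq_le_half: "\<exists>c>0. c \<le> pi / 4 \<and> (\<forall>\<alpha>. 0 < \<alpha> \<and> \<alpha> < c \<longrightarrow> (tan \<alpha>)\<^sup>2 \<le> 1 / 2)"
proof -
  have "\<forall>\<^sub>F \<alpha> in at_right (0::real). (tan \<alpha>)\<^sup>2 < 1 / 2"
    by real_asymp
  then obtain b where "b > 0" "\<And>y::real. 0 < y \<Longrightarrow> y < b \<Longrightarrow> (tan y)\<^sup>2 < 1 / 2"
    by (auto simp: eventually_at_right_field)
  then show ?thesis
    by (intro exI[of _ "min b (pi/4)"]) (auto intro: less_imp_le)
qed

lemma cos_eps_ge_half:
  assumes "0 < \<alpha>" "\<alpha> < pi / 4" "(tan \<alpha>)\<^sup>2 \<le> 1 / 2"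
  shows "1 / 2 \<le> cos (eps \<alpha> \<sigma>)" "1 - cos (eps \<alpha> \<sigma>) \<le> (tan \<alpha>)\<^sup>2"
proof -
  note e = sin_eps[OF assms(1,2), of \<sigma>] cos_eps_pos[OF assms(1,2), of \<sigma>]
  have "1 - (cos (eps \<alpha> \<sigma>))\<^sup>2 = ((tan \<alpha>)\<^sup>2 * sin \<sigma>)\<^sup>2"
    using e by (simp add: cos_squared_eq)
  also have "\<dots> = (tan \<alpha>)\<^sup>2 * ((tan \<alpha>)\<^sup>2 * (sin \<sigma>)\<^sup>2)"
    by (simp add: power2_eq_square)
  also have "\<dots> \<le> (tan \<alpha>)\<^sup>2 * ((1/2) * 1)"
    using assms by (intro mult_mono mult_nonneg_nonneg) (auto simp: abs_square_le_1)
  finally have 1: "1 - (cos (eps \<alpha> \<sigma>))\<^sup>2 \<le> (tan \<alpha>)\<^sup>2 / 2" by simp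
  have 2: "(cos (eps \<alpha> \<sigma>))\<^sup>2 \<le> cos (eps \<alpha> \<sigma>) * 1"
    unfolding power2_eq_square using e by (intro mult_left_mono) auto
  show "1 / 2 \<le> cos (eps \<alpha> \<sigma>)"
    using 1 2 assms by linarith
  show "1 - cos (eps \<alpha> \<sigma>) \<le> (tan \<alpha>)\<^sup>2"
    using 1 2 zero_le_power2[of "tan \<alpha>"] by linarith
qed

lemma apx_eps: "apx (\<lambda>\<alpha> \<sigma>. 1 / cos (eps \<alpha> \<sigma>)) (\<lambda>_ _. 1)"
proof -
  obtain c where c: "c > 0" "c \<le> pi / 4" "\<And>\<alpha>. 0 < \<alpha> \<Longrightarrow> \<alpha> < c \<Longrightarrow> (tan \<alpha>)\<^sup>2 \<le> 1 / 2"
    using tan_sq_le_half by auto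
  show ?thesis
  proof (rule apx_pointwise[where c=c and b="\<lambda>\<alpha> \<sigma>. \<alpha> * (2 * ((tan \<alpha>)\<^sup>2 / \<alpha>\<^sup>2))"])
    fix \<alpha> \<sigma> :: real assume a: "0 < \<alpha>" "\<alpha> < c"
    then have a': "0 < \<alpha>" "\<alpha> < pi / 4" "(tan \<alpha>)\<^sup>2 \<le> 1 / 2" using c by auto
    note e = cos_eps_ge_half[OF a', of \<sigma>]
    have "\<bar>1 / cos (eps \<alpha> \<sigma>) - 1\<bar> = (1 - cos (eps \<alpha> \<sigma>)) / cos (eps \<alpha> \<sigma>)"
      using e cos_le_one[of "eps \<alpha> \<sigma>"] by (simp add: field_simps abs_if not_less)
    also have "\<dots> \<le> (tan \<alpha>)\<^sup>2 / (1 / 2)"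
      using e by (intro frac_le) auto
    also have "\<dots> = \<alpha> * (\<alpha> * (2 * ((tan \<alpha>)\<^sup>2 / \<alpha>\<^sup>2)))"
      using a by (simp add: power2_eq_square)
    finally show "\<bar>1 / cos (eps \<alpha> \<sigma>) - 1\<bar> \<le> \<alpha> * (\<alpha> * (2 * ((tan \<alpha>)\<^sup>2 / \<alpha>\<^sup>2)))" .
  qed (use c in \<open>(intro bd_intros apx_alpha[THEN apx_bd] | simp)+\<close>)
qed

text \<open>A bound relative to \<open>sin \<sigma>\<close> is wanted: it makes \<open>psi\<close>
  divisible by \<open>sin \<sigma>\<close> with a bounded quotient.\<close>

lemma eps_le:
  assumes "0 < \<alpha>" "\<alpha> < pi / 4" "0 \<le> \<sigma>" "\<sigma> \<le> pi"
  shows "0 \<le> eps \<alpha> \<sigma>" "eps \<alpha> \<sigma> \<le> 5 * ((tan \<alpha>)\<^sup>2 * sin \<sigma>)"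
proof -
  note e = sin_eps[OF assms(1,2), of \<sigma>] eps_bounds[OF assms(1,2), of \<sigma>]
  have s: "0 \<le> sin (eps \<alpha> \<sigma>)"
    unfolding e using assms by (simp add: sin_ge_zero)
  show p: "0 \<le> eps \<alpha> \<sigma>"
  proof (rule ccontr)
    assume "\<not> 0 \<le> eps \<alpha> \<sigma>"
    then have "sin (- eps \<alpha> \<sigma>) > 0" using e by (intro sin_gt_zero) auto
    then show False using s by simp
  qed
  \<comment> \<open>Since \<open>8/5\<close> exceeds \<open>pi/2\<close>, the estimate
    \<open>sin x \<ge> x - x^2 / 2\<close> leaves \<open>sin x \<ge> x / 5\<close> here.\<close>
  have "eps \<alpha> \<sigma> * (eps \<alpha> \<sigma>) \<le> eps \<alpha> \<sigma> * (8/5)"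
    using e p pi_approx by (intro mult_left_mono) auto
  then have "eps \<alpha> \<sigma> \<le> 5 * sin (eps \<alpha> \<sigma>)"
    using sin_diff_self_le[of "eps \<alpha> \<sigma>"] unfolding power2_eq_square by linarith
  then show "eps \<alpha> \<sigma> \<le> 5 * ((tan \<alpha>)\<^sup>2 * sin \<sigma>)" by (simp add: e)
qed

section \<open>Expansions of the ingredients of the front and of its speed\<close>

context
  fixes C :: real
begin

lemma apx_nP: "apx (nP C) (\<lambda>_ _. pi)"
  by (rule apx_trans_eq, unfold nP_def[abs_def], (rule apx_intros apx_alpha apx_dil apx_eps)+) simp

lemma psi_bound: "\<exists>K. \<forall>\<^sub>F \<alpha> in at_right 0. \<forall>\<sigma>\<in>{0..pi}. \<bar>psi (Nfun C \<alpha>) \<alpha> \<sigma>\<bar> \<le> K * (\<alpha> * sin \<sigma>)"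
proof -
  have "bd (\<lambda>\<alpha> \<sigma>. (2 * Nfun C \<alpha> * \<alpha>) * (5 * ((tan \<alpha>)\<^sup>2 / \<alpha>\<^sup>2)))"
    by (intro bd_intros apx_alpha[THEN apx_bd])
  then obtain K where "\<forall>\<^sub>F \<alpha> in at_right 0. \<forall>\<sigma>\<in>{0..pi}. \<bar>(2 * Nfun C \<alpha> * \<alpha>) * (5 * ((tan \<alpha>)\<^sup>2 / \<alpha>\<^sup>2))\<bar> \<le> K"
    by (rule bdE)
  then have "\<forall>\<^sub>F \<alpha> in at_right 0. \<forall>\<sigma>\<in>{0..pi}. \<bar>psi (Nfun C \<alpha>) \<alpha> \<sigma>\<bar> \<le> K * (\<alpha> * sin \<sigma>)"
    using at_right_0_lt[of "pi/4", OF pi_quarter]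
  proof eventually_elim
    case (elim \<alpha>)
    show ?case
    proof
      fix \<sigma> :: real assume s: "\<sigma> \<in> {0..pi}"
      have ss: "sin \<sigma> \<ge> 0" using s by (simp add: sin_ge_zero)
      have "\<bar>psi (Nfun C \<alpha>) \<alpha> \<sigma>\<bar> = \<bar>2 * Nfun C \<alpha>\<bar> * \<bar>eps \<alpha> \<sigma>\<bar>"
        by (simp add: psi_def abs_mult)
      also have "\<dots> \<le> \<bar>2 * Nfun C \<alpha>\<bar> * (5 * ((tan \<alpha>)\<^sup>2 * sin \<sigma>))"
        using eps_le[of \<alpha> \<sigma>] elim s by (intro mult_left_mono) auto
      also have "\<dots> = \<bar>(2 * Nfun C \<alpha> * \<alpha>) * (5 * ((tan \<alpha>)\<^sup>2 / \<alpha>\<^sup>2))\<bar> * (\<alpha> * sin \<sigma>)"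
        using elim by (simp add: abs_mult power2_eq_square)
      also have "\<dots> \<le> K * (\<alpha> * sin \<sigma>)"
        using elim s ss by (intro mult_right_mono) auto
      finally show "\<bar>psi (Nfun C \<alpha>) \<alpha> \<sigma>\<bar> \<le> K * (\<alpha> * sin \<sigma>)" .
    qed
  qed
  then show ?thesis by blast
qed

lemma bd_nZ: "bd (nZ C)"
proof -
  obtain K where "\<forall>\<^sub>F \<alpha> in at_right 0. \<forall>\<sigma>\<in>{0..pi}. \<bar>psi (Nfun C \<alpha>) \<alpha> \<sigma>\<bar> \<le> K * (\<alpha> * sin \<sigma>)"
    using psi_bound by auto
  then have "\<forall>\<^sub>F \<alpha> in at_right 0. \<forall>\<sigma>\<in>{0..pi}. \<bar>nZ C \<alpha> \<sigma>\<bar> \<le> \<bar>K\<bar>"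
    using at_right_0_lt[of "pi/4", OF pi_quarter]
  proof eventually_elim
    case (elim \<alpha>)
    show ?case
    proof
      fix \<sigma> :: real assume s: "\<sigma> \<in> {0..pi}"
      have ss: "sin \<sigma> \<ge> 0" using s by (simp add: sin_ge_zero)
      have "\<bar>sin (psi (Nfun C \<alpha>) \<alpha> \<sigma>)\<bar> \<le> K * (\<alpha> * sin \<sigma>)"
        using elim s abs_sin_x_le_abs_x order_trans by blast
      also have "\<dots> \<le> \<bar>K\<bar> * (\<alpha> * sin \<sigma>)"
        using ss elim by (intro mult_right_mono) auto
      \<comment> \<open>Where \<open>sin \<sigma> = 0\<close>, the quotient \<open>nZ\<close> has
        the value 0 by the convention for division.\<close>
      finally show "\<bar>nZ C \<alpha> \<sigma>\<bar> \<le> \<bar>K\<bar>"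
        using ss elim by (cases "sin \<sigma> = 0") (auto simp: nZ_def abs_mult field_simps)
    qed
  qed
  then show ?thesis by (rule bdI)
qed

lemma apx_cos_psi: "apx (\<lambda>\<alpha> \<sigma>. cos (psi (Nfun C \<alpha>) \<alpha> \<sigma>)) (\<lambda>_ _. 1)"
proof -
  obtain K where "\<forall>\<^sub>F \<alpha> in at_right 0. \<forall>\<sigma>\<in>{0..pi}. \<bar>psi (Nfun C \<alpha>) \<alpha> \<sigma>\<bar> \<le> K * (\<alpha> * sin \<sigma>)"
    using psi_bound by auto
  then have "\<forall>\<^sub>F \<alpha> in at_right 0. \<forall>\<sigma>\<in>{0..pi}. \<bar>cos (psi (Nfun C \<alpha>) \<alpha> \<sigma>) - 1\<bar> \<le> K\<^sup>2 * \<alpha>"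
    using at_right_0_lt[of "pi/4", OF pi_quarter]
  proof eventually_elim
    case (elim \<alpha>)
    show ?case
    proof
      fix \<sigma> :: real assume s: "\<sigma> \<in> {0..pi}"
      have ss: "sin \<sigma> \<ge> 0" using s by (simp add: sin_ge_zero)
      have a1: "\<alpha> \<le> 1" using elim pi_approx by auto
      have "\<bar>cos (psi (Nfun C \<alpha>) \<alpha> \<sigma>) - 1\<bar> \<le> \<bar>psi (Nfun C \<alpha>) \<alpha> \<sigma>\<bar>\<^sup>2"
        using cos_diff_one_le[of "psi (Nfun C \<alpha>) \<alpha> \<sigma>"] zero_le_power2[of "psi (Nfun C \<alpha>) \<alpha> \<sigma>"]
        unfolding power2_abs by linarith
      also have "\<dots> \<le> (K * (\<alpha> * sin \<sigma>))\<^sup>2"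
        using elim s by (intro power_mono) auto
      also have "\<dots> = K\<^sup>2 * (\<alpha> * \<alpha> * (sin \<sigma>)\<^sup>2)"
        by (simp add: power2_eq_square)
      also have "\<dots> \<le> K\<^sup>2 * (\<alpha> * 1 * 1)"
        using elim a1 by (intro mult_mono) (auto simp: abs_square_le_1)
      finally show "\<bar>cos (psi (Nfun C \<alpha>) \<alpha> \<sigma>) - 1\<bar> \<le> K\<^sup>2 * \<alpha>" by simp
    qed
  qed
  then show ?thesis by (rule apxI[OF bd_const])
qed

lemma mu_0: "0 < \<alpha> \<Longrightarrow> \<alpha> < pi / 4 \<Longrightarrow> mu (Nfun C \<alpha>) \<alpha> 0 = 2 * C * \<alpha>\<^sup>2"
  by (simp add: mu_def bet_def dil_def arcsin_sin Nfun_def field_simps power2_eq_square)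

text \<open>At \<open>\<sigma> = 0\<close> both sides agree exactly, by \<open>mu_0\<close>; from
  there the expansion of the derivative, which \<open>apx_nP\<close> provides, is
  integrated.\<close>

lemma apx_mu: "apx (\<lambda>\<alpha> \<sigma>. mu (Nfun C \<alpha>) \<alpha> \<sigma> / \<alpha>\<^sup>2) (\<lambda>_ \<sigma>. 2 * C - pi / 2 * (sin \<sigma>)\<^sup>2)"
proof -
  obtain K where "\<forall>\<^sub>F \<alpha> in at_right 0. \<forall>\<sigma>\<in>{0..pi}. \<bar>nP C \<alpha> \<sigma> - pi\<bar> \<le> K * \<alpha>"
    using apx_nP by (rule apxE)
  then have "\<forall>\<^sub>F \<alpha> in at_right 0. \<forall>\<sigma>\<in>{0..pi}.
      \<bar>mu (Nfun C \<alpha>) \<alpha> \<sigma> / \<alpha>\<^sup>2 - (2 * C - pi / 2 * (sin \<sigma>)\<^sup>2)\<bar> \<le> (K * pi) * \<alpha>"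
    using at_right_0_lt[of "pi/4", OF pi_quarter]
  proof eventually_elim
    case (elim \<alpha>)
    then have a: "0 < \<alpha>" "\<alpha> < pi / 4" by auto
    define f where "f \<sigma> = mu (Nfun C \<alpha>) \<alpha> \<sigma> / \<alpha>\<^sup>2 - (2 * C - pi / 2 * (sin \<sigma>)\<^sup>2)" for \<sigma>
    have d: "(f has_real_derivative - (sin \<sigma> * cos \<sigma> * (nP C \<alpha> \<sigma> - pi))) (at \<sigma>)" for \<sigma>
    proof -
      have "((\<lambda>\<sigma>. 2 * C - pi / 2 * (sin \<sigma>)\<^sup>2) has_real_derivative - (pi * sin \<sigma> * cos \<sigma>)) (at \<sigma>)"
        by (auto intro!: derivative_eq_intros)
      from DERIV_diff[OF DERIV_cdivide[OF DERIV_mu'[OF a], where c="\<alpha>\<^sup>2"] this] show ?thesis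
        unfolding f_def by (rule DERIV_cong) (use a in \<open>simp add: algebra_simps\<close>)
    qed
    have b: "\<bar>- (sin \<sigma> * cos \<sigma> * (nP C \<alpha> \<sigma> - pi))\<bar> \<le> K * \<alpha>" if "\<sigma> \<in> {0..pi}" for \<sigma>
    proof -
      have "\<bar>sin \<sigma> * cos \<sigma>\<bar> * \<bar>nP C \<alpha> \<sigma> - pi\<bar> \<le> 1 * \<bar>nP C \<alpha> \<sigma> - pi\<bar>"
        by (intro mult_right_mono) (auto simp: abs_mult intro!: mult_le_one)
      then show ?thesis using order_trans[OF _ bspec[OF elim(1) that]] by (simp add: abs_mult)
    qed
    show ?case
    proof
      fix \<sigma> :: real assume s: "\<sigma> \<in> {0..pi}"
      have "norm (f \<sigma> - f 0) \<le> K * \<alpha> * norm (\<sigma> - 0)"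
      proof (rule field_differentiable_bound[of "{0..pi}"])
        show "(f has_field_derivative - (sin z * cos z * (nP C \<alpha> z - pi))) (at z within {0..pi})" for z
          using d has_field_derivative_at_within by blast
      qed (use b s in auto)
      also have "\<dots> \<le> K * \<alpha> * pi"
        using s b[of 0] by (intro mult_left_mono) auto
      finally show "\<bar>mu (Nfun C \<alpha>) \<alpha> \<sigma> / \<alpha>\<^sup>2 - (2 * C - pi / 2 * (sin \<sigma>)\<^sup>2)\<bar> \<le> (K * pi) * \<alpha>"
        using mu_0[OF a] a by (simp add: f_def mult_ac)
    qed
  qed
  then show ?thesis
    by (rule apxI[rotated]) (unfold power2_eq_square, intro bd_intros)
qed

lemma apx_cos_mu: "apx (\<lambda>\<alpha> \<sigma>. cos (mu (Nfun C \<alpha>) \<alpha> \<sigma>)) (\<lambda>_ _. 1)"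
proof (rule apx_pointwise[where c="1" and b="\<lambda>\<alpha> \<sigma>. \<alpha> * (\<alpha> * (\<alpha> * ((mu (Nfun C \<alpha>) \<alpha> \<sigma> / \<alpha>\<^sup>2) * (mu (Nfun C \<alpha>) \<alpha> \<sigma> / \<alpha>\<^sup>2)) / 2))"])
  fix \<alpha> \<sigma> :: real assume a: "0 < \<alpha>"
  show "\<bar>cos (mu (Nfun C \<alpha>) \<alpha> \<sigma>) - 1\<bar> \<le> \<alpha> * (\<alpha> * (\<alpha> * (\<alpha> * ((mu (Nfun C \<alpha>) \<alpha> \<sigma> / \<alpha>\<^sup>2) * (mu (Nfun C \<alpha>) \<alpha> \<sigma> / \<alpha>\<^sup>2)) / 2)))"
    using cos_diff_one_le[of "mu (Nfun C \<alpha>) \<alpha> \<sigma>"] a by (simp add: power2_eq_square)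
next
  show "bd (\<lambda>\<alpha> \<sigma>. \<alpha> * (\<alpha> * (\<alpha> * ((mu (Nfun C \<alpha>) \<alpha> \<sigma> / \<alpha>\<^sup>2) * (mu (Nfun C \<alpha>) \<alpha> \<sigma> / \<alpha>\<^sup>2)) / 2)))"
    unfolding divide_inverse[of _ 2] by (intro bd_intros apx_mu[THEN apx_bd])
qed (auto intro: bd_intros)

lemma apx_nQ: "apx (nQ C) (\<lambda>_ \<sigma>. 2 * C - pi / 2 * (sin \<sigma>)\<^sup>2)"
proof -
  have "apx (\<lambda>\<alpha> \<sigma>. nQ C \<alpha> \<sigma> - mu (Nfun C \<alpha>) \<alpha> \<sigma> / \<alpha>\<^sup>2) (\<lambda>_ _. 0)"
  proof (rule apx_pointwise[where c="1" and b="\<lambda>\<alpha> \<sigma>. \<alpha> * ((mu (Nfun C \<alpha>) \<alpha> \<sigma> / \<alpha>\<^sup>2) * (mu (Nfun C \<alpha>) \<alpha> \<sigma> / \<alpha>\<^sup>2)) / 2"])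
    fix \<alpha> \<sigma> :: real assume a: "0 < \<alpha>"
    have "\<bar>nQ C \<alpha> \<sigma> - mu (Nfun C \<alpha>) \<alpha> \<sigma> / \<alpha>\<^sup>2\<bar> = \<bar>sin (mu (Nfun C \<alpha>) \<alpha> \<sigma>) - mu (Nfun C \<alpha>) \<alpha> \<sigma>\<bar> / \<alpha>\<^sup>2"
      using a by (simp add: nQ_def diff_divide_distrib[symmetric])
    also have "\<dots> \<le> ((mu (Nfun C \<alpha>) \<alpha> \<sigma>)\<^sup>2 / 2) / \<alpha>\<^sup>2"
      by (intro divide_right_mono sin_diff_self_le) auto
    finally show "\<bar>nQ C \<alpha> \<sigma> - mu (Nfun C \<alpha>) \<alpha> \<sigma> / \<alpha>\<^sup>2 - 0\<bar> \<le> \<alpha> * (\<alpha> * ((mu (Nfun C \<alpha>) \<alpha> \<sigma> / \<alpha>\<^sup>2) * (mu (Nfun C \<alpha>) \<alpha> \<sigma> / \<alpha>\<^sup>2)) / 2)"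
      using a by (simp add: power2_eq_square)
  next
    show "bd (\<lambda>\<alpha> \<sigma>. \<alpha> * ((mu (Nfun C \<alpha>) \<alpha> \<sigma> / \<alpha>\<^sup>2) * (mu (Nfun C \<alpha>) \<alpha> \<sigma> / \<alpha>\<^sup>2)) / 2)"
      unfolding divide_inverse[of _ 2] by (intro bd_intros apx_mu[THEN apx_bd])
  qed (auto intro: bd_intros)
  from apx_add[OF this apx_mu] show ?thesis by simp
qed

lemma apx_nS: "apx (nS C) (\<lambda>_ \<sigma>. 2 * C - pi / 2 * (sin \<sigma>)\<^sup>2)"
  by (rule apx_trans_eq, unfold nS_def[abs_def], (rule apx_intros apx_nQ apx_dil)+) simp

lemmas apx_atoms = apx_alpha apx_dil apx_eps apx_nP apx_cos_psi apx_cos_mu apx_nQ apx_nS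
lemmas apx_trig = bd_sin_cos(1,2)[THEN apx_refl] bd_const[THEN apx_refl]

lemma apx_nSd: "apx (nSd C) (\<lambda>_ \<sigma>. - (pi * cos \<sigma>))"
  by (rule apx_trans_eq, unfold nSd_def[abs_def],
    (rule apx_small apx_add apx_minus apx_mult apx_trig apx_atoms | intro bd_intros apx_atoms[THEN apx_bd])+)
    simp

lemma apx_nPd: "apx (nPd C) (\<lambda>_ \<sigma>. pi * cos \<sigma>)"
  by (rule apx_trans_eq, unfold nPd_def[abs_def], (rule apx_mult apx_trig apx_atoms)+) simp

lemma apx_nW: "apx (nW C) (\<lambda>_ _. 1)"
  by (rule apx_trans_eq, unfold nW_def[abs_def],
    (rule apx_small apx_add apx_mult apx_trig apx_atoms | intro bd_intros apx_atoms[THEN apx_bd])+) simp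

lemma bd_nWd: "bd (nWd C)"
  unfolding nWd_def[abs_def] by (intro bd_intros apx_atoms[THEN apx_bd] apx_nSd[THEN apx_bd])

lemma apx_nX: "apx (nX C) (\<lambda>_ \<sigma>. 2 * C + pi - 3 * pi / 2 * (sin \<sigma>)\<^sup>2)"
proof (rule apx_trans_eq)
  \<comment> \<open>The factor \<open>1 - cos psi\<close> is small, so that \<open>nWd\<close>
    enters only through its boundedness: it serves as its own expansion, and the limit of the
    product vanishes through the factor \<open>1 - 1\<close>.\<close>
  have "apx (\<lambda>\<alpha> \<sigma>. (1 - cos (psi (Nfun C \<alpha>) \<alpha> \<sigma>)) * (cos \<alpha> * nWd C \<alpha> \<sigma>)) (\<lambda>\<alpha> \<sigma>. (1 - 1) * (cos \<alpha> * nWd C \<alpha> \<sigma>))"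
    by (intro apx_mult[where f' = "\<lambda>_ _. 1 - 1"] apx_diff apx_trig apx_cos_psi apx_refl bd_mult bd_nWd apx_atoms[THEN apx_bd])
  note L = this
  show "apx (nX C) (\<lambda>\<alpha> \<sigma>. 2 * C - pi / 2 * (sin \<sigma>)\<^sup>2 - cos \<sigma> * - (pi * cos \<sigma>) + 0 + (1 - 1) * (cos \<alpha> * nWd C \<alpha> \<sigma>))"
    unfolding nX_def[abs_def]
    by (rule apx_add[OF _ L]) (intro apx_add[where f' = "\<lambda>\<alpha> \<sigma>. 2 * C - pi / 2 * (sin \<sigma>)\<^sup>2 - cos \<sigma> * - (pi * cos \<sigma>)"]
       apx_diff apx_nS apx_mult apx_trig apx_nSd apx_small bd_intros bd_nZ
       apx_atoms[THEN apx_bd] apx_nSd[THEN apx_bd] apx_nPd[THEN apx_bd] apx_nW[THEN apx_bd])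
qed (simp add: cos_squared_eq algebra_simps flip: power2_eq_square)

lemma apx_nY: "apx (nY C) (\<lambda>_ \<sigma>. cos \<sigma> * (2 * C + pi - 3 * pi / 2 * (sin \<sigma>)\<^sup>2))"
proof (rule apx_trans_eq)
  show "apx (nY C) (\<lambda>\<alpha> \<sigma>. 1 * (1 * (cos \<sigma> * (2 * C - pi / 2 * (sin \<sigma>)\<^sup>2) + sin \<sigma> * (sin \<sigma> * - (pi * cos \<sigma>))) - 0)
     + 1 * (pi * cos \<sigma>) * 1 + 0)"
    unfolding nY_def[abs_def]
    by (intro apx_add[where g' = "\<lambda>\<alpha> \<sigma>. 0"] apx_add apx_diff[where g' = "\<lambda>\<alpha> \<sigma>. 0"] apx_mult apx_trig apx_atoms apx_nSd apx_nPd apx_nW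
       apx_small bd_intros bd_nZ bd_nWd
       apx_atoms[THEN apx_bd] apx_nSd[THEN apx_bd] apx_nPd[THEN apx_bd] apx_nW[THEN apx_bd])
qed (simp add: algebra_simps power2_eq_square)

end

section \<open>Planar regions between graphs\<close>

abbreviation pt :: "real \<Rightarrow> real \<Rightarrow> real^2" where "pt p q \<equiv> vector [p, q]"

lemma pt_eq_iff [simp]: "pt p q = pt p' q' \<longleftrightarrow> p = p' \<and> q = q'"
  by (auto simp: vec_eq_iff forall_2)

lemma pt_eta [simp]: "pt (z $ 1) (z $ 2) = z"
  by (simp add: vec_eq_iff forall_2)

lemma continuous_on_pt [continuous_intros]:
  fixes f g :: "'a :: topological_space \<Rightarrow> real"
  assumes "continuous_on S f" "continuous_on S g"
  shows "continuous_on S (\<lambda>x. pt (f x) (g x))"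
proof -
  have "pt p q = p *\<^sub>R axis 1 1 + q *\<^sub>R axis 2 1" for p q
    by (simp add: vec_eq_iff forall_2 axis_def)
  then show ?thesis
    by (simp add: assms continuous_intros)
qed

lemma continuous_on_coord [continuous_intros]:
  "continuous_on S f \<Longrightarrow> continuous_on S (\<lambda>x. (f x :: real^2) $ i)"
  by (intro continuous_intros)

definition graph :: "(real \<Rightarrow> real) \<Rightarrow> real set \<Rightarrow> (real^2) set" where
  "graph f I = (\<lambda>t. pt t (f t)) ` I"

definition between :: "real \<Rightarrow> (real \<Rightarrow> real) \<Rightarrow> (real \<Rightarrow> real) \<Rightarrow> (real^2) set" where
  "between a f g = {z. -a < z $ 1 \<and> z $ 1 < a \<and> f (z $ 1) < z $ 2 \<and> z $ 2 < g (z $ 1)}"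

lemma in_graph: "z \<in> graph f I \<longleftrightarrow> z $ 1 \<in> I \<and> z $ 2 = f (z $ 1)"
  by (auto simp: graph_def image_iff vec_eq_iff forall_2)

lemma open_between:
  assumes f: "continuous_on {-a<..<a} f" and g: "continuous_on {-a<..<a} g"
  shows "open (between a f g)"
proof -
  let ?s = "{z :: real^2. -a < z $ 1 \<and> z $ 1 < a}"
  have s: "open ?s"
    by (intro open_Collect_conj open_Collect_less continuous_intros)
  have c: "continuous_on ?s (\<lambda>z. z $ 2 - f (z $ 1))" "continuous_on ?s (\<lambda>z. g (z $ 1) - z $ 2)"
    by (intro continuous_intros continuous_on_compose2[OF f] continuous_on_compose2[OF g]; force)+
  have "between a f g = (?s \<inter> (\<lambda>z. z $ 2 - f (z $ 1)) -` {0<..}) \<inter> (?s \<inter> (\<lambda>z. g (z $ 1) - z $ 2) -` {0<..})"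
    by (auto simp: between_def)
  then show ?thesis
    using continuous_open_preimage[OF c(1) s] continuous_open_preimage[OF c(2) s] by auto
qed

text \<open>The set is a continuous image of a rectangle: the second coordinate is interpolated
  between the two graphs.\<close>

lemma connected_between:
  assumes f: "continuous_on {-a<..<a} f" and g: "continuous_on {-a<..<a} g"
    and "\<And>t. -a < t \<Longrightarrow> t < a \<Longrightarrow> f t < g t"
  shows "connected (between a f g)"
proof -
  define h where "h = (\<lambda>w :: real \<times> real. pt (fst w) (f (fst w) + snd w * (g (fst w) - f (fst w))))"
  have "between a f g = h ` ({-a<..<a} \<times> {0<..<1})"
  proof (intro equalityI subsetI)
    fix z assume z: "z \<in> between a f g"
    then have pos: "0 < g (z $ 1) - f (z $ 1)" using assms(3)[of "z $ 1"] by (simp add: between_def)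
    let ?s = "(z $ 2 - f (z $ 1)) / (g (z $ 1) - f (z $ 1))"
    have "z = h (z $ 1, ?s)"
      using pos by (simp add: h_def)
    moreover have "(z $ 1, ?s) \<in> {-a<..<a} \<times> {0<..<1}"
      using z pos by (simp add: between_def)
    ultimately show "z \<in> h ` ({-a<..<a} \<times> {0<..<1})"
      by (rule image_eqI)
  next
    fix z assume "z \<in> h ` ({-a<..<a} \<times> {0<..<1})"
    then obtain t s where ts: "t \<in> {-a<..<a}" "s \<in> {0<..<1}" and z: "z = h (t, s)" by auto
    have "0 < g t - f t" using assms(3)[of t] ts by auto
    then have "0 < s * (g t - f t)" "s * (g t - f t) < 1 * (g t - f t)"
      using ts by (auto intro!: mult_strict_right_mono)
    then show "z \<in> between a f g"
      using ts by (simp add: between_def z h_def)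
  qed
  moreover have "continuous_on ({-a<..<a} \<times> {0<..<1}) h"
    unfolding h_def
    by (intro continuous_intros continuous_on_compose2[OF f] continuous_on_compose2[OF g]; force)
  ultimately show ?thesis
    by (auto intro!: connected_continuous_image connected_Times)
qed

text \<open>A connected subset of the union that meets one of two disjoint open sets stays in
  it.\<close>

lemma components_Un_open:
  fixes A B :: "'a :: topological_space set"
  assumes "open A" "open B" "connected A" "connected B" "A \<inter> B = {}" "A \<noteq> {}" "B \<noteq> {}"
  shows "components (A \<union> B) = {A, B}"
proof -
  have *: "connected_component_set (A \<union> B) x = A"
    if "open A" "open B" "connected A" "A \<inter> B = {}" "x \<in> A" for A B :: "'a set" and x
  proof (rule connected_component_unique)
    fix C assume C: "x \<in> C" "C \<subseteq> A \<union> B" "connected C"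
    then show "C \<subseteq> A"
      using connectedD[OF C(3) that(1,2) _ C(2)] C(1,2) that(4,5) by blast
  qed (use that in auto)
  have "connected_component_set (A \<union> B) ` A = {A}" "connected_component_set (A \<union> B) ` B = {B}"
    using *[of A B] *[of B A] assms by (auto simp: Un_commute Int_commute)
  then show ?thesis
    unfolding components_def image_Un by auto
qed

context
  fixes a :: real and f g :: "real \<Rightarrow> real"
  assumes a: "0 < a" and f: "continuous_on {-a..a} f" and g: "continuous_on {-a..a} g"
    and ends: "f (-a) = g (-a)" "f a = g a" and fg: "\<And>t. -a < t \<Longrightarrow> t < a \<Longrightarrow> f t < g t"
begin

lemma bounded_between: "bounded (between a f g)"
proof -
  obtain F where F: "\<And>t. t \<in> {-a..a} \<Longrightarrow> \<bar>f t\<bar> \<le> F"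
    using compact_continuous_image[OF f] compact_imp_bounded by (fastforce simp: bounded_real)
  obtain G where G: "\<And>t. t \<in> {-a..a} \<Longrightarrow> \<bar>g t\<bar> \<le> G"
    using compact_continuous_image[OF g] compact_imp_bounded by (fastforce simp: bounded_real)
  have "norm z \<le> a + (F + G)" if "z \<in> between a f g" for z
  proof -
    have "norm z \<le> \<bar>z $ 1\<bar> + \<bar>z $ 2\<bar>"
      using norm_le_l1_cart[of z] by (simp add: sum_2)
    then show ?thesis
      using that F[of "z $ 1"] G[of "z $ 1"] by (auto simp: between_def)
  qed
  then show ?thesis by (auto simp: bounded_iff)
qed

lemma frontier_between: "frontier (between a f g) \<subseteq> graph f {-a..a} \<union> graph g {-a..a}"
proof -
  have f': "continuous_on {-a<..<a} f" and g': "continuous_on {-a<..<a} g"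
    using f g by (auto elim: continuous_on_subset)
  let ?s = "{z :: real^2. -a \<le> z $ 1 \<and> z $ 1 \<le> a}"
  let ?C = "{z :: real^2. -a \<le> z $ 1 \<and> z $ 1 \<le> a \<and> f (z $ 1) \<le> z $ 2 \<and> z $ 2 \<le> g (z $ 1)}"
  have s: "closed ?s"
    by (intro closed_Collect_conj closed_Collect_le continuous_intros)
  have c: "continuous_on ?s (\<lambda>z. z $ 2 - f (z $ 1))" "continuous_on ?s (\<lambda>z. g (z $ 1) - z $ 2)"
    by (intro continuous_intros continuous_on_compose2[OF f] continuous_on_compose2[OF g]; force)+
  have "?C = (?s \<inter> (\<lambda>z. z $ 2 - f (z $ 1)) -` {0..}) \<inter> (?s \<inter> (\<lambda>z. g (z $ 1) - z $ 2) -` {0..})"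
    by auto
  then have "closed ?C"
    using continuous_closed_preimage[OF c(1) s] continuous_closed_preimage[OF c(2) s] by auto
  moreover have "between a f g \<subseteq> ?C"
    by (auto simp: between_def)
  ultimately have "frontier (between a f g) \<subseteq> ?C - between a f g"
    using closure_minimal interior_open[OF open_between[OF f' g']] by (auto simp: frontier_def)
  also have "\<dots> \<subseteq> graph f {-a..a} \<union> graph g {-a..a}"
  proof
    fix z assume z: "z \<in> ?C - between a f g"
    then consider "z $ 1 = -a" | "z $ 1 = a" | "-a < z $ 1" "z $ 1 < a" by fastforce
    then show "z \<in> graph f {-a..a} \<union> graph g {-a..a}"
      using z ends a by cases (auto simp: in_graph between_def)
  qed
  finally show ?thesis .
qed

text \<open>A component of the complement that starts in the region cannot cross the frontier, which
  consists of points of the graphs, and is therefore bounded. A point off the region and off the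
  graphs lies above, below or beside them and escapes along a vertical half line.\<close>

lemma inside_graphs: "inside (graph f {-a..a} \<union> graph g {-a..a}) = between a f g"
proof -
  let ?S = "graph f {-a..a} \<union> graph g {-a..a}" and ?R = "between a f g"
  have disj: "?R \<inter> ?S = {}"
    by (auto simp: between_def in_graph)
  have "z \<in> inside ?S" if z: "z \<in> ?R" for z
  proof -
    let ?C = "connected_component_set (- ?S) z"
    have "z \<in> - ?S" using disj z by auto
    then have zC: "z \<in> ?C" by simp
    have "?C \<inter> frontier ?R = {}"
      using connected_component_subset[of "- ?S" z] frontier_between by blast
    then have "?C \<subseteq> ?R"
      using connected_Int_frontier[of ?C ?R] zC z connected_connected_component by blast
    then show ?thesis
      using \<open>z \<in> - ?S\<close> bounded_subset[OF bounded_between] by (auto simp: inside_def)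
  qed
  moreover have "z \<in> ?R" if z: "z \<in> inside ?S" for z
  proof (rule ccontr)
    assume nR: "z \<notin> ?R"
    have nS: "z \<notin> ?S" and bd: "bounded (connected_component_set (- ?S) z)"
      using z by (auto simp: inside_def)
    have ray: False if d: "d = 1 \<or> d = -1" and r: "\<And>t. t \<ge> 0 \<Longrightarrow> pt (z $ 1) (z $ 2 + d * t) \<notin> ?S" for d :: real
    proof -
      let ?r = "\<lambda>t. pt (z $ 1) (z $ 2 + d * t)"
      have "connected (?r ` {0..})"
        by (intro connected_continuous_image continuous_intros) auto
      moreover have "z \<in> ?r ` {0..}" by (intro image_eqI[of _ _ 0]) auto
      moreover have "?r ` {0..} \<subseteq> - ?S" using r by blast
      ultimately have "?r ` {0..} \<subseteq> connected_component_set (- ?S) z"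
        by (intro connected_component_maximal) auto
      then have "bounded (?r ` {0..})" using bd bounded_subset by blast
      then obtain B where B: "\<And>t. t \<ge> 0 \<Longrightarrow> norm (?r t) \<le> B"
        by (auto simp: bounded_iff)
      have "\<bar>z $ 2 + d * (\<bar>B\<bar> + \<bar>z $ 2\<bar> + 1)\<bar> \<le> norm (?r (\<bar>B\<bar> + \<bar>z $ 2\<bar> + 1))"
        using component_le_norm_cart[of "?r (\<bar>B\<bar> + \<bar>z $ 2\<bar> + 1)" 2] by simp
      then have "\<bar>z $ 2 + d * (\<bar>B\<bar> + \<bar>z $ 2\<bar> + 1)\<bar> \<le> B"
        using B[of "\<bar>B\<bar> + \<bar>z $ 2\<bar> + 1"] by linarith
      then show False using d by auto
    qed
    have fg': "f t \<le> g t" if "t \<in> {-a..a}" for t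
      using fg[of t] ends that by (cases "t = a \<or> t = -a") auto
    consider "z $ 1 \<notin> {-a..a}" | "z $ 1 \<in> {-a..a}" "g (z $ 1) < z $ 2" | "z $ 1 \<in> {-a..a}" "z $ 2 < f (z $ 1)"
    proof (rule ccontr)
      assume "\<not> thesis"
      then have z1: "z $ 1 \<in> {-a..a}" and z2: "f (z $ 1) \<le> z $ 2" "z $ 2 \<le> g (z $ 1)"
        using that by force+
      then have z3: "f (z $ 1) < z $ 2" "z $ 2 < g (z $ 1)"
        using nS by (auto simp: in_graph)
      then have "z $ 1 \<noteq> -a" "z $ 1 \<noteq> a"
        using ends by auto
      then show False
        using nR z1 z3 by (auto simp: between_def)
    qed
    then show False
    proof cases
      case 1 then show ?thesis using ray[of 1] by (auto simp: in_graph)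
    next
      case 2 then show ?thesis using ray[of 1] fg'[of "z $ 1"] by (auto simp: in_graph)
    next
      case 3 then show ?thesis using ray[of "-1"] fg'[of "z $ 1"] by (auto simp: in_graph)
    qed
  qed
  ultimately show ?thesis by blast
qed

lemma components_between:
  assumes m: "continuous_on {-a<..<a} m" and fm: "\<And>t. -a < t \<Longrightarrow> t < a \<Longrightarrow> f t < m t"
    and mg: "\<And>t. -a < t \<Longrightarrow> t < a \<Longrightarrow> m t < g t"
  shows "components (between a f g - graph m {-a<..<a}) = {between a m g, between a f m}"
    and "between a m g \<noteq> between a f m"
proof -
  have f': "continuous_on {-a<..<a} f" and g': "continuous_on {-a<..<a} g"
    using f g by (auto elim: continuous_on_subset)
  have eq: "between a f g - graph m {-a<..<a} = between a m g \<union> between a f m"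
    using fm mg by (fastforce simp: between_def in_graph)
  have ne: "pt 0 ((m 0 + g 0) / 2) \<in> between a m g" "pt 0 ((f 0 + m 0) / 2) \<in> between a f m"
    using fm[of 0] mg[of 0] a by (auto simp: between_def field_simps)
  have disj: "between a m g \<inter> between a f m = {}"
    by (auto simp: between_def)
  show "components (between a f g - graph m {-a<..<a}) = {between a m g, between a f m}"
    unfolding eq using ne disj
    by (intro components_Un_open open_between connected_between f' g' m fm mg) auto
  show "between a m g \<noteq> between a f m"
    using ne disj by blast
qed

end

section \<open>Absolutely continuous functions with bounded density\<close>

definition bmeas :: "real \<Rightarrow> real \<Rightarrow> (real \<Rightarrow> real) \<Rightarrow> bool" where
  "bmeas a b g \<longleftrightarrow> g \<in> borel_measurable (lebesgue_on {a..b}) \<and> (\<exists>B. \<forall>t\<in>{a..b}. \<bar>g t\<bar> \<le> B)"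

text \<open>Absolute continuity in integral form. It matches the definition of
  \<open>trajectory\<close>, whose controls are merely measurable; with a bounded density
  \<open>f\<close> is Lipschitz.\<close>

definition prim :: "real \<Rightarrow> real \<Rightarrow> (real \<Rightarrow> real) \<Rightarrow> (real \<Rightarrow> real) \<Rightarrow> bool" where
  "prim a b f g \<longleftrightarrow> bmeas a b g \<and> (\<forall>s t. a \<le> s \<and> s \<le> t \<and> t \<le> b \<longrightarrow> (g has_integral (f t - f s)) {s..t})"

lemma bmeasE:
  assumes "bmeas a b g"
  obtains B where "g \<in> borel_measurable (lebesgue_on {a..b})" "\<And>t. t \<in> {a..b} \<Longrightarrow> \<bar>g t\<bar> \<le> B"
  using assms unfolding bmeas_def by blast

lemma bmeasI:
  "g \<in> borel_measurable (lebesgue_on {a..b}) \<Longrightarrow> (\<And>t. t \<in> {a..b} \<Longrightarrow> \<bar>g t\<bar> \<le> B) \<Longrightarrow> bmeas a b g"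
  unfolding bmeas_def by blast

lemma bmeas_integrable:
  assumes "bmeas a b g" "a \<le> s" "t \<le> b" shows "g integrable_on {s..t}"
proof -
  obtain B where "g \<in> borel_measurable (lebesgue_on {a..b})" "\<And>t. t \<in> {a..b} \<Longrightarrow> \<bar>g t\<bar> \<le> B"
    using assms(1) by (rule bmeasE) blast
  then have "g absolutely_integrable_on {a..b}"
    by (intro measurable_bounded_by_integrable_imp_absolutely_integrable[where g="\<lambda>_. B"])
      (auto intro: integrable_const_ivl)
  then have "g integrable_on {a..b}"
    by (auto simp: absolutely_integrable_on_def)
  then show ?thesis
    by (rule integrable_subinterval_real) (use assms in auto)
qed

lemma bmeas_continuous: "continuous_on {a..b} f \<Longrightarrow> bmeas a b f"
  using compact_continuous_image[of "{a..b}" f, THEN compact_imp_bounded]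
  by (auto simp: bmeas_def bounded_real intro: continuous_imp_measurable_on_sets_lebesgue)

lemma bmeas_mult: "bmeas a b f \<Longrightarrow> bmeas a b g \<Longrightarrow> bmeas a b (\<lambda>t. f t * g t)"
proof -
  assume a: "bmeas a b f" "bmeas a b g"
  obtain B where B: "\<And>t. t \<in> {a..b} \<Longrightarrow> \<bar>f t\<bar> \<le> B"
    using a(1) by (rule bmeasE) blast
  obtain C where C: "\<And>t. t \<in> {a..b} \<Longrightarrow> \<bar>g t\<bar> \<le> C"
    using a(2) by (rule bmeasE) blast
  have "\<bar>f t * g t\<bar> \<le> B * C" if "t \<in> {a..b}" for t
    using B[OF that] C[OF that] by (auto simp: abs_mult intro!: mult_mono)
  then show ?thesis using a by (intro bmeasI borel_measurable_times) (auto simp: bmeas_def)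
qed

lemma bmeas_add: "bmeas a b f \<Longrightarrow> bmeas a b g \<Longrightarrow> bmeas a b (\<lambda>t. f t + g t)"
proof -
  assume a: "bmeas a b f" "bmeas a b g"
  obtain B where B: "\<And>t. t \<in> {a..b} \<Longrightarrow> \<bar>f t\<bar> \<le> B"
    using a(1) by (rule bmeasE) blast
  obtain C where C: "\<And>t. t \<in> {a..b} \<Longrightarrow> \<bar>g t\<bar> \<le> C"
    using a(2) by (rule bmeasE) blast
  have "\<bar>f t + g t\<bar> \<le> B + C" if "t \<in> {a..b}" for t
    using B[OF that] C[OF that] by linarith
  then show ?thesis using a by (intro bmeasI borel_measurable_add) (auto simp: bmeas_def)
qed

lemma bmeas_const: "bmeas a b (\<lambda>_. c)"
  by (intro bmeas_continuous continuous_on_const)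

lemma primD: "prim a b f g \<Longrightarrow> a \<le> s \<Longrightarrow> s \<le> t \<Longrightarrow> t \<le> b \<Longrightarrow> (g has_integral (f t - f s)) {s..t}"
  by (simp add: prim_def)

lemma prim_lipschitz:
  assumes "prim a b f g"
  obtains B where "B > 0" "\<And>t. t \<in> {a..b} \<Longrightarrow> \<bar>g t\<bar> \<le> B"
    "\<And>s t. s \<in> {a..b} \<Longrightarrow> t \<in> {a..b} \<Longrightarrow> \<bar>f s - f t\<bar> \<le> B * \<bar>s - t\<bar>"
proof -
  have "bmeas a b g" using assms by (simp add: prim_def)
  then obtain B where B: "\<And>t. t \<in> {a..b} \<Longrightarrow> \<bar>g t\<bar> \<le> B"
    by (rule bmeasE) blast
  have *: "\<bar>f t - f s\<bar> \<le> (\<bar>B\<bar> + 1) * \<bar>t - s\<bar>" if "a \<le> s" "s \<le> t" "t \<le> b" for s t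
  proof -
    have "norm (f t - f s) \<le> (\<bar>B\<bar> + 1) * Henstock_Kurzweil_Integration.content (cbox s t)"
    proof (rule has_integral_bound)
      show "(g has_integral (f t - f s)) (cbox s t)"
        using primD[OF assms that] by simp
      show "norm (g x) \<le> \<bar>B\<bar> + 1" if "x \<in> cbox s t" for x
        using B[of x] that \<open>a \<le> s\<close> \<open>t \<le> b\<close> by auto
    qed auto
    then show ?thesis using that by simp
  qed
  show ?thesis
  proof
    show "\<bar>B\<bar> + 1 > 0" by simp
    show "\<bar>g t\<bar> \<le> \<bar>B\<bar> + 1" if "t \<in> {a..b}" for t
      using B[OF that] by auto
    show "\<bar>f s - f t\<bar> \<le> (\<bar>B\<bar> + 1) * \<bar>s - t\<bar>" if "s \<in> {a..b}" "t \<in> {a..b}" for s t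
      using *[of s t] *[of t s] that by (cases "s \<le> t") (auto simp: abs_minus_commute)
  qed
qed

lemma prim_continuous: "prim a b f g \<Longrightarrow> continuous_on {a..b} f"
proof -
  assume "prim a b f g"
  then obtain B where "B > 0" "\<And>s t. s \<in> {a..b} \<Longrightarrow> t \<in> {a..b} \<Longrightarrow> \<bar>f s - f t\<bar> \<le> B * \<bar>s - t\<bar>"
    by (rule prim_lipschitz) blast
  then have "B-lipschitz_on {a..b} f"
    by (intro lipschitz_onI) (auto simp: dist_real_def)
  then show ?thesis by (rule lipschitz_on_continuous_on)
qed

lemma bmeas_subinterval: "bmeas a b g \<Longrightarrow> a \<le> s \<Longrightarrow> t \<le> b \<Longrightarrow> bmeas s t g"
  unfolding bmeas_def by (force intro: measurable_restrict_mono)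

lemma prim_subinterval: "prim a b f g \<Longrightarrow> a \<le> s \<Longrightarrow> t \<le> b \<Longrightarrow> prim s t f g"
  unfolding prim_def by (auto intro: bmeas_subinterval)

lemma prim_cong:
  assumes "prim a b f g" "\<And>t. t \<in> {a..b} \<Longrightarrow> f t = f' t" "\<And>t. t \<in> {a..b} \<Longrightarrow> g t = g' t"
  shows "prim a b f' g'"
  unfolding prim_def bmeas_def
proof (intro conjI allI impI)
  show "g' \<in> borel_measurable (lebesgue_on {a..b})"
    using assms(1,3) by (subst measurable_cong[where g=g]) (auto simp: prim_def bmeas_def)
  show "\<exists>B. \<forall>t\<in>{a..b}. \<bar>g' t\<bar> \<le> B"
    using assms(1,3) by (auto simp: prim_def bmeas_def)
  fix s t assume "a \<le> s \<and> s \<le> t \<and> t \<le> b"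
  then show "(g' has_integral f' t - f' s) {s..t}"
    using primD[OF assms(1), of s t] assms(2)[of s] assms(2)[of t] assms(3)
    by (auto elim!: has_integral_eq[rotated])
qed

lemma prim_add: "prim a b f g \<Longrightarrow> prim a b f' g' \<Longrightarrow> prim a b (\<lambda>t. f t + f' t) (\<lambda>t. g t + g' t)"
  unfolding prim_def by (simp add: bmeas_add add_diff_add has_integral_add)

lemma prim_const: "prim a b (\<lambda>_. c) (\<lambda>_. 0)"
  unfolding prim_def by (simp add: bmeas_const)

lemma prim_cmult: "prim a b f g \<Longrightarrow> prim a b (\<lambda>t. c * f t) (\<lambda>t. c * g t)"
  unfolding prim_def
  by (auto intro!: bmeas_mult bmeas_const simp flip: right_diff_distrib intro: has_integral_mult_right)

lemma prim_ident: "prim a b (\<lambda>t. t) (\<lambda>_. 1)"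
  unfolding prim_def
proof (intro conjI allI impI bmeas_const)
  fix s t :: real assume "a \<le> s \<and> s \<le> t \<and> t \<le> b"
  then show "((\<lambda>_. 1) has_integral t - s) {s..t}"
    using has_integral_const_real[of "1::real" s t] by simp
qed

text \<open>Chain rule. The difference of \<open>\<phi> (f t)\<close> and the integral of the
  proposed density has derivative zero at every point, although \<open>f\<close> may fail to be
  differentiable: on a short interval the mean value theorem gives the increment with
  \<open>\<phi>'\<close> taken at one value of \<open>f\<close>, and \<open>\<phi>'\<close> is
  nearly constant along \<open>f\<close> there.\<close>

lemma prim_compose:
  assumes f: "prim a b f g"
    and d: "\<And>t. t \<in> {a..b} \<Longrightarrow> (\<phi> has_real_derivative \<phi>' (f t)) (at (f t))"
    and c: "continuous_on (f ` {a..b}) \<phi>'"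
  shows "prim a b (\<lambda>t. \<phi> (f t)) (\<lambda>t. \<phi>' (f t) * g t)"
proof (cases "a \<le> b")
  case False
  then show ?thesis
    by (auto simp: prim_def bmeas_def measurable_def space_restrict_space)
next
  case True
  obtain B where B: "B > 0" "\<And>t. t \<in> {a..b} \<Longrightarrow> \<bar>g t\<bar> \<le> B"
    using f by (rule prim_lipschitz) blast
  note fc = prim_continuous[OF f]
  let ?h = "\<lambda>t. \<phi>' (f t) * g t"
  have c': "continuous_on {a..b} (\<lambda>t. \<phi>' (f t))"
    by (rule continuous_on_compose2[OF c fc]) auto
  have h: "bmeas a b ?h"
    using f by (intro bmeas_mult bmeas_continuous[OF c']) (auto simp: prim_def)
  \<comment> \<open>The mean value theorem yields a value between \<open>f s\<close> and
    \<open>f t\<close>; by continuity \<open>f\<close> attains it at some time in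
    \<open>{s..t}\<close>.\<close>
  have mvt: "\<exists>\<tau>\<in>{s..t}. \<phi> (f t) - \<phi> (f s) = \<phi>' (f \<tau>) * (f t - f s)" if st: "a \<le> s" "s \<le> t" "t \<le> b" for s t
  proof -
    have fst: "continuous_on {s..t} f"
      using fc by (rule continuous_on_subset) (use st in auto)
    have iv: "\<exists>\<tau>\<in>{s..t}. f \<tau> = y" if "min (f s) (f t) \<le> y" "y \<le> max (f s) (f t)" for y
    proof (cases "f s \<le> f t")
      case True
      then show ?thesis using IVT'[of f s y t] that st fst by auto
    next
      case False
      then show ?thesis using IVT2'[of f t y s] that st fst by auto
    qed
    have dy: "(\<phi> has_real_derivative \<phi>' y) (at y)" if "min (f s) (f t) \<le> y" "y \<le> max (f s) (f t)" for y
      using iv[OF that] d st by force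
    consider "f s = f t" | "f s < f t" | "f t < f s" by linarith
    then show ?thesis
    proof cases
      case 1 then show ?thesis using st by auto
    next
      case 2
      then obtain y where y: "f s < y" "y < f t" "\<phi> (f t) - \<phi> (f s) = (f t - f s) * \<phi>' y"
        using MVT2[of "f s" "f t" \<phi> \<phi>'] dy by auto
      then show ?thesis using iv[of y] by (auto simp: mult.commute)
    next
      case 3
      then obtain y where y: "f t < y" "y < f s" "\<phi> (f s) - \<phi> (f t) = (f s - f t) * \<phi>' y"
        using MVT2[of "f t" "f s" \<phi> \<phi>'] dy by auto
      then have "\<phi> (f t) - \<phi> (f s) = \<phi>' y * (f t - f s)" by (simp add: algebra_simps)
      then show ?thesis using iv[of y] y by auto
    qed
  qed
  have est: "\<bar>\<phi> (f t) - \<phi> (f s) - integral {s..t} ?h\<bar> \<le> 2 * \<eta> * B * (t - s)"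
    if st: "a \<le> s" "s \<le> t" "t \<le> b" and v: "\<And>r. r \<in> {s..t} \<Longrightarrow> \<bar>\<phi>' (f r) - v\<bar> \<le> \<eta>" for s t v \<eta>
  proof -
    obtain \<tau> where \<tau>: "\<tau> \<in> {s..t}" "\<phi> (f t) - \<phi> (f s) = \<phi>' (f \<tau>) * (f t - f s)"
      using mvt[OF st] by auto
    have i1: "((\<lambda>r. \<phi>' (f \<tau>) * g r) has_integral \<phi>' (f \<tau>) * (f t - f s)) {s..t}"
      using primD[OF f st] by (rule has_integral_mult_right)
    have i2: "(?h has_integral integral {s..t} ?h) {s..t}"
      using bmeas_integrable[OF h] st by (auto intro: integrable_integral)
    have "norm (\<phi>' (f \<tau>) * (f t - f s) - integral {s..t} ?h) \<le> (2 * \<eta> * B) * Henstock_Kurzweil_Integration.content (cbox s t)"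
    proof (rule has_integral_bound)
      show "((\<lambda>r. \<phi>' (f \<tau>) * g r - ?h r) has_integral \<phi>' (f \<tau>) * (f t - f s) - integral {s..t} ?h) (cbox s t)"
        using has_integral_diff[OF i1 i2] by simp
      have "0 \<le> \<eta>" using v[OF \<tau>(1)] by linarith
      then show "0 \<le> 2 * \<eta> * B" using B by simp
      fix r assume r: "r \<in> cbox s t"
      have "\<bar>\<phi>' (f \<tau>) - \<phi>' (f r)\<bar> \<le> 2 * \<eta>" using v[of r] v[OF \<tau>(1)] r by auto
      then have "\<bar>\<phi>' (f \<tau>) - \<phi>' (f r)\<bar> * \<bar>g r\<bar> \<le> (2 * \<eta>) * B"
        using B(2)[of r] r st \<open>0 \<le> \<eta>\<close> by (intro mult_mono) auto
      then show "norm (\<phi>' (f \<tau>) * g r - ?h r) \<le> 2 * \<eta> * B"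
        by (simp add: abs_mult flip: left_diff_distrib)
    qed
    then show ?thesis using \<tau> st by simp
  qed
  define D where "D t = \<phi> (f t) - integral {a..t} ?h" for t
  have Dst: "D t - D s = \<phi> (f t) - \<phi> (f s) - integral {s..t} ?h" if "a \<le> s" "s \<le> t" "t \<le> b" for s t
    using Henstock_Kurzweil_Integration.integral_combine[of a s t ?h] bmeas_integrable[OF h, of a t] that by (simp add: D_def)
  have "(D has_derivative (\<lambda>_. 0)) (at t within {a..b})" if t: "t \<in> {a..b}" for t
    unfolding has_derivative_within_alt
  proof (intro conjI allI impI)
    fix e :: real assume e: "e > 0"
    then have "e / (2 * B) > 0" using B by simp
    then obtain \<delta> where \<delta>: "\<delta> > 0" "\<And>r. r \<in> {a..b} \<Longrightarrow> dist r t < \<delta> \<Longrightarrow> dist (\<phi>' (f r)) (\<phi>' (f t)) < e / (2 * B)"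
      using c' t unfolding continuous_on_iff by metis
    have "norm (D s - D t - 0) \<le> e * norm (s - t)" if s: "s \<in> {a..b}" "norm (s - t) < \<delta>" for s
    proof (cases "s \<le> t")
      case True
      have "\<bar>\<phi>' (f r) - \<phi>' (f t)\<bar> \<le> e / (2 * B)" if "r \<in> {s..t}" for r
        using \<delta>(2)[of r] that s t True by (auto simp: dist_real_def)
      then have "\<bar>\<phi> (f t) - \<phi> (f s) - integral {s..t} ?h\<bar> \<le> 2 * (e / (2 * B)) * B * (t - s)"
        using s t True by (intro est) auto
      then show ?thesis using B True Dst[of s t] s t by (simp add: abs_minus_commute)
    next
      case False
      have "\<bar>\<phi>' (f r) - \<phi>' (f t)\<bar> \<le> e / (2 * B)" if "r \<in> {t..s}" for r
        using \<delta>(2)[of r] that s t False by (auto simp: dist_real_def)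
      then have "\<bar>\<phi> (f s) - \<phi> (f t) - integral {t..s} ?h\<bar> \<le> 2 * (e / (2 * B)) * B * (s - t)"
        using s t False by (intro est) auto
      then show ?thesis using B False Dst[of t s] s t by simp
    qed
    then show "\<exists>d>0. \<forall>y\<in>{a..b}. norm (y - t) < d \<longrightarrow> norm (D y - D t - 0) \<le> e * norm (y - t)"
      using \<delta>(1) by blast
  qed auto
  then obtain k where k: "\<And>t. t \<in> {a..b} \<Longrightarrow> D t = k"
    using has_derivative_zero_constant[of "{a..b}" D] by auto
  show ?thesis
    unfolding prim_def
  proof (intro conjI h allI impI)
    fix s t assume st: "a \<le> s \<and> s \<le> t \<and> t \<le> b"
    then have "\<phi> (f t) - \<phi> (f s) = integral {s..t} ?h"
      using Dst[of s t] k[of s] k[of t] by simp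
    then show "(?h has_integral \<phi> (f t) - \<phi> (f s)) {s..t}"
      using bmeas_integrable[OF h, of s t] st by (simp add: integrable_integral)
  qed
qed

lemma prim_square: "prim a b f g \<Longrightarrow> prim a b (\<lambda>t. (f t)\<^sup>2) (\<lambda>t. 2 * f t * g t)"
  by (rule prim_compose[where \<phi>="\<lambda>x. x\<^sup>2" and \<phi>'="\<lambda>x. 2 * x"]) (auto intro!: derivative_eq_intros continuous_intros)

text \<open>By polarisation from the rule for squares.\<close>

lemma prim_mult:
  assumes "prim a b f g" "prim a b f' g'"
  shows "prim a b (\<lambda>t. f t * f' t) (\<lambda>t. g t * f' t + f t * g' t)"
proof -
  have "prim a b (\<lambda>t. (1/2) * ((f t + f' t)\<^sup>2 + (-1) * ((f t)\<^sup>2 + (f' t)\<^sup>2)))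
     (\<lambda>t. (1/2) * (2 * (f t + f' t) * (g t + g' t) + (-1) * (2 * f t * g t + 2 * f' t * g' t)))"
    by (intro prim_cmult prim_add prim_square assms)
  then show ?thesis
    by (rule prim_cong) (auto simp: algebra_simps power2_eq_square)
qed

lemma prim_nonneg_zero:
  assumes f: "prim a b f g" and "a \<le> b" and nn: "\<And>t. t \<in> {a..b} \<Longrightarrow> 0 \<le> g t" and 0: "f a = f b"
  shows "AE t in lebesgue_on {a..b}. g t = 0"
proof -
  have "bmeas a b g" using f by (simp add: prim_def)
  then obtain B where "g \<in> borel_measurable (lebesgue_on {a..b})" "\<And>t. t \<in> {a..b} \<Longrightarrow> \<bar>g t\<bar> \<le> B"
    by (rule bmeasE) blast
  then have "g absolutely_integrable_on {a..b}"
    by (intro measurable_bounded_by_integrable_imp_absolutely_integrable[where g="\<lambda>_. B"])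
      (auto intro: integrable_const_ivl)
  then have i: "integrable (lebesgue_on {a..b}) g"
    by (simp add: integrable_restrict_space set_integrable_def)
  have "integral\<^sup>L (lebesgue_on {a..b}) g = integral {a..b} g"
    by (rule lebesgue_integral_eq_integral[OF i]) auto
  also have "\<dots> = 0"
    using primD[OF f, of a b] assms by (auto simp: integral_unique)
  finally show ?thesis
    using integral_nonneg_eq_0_iff_AE[OF i, OF AE_I2] nn by (simp add: space_restrict_space)
qed

section \<open>Trajectories\<close>

text \<open>Minus the third coordinate of the point of the southern hemisphere over
  \<open>z\<close>.\<close>

definition rr :: "real \<Rightarrow> real^2 \<Rightarrow> real" where
  "rr \<alpha> z = sqrt (1 - \<alpha>^4 * ((z $ 1)\<^sup>2 + (z $ 2)\<^sup>2))"

lemma norm_sq2: "(norm (z :: real^2))\<^sup>2 = (z $ 1)\<^sup>2 + (z $ 2)\<^sup>2"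
  unfolding power2_norm_eq_inner by (simp add: inner_vec_def sum_2 power2_eq_square)

lemma rr_pos:
  assumes "\<alpha>\<^sup>2 * norm z < 1"
  shows "0 < 1 - \<alpha>^4 * ((z $ 1)\<^sup>2 + (z $ 2)\<^sup>2)" "0 < rr \<alpha> z"
proof -
  have "(\<alpha>\<^sup>2 * norm z)\<^sup>2 < 1"
    using assms by (simp add: power_less_one_iff abs_square_less_1)
  then show "0 < 1 - \<alpha>^4 * ((z $ 1)\<^sup>2 + (z $ 2)\<^sup>2)"
    by (simp add: power_mult_distrib norm_sq2)
  then show "0 < rr \<alpha> z"
    by (simp add: rr_def)
qed

lemma rr_sq: "\<alpha>\<^sup>2 * norm z < 1 \<Longrightarrow> (rr \<alpha> z)\<^sup>2 = 1 - \<alpha>^4 * ((z $ 1)\<^sup>2 + (z $ 2)\<^sup>2)"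
  using rr_pos(1)[of \<alpha> z] by (simp add: rr_def)

lemma field_Lambda_eq: "field_Lambda \<alpha> u z =
    vector [- cos \<alpha> * z $ 2, cos \<alpha> * z $ 1 + u * (sin \<alpha> / \<alpha>\<^sup>2) * rr \<alpha> z]"
  by (simp add: field_Lambda_def rr_def norm_sq2)

lemma continuous_on_rr: "continuous_on S z \<Longrightarrow> continuous_on S (\<lambda>t. rr \<alpha> (z t))"
  unfolding rr_def by (intro continuous_intros)

lemma trajectory_continuous:
  assumes "trajectory \<alpha> T z u" shows "continuous_on {0..T} z"
proof -
  let ?F = "\<lambda>\<tau>. field_Lambda \<alpha> (u \<tau>) (z \<tau>)"
  have T: "0 \<le> T" and i: "\<And>t. t \<in> {0..T} \<Longrightarrow> (?F has_integral (z t - z 0)) {0..t}"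
    using assms by (auto simp: trajectory_def)
  have "continuous_on {0..T} (\<lambda>t. integral {0..t} ?F)"
    using i[of T] T by (intro indefinite_integral_continuous_1) auto
  then have "continuous_on {0..T} (\<lambda>t. z 0 + integral {0..t} ?F)"
    by (intro continuous_intros)
  then show ?thesis
    by (rule continuous_on_eq) (simp add: integral_unique[OF i])
qed

lemma trajectory_prim:
  assumes "trajectory \<alpha> T z u"
  shows "prim 0 T (\<lambda>t. z t $ 1) (\<lambda>t. - cos \<alpha> * z t $ 2)"
    "prim 0 T (\<lambda>t. z t $ 2) (\<lambda>t. cos \<alpha> * z t $ 1 + u t * ((sin \<alpha> / \<alpha>\<^sup>2) * rr \<alpha> (z t)))"
proof -
  let ?F = "\<lambda>\<tau>. field_Lambda \<alpha> (u \<tau>) (z \<tau>)"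
  have T: "0 \<le> T" and i: "\<And>t. t \<in> {0..T} \<Longrightarrow> (?F has_integral (z t - z 0)) {0..t}"
    and u: "bmeas 0 T u"
    using assms by (auto simp: trajectory_def bmeas_def)
  note zc = trajectory_continuous[OF assms]
  have i': "(?F has_integral (z t - z s)) {s..t}" if "0 \<le> s" "s \<le> t" "t \<le> T" for s t
  proof -
    have "?F integrable_on {0..t}" using i[of t] that by auto
    then have "?F integrable_on {s..t}" "integral {0..s} ?F + integral {s..t} ?F = integral {0..t} ?F"
      using that Henstock_Kurzweil_Integration.integral_combine[of 0 s t ?F] by (auto intro: integrable_subinterval_real)
    moreover have "integral {0..s} ?F = z s - z 0" "integral {0..t} ?F = z t - z 0"
      using i that by (auto intro!: integral_unique)
    ultimately show ?thesis
      by (auto simp: has_integral_iff algebra_simps)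
  qed
  have comp: "((\<lambda>\<tau>. ?F \<tau> $ k) has_integral (z t $ k - z s $ k)) {s..t}" if "0 \<le> s" "s \<le> t" "t \<le> T" for s t k
    using has_integral_linear[OF i'[OF that] bounded_linear_vec_nth[of k]] by (simp add: o_def)
  show "prim 0 T (\<lambda>t. z t $ 1) (\<lambda>t. - cos \<alpha> * z t $ 2)"
    unfolding prim_def
    using comp[of _ _ 1] by (auto simp: field_Lambda_eq intro!: bmeas_continuous continuous_intros zc)
  show "prim 0 T (\<lambda>t. z t $ 2) (\<lambda>t. cos \<alpha> * z t $ 1 + u t * ((sin \<alpha> / \<alpha>\<^sup>2) * rr \<alpha> (z t)))"
    unfolding prim_def
  proof (intro conjI allI impI)
    have "continuous_on {0..T} (\<lambda>t. sin \<alpha> / \<alpha>\<^sup>2 * rr \<alpha> (z t))" "continuous_on {0..T} (\<lambda>t. cos \<alpha> * z t $ 1)"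
      by (intro continuous_intros continuous_on_rr zc)+
    then show "bmeas 0 T (\<lambda>t. cos \<alpha> * z t $ 1 + u t * ((sin \<alpha> / \<alpha>\<^sup>2) * rr \<alpha> (z t)))"
      by (intro bmeas_add bmeas_mult[OF u] bmeas_continuous)
  qed (use comp[of _ _ 2] in \<open>auto simp: field_Lambda_eq mult.assoc\<close>)
qed

text \<open>The third row of the linear system on the sphere, up to sign. With it, quantities linear
  in the three coordinates of the sphere can be differentiated in the chart as easily as on the
  sphere.\<close>

lemma trajectory_rr:
  assumes "trajectory \<alpha> T z u" "\<alpha> \<noteq> 0"
  shows "prim 0 T (\<lambda>t. rr \<alpha> (z t)) (\<lambda>t. - (\<alpha>\<^sup>2) * u t * sin \<alpha> * z t $ 2)"
proof -
  let ?w = "\<lambda>t. 1 + (- (\<alpha>^4)) * ((z t $ 1)\<^sup>2 + (z t $ 2)\<^sup>2)"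
  have s: "\<alpha>\<^sup>2 * norm (z t) < 1" if "t \<in> {0..T}" for t
    using assms that by (auto simp: trajectory_def)
  have w: "0 < ?w t" "sqrt (?w t) = rr \<alpha> (z t)" if "t \<in> {0..T}" for t
    using rr_pos[OF s[OF that]] by (simp_all add: rr_def)
  have "prim 0 T ?w (\<lambda>t. 0 + (- (\<alpha>^4)) * (2 * z t $ 1 * (- cos \<alpha> * z t $ 2)
     + 2 * z t $ 2 * (cos \<alpha> * z t $ 1 + u t * ((sin \<alpha> / \<alpha>\<^sup>2) * rr \<alpha> (z t)))))"
    by (intro prim_add prim_const prim_cmult prim_square trajectory_prim[OF assms(1)])
  then have "prim 0 T (\<lambda>t. sqrt (?w t)) (\<lambda>t. inverse (sqrt (?w t)) / 2 * (0 + (- (\<alpha>^4)) * (2 * z t $ 1 * (- cos \<alpha> * z t $ 2)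
     + 2 * z t $ 2 * (cos \<alpha> * z t $ 1 + u t * ((sin \<alpha> / \<alpha>\<^sup>2) * rr \<alpha> (z t))))))"
    by (rule prim_compose[where \<phi>="sqrt" and \<phi>'="\<lambda>x. inverse (sqrt x) / 2"])
      (use w(1) in \<open>auto intro!: DERIV_real_sqrt continuous_intros simp: less_imp_neq[symmetric]\<close>)
  then show ?thesis
  proof (rule prim_cong)
    fix t assume t: "t \<in> {0..T}"
    show "sqrt (?w t) = rr \<alpha> (z t)" using w[OF t] by simp
    have "rr \<alpha> (z t) > 0" using rr_pos[OF s[OF t]] by simp
    then show "inverse (sqrt (?w t)) / 2 * (0 + (- (\<alpha>^4)) * (2 * z t $ 1 * (- cos \<alpha> * z t $ 2)
     + 2 * z t $ 2 * (cos \<alpha> * z t $ 1 + u t * ((sin \<alpha> / \<alpha>\<^sup>2) * rr \<alpha> (z t)))))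
      = - (\<alpha>\<^sup>2) * u t * sin \<alpha> * z t $ 2"
      using assms(2) unfolding w(2)[OF t] by (simp add: field_simps power2_eq_square power4_eq_xxxx)
  qed
qed

text \<open>The first integral of the motion for the control \<open>-1\<close>, the distance to its axis seen
  from the chart, and the polar angle around this axis, which is then a clock.\<close>

definition Hf :: "real \<Rightarrow> real^2 \<Rightarrow> real" where
  "Hf \<alpha> z = \<alpha>\<^sup>2 * sin \<alpha> * z $ 1 + cos \<alpha> * rr \<alpha> z"

definition Nf :: "real \<Rightarrow> real^2 \<Rightarrow> real" where
  "Nf \<alpha> z = sin \<alpha> * rr \<alpha> z - \<alpha>\<^sup>2 * cos \<alpha> * z $ 1"

definition thf :: "real \<Rightarrow> real^2 \<Rightarrow> real" where
  "thf \<alpha> z = arctan (\<alpha>\<^sup>2 * z $ 2 / Nf \<alpha> z)"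

text \<open>The loss of the clock \<open>thf\<close> per unit of \<open>1 + u\<close>. On the
  relevant set it lies between 1/2 and 2 (see \<open>Gf_bounds\<close>).\<close>

definition Gf :: "real \<Rightarrow> real^2 \<Rightarrow> real" where
  "Gf \<alpha> z = (sin \<alpha> * rr \<alpha> z * Nf \<alpha> z + (sin \<alpha>)\<^sup>2 * (\<alpha>\<^sup>2 * z $ 2)\<^sup>2) / ((Nf \<alpha> z)\<^sup>2 + (\<alpha>\<^sup>2 * z $ 2)\<^sup>2)"

lemma trajectory_Hf:
  assumes "trajectory \<alpha> T z u" "\<alpha> \<noteq> 0"
  shows "prim 0 T (\<lambda>t. Hf \<alpha> (z t)) (\<lambda>t. - (1 + u t) * (\<alpha>\<^sup>2 * sin \<alpha> * cos \<alpha> * z t $ 2))"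
proof -
  have "prim 0 T (\<lambda>t. \<alpha>\<^sup>2 * sin \<alpha> * z t $ 1 + cos \<alpha> * rr \<alpha> (z t))
     (\<lambda>t. \<alpha>\<^sup>2 * sin \<alpha> * (- cos \<alpha> * z t $ 2) + cos \<alpha> * (- (\<alpha>\<^sup>2) * u t * sin \<alpha> * z t $ 2))"
    by (intro prim_add prim_cmult trajectory_prim[OF assms(1)] trajectory_rr[OF assms])
  then show ?thesis
    by (rule prim_cong) (auto simp: Hf_def algebra_simps)
qed

lemma trajectory_thf:
  assumes tr: "trajectory \<alpha> T z u" "\<alpha> \<noteq> 0" and s: "0 \<le> s"
    and N: "\<And>t. t \<in> {s..T} \<Longrightarrow> 0 < Nf \<alpha> (z t)"
  shows "prim s T (\<lambda>t. thf \<alpha> (z t)) (\<lambda>t. (1 + u t) * Gf \<alpha> (z t) - 1)"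
proof -
  let ?N' = "\<lambda>t. sin \<alpha> * (- (\<alpha>\<^sup>2) * u t * sin \<alpha> * z t $ 2) + (- (\<alpha>\<^sup>2) * cos \<alpha>) * (- cos \<alpha> * z t $ 2)"
  let ?y' = "\<lambda>t. \<alpha>\<^sup>2 * (cos \<alpha> * z t $ 1 + u t * ((sin \<alpha> / \<alpha>\<^sup>2) * rr \<alpha> (z t)))"
  have "prim 0 T (\<lambda>t. sin \<alpha> * rr \<alpha> (z t) + (- (\<alpha>\<^sup>2) * cos \<alpha>) * z t $ 1) ?N'"
    by (rule prim_add[OF prim_cmult[OF trajectory_rr[OF tr]] prim_cmult[OF trajectory_prim(1)[OF tr(1)]]])
  then have "prim s T (\<lambda>t. sin \<alpha> * rr \<alpha> (z t) + (- (\<alpha>\<^sup>2) * cos \<alpha>) * z t $ 1) ?N'"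
    by (rule prim_subinterval) (use s in auto)
  moreover have "(\<lambda>t. sin \<alpha> * rr \<alpha> (z t) + (- (\<alpha>\<^sup>2) * cos \<alpha>) * z t $ 1) = (\<lambda>t. Nf \<alpha> (z t))"
    by (simp add: Nf_def fun_eq_iff)
  ultimately have pN: "prim s T (\<lambda>t. Nf \<alpha> (z t)) ?N'"
    by simp
  have py: "prim s T (\<lambda>t. \<alpha>\<^sup>2 * z t $ 2) ?y'"
    by (rule prim_subinterval[OF prim_cmult[OF trajectory_prim(2)[OF tr(1)]] s order_refl])
  have "prim s T (\<lambda>t. inverse (Nf \<alpha> (z t))) (\<lambda>t. - (inverse (Nf \<alpha> (z t)))\<^sup>2 * ?N' t)"
  proof (rule prim_compose[OF pN, where \<phi>="inverse" and \<phi>'="\<lambda>x. - (inverse x)\<^sup>2"])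
    fix t assume t: "t \<in> {s..T}"
    show "(inverse has_real_derivative - (inverse (Nf \<alpha> (z t)))\<^sup>2) (at (Nf \<alpha> (z t)))"
      using N[OF t] by (auto intro!: derivative_eq_intros simp: power2_eq_square)
  qed (use N in \<open>force intro!: continuous_intros\<close>)
  from prim_mult[OF py this]
  have "prim s T (\<lambda>t. arctan (\<alpha>\<^sup>2 * z t $ 2 * inverse (Nf \<alpha> (z t))))
     (\<lambda>t. inverse (1 + (\<alpha>\<^sup>2 * z t $ 2 * inverse (Nf \<alpha> (z t)))\<^sup>2) *
      (?y' t * inverse (Nf \<alpha> (z t)) + \<alpha>\<^sup>2 * z t $ 2 * (- (inverse (Nf \<alpha> (z t)))\<^sup>2 * ?N' t)))"
    by (rule prim_compose[where \<phi>="arctan" and \<phi>'="\<lambda>x. inverse (1 + x\<^sup>2)"])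
      (auto intro!: DERIV_arctan continuous_intros simp: add_nonneg_eq_0_iff)
  then show ?thesis
  proof (rule prim_cong)
    fix t assume t: "t \<in> {s..T}"
    show "arctan (\<alpha>\<^sup>2 * z t $ 2 * inverse (Nf \<alpha> (z t))) = thf \<alpha> (z t)"
      by (simp add: thf_def divide_inverse)
    define N y r where "N = Nf \<alpha> (z t)" and "y = \<alpha>\<^sup>2 * z t $ 2" and "r = rr \<alpha> (z t)"
    have N0: "N > 0" using N[OF t] by (simp add: N_def)
    \<comment> \<open>For \<open>u = -1\<close> the pair \<open>(N, y)\<close> rotates with unit
      speed, \<open>N' = y\<close> and \<open>y' = - N\<close>; \<open>y'\<close> and
      \<open>N'\<close> are written as this rotation plus a multiple of
      \<open>1 + u\<close>.\<close>
    have y': "?y' t = - N + (1 + u t) * (sin \<alpha> * r)"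
      using tr(2) by (simp add: N_def r_def Nf_def algebra_simps)
    have N': "?N' t = y * (1 - (1 + u t) * (sin \<alpha>)\<^sup>2)"
    proof -
      have c: "cos \<alpha> * cos \<alpha> = 1 - (sin \<alpha>)\<^sup>2"
        by (simp add: cos_squared_eq flip: power2_eq_square)
      have "?N' t = y * (cos \<alpha> * cos \<alpha> - u t * (sin \<alpha>)\<^sup>2)"
        by (simp add: y_def power2_eq_square algebra_simps)
      also have "\<dots> = y * (1 - (1 + u t) * (sin \<alpha>)\<^sup>2)"
        unfolding c by (simp add: algebra_simps)
      finally show ?thesis .
    qed
    have den: "N\<^sup>2 + y\<^sup>2 > 0" using N0 by (simp add: add_pos_nonneg)
    have e1: "inverse (1 + (y * inverse N)\<^sup>2) = N\<^sup>2 / (N\<^sup>2 + y\<^sup>2)"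
      using N0 den by (simp add: field_simps power2_eq_square)
    have aux: "N\<^sup>2 / d * (A * inverse N + y * (- (inverse N)\<^sup>2 * (y * B))) = (A * N - y * (y * B)) / d" for A B d
    proof -
      have "N\<^sup>2 * (A * inverse N + y * (- (inverse N)\<^sup>2 * (y * B))) = A * N - y * (y * B)"
        using N0 by (simp add: field_simps power2_eq_square)
      then show ?thesis by (metis times_divide_eq_left)
    qed
    have e2: "N\<^sup>2 / (N\<^sup>2 + y\<^sup>2) * ((- N + (1 + u t) * (sin \<alpha> * r)) * inverse N + y * (- (inverse N)\<^sup>2 * (y * (1 - (1 + u t) * (sin \<alpha>)\<^sup>2))))
      = ((- N + (1 + u t) * (sin \<alpha> * r)) * N - y * (y * (1 - (1 + u t) * (sin \<alpha>)\<^sup>2))) / (N\<^sup>2 + y\<^sup>2)"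
      by (rule aux)
    have e3: "((- N + (1 + u t) * (sin \<alpha> * r)) * N - y * (y * (1 - (1 + u t) * (sin \<alpha>)\<^sup>2))) / (N\<^sup>2 + y\<^sup>2) = (1 + u t) * ((sin \<alpha> * r * N + (sin \<alpha>)\<^sup>2 * y\<^sup>2) / (N\<^sup>2 + y\<^sup>2)) - 1"
    proof -
      have "(- N + (1 + u t) * (sin \<alpha> * r)) * N - y * (y * (1 - (1 + u t) * (sin \<alpha>)\<^sup>2))
        = (1 + u t) * (sin \<alpha> * r * N + (sin \<alpha>)\<^sup>2 * y\<^sup>2) - (N\<^sup>2 + y\<^sup>2)"
        by (simp add: algebra_simps power2_eq_square)
      then show ?thesis using N0 by (simp add: diff_divide_distrib)
    qed
    show "inverse (1 + (\<alpha>\<^sup>2 * z t $ 2 * inverse (Nf \<alpha> (z t)))\<^sup>2) *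
      (?y' t * inverse (Nf \<alpha> (z t)) + \<alpha>\<^sup>2 * z t $ 2 * (- (inverse (Nf \<alpha> (z t)))\<^sup>2 * ?N' t)) = (1 + u t) * Gf \<alpha> (z t) - 1"
      unfolding y' N' Gf_def unfolding N_def[symmetric] y_def[symmetric] r_def[symmetric] e1 e2 e3 ..
  qed
qed

text \<open>The field is odd under a simultaneous change of sign of state and control. The
  restriction to \<open>{0..T}\<close> keeps the curve extensional.\<close>

lemma trajectory_uminus:
  assumes "trajectory \<alpha> T z u"
  shows "trajectory \<alpha> T (\<lambda>t\<in>{0..T}. - z t) (\<lambda>t. - u t)"
proof -
  have "field_Lambda \<alpha> (- u) (- z) = - field_Lambda \<alpha> u z" for u z
    by (simp add: field_Lambda_def vec_eq_iff forall_2)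
  note f = this
  show ?thesis
    unfolding trajectory_def
  proof (intro conjI ballI)
    fix t assume t: "t \<in> {0..T}"
    have "((\<lambda>\<tau>. field_Lambda \<alpha> (u \<tau>) (z \<tau>)) has_integral (z t - z 0)) {0..t}"
      using assms t by (auto simp: trajectory_def)
    from has_integral_neg[OF this]
    have "((\<lambda>\<tau>. field_Lambda \<alpha> (- u \<tau>) ((\<lambda>t\<in>{0..T}. - z t) \<tau>)) has_integral - (z t - z 0)) {0..t}"
      by (rule has_integral_eq[rotated]) (use t in \<open>auto simp: f\<close>)
    then show "((\<lambda>\<tau>. field_Lambda \<alpha> (- u \<tau>) ((\<lambda>t\<in>{0..T}. - z t) \<tau>)) has_integral
        (\<lambda>t\<in>{0..T}. - z t) t - (\<lambda>t\<in>{0..T}. - z t) 0) {0..t}"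
      using t by simp
  qed (use assms in \<open>auto simp: trajectory_def\<close>)
qed

section \<open>Monotone arcs\<close>

lemma nondecreasing_if_deriv_nonneg:
  fixes f :: "real \<Rightarrow> real"
  assumes "a \<le> b" "continuous_on {a..b} f"
    "\<And>x. a < x \<Longrightarrow> x < b \<Longrightarrow> (f has_real_derivative f' x) (at x)" "\<And>x. a < x \<Longrightarrow> x < b \<Longrightarrow> 0 \<le> f' x"
  shows "f a \<le> f b"
  using assms by (intro DERIV_nonneg_imp_increasing_open[of a b f]) auto

lemma one_minus_cos_le: "- 1 / 2 \<le> cos \<sigma> \<Longrightarrow> 1 - cos \<sigma> \<le> 2 * (sin \<sigma>)\<^sup>2" for \<sigma> :: real
proof -
  assume c: "- 1 / 2 \<le> cos \<sigma>"
  have "(1 - cos \<sigma>) * 1 \<le> (1 - cos \<sigma>) * (2 * (1 + cos \<sigma>))"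
    using c by (intro mult_left_mono) auto
  also have "\<dots> = 2 * (sin \<sigma>)\<^sup>2"
    unfolding sin_squared_eq by (simp add: power2_eq_square algebra_simps)
  finally show ?thesis by simp
qed

text \<open>Both speeds vanish like \<open>sin \<sigma>\<close> at the end \<open>\<sigma> = 0\<close>, where \<open>f = -b\<close>, and so does
  \<open>sqrt (b\<^sup>2 - f\<^sup>2)\<close>: hence \<open>arcsin (f / b)\<close> has positive speed up to the end.\<close>

lemma half_arc:
  fixes f \<phi> f' \<phi>' :: "real \<Rightarrow> real"
  assumes df: "\<And>\<sigma>. \<sigma> \<in> {0..s} \<Longrightarrow> (f has_real_derivative f' \<sigma>) (at \<sigma>)"
    and d\<phi>: "\<And>\<sigma>. \<sigma> \<in> {0..s} \<Longrightarrow> (\<phi> has_real_derivative \<phi>' \<sigma>) (at \<sigma>)"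
    and s: "s < pi" "- 1 / 2 \<le> cos s"
    and bnd: "\<And>\<sigma>. \<sigma> \<in> {0..s} \<Longrightarrow> c * sin \<sigma> \<le> f' \<sigma>" "\<And>\<sigma>. \<sigma> \<in> {0..s} \<Longrightarrow> f' \<sigma> \<le> d * sin \<sigma>"
      "\<And>\<sigma>. \<sigma> \<in> {0..s} \<Longrightarrow> \<bar>\<phi>' \<sigma>\<bar> \<le> e"
    and cd: "0 < c" "0 < d" and f0: "f 0 = - b" and fs: "f s < b"
    and st: "0 \<le> \<sigma>" "\<sigma> < \<tau>" "\<tau> \<le> s"
  shows "f \<sigma> < f \<tau>" "c * (1 - cos \<tau>) \<le> f \<tau> + b" "f \<tau> + b \<le> d * (1 - cos \<tau>)"
    and "\<bar>\<phi> \<tau> - \<phi> \<sigma>\<bar> \<le> 2 * e * sqrt (b * d) / c * (arcsin (f \<tau> / b) - arcsin (f \<sigma> / b))"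
proof -
  have sin0: "0 < sin r" if "0 < r" "r \<le> s" for r
    using that s by (intro sin_gt_zero) auto
  have cf: "continuous_on {p..q} f" and c\<phi>: "continuous_on {p..q} \<phi>" if "0 \<le> p" "q \<le> s" for p q
  proof -
    show "continuous_on {p..q} f"
      by (rule DERIV_continuous_on[where D=f'], rule has_field_derivative_at_within, rule df) (use that in auto)
    show "continuous_on {p..q} \<phi>"
      by (rule DERIV_continuous_on[where D=\<phi>'], rule has_field_derivative_at_within, rule d\<phi>) (use that in auto)
  qed
  have mono: "f p < f q" if "0 \<le> p" "p < q" "q \<le> s" for p q
  proof (rule DERIV_pos_imp_increasing_open[OF that(2)])
    fix r assume r: "p < r" "r < q"
    have "0 < c * sin r" using sin0[of r] r that cd by simp
    then show "\<exists>y. (f has_real_derivative y) (at r) \<and> 0 < y"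
      using df[of r] bnd(1)[of r] r that by (intro exI[of _ "f' r"]) auto
  qed (rule cf[OF that(1,3)])
  show "f \<sigma> < f \<tau>" using mono st by simp
  have up: "f r + b \<le> d * (1 - cos r)" if "0 \<le> r" "r \<le> s" for r
  proof -
    have "d * (1 - cos 0) - f 0 \<le> d * (1 - cos r) - f r"
    proof (rule nondecreasing_if_deriv_nonneg[where f="\<lambda>r. d * (1 - cos r) - f r"])
      show "((\<lambda>r. d * (1 - cos r) - f r) has_real_derivative d * sin q - f' q) (at q)" if "0 < q" "q < r" for q
        using df[of q] that \<open>r \<le> s\<close> by (auto intro!: derivative_eq_intros)
    qed (use that bnd(2) in \<open>auto intro!: continuous_intros cf\<close>)
    then show ?thesis by (simp add: f0)
  qed
  have lo: "c * (1 - cos r) \<le> f r + b" if "0 \<le> r" "r \<le> s" for r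
  proof -
    have "f 0 - c * (1 - cos 0) \<le> f r - c * (1 - cos r)"
    proof (rule nondecreasing_if_deriv_nonneg[where f="\<lambda>r. f r - c * (1 - cos r)"])
      show "((\<lambda>r. f r - c * (1 - cos r)) has_real_derivative f' q - c * sin q) (at q)" if "0 < q" "q < r" for q
        using df[of q] that \<open>r \<le> s\<close> by (auto intro!: derivative_eq_intros)
    qed (use that bnd(1) in \<open>auto intro!: continuous_intros cf\<close>)
    then show ?thesis by (simp add: f0)
  qed
  show "c * (1 - cos \<tau>) \<le> f \<tau> + b" "f \<tau> + b \<le> d * (1 - cos \<tau>)"
    using up[of \<tau>] lo[of \<tau>] st by auto
  have b: "b > 0"
    using mono[of 0 s] f0 fs st by auto
  have fb: "- b \<le> f r" "f r < b" if "0 \<le> r" "r \<le> s" for r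
  proof -
    show "- b \<le> f r" using mono[of 0 r] f0 that by (cases "r = 0") auto
    show "f r < b" using mono[of r s] fs that by (cases "r = s") auto
  qed
  have fb': "- b < f r" if "0 < r" "r \<le> s" for r
    using mono[of 0 r] f0 that by auto
  have e0: "0 \<le> e" using bnd(3)[of \<sigma>] st by (auto intro: order_trans[OF abs_ge_zero])
  define L where "L = 2 * e * sqrt (b * d) / c"
  \<comment> \<open>Numerator and denominator of the quotient are both comparable to
    \<open>sin r\<close>: the first is at least \<open>c * sin r\<close>, and the square of the
    second, \<open>(f + b) * (b - f)\<close>, is at most \<open>4 b d sin^2 r\<close>. The factor
    \<open>L\<close> lifts the resulting lower bound to \<open>e\<close>.\<close>
  have key: "\<bar>\<phi>' r\<bar> \<le> L * (f' r / sqrt (b\<^sup>2 - (f r)\<^sup>2))" if r: "0 < r" "r \<le> s" for r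
  proof -
    have "cos s \<le> cos r" using r s by (intro cos_monotone_0_pi_le) auto
    then have "1 - cos r \<le> 2 * (sin r)\<^sup>2" using s by (intro one_minus_cos_le) auto
    then have "f r + b \<le> d * (2 * (sin r)\<^sup>2)"
      using up[of r] r cd by (meson less_imp_le mult_left_mono order_trans)
    then have "(f r + b) * (b - f r) \<le> (d * (2 * (sin r)\<^sup>2)) * (2 * b)"
      using fb[of r] r b cd by (intro mult_mono) auto
    then have "b\<^sup>2 - (f r)\<^sup>2 \<le> (b * d) * (2 * sin r)\<^sup>2"
      by (simp add: algebra_simps power2_eq_square)
    then have "sqrt (b\<^sup>2 - (f r)\<^sup>2) \<le> sqrt ((b * d) * (2 * sin r)\<^sup>2)"
      by (rule real_sqrt_le_mono)
    also have "\<dots> = sqrt (b * d) * (2 * sin r)"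
      using sin0[OF r] unfolding real_sqrt_mult[of "b * d"] real_sqrt_abs by simp
    finally have "sqrt (b\<^sup>2 - (f r)\<^sup>2) \<le> sqrt (b * d) * (2 * sin r)" .
    moreover have pos: "0 < sqrt (b\<^sup>2 - (f r)\<^sup>2)"
    proof -
      have "0 < (b - f r) * (b + f r)"
        using fb[of r] fb'[of r] r by (intro mult_pos_pos) auto
      then show ?thesis by (simp add: power2_eq_square algebra_simps)
    qed
    moreover have "0 \<le> f' r"
      using bnd(1)[of r] r mult_pos_pos[OF cd(1) sin0[OF r]] by simp
    ultimately have "(c * sin r) / (sqrt (b * d) * (2 * sin r)) \<le> f' r / sqrt (b\<^sup>2 - (f r)\<^sup>2)"
      using bnd(1)[of r] r by (intro frac_le) auto
    then have "L * ((c * sin r) / (sqrt (b * d) * (2 * sin r))) \<le> L * (f' r / sqrt (b\<^sup>2 - (f r)\<^sup>2))"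
      using e0 b cd by (intro mult_left_mono) (auto simp: L_def)
    moreover have "L * ((c * sin r) / (sqrt (b * d) * (2 * sin r))) = e"
      using sin0[OF r] b cd by (simp add: L_def)
    ultimately show ?thesis using bnd(3)[of r] r by auto
  qed
  have ca: "continuous_on {\<sigma>..\<tau>} (\<lambda>r. arcsin (f r / b))"
  proof (intro continuous_on_arcsin continuous_intros cf ballI)
    fix r assume "r \<in> {\<sigma>..\<tau>}"
    then show "- 1 \<le> f r / b \<and> f r / b \<le> 1" using fb[of r] b st by (auto simp: field_simps)
  qed (use b st in auto)
  have da: "((\<lambda>r. arcsin (f r / b)) has_real_derivative f' r / sqrt (b\<^sup>2 - (f r)\<^sup>2)) (at r)" if r: "0 < r" "r \<le> s" for r
  proof -
    have "sqrt (1 - (f r / b)\<^sup>2) = sqrt ((b\<^sup>2 - (f r)\<^sup>2) / b\<^sup>2)"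
      using b by (simp add: power_divide diff_divide_distrib)
    also have "\<dots> = sqrt (b\<^sup>2 - (f r)\<^sup>2) / b"
      using b by (simp add: real_sqrt_divide)
    finally have q: "sqrt (1 - (f r / b)\<^sup>2) = sqrt (b\<^sup>2 - (f r)\<^sup>2) / b" .
    have "((\<lambda>r. arcsin (f r / b)) has_real_derivative inverse (sqrt (1 - (f r / b)\<^sup>2)) * (f' r / b)) (at r)"
      using fb[of r] fb'[of r] b r
      by (intro DERIV_chain2[OF DERIV_arcsin] DERIV_cdivide df) (auto simp: field_simps)
    then show ?thesis
      unfolding q using b by (simp add: field_simps)
  qed
  have "L * arcsin (f \<sigma> / b) - \<phi> \<sigma> \<le> L * arcsin (f \<tau> / b) - \<phi> \<tau>"
  proof (rule nondecreasing_if_deriv_nonneg[where f="\<lambda>r. L * arcsin (f r / b) - \<phi> r"])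
    fix r assume r: "\<sigma> < r" "r < \<tau>"
    show "((\<lambda>r. L * arcsin (f r / b) - \<phi> r) has_real_derivative L * (f' r / sqrt (b\<^sup>2 - (f r)\<^sup>2)) - \<phi>' r) (at r)"
      using r st by (intro DERIV_diff DERIV_cmult da d\<phi>) auto
    show "0 \<le> L * (f' r / sqrt (b\<^sup>2 - (f r)\<^sup>2)) - \<phi>' r"
      using key[of r] r st by auto
  qed (use st in \<open>auto intro!: continuous_intros ca c\<phi>\<close>)
  moreover have "L * arcsin (f \<sigma> / b) + \<phi> \<sigma> \<le> L * arcsin (f \<tau> / b) + \<phi> \<tau>"
  proof (rule nondecreasing_if_deriv_nonneg[where f="\<lambda>r. L * arcsin (f r / b) + \<phi> r"])
    fix r assume r: "\<sigma> < r" "r < \<tau>"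
    show "((\<lambda>r. L * arcsin (f r / b) + \<phi> r) has_real_derivative L * (f' r / sqrt (b\<^sup>2 - (f r)\<^sup>2)) + \<phi>' r) (at r)"
      using r st by (intro DERIV_add DERIV_cmult da d\<phi>) auto
    show "0 \<le> L * (f' r / sqrt (b\<^sup>2 - (f r)\<^sup>2)) + \<phi>' r"
      using key[of r] r st by auto
  qed (use st in \<open>auto intro!: continuous_intros ca c\<phi>\<close>)
  ultimately show "\<bar>\<phi> \<tau> - \<phi> \<sigma>\<bar> \<le> 2 * e * sqrt (b * d) / c * (arcsin (f \<tau> / b) - arcsin (f \<sigma> / b))"
    unfolding L_def[symmetric] by (simp add: abs_le_iff algebra_simps)
qed

text \<open>A curve with the piece between \<open>s1\<close> and \<open>s2\<close> cut out and the
  ends of the cut glued together; for \<open>s1 = s2\<close> it is a complete curve. The bounds on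
  the cosines keep each branch away from the opposite end, so that \<open>sin \<sigma>\<close>
  degenerates on it only at its own end. There are two instances: the coordinates of the upper half,
  and level and clock angle along it.\<close>

locale arc =
  fixes f \<phi> f' \<phi>' :: "real \<Rightarrow> real" and b c d e s1 s2 :: real
  assumes df: "\<And>\<sigma>. \<sigma> \<in> {0..s1} \<union> {s2..pi} \<Longrightarrow> (f has_real_derivative f' \<sigma>) (at \<sigma>)"
    and d\<phi>: "\<And>\<sigma>. \<sigma> \<in> {0..s1} \<union> {s2..pi} \<Longrightarrow> (\<phi> has_real_derivative \<phi>' \<sigma>) (at \<sigma>)"
    and s1: "0 < s1" "s1 < pi" "- 1 / 2 \<le> cos s1"
    and s2: "0 < s2" "s2 < pi" "cos s2 \<le> 1 / 2"
    and bnd: "\<And>\<sigma>. \<sigma> \<in> {0..s1} \<union> {s2..pi} \<Longrightarrow> c * sin \<sigma> \<le> f' \<sigma>"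
      "\<And>\<sigma>. \<sigma> \<in> {0..s1} \<union> {s2..pi} \<Longrightarrow> f' \<sigma> \<le> d * sin \<sigma>"
      "\<And>\<sigma>. \<sigma> \<in> {0..s1} \<union> {s2..pi} \<Longrightarrow> \<bar>\<phi>' \<sigma>\<bar> \<le> e"
    and cd: "0 < c" "0 < d"
    and ends: "f 0 = - b" "f pi = b" "f s1 = f s2" "\<phi> s1 = \<phi> s2"
begin

abbreviation "J \<equiv> {0..s1} \<union> {s2..pi}"

lemma continuous_on_f: "continuous_on J f"
  by (rule DERIV_continuous_on[where D=f'], rule has_field_derivative_at_within, rule df)

lemma f_less_right:
  assumes "s2 \<le> \<sigma>" "\<sigma> < \<tau>" "\<tau> \<le> pi" shows "f \<sigma> < f \<tau>"
proof (rule DERIV_pos_imp_increasing_open[OF assms(2)])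
  fix r assume "\<sigma> < r" "r < \<tau>"
  note * = this assms
  then have "0 < c * sin r" using s2 cd by (simp add: sin_gt_zero)
  then show "\<exists>y. (f has_real_derivative y) (at r) \<and> 0 < y"
    using df[of r] bnd(1)[of r] * by (intro exI[of _ "f' r"]) auto
qed (use assms in \<open>auto intro: continuous_on_subset[OF continuous_on_f]\<close>)

lemma f_s1_less: "f s1 < b"
  using f_less_right[of s2 pi] ends s2 by auto

lemma left:
  assumes "0 \<le> \<sigma>" "\<sigma> < \<tau>" "\<tau> \<le> s1"
  shows "f \<sigma> < f \<tau>" "c * (1 - cos \<tau>) \<le> f \<tau> + b" "f \<tau> + b \<le> d * (1 - cos \<tau>)"
    and "\<bar>\<phi> \<tau> - \<phi> \<sigma>\<bar> \<le> 2 * e * sqrt (b * d) / c * (arcsin (f \<tau> / b) - arcsin (f \<sigma> / b))"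
proof -
  have J: "r \<in> J" if "r \<in> {0..s1}" for r using that by simp
  note h = half_arc[of s1 f f' \<phi> \<phi>' c d e b \<sigma> \<tau>, OF df[OF J] d\<phi>[OF J] s1(2,3) bnd[OF J] cd ends(1) f_s1_less assms]
  show "f \<sigma> < f \<tau>" "c * (1 - cos \<tau>) \<le> f \<tau> + b" "f \<tau> + b \<le> d * (1 - cos \<tau>)"
    "\<bar>\<phi> \<tau> - \<phi> \<sigma>\<bar> \<le> 2 * e * sqrt (b * d) / c * (arcsin (f \<tau> / b) - arcsin (f \<sigma> / b))"
    by (rule h; assumption)+
qed

text \<open>This is \<open>half_arc\<close> after the reflection that replaces \<sigma> by
  \<open>pi - \<sigma>\<close> and changes the sign of \<open>f\<close>.\<close>

lemma right:
  assumes "s2 \<le> \<sigma>" "\<sigma> < \<tau>" "\<tau> \<le> pi"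
  shows "f \<sigma> < f \<tau>" "c * (1 + cos \<sigma>) \<le> b - f \<sigma>" "b - f \<sigma> \<le> d * (1 + cos \<sigma>)"
    and "\<bar>\<phi> \<tau> - \<phi> \<sigma>\<bar> \<le> 2 * e * sqrt (b * d) / c * (arcsin (f \<tau> / b) - arcsin (f \<sigma> / b))"
proof -
  have b: "- b < f s1" using left[of 0 s1] s1 ends by simp
  have bb: "- b < f \<sigma>" "f \<tau> \<le> b"
  proof -
    show "- b < f \<sigma>" using b f_less_right[of s2 \<sigma>] assms ends by (cases "\<sigma> = s2") auto
    show "f \<tau> \<le> b" using f_less_right[of \<tau> pi] assms ends by (cases "\<tau> = pi") auto
  qed
  let ?f = "\<lambda>r. - f (pi - r)" and ?p = "\<lambda>r. \<phi> (pi - r)"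
  note h = half_arc[of "pi - s2" ?f "\<lambda>r. f' (pi - r)" ?p "\<lambda>r. - \<phi>' (pi - r)" c d e b "pi - \<tau>" "pi - \<sigma>"]
  have 1: "(?f has_real_derivative f' (pi - r)) (at r)" "(?p has_real_derivative - \<phi>' (pi - r)) (at r)"
    if "r \<in> {0..pi - s2}" for r
  proof -
    have r: "((\<lambda>r. pi - r) has_real_derivative - 1) (at r)" by (auto intro!: derivative_eq_intros)
    show "(?f has_real_derivative f' (pi - r)) (at r)"
      using DERIV_minus[OF DERIV_chain2[OF df r]] that by simp
    show "(?p has_real_derivative - \<phi>' (pi - r)) (at r)"
      using DERIV_chain2[OF d\<phi> r] that by simp
  qed
  have 2: "c * sin r \<le> f' (pi - r)" "f' (pi - r) \<le> d * sin r" "\<bar>- \<phi>' (pi - r)\<bar> \<le> e" if "r \<in> {0..pi - s2}" for r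
    using bnd[of "pi - r"] that by auto
  have 3: "pi - s2 < pi" "- 1 / 2 \<le> cos (pi - s2)" "?f 0 = - b" "?f (pi - s2) < b" "0 \<le> pi - \<tau>" "pi - \<tau> < pi - \<sigma>" "pi - \<sigma> \<le> pi - s2"
    using s2 ends b assms by auto
  note h = h[OF 1 3(1,2) 2 cd 3(3-7), simplified]
  show "f \<sigma> < f \<tau>" "c * (1 + cos \<sigma>) \<le> b - f \<sigma>" "b - f \<sigma> \<le> d * (1 + cos \<sigma>)"
    using h by auto
  have "-1 \<le> f \<sigma> / b" "f \<sigma> / b \<le> 1" "-1 \<le> f \<tau> / b" "f \<tau> / b \<le> 1"
    using bb h(1) by (auto simp: field_simps)
  then have "arcsin (- (f \<sigma> / b)) = - arcsin (f \<sigma> / b)" "arcsin (- (f \<tau> / b)) = - arcsin (f \<tau> / b)"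
    by (auto intro!: arcsin_minus)
  then show "\<bar>\<phi> \<tau> - \<phi> \<sigma>\<bar> \<le> 2 * e * sqrt (b * d) / c * (arcsin (f \<tau> / b) - arcsin (f \<sigma> / b))"
    using h(4) by (simp add: abs_minus_commute)
qed

lemma b_pos: "0 < b"
  using left(1)[of 0 s1] f_s1_less s1 ends by auto

lemma f_le: "0 \<le> \<sigma> \<Longrightarrow> \<sigma> \<le> s1 \<Longrightarrow> - b \<le> f \<sigma> \<and> f \<sigma> \<le> f s1"
  using left(1)[of 0 \<sigma>] left(1)[of \<sigma> s1] ends by (cases "\<sigma> = 0"; cases "\<sigma> = s1") auto

lemma f_ge: "s2 \<le> \<sigma> \<Longrightarrow> \<sigma> \<le> pi \<Longrightarrow> f s1 \<le> f \<sigma> \<and> f \<sigma> \<le> b"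
  using right(1)[of s2 \<sigma>] right(1)[of \<sigma> pi] ends by (cases "\<sigma> = s2"; cases "\<sigma> = pi") auto

lemma f_range: "\<sigma> \<in> J \<Longrightarrow> - b \<le> f \<sigma> \<and> f \<sigma> \<le> b"
  using f_ge[of \<sigma>] f_le[of \<sigma>] ends(1,2) f_s1_less left(1)[of 0 s1] s1 ends by (cases "\<sigma> \<le> s1") auto

lemma f_interior: "\<sigma> \<in> J \<Longrightarrow> 0 < \<sigma> \<Longrightarrow> \<sigma> < pi \<Longrightarrow> - b < f \<sigma> \<and> f \<sigma> < b"
  using f_ge[of \<sigma>] f_le[of \<sigma>] left(1)[of 0 \<sigma>] right(1)[of \<sigma> pi] left(1)[of 0 s1] f_s1_less s1 ends
  by (cases "\<sigma> \<le> s1") auto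

lemma f_surj:
  assumes "- b \<le> v" "v \<le> b" obtains \<sigma> where "\<sigma> \<in> J" "f \<sigma> = v"
proof (cases "v \<le> f s1")
  case True
  then obtain \<sigma> where "0 \<le> \<sigma>" "\<sigma> \<le> s1" "f \<sigma> = v"
    using IVT'[of f 0 v s1] assms s1 ends continuous_on_subset[OF continuous_on_f, of "{0..s1}"] by auto
  then show ?thesis using that by auto
next
  case False
  then obtain \<sigma> where "s2 \<le> \<sigma>" "\<sigma> \<le> pi" "f \<sigma> = v"
    using IVT'[of f s2 v pi] assms s2 ends continuous_on_subset[OF continuous_on_f, of "{s2..pi}"] by auto
  then show ?thesis using that by auto
qed

text \<open>For points on different branches the estimates on the two branches add up, since the two
  ends of the cut agree in both coordinates.\<close>

lemma lipschitz_aux: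
  assumes "\<sigma> \<in> J" "\<tau> \<in> J" "f \<sigma> \<le> f \<tau>"
  shows "\<bar>\<phi> \<tau> - \<phi> \<sigma>\<bar> \<le> 2 * e * sqrt (b * d) / c * (arcsin (f \<tau> / b) - arcsin (f \<sigma> / b))"
proof -
  define L where "L = 2 * e * sqrt (b * d) / c"
  have LL: "\<bar>\<phi> q - \<phi> p\<bar> \<le> L * (arcsin (f q / b) - arcsin (f p / b))" if "0 \<le> p" "p \<le> q" "q \<le> s1" for p q
    using left(4)[of p q, folded L_def] that by (cases "p = q") simp_all
  have RR: "\<bar>\<phi> q - \<phi> p\<bar> \<le> L * (arcsin (f q / b) - arcsin (f p / b))" if "s2 \<le> p" "p \<le> q" "q \<le> pi" for p q
    using right(4)[of p q, folded L_def] that by (cases "p = q") simp_all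
  have lm: "p \<le> q" if "f p \<le> f q" "p \<in> {0..s1}" "q \<in> {0..s1}" for p q
    using left(1)[of q p] that by (cases "p \<le> q") auto
  have rm: "p \<le> q" if "f p \<le> f q" "p \<in> {s2..pi}" "q \<in> {s2..pi}" for p q
    using right(1)[of q p] that by (cases "p \<le> q") auto
  have "\<bar>\<phi> \<tau> - \<phi> \<sigma>\<bar> \<le> L * (arcsin (f \<tau> / b) - arcsin (f \<sigma> / b))"
  proof -
  consider "\<sigma> \<in> {0..s1}" "\<tau> \<in> {0..s1}" | "\<sigma> \<in> {s2..pi}" "\<tau> \<in> {s2..pi}"
    | "\<sigma> \<in> {0..s1}" "\<tau> \<in> {s2..pi}" | "\<sigma> \<in> {s2..pi}" "\<tau> \<in> {0..s1}"
    using assms by blast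
  then show ?thesis
  proof cases
    case 1 then show ?thesis using LL[of \<sigma> \<tau>] lm[OF assms(3)] by auto
  next
    case 2 then show ?thesis using RR[of \<sigma> \<tau>] rm[OF assms(3)] by auto
  next
    case 3
    have "\<bar>\<phi> \<tau> - \<phi> \<sigma>\<bar> \<le> \<bar>\<phi> s1 - \<phi> \<sigma>\<bar> + \<bar>\<phi> \<tau> - \<phi> s2\<bar>" using ends by simp
    also have "\<dots> \<le> L * (arcsin (f s1 / b) - arcsin (f \<sigma> / b)) + L * (arcsin (f \<tau> / b) - arcsin (f s2 / b))"
      using LL[of \<sigma> s1] RR[of s2 \<tau>] 3 by auto
    also have "\<dots> = L * (arcsin (f \<tau> / b) - arcsin (f \<sigma> / b))"
      by (simp add: ends(3) flip: distrib_left)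
    finally show ?thesis .
  next
    case 4
    have "f \<tau> \<le> f s1" using 4 left(1)[of \<tau> s1] by (cases "\<tau> = s1") auto
    moreover have "f s2 \<le> f \<sigma>" using 4 right(1)[of s2 \<sigma>] by (cases "\<sigma> = s2") auto
    ultimately have "f \<tau> = f s1" "f \<sigma> = f s2" using assms(3) ends by auto
    then have "\<tau> = s1" "\<sigma> = s2"
      using 4 left(1)[of \<tau> s1] right(1)[of s2 \<sigma>] by (cases "\<tau> = s1"; cases "\<sigma> = s2"; auto)+
    then show ?thesis using ends by simp
  qed
qed
  then show ?thesis by (simp only: L_def)
qed

text \<open>The curve as a graph over its first coordinate. The choice is harmless: by
  \<open>lipschitz_aux\<close>, equal values of \<open>f\<close> entail equal values of
  \<phi>.\<close>

definition lift :: "real \<Rightarrow> real" where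
  "lift v = \<phi> (SOME \<sigma>. \<sigma> \<in> J \<and> f \<sigma> = v)"

lemma lift_f: "\<sigma> \<in> J \<Longrightarrow> lift (f \<sigma>) = \<phi> \<sigma>"
proof -
  assume s: "\<sigma> \<in> J"
  let ?t = "SOME \<tau>. \<tau> \<in> J \<and> f \<tau> = f \<sigma>"
  have "?t \<in> J \<and> f ?t = f \<sigma>"
    by (rule someI[of _ \<sigma>]) (use s in auto)
  then show ?thesis
    using lipschitz_aux[of \<sigma> ?t] s by (simp add: lift_def)
qed

lemma lift_lipschitz:
  assumes "u \<in> {-b..b}" "v \<in> {-b..b}"
  shows "\<bar>lift u - lift v\<bar> \<le> 2 * e * sqrt (b * d) / c * \<bar>arcsin (u / b) - arcsin (v / b)\<bar>"
proof -
  obtain \<sigma> \<tau> where \<sigma>: "\<sigma> \<in> J" "f \<sigma> = u" and \<tau>: "\<tau> \<in> J" "f \<tau> = v"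
    using f_surj assms by (metis atLeastAtMost_iff)
  have mono: "arcsin (p / b) \<le> arcsin (q / b)" if "p \<le> q" "- b \<le> p" "q \<le> b" for p q
    using that b_pos by (intro arcsin_le_arcsin) (auto simp: field_simps)
  show ?thesis
  proof (cases "u \<le> v")
    case True
    then show ?thesis
      using lipschitz_aux[of \<sigma> \<tau>] \<sigma> \<tau> lift_f[of \<sigma>] lift_f[of \<tau>] mono[of u v] assms
      by (simp add: abs_minus_commute)
  next
    case False
    then show ?thesis
      using lipschitz_aux[of \<tau> \<sigma>] \<sigma> \<tau> lift_f[of \<sigma>] lift_f[of \<tau>] mono[of v u] assms
      by simp
  qed
qed

lemma continuous_on_lift: "continuous_on {-b..b} lift"
proof -
  let ?L = "2 * e * sqrt (b * d) / c"
  have ca: "continuous_on {-b..b} (\<lambda>u. arcsin (u / b))"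
    using b_pos by (intro continuous_on_arcsin continuous_intros) (auto simp: field_simps)
  show ?thesis
    unfolding continuous_on_def
  proof
    fix v assume v: "v \<in> {-b..b}"
    have "((\<lambda>u. ?L * \<bar>arcsin (u / b) - arcsin (v / b)\<bar>) \<longlongrightarrow> ?L * \<bar>arcsin (v / b) - arcsin (v / b)\<bar>) (at v within {-b..b})"
      using bspec[OF ca[unfolded continuous_on_def] v] by (rule tendsto_mult_left[OF tendsto_rabs[OF tendsto_diff[OF _ tendsto_const]]])
    then have lim: "((\<lambda>u. ?L * \<bar>arcsin (u / b) - arcsin (v / b)\<bar>) \<longlongrightarrow> 0) (at v within {-b..b})"
      unfolding diff_self abs_zero mult_zero_right .
    have "norm (lift u - lift v) \<le> norm (?L * \<bar>arcsin (u / b) - arcsin (v / b)\<bar>) * 1" if "u \<in> {-b..b}" for u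
      unfolding real_norm_def mult_1_right by (rule order_trans[OF lift_lipschitz[OF that v] abs_ge_self])
    then have "\<forall>\<^sub>F u in at v within {-b..b}. norm (lift u - lift v) \<le> norm (?L * \<bar>arcsin (u / b) - arcsin (v / b)\<bar>) * 1"
      unfolding eventually_at_filter by (intro always_eventually) blast
    from tendsto_0_le[OF lim this] have "((\<lambda>u. lift u - lift v) \<longlongrightarrow> 0) (at v within {-b..b})" .
    then show "(lift \<longlongrightarrow> lift v) (at v within {-b..b})"
      by (simp add: LIM_zero_iff)
  qed
qed

end

text \<open>Let \<open>h\<close> be half the difference of the angles \<open>A\<close> and
  \<open>B\<close>. Then \<open>x - y = 2 sin h cos ((A + B) / 2)\<close>, and this cosine is at
  least \<open>sin h\<close>. With \<open>sin h \<ge> h / 5\<close> it follows that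
  \<open>x - y \<ge> h^2 / 16\<close>, and the angles differ by \<open>2 h\<close>.\<close>

lemma arcsin_holder:
  assumes "x \<in> {-1..1}" "y \<in> {-1..1}"
  shows "\<bar>arcsin x - arcsin y\<bar> \<le> 8 * sqrt \<bar>x - y\<bar>"
proof -
  have *: "arcsin x - arcsin y \<le> 8 * sqrt (x - y)" if xy: "x \<in> {-1..1}" "y \<in> {-1..1}" "y \<le> x" for x y :: real
  proof -
    define A B where "A = arcsin x" and "B = arcsin y"
    have AB: "- (pi/2) \<le> B" "B \<le> A" "A \<le> pi/2" "sin A = x" "sin B = y"
      using xy arcsin_bounded[of x] arcsin_bounded[of y] arcsin_le_arcsin[of y x] by (auto simp: A_def B_def)
    define h where "h = (A - B) / 2"
    have h: "0 \<le> h" "h \<le> pi / 2" using AB by (auto simp: h_def)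
    have sh: "0 \<le> sin h" using h by (intro sin_ge_zero) auto
    have "x - y = 2 * sin h * cos ((A + B) / 2)"
      using sin_diff_sin[of A B] AB by (simp add: h_def)
    moreover have "sin h \<le> cos ((A + B) / 2)"
    proof -
      have "sin h = cos (pi / 2 - h)" by (simp add: cos_diff)
      also have "\<dots> \<le> cos \<bar>(A + B) / 2\<bar>"
        using AB h by (intro cos_monotone_0_pi_le) (auto simp: h_def field_simps)
      also have "\<dots> = cos ((A + B) / 2)" by (rule cos_abs_real)
      finally show ?thesis .
    qed
    ultimately have "2 * sin h * sin h \<le> x - y"
      using sh by (simp add: mult_left_mono)
    moreover have "h / 5 \<le> sin h"
    proof -
      have "h * h \<le> h * (8 / 5)" using h pi_approx by (intro mult_left_mono) auto
      moreover have "h - sin h \<le> h * h / 2"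
      proof -
        have "\<bar>sin h - h\<bar> \<le> h * h / 2"
          using Maclaurin_sin_bound[of h 2] by (simp add: sin_coeff_def numeral_2_eq_2 power2_eq_square)
        then show ?thesis using abs_ge_minus_self[of "sin h - h"] by linarith
      qed
      ultimately show ?thesis by linarith
    qed
    then have "h / 5 * (h / 5) \<le> sin h * sin h"
      using h by (intro mult_mono) auto
    ultimately have "(h / 4)\<^sup>2 \<le> x - y"
      using xy(3) unfolding power2_eq_square by (simp add: mult.assoc)
    then have "h / 4 \<le> sqrt (x - y)" by (rule real_le_rsqrt)
    then show ?thesis by (simp add: h_def A_def B_def)
  qed
  show ?thesis
    using *[of x y] *[of y x] assms arcsin_le_arcsin[of x y] arcsin_le_arcsin[of y x]
    by (cases "y \<le> x") (auto simp: abs_if)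
qed

text \<open>A first use of the linearisation of \<open>W\<close>, with error
  \<open>\<bar>w2\<bar> / 2\<close>, shows that \<open>g\<close> is Lipschitz at \<open>t\<close>;
  with this, a second use with a small error gives the derivative. Differentiability of
  \<open>W\<close> enters at a single point only.\<close>

lemma implicit_deriv:
  fixes W :: "real \<times> real \<Rightarrow> real" and g :: "real \<Rightarrow> real"
  assumes W: "(W has_derivative (\<lambda>h. w1 * fst h + w2 * snd h)) (at (t, g t))" and w2: "w2 \<noteq> 0"
    and g: "isCont g t" and 0: "\<forall>\<^sub>F s in nhds t. W (s, g s) = 0"
  shows "(g has_real_derivative (- w1 / w2)) (at t)"
proof -
  have W0: "W (t, g t) = 0" using 0 by (rule eventually_nhds_x_imp_x)
  have key: "\<forall>\<^sub>F s in nhds t. \<bar>w1 * (s - t) + w2 * (g s - g t)\<bar> \<le> e * (\<bar>s - t\<bar> + \<bar>g s - g t\<bar>)" if "e > 0" for e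
  proof -
    obtain \<delta> where \<delta>: "\<delta> > 0" "\<And>z. norm (z - (t, g t)) < \<delta> \<Longrightarrow>
        norm (W z - W (t, g t) - (w1 * fst (z - (t, g t)) + w2 * snd (z - (t, g t)))) \<le> e * norm (z - (t, g t))"
      using W \<open>e > 0\<close> unfolding has_derivative_at_alt by blast
    have "((\<lambda>s. (s, g s)) \<longlongrightarrow> (t, g t)) (nhds t)"
      using g by (intro tendsto_Pair filterlim_ident) (simp add: tendsto_nhds_iff isCont_def)
    then have "\<forall>\<^sub>F s in nhds t. norm ((s, g s) - (t, g t)) < \<delta>"
      using \<delta>(1) by (auto simp: tendsto_iff dist_norm)
    with 0 show ?thesis
    proof eventually_elim
      case (elim s)
      have "norm (W (s, g s) - W (t, g t) - (w1 * (s - t) + w2 * (g s - g t))) \<le> e * norm ((s, g s) - (t, g t))"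
        using \<delta>(2)[OF elim(2)] by simp
      also have "\<dots> \<le> e * (\<bar>s - t\<bar> + \<bar>g s - g t\<bar>)"
        using \<open>e > 0\<close> norm_Pair_le[of "s - t" "g s - g t"] by (intro mult_left_mono) auto
      finally show ?case using elim W0 by simp
    qed
  qed
  define B where "B = (\<bar>w1\<bar> + \<bar>w2\<bar> / 2) / (\<bar>w2\<bar> / 2)"
  have B: "\<forall>\<^sub>F s in nhds t. \<bar>g s - g t\<bar> \<le> B * \<bar>s - t\<bar>"
  proof -
    have "0 < \<bar>w2\<bar> / 2" using w2 by simp
    from key[OF this] show ?thesis
    proof eventually_elim
      case (elim s)
      have "\<bar>w2\<bar> * \<bar>g s - g t\<bar> \<le> \<bar>w1 * (s - t) + w2 * (g s - g t)\<bar> + \<bar>w1\<bar> * \<bar>s - t\<bar>"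
        by (simp flip: abs_mult)
      then have "(\<bar>w2\<bar> / 2) * \<bar>g s - g t\<bar> \<le> (\<bar>w1\<bar> + \<bar>w2\<bar> / 2) * \<bar>s - t\<bar>"
        using elim by (simp add: algebra_simps)
      then show ?case using w2 by (simp add: B_def field_simps)
    qed
  qed
  have B0: "B \<ge> 0" by (simp add: B_def)
  have "((\<lambda>s. (g s - g t) / (s - t)) \<longlongrightarrow> - w1 / w2) (at t)"
  proof (rule tendstoI)
    fix e :: real assume e: "e > 0"
    define e' where "e' = e * \<bar>w2\<bar> / (2 * (1 + B))"
    have e': "e' > 0" using e w2 B0 by (simp add: e'_def)
    have "\<forall>\<^sub>F s in at t. \<bar>w1 * (s - t) + w2 * (g s - g t)\<bar> \<le> e' * (\<bar>s - t\<bar> + \<bar>g s - g t\<bar>) \<and> \<bar>g s - g t\<bar> \<le> B * \<bar>s - t\<bar> \<and> s \<noteq> t"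
      unfolding eventually_at_filter using key[OF e'] B by eventually_elim auto
    then show "\<forall>\<^sub>F s in at t. dist ((g s - g t) / (s - t)) (- w1 / w2) < e"
    proof eventually_elim
      case (elim s)
      have "\<bar>w1 * (s - t) + w2 * (g s - g t)\<bar> \<le> e' * (\<bar>s - t\<bar> + \<bar>g s - g t\<bar>)" using elim by simp
      also have "\<dots> \<le> e' * (\<bar>s - t\<bar> + B * \<bar>s - t\<bar>)" using elim e' by (intro mult_left_mono) auto
      also have "\<dots> = e * \<bar>w2\<bar> / 2 * \<bar>s - t\<bar>"
        using B0 by (simp add: e'_def field_simps)
      also have "\<dots> < e * \<bar>w2\<bar> * \<bar>s - t\<bar>" using e w2 elim by simp
      finally have "\<bar>w1 * (s - t) + w2 * (g s - g t)\<bar> < e * \<bar>w2 * (s - t)\<bar>" by (simp add: abs_mult)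
      moreover have "(g s - g t) / (s - t) - (- w1 / w2) = (w1 * (s - t) + w2 * (g s - g t)) / (w2 * (s - t))"
        using w2 elim by (simp add: field_simps)
      ultimately show ?case
        using w2 elim by (simp add: dist_real_def abs_divide pos_divide_less_eq)
    qed
  qed
  then show ?thesis unfolding has_field_derivative_iff .
qed

section \<open>The geometry of a front\<close>

lemma DERIV_rr:
  assumes f: "(f has_real_derivative f') (at s)" and g: "(g has_real_derivative g') (at s)"
    and p: "0 < rr \<alpha> (pt (f s) (g s))"
  shows "((\<lambda>s. rr \<alpha> (pt (f s) (g s))) has_real_derivative
    - (\<alpha>^4 * (f s * f' + g s * g')) / rr \<alpha> (pt (f s) (g s))) (at s)"
proof -
  have pos: "0 < 1 - \<alpha>^4 * (f s * f s + g s * g s)"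
    using p unfolding rr_def vector_2 power2_eq_square real_sqrt_gt_0_iff .
  note q = DERIV_diff[OF DERIV_const[of 1] DERIV_cmult[OF DERIV_add[OF DERIV_mult[OF f f] DERIV_mult[OF g g]], of "\<alpha>^4"]]
  have e: "inverse R / 2 * (0 - \<alpha>^4 * (f' * f s + f' * f s + (g' * g s + g' * g s))) = - (\<alpha>^4 * (f s * f' + g s * g')) / R" for R
  proof -
    have 1: "0 - \<alpha>^4 * (f' * f s + f' * f s + (g' * g s + g' * g s)) = - (2 * (\<alpha>^4 * (f s * f' + g s * g')))"
      by (simp only: distrib_left mult.commute[of f'] mult.commute[of g'] mult_2 diff_0 minus_add_distrib add_ac)
    have 2: "inverse R / 2 * - (2 * X) = - X / R" for X
      by (cases "R = 0") (simp_all add: field_simps)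
    show ?thesis unfolding 1 2 ..
  qed
  show ?thesis
    unfolding rr_def vector_2 power2_eq_square
    by (rule DERIV_cong[OF DERIV_chain2[OF DERIV_real_sqrt[OF pos] q] e])
qed

text \<open>The properties of the upper half on which the synthesis rests. \<open>K\<close> collects
  the constants independent of \<alpha>, \<open>a\<close> is half the width, \<open>sym\<close> is
  the reflection symmetry up to O(\<alpha>), and \<open>lev\<close> places the cut at the level of
  the origin (see \<open>Hf_0\<close>).\<close>

locale front =
  fixes \<alpha> a K s1 s2 :: real and x y x' y' :: "real \<Rightarrow> real"
  assumes K: "1 \<le> K" and \<alpha>: "0 < \<alpha>" and small: "1000000 * (K^30 * \<alpha>) \<le> 1"
    and a: "1 / K \<le> a" "a \<le> K"
    and dx: "\<And>\<sigma>. (x has_real_derivative x' \<sigma>) (at \<sigma>)"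
    and dy: "\<And>\<sigma>. (y has_real_derivative y' \<sigma>) (at \<sigma>)"
    and cx': "continuous_on UNIV x'" and cy': "continuous_on UNIV y'"
    and s1: "0 < s1" "s1 < pi" "- 1 / 2 \<le> cos s1"
    and s2: "0 < s2" "s2 < pi" "cos s2 \<le> 1 / 2"
    and far: "1 / K \<le> 1 - cos s1" "1 / K \<le> 1 + cos s2"
    and xb: "\<And>\<sigma>. \<sigma> \<in> {0..s1} \<union> {s2..pi} \<Longrightarrow> 1 / K * sin \<sigma> \<le> x' \<sigma>"
      "\<And>\<sigma>. \<sigma> \<in> {0..s1} \<union> {s2..pi} \<Longrightarrow> x' \<sigma> \<le> K * sin \<sigma>"
    and yb: "\<And>\<sigma>. \<sigma> \<in> {0..s1} \<union> {s2..pi} \<Longrightarrow> \<bar>y' \<sigma>\<bar> \<le> K"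
      "\<And>\<sigma>. \<sigma> \<in> {0..s1} \<union> {s2..pi} \<Longrightarrow> 1 / K * sin \<sigma> \<le> y \<sigma>"
      "\<And>\<sigma>. \<sigma> \<in> {0..s1} \<union> {s2..pi} \<Longrightarrow> y \<sigma> \<le> K * sin \<sigma>"
    and ends: "x 0 = - a" "x pi = a" "x s1 = x s2" "y s1 = y s2"
    and sym: "\<And>\<sigma>. \<sigma> \<in> {0..s1} \<union> {s2..pi} \<Longrightarrow> pi - \<sigma> \<in> {0..s1} \<union> {s2..pi}"
      "\<And>\<sigma>. \<sigma> \<in> {0..s1} \<union> {s2..pi} \<Longrightarrow> \<bar>x \<sigma> + x (pi - \<sigma>)\<bar> \<le> K * \<alpha>"
      "\<And>\<sigma>. \<sigma> \<in> {0..s1} \<union> {s2..pi} \<Longrightarrow> \<bar>y \<sigma> - y (pi - \<sigma>)\<bar> \<le> K * \<alpha>"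
    and lev: "Hf \<alpha> (pt (x s1) (y s1)) = cos \<alpha>"

sublocale front \<subseteq> xy: arc x y x' y' a "1 / K" K K s1 s2
proof (unfold_locales, goal_cases)
  case (1 \<sigma>) show ?case by (rule dx)
next case (2 \<sigma>) show ?case by (rule dy)
next case 3 show ?case by (rule s1)
next case 4 show ?case by (rule s1)
next case 5 show ?case by (rule s1)
next case 6 show ?case by (rule s2)
next case 7 show ?case by (rule s2)
next case 8 show ?case by (rule s2)
next case (9 \<sigma>) then show ?case by (rule xb)
next case (10 \<sigma>) then show ?case by (rule xb)
next case (11 \<sigma>) then show ?case by (rule yb)
next case 12 show ?case using K by simp
next case 13 show ?case using K by simp
next case 14 show ?case by (rule ends)
next case 15 show ?case by (rule ends)
next case 16 show ?case by (rule ends)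
next case 17 show ?case by (rule ends)
qed

context front
begin

abbreviation "J \<equiv> {0..s1} \<union> {s2..pi}"

lemma small_pow: "i \<le> 30 \<Longrightarrow> K ^ i * \<alpha> \<le> 1 / 1000000"
proof -
  assume "i \<le> 30"
  then have "K ^ i * \<alpha> \<le> K ^ 30 * \<alpha>"
    using K \<alpha> by (intro mult_right_mono power_increasing) auto
  then show ?thesis using small by simp
qed

lemma alpha_small: "\<alpha> \<le> 1 / 1000000" "K * \<alpha> \<le> 1 / 1000000"
  using small_pow[of 0] small_pow[of 1] by simp_all

lemma trig: "(99 / 100) * \<alpha> \<le> sin \<alpha>" "sin \<alpha> \<le> \<alpha>" "(99 / 100) \<le> cos \<alpha>" "cos \<alpha> \<le> 1" "0 < sin \<alpha>"
proof -
  have q: "\<alpha> * \<alpha> \<le> \<alpha> * (1 / 1000000)" using alpha_small \<alpha> by (intro mult_left_mono) auto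
  have "\<bar>sin \<alpha> - \<alpha>\<bar> \<le> \<alpha> * \<alpha> / 2"
    using Maclaurin_sin_bound[of \<alpha> 2] by (simp add: sin_coeff_def numeral_2_eq_2 power2_eq_square)
  moreover have "\<alpha> * \<alpha> \<le> \<alpha> / 1000000" using q by simp
  ultimately have "99 / 100 * \<alpha> \<le> sin \<alpha>" using \<alpha> abs_ge_minus_self[of "sin \<alpha> - \<alpha>"] by linarith
  then show 1: "(99 / 100) * \<alpha> \<le> sin \<alpha>" by simp
  show "sin \<alpha> \<le> \<alpha>" using \<alpha> by (intro sin_x_le_x) simp
  have "(sin \<alpha>)\<^sup>2 \<le> 1 - (99 / 100)\<^sup>2"
  proof -
    have "0 \<le> sin \<alpha>" using 1 \<alpha> by simp
    then have "sin \<alpha> * sin \<alpha> \<le> \<alpha> * \<alpha>" using \<open>sin \<alpha> \<le> \<alpha>\<close> \<alpha> by (intro mult_mono) auto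
    then show ?thesis using q alpha_small by (simp add: power2_eq_square)
  qed
  then have "(99 / 100)\<^sup>2 \<le> (cos \<alpha>)\<^sup>2" by (simp add: sin_squared_eq)
  moreover have "0 \<le> cos \<alpha>" using \<alpha> alpha_small pi_gt3 by (intro cos_ge_zero) auto
  ultimately show "(99 / 100) \<le> cos \<alpha>" by (rule power2_le_imp_le)
  show "cos \<alpha> \<le> 1" by simp
  show "0 < sin \<alpha>" by (rule less_le_trans[OF _ 1]) (use \<alpha> in simp)
qed

text \<open>The weight that the curvature of the level lines of \<open>Hf\<close> has in the
  normalised first integral (see \<open>xi_alt\<close>). It is of order \<alpha>.\<close>

definition kap :: real where "kap = \<alpha>\<^sup>2 * cos \<alpha> / (sin \<alpha> * a)"

lemma a_pos: "0 < a"
  using a K by (meson less_le_trans zero_less_divide_1_iff zero_less_one order.strict_trans2)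

lemma kap: "0 < kap" "kap * a \<le> (102 / 100) * \<alpha>" "kap \<le> (102 / 100) * K * \<alpha>"
proof -
  show "0 < kap" using \<alpha> trig a_pos by (simp add: kap_def)
  have "kap * a = \<alpha> * (\<alpha> * cos \<alpha> / sin \<alpha>)"
    using a_pos by (simp add: kap_def power2_eq_square)
  also have "\<alpha> * cos \<alpha> / sin \<alpha> \<le> \<alpha> * 1 / ((99 / 100) * \<alpha>)"
    using trig \<alpha> by (intro frac_le mult_mono) auto
  finally show 1: "kap * a \<le> (102 / 100) * \<alpha>"
    using \<alpha> by (simp add: mult_left_mono)
  have "kap * (1 / K) \<le> kap * a" using a \<open>0 < kap\<close> by (intro mult_left_mono) auto
  then have "kap * (1 / K) \<le> (102 / 100) * \<alpha>" using 1 by linarith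
  then show "kap \<le> (102 / 100) * K * \<alpha>" using K by (simp add: field_simps)
qed

text \<open>A filled ellipse through the two ends of the front that contains the front and the
  enclosed region (see \<open>top_ell\<close> and \<open>R_ell\<close>). On it the second coordinate
  is bounded by the square root of the distance to the ends, which is what the arcsine scale of the
  levels requires.\<close>

definition ell :: "(real^2) set" where
  "ell = {z. \<bar>z $ 1\<bar> \<le> a \<and> (z $ 2)\<^sup>2 \<le> 4 * K^6 * (a\<^sup>2 - (z $ 1)\<^sup>2)}"

lemma ell_uminus: "z \<in> ell \<Longrightarrow> - z \<in> ell"
  by (simp add: ell_def)

lemma a_sq: "a\<^sup>2 \<le> K\<^sup>2"
  using a a_pos by (intro power_mono) auto

lemma ell_bounds:
  assumes "z \<in> ell"
  shows "\<alpha>\<^sup>2 * \<bar>z $ 1\<bar> \<le> \<alpha> / 1000000" "(\<alpha>\<^sup>2 * z $ 2)\<^sup>2 \<le> \<alpha>\<^sup>2 / 1000000"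
    "(99 / 100) \<le> rr \<alpha> z" "rr \<alpha> z \<le> 1" "\<alpha>\<^sup>2 * norm z < 1"
    "(97 / 100) * \<alpha> \<le> Nf \<alpha> z" "Nf \<alpha> z \<le> (101 / 100) * \<alpha>" "\<bar>z $ 2\<bar> \<le> 2 * K^4"
proof -
  have z: "\<bar>z $ 1\<bar> \<le> a" "(z $ 2)\<^sup>2 \<le> 4 * K^6 * (a\<^sup>2 - (z $ 1)\<^sup>2)"
    using assms by (auto simp: ell_def)
  have "\<alpha>\<^sup>2 * \<bar>z $ 1\<bar> = \<alpha> * (\<alpha> * \<bar>z $ 1\<bar>)" by (simp add: power2_eq_square)
  also have "\<dots> \<le> \<alpha> * (K * \<alpha>)"
    using z a \<alpha> by (intro mult_left_mono) (auto simp: mult.commute)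
  also have "\<dots> \<le> \<alpha> * (1 / 1000000)" using alpha_small \<alpha> by (intro mult_left_mono) auto
  finally show 1: "\<alpha>\<^sup>2 * \<bar>z $ 1\<bar> \<le> \<alpha> / 1000000" by simp
  have "(z $ 2)\<^sup>2 \<le> 4 * K^6 * (K\<^sup>2 - 0)"
    by (rule order_trans[OF z(2)], intro mult_left_mono diff_mono a_sq) (use K in auto)
  also have "\<dots> = (2 * K^4)\<^sup>2" by (simp flip: power_add power_mult)
  finally have z2: "(z $ 2)\<^sup>2 \<le> (2 * K^4)\<^sup>2" .
  then have "\<bar>z $ 2\<bar> \<le> \<bar>2 * K^4\<bar>" by (simp only: abs_le_square_iff)
  then show "\<bar>z $ 2\<bar> \<le> 2 * K^4" using K by simp
  have "(\<alpha>\<^sup>2 * z $ 2)\<^sup>2 = \<alpha>\<^sup>2 * (\<alpha>\<^sup>2 * (z $ 2)\<^sup>2)" by (simp add: power2_eq_square)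
  also have "\<dots> \<le> \<alpha>\<^sup>2 * (\<alpha>\<^sup>2 * (2 * K^4)\<^sup>2)" by (intro mult_left_mono z2) auto
  also have "\<dots> = \<alpha>\<^sup>2 * (2 * (K^4 * \<alpha>))\<^sup>2" by (simp add: power_mult_distrib mult_ac)
  also have "\<dots> \<le> \<alpha>\<^sup>2 * (2 * (1 / 1000000))\<^sup>2"
    using small_pow[of 4] K \<alpha> by (intro mult_left_mono power_mono) auto
  finally show 2: "(\<alpha>\<^sup>2 * z $ 2)\<^sup>2 \<le> \<alpha>\<^sup>2 / 1000000"
    by (rule order_trans) (simp add: power2_eq_square)
  have a2: "\<alpha>\<^sup>2 \<le> 1 / 1000000" 
    using power_mono[of \<alpha> "1 / 1000000" 2] alpha_small \<alpha> by (simp add: power2_eq_square)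
  have "(\<alpha>\<^sup>2 * \<bar>z $ 1\<bar>)\<^sup>2 \<le> (\<alpha> / 1000000)\<^sup>2" using 1 by (intro power_mono) auto
  then have 3: "\<alpha>^4 * ((z $ 1)\<^sup>2 + (z $ 2)\<^sup>2) \<le> 1 - (99 / 100)\<^sup>2"
  proof -
    have "\<alpha>^4 * ((z $ 1)\<^sup>2 + (z $ 2)\<^sup>2) = (\<alpha>\<^sup>2 * \<bar>z $ 1\<bar>)\<^sup>2 + (\<alpha>\<^sup>2 * z $ 2)\<^sup>2"
      by (simp add: power_mult_distrib distrib_left flip: power_mult)
    also have "\<dots> \<le> (\<alpha> / 1000000)\<^sup>2 + \<alpha>\<^sup>2 / 1000000" using 2 \<open>(\<alpha>\<^sup>2 * \<bar>z $ 1\<bar>)\<^sup>2 \<le> (\<alpha> / 1000000)\<^sup>2\<close> by (rule add_mono[rotated])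
    also have "\<dots> = \<alpha>\<^sup>2 * (1 / 1000000000000 + 1 / 1000000)" by (simp add: power_divide)
    also have "\<dots> \<le> 1 * (1 / 1000000000000 + 1 / 1000000)" using a2 by (intro mult_right_mono) auto
    also have "\<dots> \<le> 1 - (99 / 100)\<^sup>2" by (simp add: power2_eq_square)
    finally show ?thesis .
  qed
  have "sqrt ((99 / 100)\<^sup>2) \<le> rr \<alpha> z" unfolding rr_def using 3 by (intro real_sqrt_le_mono) simp
  then show r: "(99 / 100) \<le> rr \<alpha> z" by simp
  show r1: "rr \<alpha> z \<le> 1" by (simp add: rr_def)
  have "\<alpha>^4 * ((z $ 1)\<^sup>2 + (z $ 2)\<^sup>2) < 1"
    using 3 by (rule le_less_trans) (simp add: power2_eq_square)
  then have "(\<alpha>\<^sup>2 * norm z)\<^sup>2 < 1\<^sup>2" by (simp add: power_mult_distrib norm_sq2 flip: power_mult)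
  then show "\<alpha>\<^sup>2 * norm z < 1" by (rule power2_less_imp_less) simp
  have c: "\<bar>\<alpha>\<^sup>2 * cos \<alpha> * z $ 1\<bar> \<le> \<alpha> / 1000000"
  proof -
    have "\<bar>\<alpha>\<^sup>2 * cos \<alpha> * z $ 1\<bar> = (\<alpha>\<^sup>2 * \<bar>z $ 1\<bar>) * cos \<alpha>" using trig by (simp add: abs_mult)
    also have "\<dots> \<le> (\<alpha>\<^sup>2 * \<bar>z $ 1\<bar>) * 1" using trig by (intro mult_left_mono) auto
    finally show ?thesis using 1 by simp
  qed
  have "((99 / 100) * \<alpha>) * (99 / 100) \<le> sin \<alpha> * rr \<alpha> z" using trig r \<alpha> by (intro mult_mono) auto
  then show "(97 / 100) * \<alpha> \<le> Nf \<alpha> z" unfolding Nf_def using c \<alpha> by linarith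
  have "sin \<alpha> * rr \<alpha> z \<le> \<alpha> * 1" using trig r1 r \<alpha> by (intro mult_mono) auto
  then show "Nf \<alpha> z \<le> (101 / 100) * \<alpha>" unfolding Nf_def using c \<alpha> by linarith
qed

text \<open>The first integral, normalised to have the values \<open>-1\<close> and \<open>1\<close> at the ends of the front.\<close>

definition r0 :: real where "r0 = rr \<alpha> (pt a 0)"

definition xi :: "real^2 \<Rightarrow> real" where
  "xi z = (Hf \<alpha> z - cos \<alpha> * r0) / (\<alpha>\<^sup>2 * sin \<alpha> * a)"

lemma xi_alt: "xi z = z $ 1 / a + kap / \<alpha>^4 * (rr \<alpha> z - r0)"
proof -
  have "Hf \<alpha> z - cos \<alpha> * r0 = \<alpha>\<^sup>2 * sin \<alpha> * z $ 1 + cos \<alpha> * (rr \<alpha> z - r0)"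
    by (simp add: Hf_def algebra_simps)
  then show ?thesis
    using \<alpha> trig a_pos by (simp add: xi_def kap_def add_divide_distrib power4_eq_xxxx power2_eq_square)
qed

lemma end_ell: "pt a 0 \<in> ell"
  using a_pos by (simp add: ell_def)

text \<open>With \<open>q = a^2 - z_1^2\<close>, the difference \<open>rr - r0\<close> equals
  \<open>\<alpha>^4 * (q - z_2^2) / (rr + r0)\<close>. In the ellipse \<open>z_2^2\<close> is at
  most a multiple of \<open>q\<close>, and \<open>q\<close> contains the distances to both ends as
  factors. Hence the correction to \<open>z_1 / a\<close> consumes at most half of the distance to
  either end.\<close>

lemma xi_bounds:
  assumes "z \<in> ell"
  shows "(a + z $ 1) / (2 * a) \<le> 1 + xi z" "(a - z $ 1) / (2 * a) \<le> 1 - xi z"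
    "\<bar>xi z - z $ 1 / a\<bar> \<le> 5 * (K ^ 9 * \<alpha>)"
    "\<bar>z $ 2\<bar> \<le> 4 * K^4 * sqrt (1 - (xi z)\<^sup>2)"
proof -
  have z: "\<bar>z $ 1\<bar> \<le> a" "(z $ 2)\<^sup>2 \<le> 4 * K^6 * (a\<^sup>2 - (z $ 1)\<^sup>2)"
    using assms by (auto simp: ell_def)
  define q where "q = a\<^sup>2 - (z $ 1)\<^sup>2"
  have q: "q = (a - z $ 1) * (a + z $ 1)" by (simp add: q_def power2_eq_square algebra_simps)
  have q0: "0 \<le> q" unfolding q using z by (intro mult_nonneg_nonneg) auto
  have qb: "q \<le> 2 * a * (a - z $ 1)" "q \<le> 2 * a * (a + z $ 1)"
    unfolding q using z mult_right_mono[of "a - z $ 1" "2 * a" "a + z $ 1"] mult_left_mono[of "a + z $ 1" "2 * a" "a - z $ 1"]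
    by (auto simp: mult.commute)
  have K6: "1 \<le> K ^ 6" using K by simp
  note r = ell_bounds(3,4,5)[OF assms] ell_bounds(3,4,5)[OF end_ell]
  define e where "e = kap * (q - (z $ 2)\<^sup>2) / (rr \<alpha> z + r0)"
  have "(rr \<alpha> z - r0) * (rr \<alpha> z + r0) = \<alpha>^4 * (q - (z $ 2)\<^sup>2)"
    using rr_sq[OF r(3)] rr_sq[OF r(6)] by (simp add: r0_def q_def power2_eq_square algebra_simps)
  moreover have rp: "1 \<le> rr \<alpha> z + r0" using r by (simp add: r0_def)
  ultimately have "rr \<alpha> z - r0 = \<alpha>^4 * (q - (z $ 2)\<^sup>2) / (rr \<alpha> z + r0)"
    by (simp add: field_simps)
  then have xi: "xi z = z $ 1 / a + e"
    using \<alpha> by (simp add: xi_alt e_def)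
  have "\<bar>q - (z $ 2)\<^sup>2\<bar> \<le> 4 * K^6 * q"
  proof -
    have "q \<le> 4 * K^6 * q" using K6 q0 mult_right_mono[of 1 "4 * K^6" q] by simp
    then show ?thesis using z(2)[folded q_def] q0 zero_le_power2[of "z $ 2"] by (intro abs_leI; linarith)
  qed
  then have "\<bar>e\<bar> \<le> kap * (4 * K^6 * q) / 1"
    unfolding e_def abs_divide abs_mult using rp kap(1) q0 K by (intro frac_le mult_mono) auto
  then have e: "\<bar>e\<bar> \<le> 4 * K^6 * kap * q" by (simp add: mult_ac)
  have small1: "(1632 / 100) * (K^7 * \<alpha>) \<le> 1" using small_pow[of 7] by simp
  have half: "4 * K^6 * kap * q \<le> w / (2 * a)" if w: "q \<le> 2 * a * w" "0 \<le> w" for w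
  proof -
    have "4 * K^6 * kap * q \<le> 4 * K^6 * kap * (2 * a * w)"
      using w kap(1) K by (intro mult_left_mono) auto
    also have "\<dots> = 8 * K^6 * (kap * a) * w" by simp
    also have "\<dots> \<le> 8 * K^6 * ((102 / 100) * \<alpha>) * w"
      using kap w K by (intro mult_left_mono mult_right_mono) auto
    also have "\<dots> \<le> w / (2 * a)"
    proof -
      have "8 * K^6 * ((102 / 100) * \<alpha>) * (2 * a) \<le> 8 * K^6 * ((102 / 100) * \<alpha>) * (2 * K)"
        using a K \<alpha> by (intro mult_left_mono) auto
      also have "\<dots> = (1632 / 100) * (K^7 * \<alpha>)" by (simp add: power_Suc[symmetric] eval_nat_numeral)
      finally have "8 * K^6 * ((102 / 100) * \<alpha>) \<le> 1 / (2 * a)"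
        using small1 a_pos by (simp add: field_simps)
      from mult_right_mono[OF this w(2)] show ?thesis by simp
    qed
    finally show ?thesis .
  qed
  have "1 + xi z = (a + z $ 1) / a + e" "1 - xi z = (a - z $ 1) / a - e"
    using a_pos by (simp_all add: xi add_divide_distrib diff_divide_distrib)
  moreover have "(a + z $ 1) / a = (a + z $ 1) / (2 * a) + (a + z $ 1) / (2 * a)"
    "(a - z $ 1) / a = (a - z $ 1) / (2 * a) + (a - z $ 1) / (2 * a)"
    using a_pos by (simp_all add: field_simps)
  ultimately show 1: "(a + z $ 1) / (2 * a) \<le> 1 + xi z" and 2: "(a - z $ 1) / (2 * a) \<le> 1 - xi z"
    using half[OF qb(1)] half[OF qb(2)] z e by linarith+
  have "q \<le> K\<^sup>2" using a_sq zero_le_power2[of "z $ 1"] unfolding q_def by linarith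
  then have "4 * K^6 * kap * q \<le> 4 * K^6 * ((102 / 100) * K * \<alpha>) * K\<^sup>2"
    using kap q0 K \<alpha> by (intro mult_mono) auto
  also have "\<dots> = (408 / 100) * (K^9 * \<alpha>)" by (simp add: power_Suc[symmetric] eval_nat_numeral)
  finally have "\<bar>e\<bar> \<le> (408 / 100) * (K^9 * \<alpha>)" using e by linarith
  moreover have "0 \<le> K^9 * \<alpha>" using K \<alpha> by simp
  ultimately show "\<bar>xi z - z $ 1 / a\<bar> \<le> 5 * (K ^ 9 * \<alpha>)"
    unfolding xi by simp
  have "q / (4 * a\<^sup>2) = ((a + z $ 1) / (2 * a)) * ((a - z $ 1) / (2 * a))"
    by (simp add: q power2_eq_square mult.commute)
  also have "\<dots> \<le> (1 + xi z) * (1 - xi z)"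
    using 1 2 z a_pos by (intro mult_mono) (auto intro: order_trans[rotated])
  also have "\<dots> = 1 - (xi z)\<^sup>2" by (simp add: power2_eq_square algebra_simps)
  finally have 3: "q / (4 * a\<^sup>2) \<le> 1 - (xi z)\<^sup>2" .
  have "(z $ 2)\<^sup>2 \<le> 4 * K^6 * q" using z by (simp add: q_def)
  also have "\<dots> = 16 * K^6 * a\<^sup>2 * (q / (4 * a\<^sup>2))" using a_pos by simp
  also have "\<dots> \<le> 16 * K^6 * K\<^sup>2 * (1 - (xi z)\<^sup>2)"
    using 3 a_sq K q0 a_pos by (intro mult_mono) (auto intro: order_trans[OF _ 3])
  also have "\<dots> = (4 * K^4)\<^sup>2 * (1 - (xi z)\<^sup>2)" by (simp add: power_mult_distrib flip: power_add power_mult)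
  finally have "sqrt ((z $ 2)\<^sup>2) \<le> sqrt ((4 * K^4)\<^sup>2 * (1 - (xi z)\<^sup>2))" by (rule real_sqrt_le_mono)
  then show "\<bar>z $ 2\<bar> \<le> 4 * K^4 * sqrt (1 - (xi z)\<^sup>2)"
    unfolding real_sqrt_mult real_sqrt_abs using K by simp
qed

abbreviation top :: "real \<Rightarrow> real^2" where "top \<sigma> \<equiv> pt (x \<sigma>) (y \<sigma>)"

lemma sin_J: "\<sigma> \<in> J \<Longrightarrow> 0 \<le> sin \<sigma>"
  using s1 s2 by (intro sin_ge_zero) auto

lemma y_J: "\<sigma> \<in> J \<Longrightarrow> 0 \<le> y \<sigma>" "\<sigma> \<in> J \<Longrightarrow> 0 < \<sigma> \<Longrightarrow> \<sigma> < pi \<Longrightarrow> 0 < y \<sigma>"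
proof -
  show "0 \<le> y \<sigma>" if "\<sigma> \<in> J"
    using yb(2)[OF that] sin_J[OF that] K by (meson divide_nonneg_nonneg mult_nonneg_nonneg order_trans zero_le_one)
  show "0 < y \<sigma>" if "\<sigma> \<in> J" "0 < \<sigma>" "\<sigma> < pi"
    using yb(2)[OF that(1)] sin_gt_zero[OF that(2,3)] K by (meson less_le_trans divide_pos_pos mult_pos_pos zero_less_one)
qed

lemma y_ends: "y 0 = 0" "y pi = 0"
  using yb(2,3)[of 0] yb(2,3)[of pi] s1 s2 by auto

text \<open>By \<open>y \<le> K sin \<sigma>\<close> and
  \<open>sin^2 \<sigma> \<le> 2 (1 - cos \<sigma>)\<close>, the square of \<open>y\<close> is
  compared with the distance of \<open>x\<close> to the near end, which grows at least like
  \<open>(1 - cos \<sigma>) / K\<close>; the far end is at distance at least \<open>1 / K^2\<close>.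
  Near \<open>pi\<close> the argument is the mirror image.\<close>

lemma top_ell:
  assumes "\<sigma> \<in> J" shows "top \<sigma> \<in> ell"
proof -
  have ysq: "(y \<sigma>)\<^sup>2 \<le> K\<^sup>2 * (sin \<sigma>)\<^sup>2"
    using yb(3)[OF assms] y_J(1)[OF assms] power_mono[of "y \<sigma>" "K * sin \<sigma>" 2] by (simp add: power_mult_distrib)
  have gen: "(y \<sigma>)\<^sup>2 \<le> 4 * K^6 * (p * q)"
    if w: "0 \<le> w" "(sin \<sigma>)\<^sup>2 \<le> 2 * w" and p: "w / K \<le> p" and q: "1 / K\<^sup>2 \<le> q" for w p q
  proof -
    have "K\<^sup>2 * (sin \<sigma>)\<^sup>2 \<le> K\<^sup>2 * (2 * w)" using w by (intro mult_left_mono) auto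
    also have "\<dots> \<le> (4 * K^3) * w"
    proof -
      have "K\<^sup>2 * 2 \<le> K^3 * 4" using K power_increasing[of 2 3 K] by (intro mult_mono) auto
      from mult_right_mono[OF this w(1)] show ?thesis by (simp add: mult_ac)
    qed
    also have "\<dots> = 4 * K^6 * ((w / K) * (1 / K\<^sup>2))"
      using K by (simp add: field_simps eval_nat_numeral)
    also have "\<dots> \<le> 4 * K^6 * (p * q)"
      using p q w K by (intro mult_left_mono mult_mono) (auto intro: order_trans[rotated])
    finally show ?thesis using ysq by linarith
  qed
  have fl: "1 / K\<^sup>2 \<le> 1 / K * (1 + cos s2)" "1 / K\<^sup>2 \<le> 1 / K * (1 - cos s1)"
    using far K mult_left_mono[OF far(1), of "1 / K"] mult_left_mono[OF far(2), of "1 / K"]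
    by (simp_all add: power2_eq_square)
  have "(y \<sigma>)\<^sup>2 \<le> 4 * K^6 * ((a + x \<sigma>) * (a - x \<sigma>))"
  proof (cases "\<sigma> \<le> s1")
    case True
    have "(1 - cos \<sigma>) / K \<le> a + x \<sigma>"
      using xy.left(2)[of 0 \<sigma>] True assms s1 s2 ends by (cases "\<sigma> = 0") auto
    moreover have "1 / K\<^sup>2 \<le> a - x \<sigma>"
      using xy.right(2)[of s2 pi] xy.f_le[of \<sigma>] fl True assms s1 s2 ends by auto
    moreover have "(sin \<sigma>)\<^sup>2 \<le> 2 * (1 - cos \<sigma>)"
    proof -
      have "(sin \<sigma>)\<^sup>2 = (1 - cos \<sigma>) * (1 + cos \<sigma>)" unfolding sin_squared_eq by (simp add: power2_eq_square algebra_simps)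
      also have "\<dots> \<le> (1 - cos \<sigma>) * 2" by (intro mult_left_mono) auto
      finally show ?thesis by simp
    qed
    moreover have "0 \<le> 1 - cos \<sigma>" by simp
    ultimately show ?thesis by (intro gen[of "1 - cos \<sigma>"])
  next
    case False
    then have sg: "s2 \<le> \<sigma>" "\<sigma> \<le> pi" using assms by auto
    have "(1 + cos \<sigma>) / K \<le> a - x \<sigma>"
      using xy.right(2)[of \<sigma> pi] sg ends by (cases "\<sigma> = pi") auto
    moreover have "1 / K\<^sup>2 \<le> a + x \<sigma>"
      using xy.left(2)[of 0 s1] xy.f_ge[of \<sigma>] fl sg s1 s2 ends by auto
    moreover have "(sin \<sigma>)\<^sup>2 \<le> 2 * (1 + cos \<sigma>)"
    proof -
      have "(sin \<sigma>)\<^sup>2 = (1 + cos \<sigma>) * (1 - cos \<sigma>)" unfolding sin_squared_eq by (simp add: power2_eq_square algebra_simps)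
      also have "\<dots> \<le> (1 + cos \<sigma>) * 2"
        using cos_ge_minus_one[of \<sigma>] by (intro mult_left_mono) linarith+
      finally show ?thesis by simp
    qed
    moreover have "0 \<le> 1 + cos \<sigma>" using cos_ge_minus_one[of \<sigma>] by linarith
    ultimately have "(y \<sigma>)\<^sup>2 \<le> 4 * K^6 * ((a - x \<sigma>) * (a + x \<sigma>))" by (intro gen[of "1 + cos \<sigma>"])
    then show ?thesis by (simp add: mult_ac)
  qed
  moreover have "\<bar>x \<sigma>\<bar> \<le> a" using xy.f_range[OF assms] by auto
  ultimately show ?thesis by (simp add: ell_def power2_eq_square algebra_simps)
qed

definition xit' :: "real \<Rightarrow> real" where
  "xit' \<sigma> = x' \<sigma> / a - kap * (x \<sigma> * x' \<sigma> + y \<sigma> * y' \<sigma>) / rr \<alpha> (top \<sigma>)"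

definition Nt' :: "real \<Rightarrow> real" where
  "Nt' \<sigma> = - (sin \<alpha> * \<alpha>^4 * (x \<sigma> * x' \<sigma> + y \<sigma> * y' \<sigma>) / rr \<alpha> (top \<sigma>)) - \<alpha>\<^sup>2 * cos \<alpha> * x' \<sigma>"

definition tht' :: "real \<Rightarrow> real" where
  "tht' \<sigma> = (\<alpha>\<^sup>2 * y' \<sigma> * Nf \<alpha> (top \<sigma>) - \<alpha>\<^sup>2 * y \<sigma> * Nt' \<sigma>) / ((Nf \<alpha> (top \<sigma>))\<^sup>2 + (\<alpha>\<^sup>2 * y \<sigma>)\<^sup>2)"

lemma DERIV_xi:
  assumes "(f has_real_derivative f') (at s)" "(g has_real_derivative g') (at s)" "0 < rr \<alpha> (pt (f s) (g s))"
  shows "((\<lambda>s. xi (pt (f s) (g s))) has_real_derivative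
    f' / a - kap * (f s * f' + g s * g') / rr \<alpha> (pt (f s) (g s))) (at s)"
proof -
  have "((\<lambda>s. f s / a + kap / \<alpha>^4 * (rr \<alpha> (pt (f s) (g s)) - r0)) has_real_derivative
    f' / a + kap / \<alpha>^4 * (- (\<alpha>^4 * (f s * f' + g s * g')) / rr \<alpha> (pt (f s) (g s)) - 0)) (at s)"
    by (intro DERIV_add DERIV_cdivide DERIV_cmult DERIV_diff DERIV_rr DERIV_const assms)
  then show ?thesis
    unfolding xi_alt[abs_def] vector_2 by (rule DERIV_cong) (use \<alpha> in simp)
qed

lemma DERIV_Nf:
  assumes "(f has_real_derivative f') (at s)" "(g has_real_derivative g') (at s)" "0 < rr \<alpha> (pt (f s) (g s))"
  shows "((\<lambda>s. Nf \<alpha> (pt (f s) (g s))) has_real_derivative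
    - (sin \<alpha> * \<alpha>^4 * (f s * f' + g s * g') / rr \<alpha> (pt (f s) (g s))) - \<alpha>\<^sup>2 * cos \<alpha> * f') (at s)"
proof -
  have "((\<lambda>s. sin \<alpha> * rr \<alpha> (pt (f s) (g s)) - \<alpha>\<^sup>2 * cos \<alpha> * f s) has_real_derivative
    sin \<alpha> * (- (\<alpha>^4 * (f s * f' + g s * g')) / rr \<alpha> (pt (f s) (g s))) - \<alpha>\<^sup>2 * cos \<alpha> * f') (at s)"
    by (intro DERIV_cmult DERIV_diff DERIV_rr assms)
  then show ?thesis
    unfolding Nf_def[abs_def] vector_2 by (rule DERIV_cong) simp
qed

lemma DERIV_arctan_quotient:
  assumes "(p has_real_derivative p') (at s)" "(q has_real_derivative q') (at s)" "0 < (q s :: real)"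
  shows "((\<lambda>s. arctan (p s / q s)) has_real_derivative (p' * q s - p s * q') / ((q s)\<^sup>2 + (p s)\<^sup>2)) (at s)"
proof -
  have "q s \<noteq> 0" using assms by simp
  have d: "(q s)\<^sup>2 + (p s)\<^sup>2 \<noteq> 0" using assms by (simp add: add_nonneg_eq_0_iff)
  have "1 + (p s / q s)\<^sup>2 = ((q s)\<^sup>2 + (p s)\<^sup>2) / (q s)\<^sup>2"
    using assms by (simp add: power_divide add_divide_distrib)
  then have i: "inverse (1 + (p s / q s)\<^sup>2) = (q s)\<^sup>2 / ((q s)\<^sup>2 + (p s)\<^sup>2)" by simp
  from DERIV_chain2[OF DERIV_arctan DERIV_divide[OF assms(1,2) \<open>q s \<noteq> 0\<close>]]
  show ?thesis
    unfolding i by (rule DERIV_cong) (use assms in \<open>simp add: power2_eq_square\<close>)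
qed

lemma DERIV_thf:
  assumes "(f has_real_derivative f') (at s)" "(g has_real_derivative g') (at s)" "0 < rr \<alpha> (pt (f s) (g s))"
    and "0 < Nf \<alpha> (pt (f s) (g s))"
  shows "((\<lambda>s. thf \<alpha> (pt (f s) (g s))) has_real_derivative
    (\<alpha>\<^sup>2 * g' * Nf \<alpha> (pt (f s) (g s)) - \<alpha>\<^sup>2 * g s * (- (sin \<alpha> * \<alpha>^4 * (f s * f' + g s * g') / rr \<alpha> (pt (f s) (g s))) - \<alpha>\<^sup>2 * cos \<alpha> * f'))
     / ((Nf \<alpha> (pt (f s) (g s)))\<^sup>2 + (\<alpha>\<^sup>2 * g s)\<^sup>2)) (at s)"
  unfolding thf_def vector_2 by (intro DERIV_arctan_quotient DERIV_cmult DERIV_Nf assms)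

lemma top_pos: "\<sigma> \<in> J \<Longrightarrow> 0 < rr \<alpha> (top \<sigma>)" "\<sigma> \<in> J \<Longrightarrow> 0 < Nf \<alpha> (top \<sigma>)"
  using ell_bounds(3,6)[OF top_ell] \<alpha> by (fastforce intro: less_le_trans[rotated])+

lemma DERIV_xi_top: "\<sigma> \<in> J \<Longrightarrow> ((\<lambda>\<sigma>. xi (top \<sigma>)) has_real_derivative xit' \<sigma>) (at \<sigma>)"
  unfolding xit'_def by (rule DERIV_xi[OF dx dy top_pos(1)])

lemma DERIV_thf_top: "\<sigma> \<in> J \<Longrightarrow> ((\<lambda>\<sigma>. thf \<alpha> (top \<sigma>)) has_real_derivative tht' \<sigma>) (at \<sigma>)"
  unfolding tht'_def Nt'_def by (rule DERIV_thf[OF dx dy top_pos])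

lemma top_aux:
  assumes "\<sigma> \<in> J"
  shows "\<bar>x' \<sigma>\<bar> \<le> K * sin \<sigma>" "\<bar>x \<sigma> * x' \<sigma> + y \<sigma> * y' \<sigma>\<bar> \<le> 2 * K\<^sup>2 * sin \<sigma>"
    "\<bar>(x \<sigma> * x' \<sigma> + y \<sigma> * y' \<sigma>) / rr \<alpha> (top \<sigma>)\<bar> \<le> (21 / 10) * K\<^sup>2 * sin \<sigma>"
proof -
  note s = sin_J[OF assms]
  have "0 \<le> 1 / K * sin \<sigma>" using s K by simp
  then show x': "\<bar>x' \<sigma>\<bar> \<le> K * sin \<sigma>" using xb[OF assms] by linarith
  have "\<bar>x \<sigma> * x' \<sigma>\<bar> \<le> K * (K * sin \<sigma>)"
    unfolding abs_mult using x' xy.f_range[OF assms] a K by (intro mult_mono) auto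
  moreover have "\<bar>y \<sigma> * y' \<sigma>\<bar> \<le> (K * sin \<sigma>) * K"
    unfolding abs_mult using y_J(1)[OF assms] yb[OF assms] s K by (intro mult_mono) auto
  ultimately show 1: "\<bar>x \<sigma> * x' \<sigma> + y \<sigma> * y' \<sigma>\<bar> \<le> 2 * K\<^sup>2 * sin \<sigma>"
    by (simp add: power2_eq_square mult_ac)
  have "\<bar>(x \<sigma> * x' \<sigma> + y \<sigma> * y' \<sigma>) / rr \<alpha> (top \<sigma>)\<bar> \<le> (2 * K\<^sup>2 * sin \<sigma>) / (99 / 100)"
    unfolding abs_divide using 1 s K ell_bounds(3)[OF top_ell[OF assms]] by (intro frac_le) auto
  also have "\<dots> \<le> (21 / 10) * K\<^sup>2 * sin \<sigma>" using s K by (simp add: mult_right_mono)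
  finally show "\<bar>(x \<sigma> * x' \<sigma> + y \<sigma> * y' \<sigma>) / rr \<alpha> (top \<sigma>)\<bar> \<le> (21 / 10) * K\<^sup>2 * sin \<sigma>" .
qed

lemma inv_a: "1 / K \<le> 1 / a" "1 / a \<le> K"
  using a a_pos K by (simp_all add: field_simps)

text \<open>The curvature term is at most a multiple of
  \<open>K^3 * \<alpha> * sin \<sigma>\<close>, so it takes away no more than half of the lower
  bound for the speed of \<open>x / a\<close>.\<close>

lemma xit'_bounds:
  assumes "\<sigma> \<in> J"
  shows "1 / (2 * K\<^sup>2) * sin \<sigma> \<le> xit' \<sigma>" "xit' \<sigma> \<le> 2 * K\<^sup>2 * sin \<sigma>"
proof -
  note s = sin_J[OF assms]
  define e where "e = kap * ((x \<sigma> * x' \<sigma> + y \<sigma> * y' \<sigma>) / rr \<alpha> (top \<sigma>))"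
  have "\<bar>e\<bar> \<le> ((102 / 100) * K * \<alpha>) * ((21 / 10) * K\<^sup>2 * sin \<sigma>)"
    unfolding e_def abs_mult using kap top_aux(3)[OF assms] K \<alpha> by (intro mult_mono) auto
  also have "\<dots> = (2142 / 1000) * (K^3 * \<alpha>) * sin \<sigma>" by (simp add: eval_nat_numeral)
  finally have e: "\<bar>e\<bar> \<le> (2142 / 1000) * (K^3 * \<alpha>) * sin \<sigma>" .
  have k3: "(2142 / 1000) * (K^3 * \<alpha>) \<le> 1 / (2 * K\<^sup>2)"
  proof -
    have "(4284 / 1000) * (K^5 * \<alpha>) \<le> 1" using small_pow[of 5] by simp
    then show ?thesis using K by (simp add: field_simps eval_nat_numeral)
  qed
  have "1 / K * sin \<sigma> / a = (1 / K) * (1 / a) * sin \<sigma>" by simp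
  moreover have "(1 / K) * (1 / K) * sin \<sigma> \<le> (1 / K) * (1 / a) * sin \<sigma>"
    using inv_a K s by (intro mult_right_mono mult_left_mono) auto
  ultimately have 1: "1 / K\<^sup>2 * sin \<sigma> \<le> x' \<sigma> / a"
    using divide_right_mono[OF xb(1)[OF assms], of a] a_pos by (simp add: power2_eq_square)
  have "x' \<sigma> / a \<le> (K * sin \<sigma>) * (1 / a)"
    using divide_right_mono[OF xb(2)[OF assms], of a] a_pos by simp
  also have "\<dots> \<le> (K * sin \<sigma>) * K" using inv_a s K by (intro mult_left_mono) auto
  finally have 2: "x' \<sigma> / a \<le> K\<^sup>2 * sin \<sigma>" by (simp add: power2_eq_square mult_ac)
  have x: "xit' \<sigma> = x' \<sigma> / a - e" by (simp add: xit'_def e_def)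
  have e2: "\<bar>e\<bar> \<le> 1 / (2 * K\<^sup>2) * sin \<sigma>" using mult_right_mono[OF k3 s] e by linarith
  have "1 / K\<^sup>2 * sin \<sigma> = 1 / (2 * K\<^sup>2) * sin \<sigma> + 1 / (2 * K\<^sup>2) * sin \<sigma>" by (simp add: field_simps)
  then show "1 / (2 * K\<^sup>2) * sin \<sigma> \<le> xit' \<sigma>" unfolding x using 1 e2 by linarith
  have "1 / (2 * K\<^sup>2) \<le> 1" "1 \<le> K\<^sup>2" using K by (simp_all add: field_simps power2_eq_square mult_ge1_I)
  then have "1 / (2 * K\<^sup>2) * sin \<sigma> \<le> K\<^sup>2 * sin \<sigma>" using s by (intro mult_right_mono) auto
  then show "xit' \<sigma> \<le> 2 * K\<^sup>2 * sin \<sigma>" unfolding x using 2 e2 by linarith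
qed

text \<open>Since \<open>Nf\<close> is close to \<alpha>, the clock angle is roughly
  \<open>\<alpha> * y\<close> and inherits the speed of \<open>y\<close> with the factor
  \<alpha>.\<close>

lemma tht'_bound:
  assumes "\<sigma> \<in> J" shows "\<bar>tht' \<sigma>\<bar> \<le> 2 * K * \<alpha>"
proof -
  note s = sin_J[OF assms] and el = ell_bounds[OF top_ell[OF assms]]
  have s1: "sin \<sigma> \<le> 1" by simp
  have N': "\<bar>Nt' \<sigma>\<bar> \<le> 2 * (\<alpha>\<^sup>2 * K)"
  proof -
    have "\<bar>sin \<alpha> * \<alpha>^4 * ((x \<sigma> * x' \<sigma> + y \<sigma> * y' \<sigma>) / rr \<alpha> (top \<sigma>))\<bar> \<le> \<alpha> * \<alpha>^4 * ((21 / 10) * K\<^sup>2 * 1)"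
      unfolding abs_mult using trig \<alpha> order_trans[OF top_aux(3)[OF assms] mult_left_mono[OF s1, of "(21 / 10) * K\<^sup>2"]]
      by (intro mult_mono) auto
    also have "\<dots> = \<alpha>\<^sup>2 * K * ((21 / 10) * (K * \<alpha>) * \<alpha>\<^sup>2)" by (simp add: eval_nat_numeral)
    also have "\<dots> \<le> \<alpha>\<^sup>2 * K * 1"
    proof -
      have "(21 / 10) * (K * \<alpha>) * \<alpha>\<^sup>2 \<le> ((21 / 10) * (1 / 1000000)) * 1"
        using alpha_small \<alpha> K by (intro mult_mono) (auto simp: power_le_one)
      then show ?thesis using K by (intro mult_left_mono) auto
    qed
    finally have 1: "\<bar>sin \<alpha> * \<alpha>^4 * ((x \<sigma> * x' \<sigma> + y \<sigma> * y' \<sigma>) / rr \<alpha> (top \<sigma>))\<bar> \<le> \<alpha>\<^sup>2 * K" by simp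
    have "\<bar>x' \<sigma>\<bar> \<le> K * 1" using top_aux(1)[OF assms] mult_left_mono[OF s1, of K] K by linarith
    then have "\<bar>\<alpha>\<^sup>2 * cos \<alpha> * x' \<sigma>\<bar> \<le> \<alpha>\<^sup>2 * 1 * K"
      unfolding abs_mult using trig by (intro mult_mono) auto
    then have "\<bar>\<alpha>\<^sup>2 * cos \<alpha> * x' \<sigma>\<bar> \<le> \<alpha>\<^sup>2 * K" by simp
    moreover have "Nt' \<sigma> = - (sin \<alpha> * \<alpha>^4 * ((x \<sigma> * x' \<sigma> + y \<sigma> * y' \<sigma>) / rr \<alpha> (top \<sigma>))) - \<alpha>\<^sup>2 * cos \<alpha> * x' \<sigma>"
      by (simp add: Nt'_def)
    ultimately show ?thesis using 1 by linarith
  qed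
  have y: "\<bar>\<alpha>\<^sup>2 * y \<sigma>\<bar> \<le> \<alpha>\<^sup>2 * K"
  proof -
    have "y \<sigma> \<le> K * 1"
      using yb(3)[OF assms] by (rule order_trans) (use s1 K in \<open>intro mult_left_mono; simp\<close>)
    then show ?thesis
      unfolding abs_mult using y_J(1)[OF assms] by (intro mult_mono) auto
  qed
  have "\<bar>\<alpha>\<^sup>2 * y' \<sigma> * Nf \<alpha> (top \<sigma>) - \<alpha>\<^sup>2 * y \<sigma> * Nt' \<sigma>\<bar> \<le> \<bar>\<alpha>\<^sup>2 * y' \<sigma> * Nf \<alpha> (top \<sigma>)\<bar> + \<bar>\<alpha>\<^sup>2 * y \<sigma> * Nt' \<sigma>\<bar>"
    by simp
  also have "\<bar>\<alpha>\<^sup>2 * y' \<sigma> * Nf \<alpha> (top \<sigma>)\<bar> \<le> \<alpha>\<^sup>2 * K * ((101 / 100) * \<alpha>)"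
    unfolding abs_mult using yb(1)[OF assms] el \<alpha> K by (intro mult_mono) auto
  also have "\<bar>\<alpha>\<^sup>2 * y \<sigma> * Nt' \<sigma>\<bar> \<le> (\<alpha>\<^sup>2 * K) * (2 * (\<alpha>\<^sup>2 * K))"
    unfolding abs_mult[of "\<alpha>\<^sup>2 * y \<sigma>"] using y N' K by (intro mult_mono) auto
  also have "\<alpha>\<^sup>2 * K * ((101 / 100) * \<alpha>) + (\<alpha>\<^sup>2 * K) * (2 * (\<alpha>\<^sup>2 * K)) = (\<alpha>\<^sup>2 * K * \<alpha>) * ((101 / 100) + 2 * (K * \<alpha>))"
    by (simp add: algebra_simps power2_eq_square)
  also have "\<dots> \<le> (\<alpha>\<^sup>2 * K * \<alpha>) * (102 / 100)"
    using alpha_small \<alpha> K by (intro mult_left_mono) auto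
  finally have num: "\<bar>\<alpha>\<^sup>2 * y' \<sigma> * Nf \<alpha> (top \<sigma>) - \<alpha>\<^sup>2 * y \<sigma> * Nt' \<sigma>\<bar> \<le> (\<alpha>\<^sup>2 * K * \<alpha>) * (102 / 100)" by simp
  have den: "(94 / 100) * \<alpha>\<^sup>2 \<le> (Nf \<alpha> (top \<sigma>))\<^sup>2 + (\<alpha>\<^sup>2 * y \<sigma>)\<^sup>2"
  proof -
    have "((97 / 100) * \<alpha>)\<^sup>2 \<le> (Nf \<alpha> (top \<sigma>))\<^sup>2" using el(6) \<alpha> by (intro power_mono) auto
    moreover have "(94 / 100) * \<alpha>\<^sup>2 \<le> ((97 / 100) * \<alpha>)\<^sup>2" by (simp add: power_mult_distrib power2_eq_square)
    ultimately show ?thesis using zero_le_power2[of "\<alpha>\<^sup>2 * y \<sigma>"] by linarith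
  qed
  have "\<bar>tht' \<sigma>\<bar> \<le> ((\<alpha>\<^sup>2 * K * \<alpha>) * (102 / 100)) / ((94 / 100) * \<alpha>\<^sup>2)"
    unfolding tht'_def abs_divide using num den \<alpha> K by (intro frac_le) auto
  also have "\<dots> = ((102 / 100) / (94 / 100)) * (K * \<alpha>)" using \<alpha> by simp
  also have "\<dots> \<le> 2 * K * \<alpha>" using \<alpha> K by simp
  finally show ?thesis .
qed

lemma xi_ends: "xi (top 0) = - 1" "xi (top pi) = 1"
proof -
  have "rr \<alpha> (pt (- a) 0) = rr \<alpha> (pt a 0)" by (simp add: rr_def)
  then show "xi (top 0) = - 1" "xi (top pi) = 1"
    using a_pos by (simp_all add: xi_alt ends y_ends r0_def)
qed

end

text \<open>The upper half again, now in the coordinates level and clock angle. The clock angle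
  moves with speed O(\<alpha>); this is the origin of the small Lipschitz constant of
  \<open>Th\<close>.\<close>

sublocale front \<subseteq> xt: arc "\<lambda>\<sigma>. xi (top \<sigma>)" "\<lambda>\<sigma>. thf \<alpha> (top \<sigma>)" xit' tht' 1 "1 / (2 * K\<^sup>2)" "2 * K\<^sup>2" "2 * K * \<alpha>" s1 s2
proof unfold_locales
  show "0 < 1 / (2 * K\<^sup>2)" "0 < 2 * K\<^sup>2" using K by simp_all
  show "xi (top s1) = xi (top s2)" "thf \<alpha> (top s1) = thf \<alpha> (top s2)"
    by (simp_all add: ends)
qed (rule DERIV_xi_top DERIV_thf_top s1 s2 xit'_bounds tht'_bound xi_ends; assumption)+

lemma prim_le:
  assumes f: "prim a b f g" and F: "prim a b F G" and le: "\<And>t. t \<in> {a..b} \<Longrightarrow> \<bar>g t\<bar> \<le> G t"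
    and st: "a \<le> s" "s \<le> t" "t \<le> b"
  shows "\<bar>f t - f s\<bar> \<le> F t - F s"
proof -
  have "f t - f s \<le> F t - F s"
    by (rule has_integral_le[OF primD[OF f st] primD[OF F st]]) (use le st in \<open>force simp: abs_le_iff\<close>)
  moreover have "- (f t - f s) \<le> F t - F s"
    by (rule has_integral_le[OF has_integral_neg[OF primD[OF f st]] primD[OF F st]]) (use le st in \<open>force simp: abs_le_iff\<close>)
  ultimately show ?thesis by linarith
qed

lemma prim_mono:
  assumes f: "prim a b f g" and nn: "\<And>t. t \<in> {a..b} \<Longrightarrow> 0 \<le> g t" and st: "a \<le> s" "s \<le> t" "t \<le> b"
  shows "f s \<le> f t"
  using has_integral_nonneg[OF primD[OF f st]] nn st by force

section \<open>The time function and its monotonicity in the second coordinate\<close>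

context front
begin

lemma xi_range:
  assumes "z \<in> ell"
  shows "xi z \<in> {-1..1}" "\<bar>z $ 1\<bar> < a \<Longrightarrow> - 1 < xi z \<and> xi z < 1"
proof -
  note b = xi_bounds(1,2)[OF assms]
  have z: "\<bar>z $ 1\<bar> \<le> a" using assms by (simp add: ell_def)
  have "0 \<le> (a + z $ 1) / (2 * a)" "0 \<le> (a - z $ 1) / (2 * a)" using z a_pos by auto
  then show "xi z \<in> {-1..1}" using b by auto
  show "- 1 < xi z \<and> xi z < 1" if "\<bar>z $ 1\<bar> < a"
  proof -
    have "0 < (a + z $ 1) / (2 * a)" "0 < (a - z $ 1) / (2 * a)" using that a_pos by auto
    then show ?thesis using b by auto
  qed
qed

definition Th :: "real \<Rightarrow> real" where "Th = xt.lift"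

lemma Th_top: "\<sigma> \<in> J \<Longrightarrow> Th (xi (top \<sigma>)) = thf \<alpha> (top \<sigma>)"
  unfolding Th_def by (rule xt.lift_f)

text \<open>The general constant of \<open>xt.lift_lipschitz\<close> is \<open>2 * (2 * K *
  \<alpha>) * sqrt (2 * K\<^sup>2) * (2 * K\<^sup>2)\<close>; replacing the square root of 2 by 3/2
  gives 12.\<close>

lemma Th_lipschitz:
  assumes "u \<in> {-1..1}" "v \<in> {-1..1}"
  shows "\<bar>Th u - Th v\<bar> \<le> 12 * (K^4 * \<alpha>) * \<bar>arcsin u - arcsin v\<bar>"
proof -
  have "sqrt (1 * (2 * K\<^sup>2)) \<le> 3 / 2 * K"
    using K by (intro real_le_lsqrt) (auto simp: power2_eq_square)
  then have "2 * (2 * K * \<alpha>) * sqrt (1 * (2 * K\<^sup>2)) / (1 / (2 * K\<^sup>2)) \<le> 2 * (2 * K * \<alpha>) * (3 / 2 * K) / (1 / (2 * K\<^sup>2))"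
    using K \<alpha> by (intro divide_right_mono mult_left_mono) auto
  also have "\<dots> = 12 * (K^4 * \<alpha>)"
    using K by (simp add: eval_nat_numeral)
  finally have "2 * (2 * K * \<alpha>) * sqrt (1 * (2 * K\<^sup>2)) / (1 / (2 * K\<^sup>2)) * \<bar>arcsin u - arcsin v\<bar>
      \<le> 12 * (K^4 * \<alpha>) * \<bar>arcsin u - arcsin v\<bar>"
    by (rule mult_right_mono) simp
  with xt.lift_lipschitz[OF assms] show ?thesis
    unfolding Th_def div_by_1 by (rule order_trans)
qed

definition V :: "real^2 \<Rightarrow> real" where "V z = Th (xi z) - thf \<alpha> z"

lemma V_top: "\<sigma> \<in> J \<Longrightarrow> V (top \<sigma>) = 0"
  by (simp add: V_def Th_top)

lemma ell_segment:
  assumes "pt p t \<in> ell" "pt p t' \<in> ell" "t \<le> s" "s \<le> t'"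
  shows "pt p s \<in> ell"
proof -
  have "s\<^sup>2 \<le> t\<^sup>2 \<or> s\<^sup>2 \<le> t'\<^sup>2"
  proof (cases "0 \<le> s")
    case True then show ?thesis using assms by (auto intro: power_mono)
  next
    case False
    then have "(- s)\<^sup>2 \<le> (- t)\<^sup>2" using assms by (intro power_mono) auto
    then show ?thesis by simp
  qed
  then show ?thesis using assms(1,2) unfolding ell_def by auto
qed

text \<open>The clock angle is close to \<open>\<alpha> * z $ 2\<close>, because \<open>Nf\<close>
  is close to \<alpha>.\<close>

lemma thf_vertical:
  assumes e: "pt p t \<in> ell"
  obtains D where "((\<lambda>s. thf \<alpha> (pt p s)) has_real_derivative D) (at t)" "\<alpha> / 2 \<le> D"
proof -
  note el = ell_bounds[OF e]
  have r: "0 < rr \<alpha> (pt p t)" using el(3) by linarith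
  have N: "0 < Nf \<alpha> (pt p t)" using el(6) \<alpha> by (simp add: less_le_trans[rotated])
  define n where "n = \<alpha>\<^sup>2 * 1 * Nf \<alpha> (pt p t) - \<alpha>\<^sup>2 * t * (- (sin \<alpha> * \<alpha>^4 * (p * 0 + t * 1) / rr \<alpha> (pt p t)) - \<alpha>\<^sup>2 * cos \<alpha> * 0)"
  define d where "d = (Nf \<alpha> (pt p t))\<^sup>2 + (\<alpha>\<^sup>2 * t)\<^sup>2"
  have D: "((\<lambda>s. thf \<alpha> (pt p s)) has_real_derivative n / d) (at t)"
    unfolding n_def d_def by (rule DERIV_thf[OF DERIV_const DERIV_ident r N])
  have n: "\<alpha>\<^sup>2 * (97 / 100 * \<alpha>) \<le> n"
  proof -
    have "n = \<alpha>\<^sup>2 * Nf \<alpha> (pt p t) + \<alpha>\<^sup>2 * (sin \<alpha> * \<alpha>^4) * (t * t) / rr \<alpha> (pt p t)"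
      by (simp add: n_def)
    moreover have "0 \<le> \<alpha>\<^sup>2 * (sin \<alpha> * \<alpha>^4) * (t * t) / rr \<alpha> (pt p t)" using r trig by simp
    moreover have "\<alpha>\<^sup>2 * (97 / 100 * \<alpha>) \<le> \<alpha>\<^sup>2 * Nf \<alpha> (pt p t)" using el(6) by (intro mult_left_mono) auto
    ultimately show ?thesis by linarith
  qed
  have d0: "0 < d" using N by (simp add: d_def add_pos_nonneg)
  have "(Nf \<alpha> (pt p t))\<^sup>2 \<le> (101 / 100 * \<alpha>)\<^sup>2" using el(7) N by (intro power_mono) auto
  then have "d \<le> (101 / 100 * \<alpha>)\<^sup>2 + \<alpha>\<^sup>2 / 1000000" using el(2) by (simp add: d_def)
  also have "\<dots> \<le> 103 / 100 * \<alpha>\<^sup>2" by (simp add: power_mult_distrib power2_eq_square)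
  finally have d: "d \<le> 103 / 100 * \<alpha>\<^sup>2" .
  have "\<alpha> / 2 * d \<le> \<alpha> / 2 * (103 / 100 * \<alpha>\<^sup>2)" using d \<alpha> by (intro mult_left_mono) auto
  also have "\<dots> \<le> \<alpha>\<^sup>2 * (97 / 100 * \<alpha>)" using \<alpha> by simp
  finally have "\<alpha> / 2 \<le> n / d" using n d0 by (simp add: le_divide_eq)
  then show ?thesis using that D by blast
qed

text \<open>The level lines are nearly vertical: only the curvature term varies, with a derivative
  of order \<open>kap * \<bar>t\<bar>\<close>. The arcsine adds the factor
  \<open>1 / sqrt (1 - xi\<^sup>2)\<close>, unbounded near the ends, and the last estimate of
  \<open>xi_bounds\<close> cancels it.\<close>

lemma xi_vertical:
  assumes e: "pt p t \<in> ell" and p: "\<bar>p\<bar> < a"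
  obtains D where "((\<lambda>s. arcsin (xi (pt p s))) has_real_derivative D) (at t)" "\<bar>D\<bar> \<le> 5 * (K^5 * \<alpha>)"
proof -
  note el = ell_bounds[OF e] and xb = xi_bounds[OF e]
  have r: "0 < rr \<alpha> (pt p t)" using el(3) by linarith
  have x: "- 1 < xi (pt p t)" "xi (pt p t) < 1" using xi_range(2)[OF e] p by auto
  define q where "q = sqrt (1 - (xi (pt p t))\<^sup>2)"
  have "(xi (pt p t))\<^sup>2 < 1" using x by (simp add: abs_square_less_1 abs_less_iff)
  then have q: "0 < q" by (simp add: q_def)
  let ?D = "inverse q * (0 / a - kap * (p * 0 + t * 1) / rr \<alpha> (pt p t))"
  have D: "((\<lambda>s. arcsin (xi (pt p s))) has_real_derivative ?D) (at t)"
    unfolding q_def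
    by (rule DERIV_chain2[OF DERIV_arcsin[OF x] DERIV_xi[OF DERIV_const DERIV_ident r]])
  have "\<bar>?D\<bar> = kap * \<bar>t\<bar> / rr \<alpha> (pt p t) / q"
    using q r kap(1) by (simp add: abs_mult field_simps)
  also have "\<dots> \<le> (102 / 100 * K * \<alpha>) * (4 * K^4 * q) / (99 / 100) / q"
    using q r kap xb(4) el(3) K \<alpha> by (intro divide_right_mono frac_le mult_mono) (auto simp: q_def)
  also have "\<dots> = (408 / 99) * (K^5 * \<alpha>)" using q by (simp add: eval_nat_numeral)
  also have "\<dots> \<le> 5 * (K^5 * \<alpha>)" using K \<alpha> by (intro mult_right_mono) auto
  finally show ?thesis using that D by blast
qed

text \<open>The clock contributes at least \<open>\<alpha> / 2\<close> per unit of height. The level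
  moves by O(\<alpha>), from which \<open>Th\<close> makes at most \<open>60 K^9 \<alpha>^2\<close>,
  and this is less than \<open>\<alpha> / 4\<close>.\<close>

lemma V_vertical:
  assumes p: "\<bar>p\<bar> < a" and t: "t \<le> t'" and e: "pt p t \<in> ell" "pt p t' \<in> ell"
  shows "\<alpha> / 4 * (t' - t) \<le> V (pt p t) - V (pt p t')"
proof -
  have seg: "pt p s \<in> ell" if "t \<le> s" "s \<le> t'" for s using ell_segment[OF e] that by simp
  have c1: "continuous_on {t..t'} (\<lambda>s. thf \<alpha> (pt p s))"
  proof (intro continuous_at_imp_continuous_on ballI)
    fix s assume "s \<in> {t..t'}"
    then have s: "t \<le> s" "s \<le> t'" by auto
    obtain D where "((\<lambda>s. thf \<alpha> (pt p s)) has_real_derivative D) (at s)"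
      by (rule thf_vertical[OF seg[OF s]])
    then show "isCont (\<lambda>s. thf \<alpha> (pt p s)) s" by (rule DERIV_isCont)
  qed
  have c2: "continuous_on {t..t'} (\<lambda>s. arcsin (xi (pt p s)))"
  proof (intro continuous_at_imp_continuous_on ballI)
    fix s assume "s \<in> {t..t'}"
    then have s: "t \<le> s" "s \<le> t'" by auto
    obtain D where "((\<lambda>s. arcsin (xi (pt p s))) has_real_derivative D) (at s)"
      by (rule xi_vertical[OF seg[OF s] p])
    then show "isCont (\<lambda>s. arcsin (xi (pt p s))) s" by (rule DERIV_isCont)
  qed
  have 1: "thf \<alpha> (pt p t) - \<alpha> / 2 * t \<le> thf \<alpha> (pt p t') - \<alpha> / 2 * t'"
  proof (rule DERIV_nonneg_imp_increasing_open[OF t])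
    fix s assume s: "t < s" "s < t'"
    obtain D where D: "((\<lambda>s. thf \<alpha> (pt p s)) has_real_derivative D) (at s)" "\<alpha> / 2 \<le> D"
      by (rule thf_vertical[OF seg[OF less_imp_le less_imp_le, OF s]])
    have "((\<lambda>s. thf \<alpha> (pt p s) - \<alpha> / 2 * s) has_real_derivative D - \<alpha> / 2 * 1) (at s)"
      by (rule DERIV_diff[OF D(1) DERIV_cmult[OF DERIV_ident]])
    then show "\<exists>y. ((\<lambda>s. thf \<alpha> (pt p s) - \<alpha> / 2 * s) has_real_derivative y) (at s) \<and> 0 \<le> y"
      using D(2) by (intro exI[of _ "D - \<alpha> / 2 * 1"]) simp
  qed (intro continuous_intros c1)
  let ?c = "5 * (K^5 * \<alpha>)"
  have 2: "?c * t + i * arcsin (xi (pt p t)) \<le> ?c * t' + i * arcsin (xi (pt p t'))" if i: "i = 1 \<or> i = -1" for i :: real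
  proof (rule DERIV_nonneg_imp_increasing_open[OF t])
    fix s assume s: "t < s" "s < t'"
    obtain D where D: "((\<lambda>s. arcsin (xi (pt p s))) has_real_derivative D) (at s)" "\<bar>D\<bar> \<le> ?c"
      by (rule xi_vertical[OF seg[OF less_imp_le less_imp_le, OF s] p])
    have "((\<lambda>s. ?c * s + i * arcsin (xi (pt p s))) has_real_derivative ?c * 1 + i * D) (at s)"
      by (rule DERIV_add[OF DERIV_cmult[OF DERIV_ident] DERIV_cmult[OF D(1)]])
    moreover have "0 \<le> ?c * 1 + i * D" using D(2) i by auto
    ultimately show "\<exists>y. ((\<lambda>s. ?c * s + i * arcsin (xi (pt p s))) has_real_derivative y) (at s) \<and> 0 \<le> y"
      by blast
  qed (intro continuous_intros c2)
  have 3: "\<bar>arcsin (xi (pt p t)) - arcsin (xi (pt p t'))\<bar> \<le> ?c * (t' - t)"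
    using 2[of 1] 2[of "-1"] by (simp add: abs_le_iff algebra_simps)
  have "\<bar>Th (xi (pt p t)) - Th (xi (pt p t'))\<bar> \<le> 12 * (K^4 * \<alpha>) * (?c * (t' - t))"
    by (rule order_trans[OF Th_lipschitz[OF xi_range(1)[OF e(1)] xi_range(1)[OF e(2)]] mult_left_mono[OF 3]])
      (use K \<alpha> in simp)
  also have "\<dots> = (60 * (K^9 * \<alpha>)) * (\<alpha> * (t' - t))" by (simp add: eval_nat_numeral)
  also have "\<dots> \<le> (1 / 4) * (\<alpha> * (t' - t))"
    using small_pow[of 9] t \<alpha> by (intro mult_right_mono) auto
  finally have 4: "\<bar>Th (xi (pt p t)) - Th (xi (pt p t'))\<bar> \<le> 1 / 4 * (\<alpha> * (t' - t))" .
  have "\<alpha> / 2 * t' - \<alpha> / 2 * t = 1 / 2 * (\<alpha> * (t' - t))" "\<alpha> / 4 * (t' - t) = 1 / 4 * (\<alpha> * (t' - t))"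
    by (simp_all add: right_diff_distrib diff_divide_distrib)
  then show ?thesis using 1 4 unfolding V_def by linarith
qed

section \<open>The region enclosed by the two halves of the front\<close>

definition gt :: "real \<Rightarrow> real" where "gt = xy.lift"

lemma gt_x: "\<sigma> \<in> J \<Longrightarrow> gt (x \<sigma>) = y \<sigma>"
  unfolding gt_def by (rule xy.lift_f)

lemma gt_cont: "continuous_on {-a..a} gt"
  unfolding gt_def by (rule xy.continuous_on_lift)

lemma gt_foot:
  assumes "- a \<le> p" "p \<le> a" obtains \<sigma> where "\<sigma> \<in> J" "x \<sigma> = p" "pt p (gt p) = top \<sigma>"
proof -
  obtain \<sigma> where "\<sigma> \<in> J" "x \<sigma> = p" by (rule xy.f_surj[OF assms])
  then show ?thesis using that[of \<sigma>] gt_x[of \<sigma>] by simp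
qed

lemma gt_pos: "- a < p \<Longrightarrow> p < a \<Longrightarrow> 0 < gt p"
proof -
  assume p: "- a < p" "p < a"
  obtain \<sigma> where s: "\<sigma> \<in> J" "x \<sigma> = p" by (rule xy.f_surj[OF less_imp_le less_imp_le, OF p])
  then have "\<sigma> \<noteq> 0" "\<sigma> \<noteq> pi" using p ends by auto
  then have "0 < \<sigma>" "\<sigma> < pi" using s(1) s1 s2 by auto
  then show "0 < gt p" using y_J(2)[OF s(1)] gt_x[OF s(1)] s(2) by simp
qed

lemma gt_ends: "gt a = 0" "gt (-a) = 0"
  using gt_x[of 0] gt_x[of pi] ends y_ends s1 s2 by auto

definition gb :: "real \<Rightarrow> real" where "gb t = - gt (- t)"

lemma gb_cont: "continuous_on {-a..a} gb"
  unfolding gb_def by (intro continuous_intros continuous_on_compose2[OF gt_cont]) auto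

lemma gb_less_gt: "- a < t \<Longrightarrow> t < a \<Longrightarrow> gb t < gt t"
  using gt_pos[of t] gt_pos[of "-t"] by (simp add: gb_def)

definition R :: "(real^2) set" where "R = between a gb gt"

definition S :: "(real^2) set" where "S = graph gb {-a..a} \<union> graph gt {-a..a}"

lemma inside_S: "inside S = R"
  unfolding S_def R_def
  by (rule inside_graphs[OF a_pos gb_cont gt_cont]) (auto simp: gb_def gt_ends gb_less_gt[unfolded gb_def])

lemma frontier_R: "frontier R \<subseteq> S"
  unfolding S_def R_def
  by (rule frontier_between[OF a_pos gb_cont gt_cont]) (auto simp: gb_def gt_ends gb_less_gt[unfolded gb_def])

lemma open_R: "open R"
  unfolding R_def
  by (rule open_between) (auto intro: continuous_on_subset[OF gt_cont] continuous_on_subset[OF gb_cont])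

lemma graph_gt: "graph gt {-a..a} = top ` J"
proof (intro equalityI subsetI)
  fix z assume "z \<in> graph gt {-a..a}"
  then obtain t where t: "-a \<le> t" "t \<le> a" "z = pt t (gt t)" by (auto simp: graph_def)
  obtain \<sigma> where s: "\<sigma> \<in> J" "x \<sigma> = t" "pt t (gt t) = top \<sigma>" by (rule gt_foot[OF t(1,2)])
  show "z \<in> top ` J" unfolding t(3) s(3) by (rule imageI[OF s(1)])
next
  fix z assume "z \<in> top ` J"
  then obtain \<sigma> where "\<sigma> \<in> J" "z = top \<sigma>" by blast
  then show "z \<in> graph gt {-a..a}" using gt_x[of \<sigma>] xy.f_range[of \<sigma>] by (simp add: in_graph)
qed

lemma graph_gb: "graph gb {-a..a} = uminus ` graph gt {-a..a}"
proof (intro equalityI subsetI)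
  fix z assume "z \<in> graph gb {-a..a}"
  then have "- z \<in> graph gt {-a..a}" by (auto simp: in_graph gb_def)
  then show "z \<in> uminus ` graph gt {-a..a}" by (rule image_eqI[rotated]) simp
qed (auto simp: in_graph gb_def)

lemma S_uminus: "z \<in> S \<Longrightarrow> - z \<in> S"
  unfolding S_def graph_gb by auto

lemma R_uminus: "z \<in> R \<Longrightarrow> - z \<in> R"
  by (auto simp: R_def between_def gb_def)

lemma R_ell: "z \<in> R \<Longrightarrow> z \<in> ell" and R_less: "z \<in> R \<Longrightarrow> \<bar>z $ 1\<bar> < a"
proof -
  assume z: "z \<in> R"
  then show "\<bar>z $ 1\<bar> < a" by (auto simp: R_def between_def)
  have p: "- a \<le> z $ 1" "z $ 1 \<le> a" "- a \<le> - z $ 1" "- z $ 1 \<le> a" using z by (auto simp: R_def between_def)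
  have g: "pt t (gt t) \<in> ell" if tt: "- a \<le> t" "t \<le> a" for t
  proof -
    obtain \<sigma> where s: "\<sigma> \<in> J" "x \<sigma> = t" "pt t (gt t) = top \<sigma>" by (rule gt_foot[OF tt])
    show ?thesis unfolding s(3) by (rule top_ell[OF s(1)])
  qed
  note g1 = g[OF p(1,2)]
  have "pt (- z $ 1) (gt (- z $ 1)) \<in> ell" using g[OF p(3,4)] by simp
  then have "pt (z $ 1) (gb (z $ 1)) \<in> ell" by (simp add: ell_def gb_def)
  from ell_segment[OF this g1, of "z $ 2"] z show "z \<in> ell" by (simp add: R_def between_def)
qed

lemma S_ell: "z \<in> S \<Longrightarrow> z \<in> ell"
  unfolding S_def graph_gb graph_gt using top_ell ell_uminus by auto

text \<open>On the upper half \<open>V\<close> vanishes, and it grows on the way down.\<close>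

lemma V_pos: "z \<in> R \<Longrightarrow> 0 < V z"
proof -
  assume z: "z \<in> R"
  have p: "- a \<le> z $ 1" "z $ 1 \<le> a" using z by (auto simp: R_def between_def)
  obtain \<sigma> where s: "\<sigma> \<in> J" "x \<sigma> = z $ 1" "pt (z $ 1) (gt (z $ 1)) = top \<sigma>" by (rule gt_foot[OF p])
  have z2: "z $ 2 < gt (z $ 1)" using z by (simp add: R_def between_def)
  have "\<alpha> / 4 * (gt (z $ 1) - z $ 2) \<le> V (pt (z $ 1) (z $ 2)) - V (pt (z $ 1) (gt (z $ 1)))"
  proof (rule V_vertical[OF R_less[OF z] less_imp_le[OF z2]])
    show "pt (z $ 1) (z $ 2) \<in> ell" using R_ell[OF z] by simp
    show "pt (z $ 1) (gt (z $ 1)) \<in> ell" unfolding s(3) by (rule top_ell[OF s(1)])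
  qed
  moreover have "0 < \<alpha> / 4 * (gt (z $ 1) - z $ 2)" using z2 \<alpha> by simp
  ultimately show "0 < V z" using V_top[OF s(1)] s(3) by simp
qed

lemma Gf_bounds:
  assumes "z \<in> ell" shows "1 / 2 \<le> Gf \<alpha> z" "Gf \<alpha> z \<le> 2"
proof -
  note el = ell_bounds[OF assms]
  define n d where "n = sin \<alpha> * rr \<alpha> z * Nf \<alpha> z + (sin \<alpha>)\<^sup>2 * (\<alpha>\<^sup>2 * z $ 2)\<^sup>2"
    and "d = (Nf \<alpha> z)\<^sup>2 + (\<alpha>\<^sup>2 * z $ 2)\<^sup>2"
  have N0: "0 \<le> Nf \<alpha> z" using el(6) \<alpha> by (meson less_imp_le mult_pos_pos order_trans zero_less_divide_iff zero_less_numeral)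
  have "(99 / 100 * \<alpha>) * (99 / 100) * (97 / 100 * \<alpha>) \<le> sin \<alpha> * rr \<alpha> z * Nf \<alpha> z"
    using trig el(3,6) \<alpha> by (intro mult_mono) auto
  moreover have "0 \<le> (sin \<alpha>)\<^sup>2 * (\<alpha>\<^sup>2 * z $ 2)\<^sup>2" by simp
  ultimately have n1: "(99 / 100 * \<alpha>) * (99 / 100) * (97 / 100 * \<alpha>) \<le> n" unfolding n_def by linarith
  have "(sin \<alpha>)\<^sup>2 * (\<alpha>\<^sup>2 * z $ 2)\<^sup>2 \<le> 1 * (\<alpha>\<^sup>2 / 1000000)"
    using el(2) by (intro mult_mono) (auto simp: abs_square_le_1)
  moreover have "sin \<alpha> * rr \<alpha> z * Nf \<alpha> z \<le> \<alpha> * 1 * (101 / 100 * \<alpha>)"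
    using trig el(3,4,7) N0 \<alpha> by (intro mult_mono) auto
  ultimately have n2: "n \<le> \<alpha> * 1 * (101 / 100 * \<alpha>) + \<alpha>\<^sup>2 / 1000000" by (simp add: n_def)
  have "(Nf \<alpha> z)\<^sup>2 \<le> (101 / 100 * \<alpha>)\<^sup>2" "(97 / 100 * \<alpha>)\<^sup>2 \<le> (Nf \<alpha> z)\<^sup>2"
    using el(6,7) N0 \<alpha> by (intro power_mono; simp)+
  then have d: "(97 / 100 * \<alpha>)\<^sup>2 \<le> d" "d \<le> (101 / 100 * \<alpha>)\<^sup>2 + \<alpha>\<^sup>2 / 1000000"
    using el(2) zero_le_power2[of "\<alpha>\<^sup>2 * z $ 2"] unfolding d_def by linarith+
  have "0 < (97 / 100 * \<alpha>)\<^sup>2" using \<alpha> by simp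
  then have d0: "0 < d" using d(1) by linarith
  have G: "Gf \<alpha> z = n / d" by (simp add: Gf_def n_def d_def)
  have q: "0 < \<alpha> * \<alpha>" using \<alpha> by simp
  have "1 / 2 * d \<le> n" using n1 d(2) q unfolding power_mult_distrib power2_eq_square by (simp add: mult_ac)
  then show "1 / 2 \<le> Gf \<alpha> z" unfolding G using d0 by (simp add: le_divide_eq)
  have "n \<le> 2 * d" using n2 d(1) q unfolding power_mult_distrib power2_eq_square by (simp add: mult_ac)
  then show "Gf \<alpha> z \<le> 2" unfolding G using d0 by (simp add: divide_le_eq)
qed

end

section \<open>Minimal times\<close>

context front
begin

lemma rotated_squares:
  fixes c s p r :: real
  shows "(s * p + c * r)\<^sup>2 + (s * r - c * p)\<^sup>2 = (s\<^sup>2 + c\<^sup>2) * (r\<^sup>2 + p\<^sup>2)"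
  by (simp add: power2_eq_square algebra_simps)

text \<open>The increase of \<open>w\<close> measures how much the control deviates from
  \<open>-1\<close>. The loss of the clock and the drift of the level are both compared with
  it.\<close>

lemma prim_control:
  assumes "trajectory \<alpha> T z u"
  obtains w where "prim 0 T w (\<lambda>t. 1 + u t)"
proof
  have u: "bmeas 0 T u" using assms by (auto simp: trajectory_def bmeas_def)
  show "prim 0 T (\<lambda>t. t + integral {0..t} u) (\<lambda>t. 1 + u t)"
    unfolding prim_def
  proof (intro conjI allI impI)
    show "bmeas 0 T (\<lambda>t. 1 + u t)" by (rule bmeas_add[OF bmeas_const u])
    fix s t assume st: "0 \<le> s \<and> s \<le> t \<and> t \<le> T"
    have c: "integral {0..s} u + integral {s..t} u = integral {0..t} u"
      using st by (intro Henstock_Kurzweil_Integration.integral_combine bmeas_integrable[OF u]) auto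
    have "((\<lambda>t. 1 + u t) has_integral (t - s) + integral {s..t} u) {s..t}"
      using st by (intro has_integral_add primD[OF prim_ident[of 0 T]] integrable_integral bmeas_integrable[OF u]) auto
    also have "(t - s) + integral {s..t} u = t + integral {0..t} u - (s + integral {0..s} u)"
      using c by linarith
    finally show "((\<lambda>t. 1 + u t) has_integral (t + integral {0..t} u - (s + integral {0..s} u))) {s..t}" .
  qed
qed

context
  fixes T t0 :: real and z u w
  assumes tr: "trajectory \<alpha> T z u" and t0: "0 \<le> t0" "t0 \<le> T"
    and el: "\<And>t. t \<in> {t0..T} \<Longrightarrow> z t \<in> ell"
    and w: "prim 0 T w (\<lambda>t. 1 + u t)"
begin

lemma u_range: "t \<in> {t0..T} \<Longrightarrow> 0 \<le> 1 + u t"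
proof -
  assume "t \<in> {t0..T}"
  then have "t \<in> {0..T}" using t0 by auto
  then have "\<bar>u t\<bar> \<le> 1" using tr unfolding trajectory_def by blast
  then show "0 \<le> 1 + u t" by linarith
qed

lemma w_mono: "t0 \<le> s \<Longrightarrow> s \<le> t \<Longrightarrow> t \<le> T \<Longrightarrow> w s \<le> w t"
  by (rule prim_mono[OF prim_subinterval[OF w t0(1) order_refl]]) (use u_range in auto)

lemma prim_thf: "prim t0 T (\<lambda>t. thf \<alpha> (z t)) (\<lambda>t. (1 + u t) * Gf \<alpha> (z t) - 1)"
proof (rule trajectory_thf[OF tr _ t0(1)])
  show "\<alpha> \<noteq> 0" using \<alpha> by simp
  fix t assume "t \<in> {t0..T}"
  from ell_bounds(6)[OF el[OF this]] show "0 < Nf \<alpha> (z t)"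
    using \<alpha> by (simp add: less_le_trans[rotated])
qed

lemma prim_clock: "prim t0 T (\<lambda>t. thf \<alpha> (z t) + t) (\<lambda>t. (1 + u t) * Gf \<alpha> (z t))"
  using prim_add[OF prim_thf prim_ident] by simp

text \<open>By \<open>Gf \<ge> 1/2\<close>, a deviation from \<open>u = -1\<close> costs at least
  half of its amount in time.\<close>

lemma clock_bound: "thf \<alpha> (z t0) - thf \<alpha> (z T) + (w T - w t0) / 2 \<le> T - t0"
proof -
  have "\<bar>(1/2) * w T - (1/2) * w t0\<bar> \<le> (thf \<alpha> (z T) + T) - (thf \<alpha> (z t0) + t0)"
  proof (rule prim_le[OF prim_cmult[OF prim_subinterval[OF w t0(1) order_refl], of "1/2"] prim_clock])
    fix t assume t: "t \<in> {t0..T}"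
    have "(1 + u t) * (1 / 2) \<le> (1 + u t) * Gf \<alpha> (z t)"
      using u_range[OF t] Gf_bounds(1)[OF el[OF t]] by (intro mult_left_mono) auto
    then show "\<bar>1 / 2 * (1 + u t)\<bar> \<le> (1 + u t) * Gf \<alpha> (z t)"
      using u_range[OF t] by simp
  qed (use t0 in auto)
  from order_trans[OF abs_ge_self this] show ?thesis by (simp add: field_simps)
qed

lemma prim_xi: "prim t0 T (\<lambda>t. xi (z t)) (\<lambda>t. - (1 + u t) * (cos \<alpha> * z t $ 2 / a))"
proof -
  let ?c = "1 / (\<alpha>\<^sup>2 * sin \<alpha> * a)"
  have "prim t0 T (\<lambda>t. ?c * (Hf \<alpha> (z t) + (- (cos \<alpha> * r0)))) (\<lambda>t. ?c * (- (1 + u t) * (\<alpha>\<^sup>2 * sin \<alpha> * cos \<alpha> * z t $ 2) + 0))"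
    using \<alpha> by (intro prim_cmult prim_add prim_const prim_subinterval[OF trajectory_Hf[OF tr] t0(1) order_refl]) simp
  then show ?thesis
    by (rule prim_cong) (use \<alpha> trig a_pos in \<open>simp_all add: xi_def\<close>)
qed

text \<open>The start may be an end of the front, where the arcsine of the level is not
  differentiable. So the estimate is derived on \<open>{s..T}\<close> for \<open>s > t0\<close> and
  transferred to \<open>t0\<close> by continuity. It stays uniform because
  \<open>\<bar>z $ 2\<bar>\<close> compensates the pole of the derivative of the arcsine.\<close>

lemma level_bound:
  assumes int: "\<And>t. t0 < t \<Longrightarrow> t \<le> T \<Longrightarrow> \<bar>z t $ 1\<bar> < a"
  shows "\<bar>arcsin (xi (z t0)) - arcsin (xi (z T))\<bar> \<le> 4 * K^5 * (w T - w t0)"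
proof (cases "t0 = T")
  case False
  then have t0T: "t0 < T" using t0 by simp
  have ineq: "\<bar>arcsin (xi (z T)) - arcsin (xi (z s))\<bar> \<le> 4 * K^5 * w T - 4 * K^5 * w s" if s: "s \<in> {t0<..T}" for s
  proof -
    have sT: "t0 \<le> s" "s \<le> T" using s by auto
    have xr: "- 1 < xi (z t) \<and> xi (z t) < 1" if t: "t \<in> {s..T}" for t
    proof -
      have "t0 < t" "t \<le> T" using t s by auto
      then show ?thesis using xi_range(2)[OF el[of t] int[of t]] by simp
    qed
    have sq: "0 < 1 - (xi (z t))\<^sup>2" if t: "t \<in> {s..T}" for t
      using xr[OF t] by (simp add: abs_square_less_1 abs_less_iff)
    have "prim s T (\<lambda>t. arcsin (xi (z t))) (\<lambda>t. inverse (sqrt (1 - (xi (z t))\<^sup>2)) * (- (1 + u t) * (cos \<alpha> * z t $ 2 / a)))"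
    proof (rule prim_compose[OF prim_subinterval[OF prim_xi sT(1) order_refl], where \<phi>=arcsin and \<phi>'="\<lambda>v. inverse (sqrt (1 - v\<^sup>2))"])
      show "(arcsin has_real_derivative inverse (sqrt (1 - (xi (z t))\<^sup>2))) (at (xi (z t)))" if "t \<in> {s..T}" for t
        using xr[OF that] by (intro DERIV_arcsin) auto
      show "continuous_on ((\<lambda>t. xi (z t)) ` {s..T}) (\<lambda>v. inverse (sqrt (1 - v\<^sup>2)))"
      proof (intro continuous_intros ballI)
        fix v assume "v \<in> (\<lambda>t. xi (z t)) ` {s..T}"
        then show "sqrt (1 - v\<^sup>2) \<noteq> 0" using sq by force
      qed
    qed
    moreover have "prim s T (\<lambda>t. 4 * K^5 * w t) (\<lambda>t. 4 * K^5 * (1 + u t))"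
      by (intro prim_cmult prim_subinterval[OF w]) (use t0 sT in auto)
    ultimately show ?thesis
    proof (rule prim_le)
      fix t assume t: "t \<in> {s..T}"
      then have t': "t \<in> {t0..T}" using sT by auto
      have q: "0 < sqrt (1 - (xi (z t))\<^sup>2)" using sq[OF t] by simp
      have "\<bar>inverse (sqrt (1 - (xi (z t))\<^sup>2)) * (- (1 + u t) * (cos \<alpha> * z t $ 2 / a))\<bar>
         = (1 + u t) * (cos \<alpha> * (\<bar>z t $ 2\<bar> / sqrt (1 - (xi (z t))\<^sup>2)) * (1 / a))"
      proof -
        have *: "\<bar>inverse r * (- e * (c * y / a))\<bar> = e * (c * (\<bar>y\<bar> / r) * (1 / a))" if "0 \<le> e" "0 < r" "0 < c" for e r c y
          using that a_pos by (simp add: abs_mult field_simps)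
        show ?thesis by (rule *[OF u_range[OF t'] q]) (use trig in simp)
      qed
      also have "\<dots> \<le> (1 + u t) * (1 * (4 * K^4) * K)"
        using xi_bounds(4)[OF el[OF t']] q trig inv_a a_pos K u_range[OF t']
        by (intro mult_left_mono mult_mono) (auto simp: pos_divide_le_eq)
      also have "\<dots> = 4 * K^5 * (1 + u t)" by (simp add: eval_nat_numeral)
      finally show "\<bar>inverse (sqrt (1 - (xi (z t))\<^sup>2)) * (- (1 + u t) * (cos \<alpha> * z t $ 2 / a))\<bar> \<le> 4 * K^5 * (1 + u t)" .
    qed (use sT in auto)
  qed
  have ca: "continuous_on {t0..T} (\<lambda>s. arcsin (xi (z s)))"
    using xi_range(1)[OF el] by (intro continuous_on_arcsin prim_continuous[OF prim_xi]) auto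
  have cw: "continuous_on {t0..T} w"
    by (rule prim_continuous[OF prim_subinterval[OF w t0(1) order_refl]])
  let ?F = "\<lambda>s. 4 * K^5 * w T - 4 * K^5 * w s - \<bar>arcsin (xi (z T)) - arcsin (xi (z s))\<bar>"
  have "continuous_on {t0..T} ?F" by (intro continuous_intros ca cw)
  then have "continuous_on (closure {t0<..T}) ?F" using t0T by simp
  moreover have "t0 \<in> closure {t0<..T}" using t0T by simp
  ultimately have "0 \<le> ?F t0"
    by (rule continuous_ge_on_closure) (use ineq in force)
  then show ?thesis by (simp add: algebra_simps abs_minus_commute)
qed simp

text \<open>The clock loses at least half of the increase of \<open>w\<close>. Drifting to another
  level changes the angle of the starting point by at most \<open>48 K^9 \<alpha>\<close> times this
  increase, hence regains less than a quarter of it.\<close>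

lemma time_bound:
  assumes int: "\<And>t. t0 < t \<Longrightarrow> t \<le> T \<Longrightarrow> \<bar>z t $ 1\<bar> < a" and \<sigma>: "\<sigma> \<in> J" "z t0 = top \<sigma>"
  shows "V (z T) + (w T - w t0) / 4 \<le> T - t0"
proof -
  have w0: "0 \<le> w T - w t0" using w_mono[of t0 T] t0 by simp
  have xr: "xi (z t0) \<in> {-1..1}" "xi (z T) \<in> {-1..1}" using xi_range(1)[OF el] t0 by auto
  have "\<bar>Th (xi (z t0)) - Th (xi (z T))\<bar> \<le> 12 * (K^4 * \<alpha>) * (4 * K^5 * (w T - w t0))"
    by (rule order_trans[OF Th_lipschitz[OF xr] mult_left_mono[OF level_bound[OF int]]]) (use K \<alpha> in auto)
  also have "\<dots> = (48 * (K^9 * \<alpha>)) * (w T - w t0)" by (simp add: eval_nat_numeral)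
  also have "\<dots> \<le> (1 / 4) * (w T - w t0)"
    using small_pow[of 9] w0 by (intro mult_right_mono) auto
  finally have "\<bar>Th (xi (z t0)) - Th (xi (z T))\<bar> \<le> 1 / 4 * (w T - w t0)" .
  moreover have "Th (xi (z t0)) = thf \<alpha> (z t0)" using Th_top[OF \<sigma>(1)] \<sigma>(2) by simp
  ultimately show ?thesis using clock_bound unfolding V_def by linarith
qed

text \<open>The densities of \<open>Hf\<close> and of \<open>thf + t\<close> are bounded by
  multiples of \<open>1 + u\<close>, so that their variation is controlled by that of
  \<open>w\<close>.\<close>

lemma bang_invariants:
  assumes W: "w T = w t0" and t: "t \<in> {t0..T}"
  shows "Hf \<alpha> (z t) = Hf \<alpha> (z T)" "thf \<alpha> (z t) = thf \<alpha> (z T) + (T - t)"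
proof -
  have wt: "w t = w T" using W w_mono[of t0 t] w_mono[of t T] t by auto
  have "\<bar>Hf \<alpha> (z T) - Hf \<alpha> (z t)\<bar> \<le> 2 * K^4 * w T - 2 * K^4 * w t"
  proof (rule prim_le)
    show "prim t0 T (\<lambda>t. Hf \<alpha> (z t)) (\<lambda>t. - (1 + u t) * (\<alpha>\<^sup>2 * sin \<alpha> * cos \<alpha> * z t $ 2))"
      using \<alpha> by (intro prim_subinterval[OF trajectory_Hf[OF tr] t0(1) order_refl]) simp
    show "prim t0 T (\<lambda>t. 2 * K^4 * w t) (\<lambda>t. 2 * K^4 * (1 + u t))"
      by (intro prim_cmult prim_subinterval[OF w t0(1) order_refl])
    fix t assume t: "t \<in> {t0..T}"
    have a2: "\<alpha>\<^sup>2 \<le> 1" using alpha_small \<alpha> by (intro power_le_one) auto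
    have "\<bar>- (1 + u t) * (\<alpha>\<^sup>2 * sin \<alpha> * cos \<alpha> * z t $ 2)\<bar> = (1 + u t) * (\<alpha>\<^sup>2 * sin \<alpha> * cos \<alpha> * \<bar>z t $ 2\<bar>)"
      using u_range[OF t] trig by (simp add: abs_mult)
    also have "\<dots> \<le> (1 + u t) * (1 * 1 * 1 * (2 * K^4))"
      using u_range[OF t] trig a2 ell_bounds(8)[OF el[OF t]] K by (intro mult_left_mono mult_mono) auto
    finally show "\<bar>- (1 + u t) * (\<alpha>\<^sup>2 * sin \<alpha> * cos \<alpha> * z t $ 2)\<bar> \<le> 2 * K^4 * (1 + u t)" by (simp add: mult.commute)
  qed (use t in auto)
  then show "Hf \<alpha> (z t) = Hf \<alpha> (z T)" using wt by simp
  have "\<bar>(thf \<alpha> (z T) + T) - (thf \<alpha> (z t) + t)\<bar> \<le> 2 * w T - 2 * w t"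
  proof (rule prim_le[OF prim_clock prim_cmult[OF prim_subinterval[OF w t0(1) order_refl], of 2]])
    fix t assume t: "t \<in> {t0..T}"
    have "(1 + u t) * Gf \<alpha> (z t) \<le> (1 + u t) * 2"
      by (rule mult_left_mono[OF Gf_bounds(2)[OF el[OF t]] u_range[OF t]])
    moreover have "0 \<le> (1 + u t) * Gf \<alpha> (z t)"
      using u_range[OF t] Gf_bounds(1)[OF el[OF t]] by (intro mult_nonneg_nonneg) auto
    ultimately
    show "\<bar>(1 + u t) * Gf \<alpha> (z t)\<bar> \<le> 2 * (1 + u t)" by linarith
  qed (use t in auto)
  then show "thf \<alpha> (z t) = thf \<alpha> (z T) + (T - t)" using wt by simp
qed

end

text \<open>Chart coordinates of the point with height \<open>H\<close> and polar angle \<theta>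
  with respect to the axis of the rotation for \<open>u = -1\<close>.\<close>

definition Zc :: "real \<Rightarrow> real \<Rightarrow> real^2" where
  "Zc H \<theta> = pt ((H * sin \<alpha> - sqrt (1 - H\<^sup>2) * cos \<theta> * cos \<alpha>) / \<alpha>\<^sup>2) (sqrt (1 - H\<^sup>2) * sin \<theta> / \<alpha>\<^sup>2)"

lemma Zc_inverse:
  assumes "z \<in> ell"
  shows "Zc (Hf \<alpha> z) (thf \<alpha> z) = z" "0 < Hf \<alpha> z" "(Hf \<alpha> z)\<^sup>2 < 1"
proof -
  note e = ell_bounds[OF assms]
  define N Y r p where "N = Nf \<alpha> z" and "Y = \<alpha>\<^sup>2 * z $ 2" and "r = rr \<alpha> z" and "p = \<alpha>\<^sup>2 * z $ 1"
  have N: "0 < N" using e(6) \<alpha> by (simp add: N_def less_le_trans[rotated])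
  have HN: "Hf \<alpha> z = sin \<alpha> * p + cos \<alpha> * r" "N = sin \<alpha> * r - cos \<alpha> * p"
    by (simp_all add: Hf_def N_def Nf_def p_def r_def)
  have sc: "(sin \<alpha>)\<^sup>2 + (cos \<alpha>)\<^sup>2 = 1" by simp
  have "r\<^sup>2 + p\<^sup>2 + Y\<^sup>2 = 1"
    using rr_sq[OF e(5)] by (simp add: r_def p_def Y_def power_mult_distrib distrib_left flip: power_mult)
  moreover have "1 - A = B + D" if "E + D = 1" "A + B = 1 * E" for A B D E :: real
    using that by simp
  ultimately have sq: "1 - (Hf \<alpha> z)\<^sup>2 = N\<^sup>2 + Y\<^sup>2"
    using rotated_squares[of "sin \<alpha>" p "cos \<alpha>" r] unfolding HN sc by metis
  have pos: "0 < N\<^sup>2 + Y\<^sup>2" using N by (simp add: add_pos_nonneg)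
  then show "(Hf \<alpha> z)\<^sup>2 < 1" using sq by linarith
  have c: "\<bar>sin \<alpha> * p\<bar> \<le> 1 * (\<alpha> / 1000000)"
    unfolding abs_mult using e(1) \<alpha> by (intro mult_mono) (auto simp: p_def abs_mult)
  have "99 / 100 * (99 / 100) \<le> cos \<alpha> * r" using trig e(3) by (intro mult_mono) (auto simp: r_def)
  then show "0 < Hf \<alpha> z" unfolding HN using c alpha_small \<alpha> by (simp add: abs_le_iff)
  define s where "s = sqrt (N\<^sup>2 + Y\<^sup>2)"
  have s: "0 < s" using pos by (simp add: s_def)
  have "1 + (Y / N)\<^sup>2 = (N\<^sup>2 + Y\<^sup>2) / N\<^sup>2" using N by (simp add: power_divide add_divide_distrib)
  then have "sqrt (1 + (Y / N)\<^sup>2) = s / N" using N by (simp add: s_def real_sqrt_divide)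
  then have cs: "cos (arctan (Y / N)) = N / s" "sin (arctan (Y / N)) = Y / s"
    using N s by (simp_all add: cos_arctan sin_arctan)
  have th: "thf \<alpha> z = arctan (Y / N)" by (simp add: thf_def Y_def N_def)
  have "(S * p + C * r) * S - s * ((S * r - C * p) / s) * C = (S\<^sup>2 + C\<^sup>2) * p" for S C
  proof -
    have "s * (D / s) = D" for D using s by simp
    show ?thesis unfolding \<open>\<And>D. s * (D / s) = D\<close> by (simp add: power2_eq_square algebra_simps)
  qed
  from this[of "sin \<alpha>" "cos \<alpha>", folded HN] have "Hf \<alpha> z * sin \<alpha> - s * (N / s) * cos \<alpha> = p" unfolding sc by simp
  then show "Zc (Hf \<alpha> z) (thf \<alpha> z) = z"
    unfolding Zc_def th cs sq s_def[symmetric] using s \<alpha> by (simp add: p_def Y_def vec_eq_iff forall_2)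
qed

lemma Zc_rr:
  assumes H: "0 < H" "H\<^sup>2 < 1" and c: "0 < cos \<theta>"
  shows "rr \<alpha> (Zc H \<theta>) = H * cos \<alpha> + sqrt (1 - H\<^sup>2) * cos \<theta> * sin \<alpha>" "\<alpha>\<^sup>2 * norm (Zc H \<theta>) < 1"
proof -
  define s where "s = sqrt (1 - H\<^sup>2)"
  have s2: "s\<^sup>2 = 1 - H\<^sup>2" and s: "0 < s" using H by (simp_all add: s_def)
  define P Q where "P = H * sin \<alpha> - s * cos \<theta> * cos \<alpha>" and "Q = s * sin \<theta>"
  define M where "M = H * cos \<alpha> + s * cos \<theta> * sin \<alpha>"
  have Z: "Zc H \<theta> = pt (P / \<alpha>\<^sup>2) (Q / \<alpha>\<^sup>2)" by (simp add: Zc_def P_def Q_def s_def)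
  have M: "0 < M" unfolding M_def using H c s trig by (intro add_pos_pos mult_pos_pos) auto
  have t: "(sin \<alpha>)\<^sup>2 = 1 - (cos \<alpha>)\<^sup>2" "(sin \<theta>)\<^sup>2 = 1 - (cos \<theta>)\<^sup>2" by (rule sin_squared_eq)+
  have PM: "P\<^sup>2 + M\<^sup>2 = H\<^sup>2 + (s * cos \<theta>)\<^sup>2"
    using rotated_squares[of "sin \<alpha>" "s * cos \<theta>" "cos \<alpha>" H] by (simp add: P_def M_def mult_ac add_ac)
  have "(s * cos \<theta>)\<^sup>2 + Q\<^sup>2 = s\<^sup>2 * ((cos \<theta>)\<^sup>2 + (sin \<theta>)\<^sup>2)"
    unfolding Q_def power_mult_distrib distrib_left ..
  then have PQ: "P\<^sup>2 + Q\<^sup>2 = 1 - M\<^sup>2" using PM s2 by simp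
  have a4: "\<alpha>^4 * ((P / \<alpha>\<^sup>2)\<^sup>2 + (Q / \<alpha>\<^sup>2)\<^sup>2) = P\<^sup>2 + Q\<^sup>2"
    using \<alpha> by (simp add: power_divide distrib_left flip: power_mult)
  show "rr \<alpha> (Zc H \<theta>) = H * cos \<alpha> + sqrt (1 - H\<^sup>2) * cos \<theta> * sin \<alpha>"
    unfolding rr_def Z vector_2 a4 PQ s_def[symmetric] M_def[symmetric] using M by simp
  have "(\<alpha>\<^sup>2 * norm (Zc H \<theta>))\<^sup>2 = \<alpha>^4 * ((P / \<alpha>\<^sup>2)\<^sup>2 + (Q / \<alpha>\<^sup>2)\<^sup>2)"
    by (simp add: Z power_mult_distrib norm_sq2 flip: power_mult)
  also have "\<dots> < 1\<^sup>2" unfolding a4 PQ using M by simp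
  finally show "\<alpha>\<^sup>2 * norm (Zc H \<theta>) < 1" by (rule power2_less_imp_less) simp
qed

lemma has_vector_derivative_pt:
  assumes "(f has_real_derivative f') (at t within A)" "(g has_real_derivative g') (at t within A)"
  shows "((\<lambda>t. pt (f t) (g t)) has_vector_derivative pt f' g') (at t within A)"
proof -
  have e: "pt p q = p *\<^sub>R axis 1 1 + q *\<^sub>R axis 2 1" for p q
    by (simp add: vec_eq_iff forall_2 axis_def)
  have "((\<lambda>t. f t *\<^sub>R axis 1 1 + g t *\<^sub>R axis 2 1) has_vector_derivative f' *\<^sub>R axis 1 1 + g' *\<^sub>R axis 2 (1::real)) (at t within A)"
    using assms unfolding has_real_derivative_iff_has_vector_derivative
    by (intro has_vector_derivative_add bounded_linear.has_vector_derivative[OF bounded_linear_scaleR_left])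
  then show ?thesis unfolding e .
qed

text \<open>Rotation with unit speed at a fixed height. The positive cosine keeps the point in the
  open southern hemisphere, as \<open>trajectory\<close> demands.\<close>

lemma Zc_trajectory:
  assumes H: "0 < H" "H\<^sup>2 < 1" and T: "0 \<le> T" and c: "\<And>t. t \<in> {0..T} \<Longrightarrow> 0 < cos (\<theta> - t)"
  shows "trajectory \<alpha> T (\<lambda>t\<in>{0..T}. Zc H (\<theta> - t)) (\<lambda>_. - 1)"
  unfolding trajectory_def
proof (intro conjI T ballI)
  define s where "s = sqrt (1 - H\<^sup>2)"
  define z where "z t = Zc H (\<theta> - t)" for t
  have d: "(z has_vector_derivative field_Lambda \<alpha> (- 1) (z t)) (at t within A)" if t: "t \<in> {0..T}" for t A
  proof -
    have i: "((\<lambda>t. \<theta> - t) has_real_derivative - 1) (at t within A)"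
      using DERIV_diff[OF DERIV_const DERIV_ident, of \<theta> t A] by simp
    have c: "((\<lambda>t. cos (\<theta> - t)) has_real_derivative - sin (\<theta> - t) * - 1) (at t within A)"
      and s: "((\<lambda>t. sin (\<theta> - t)) has_real_derivative cos (\<theta> - t) * - 1) (at t within A)"
      by (rule DERIV_chain2[OF DERIV_cos i] DERIV_chain2[OF DERIV_sin i])+
    note d = has_vector_derivative_pt[OF
        DERIV_cdivide[OF DERIV_diff[OF DERIV_const[of "H * sin \<alpha>"] DERIV_cmult_right[OF DERIV_cmult[OF c, of s], of "cos \<alpha>"]], of "\<alpha>\<^sup>2"]
        DERIV_cdivide[OF DERIV_cmult[OF s, of s], of "\<alpha>\<^sup>2"]]
    have zt: "z t $ 1 = (H * sin \<alpha> - s * cos (\<theta> - t) * cos \<alpha>) / \<alpha>\<^sup>2" "z t $ 2 = s * sin (\<theta> - t) / \<alpha>\<^sup>2"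
      by (simp_all add: z_def Zc_def s_def)
    have "field_Lambda \<alpha> (- 1) (z t) = pt ((0 - s * (- sin (\<theta> - t) * - 1) * cos \<alpha>) / \<alpha>\<^sup>2) (s * (cos (\<theta> - t) * - 1) / \<alpha>\<^sup>2)"
    proof -
      have "C * (H * S - s * c * C) - S * (H * C + s * c * S) = - (s * c) * (S\<^sup>2 + C\<^sup>2)" for S C c
        by (simp add: power2_eq_square algebra_simps)
      from this[of "cos \<alpha>" "sin \<alpha>"] have "cos \<alpha> * (H * sin \<alpha> - s * cos (\<theta> - t) * cos \<alpha>) - sin \<alpha> * (H * cos \<alpha> + s * cos (\<theta> - t) * sin \<alpha>)
         = - (s * cos (\<theta> - t))" by simp
      then have "(cos \<alpha> * (H * sin \<alpha> - s * cos (\<theta> - t) * cos \<alpha>) - sin \<alpha> * (H * cos \<alpha> + s * cos (\<theta> - t) * sin \<alpha>)) / \<alpha>\<^sup>2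
         = - (s * cos (\<theta> - t)) / \<alpha>\<^sup>2" by simp
      moreover have "rr \<alpha> (z t) = H * cos \<alpha> + s * cos (\<theta> - t) * sin \<alpha>"
        unfolding z_def s_def by (rule Zc_rr(1)[OF H assms(4)[OF t]])
      ultimately show ?thesis
        unfolding field_Lambda_eq zt times_divide_eq_right minus_mult_left[symmetric] by (simp add: diff_divide_distrib mult_ac right_diff_distrib)
    qed
    with d show ?thesis unfolding z_def Zc_def s_def[symmetric] by simp
  qed
  show "(\<lambda>_. - 1 :: real) \<in> borel_measurable (lebesgue_on {0..T})" by simp
  fix t assume t: "t \<in> {0..T}"
  show "\<bar>- 1\<bar> \<le> (1 :: real)" by simp
  show "\<alpha>\<^sup>2 * norm ((\<lambda>t\<in>{0..T}. Zc H (\<theta> - t)) t) < 1"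
    using t Zc_rr(2)[OF H c[OF t]] by simp
  have "((\<lambda>\<tau>. field_Lambda \<alpha> (- 1) (z \<tau>)) has_integral (z t - z 0)) {0..t}"
    by (rule fundamental_theorem_of_calculus) (use t d in auto)
  then have "((\<lambda>\<tau>. field_Lambda \<alpha> (- 1) ((\<lambda>t\<in>{0..T}. Zc H (\<theta> - t)) \<tau>)) has_integral (z t - z 0)) {0..t}"
    by (rule has_integral_eq[rotated]) (use t in \<open>auto simp: z_def\<close>)
  then show "((\<lambda>\<tau>. field_Lambda \<alpha> (- 1) ((\<lambda>t\<in>{0..T}. Zc H (\<theta> - t)) \<tau>)) has_integral
      ((\<lambda>t\<in>{0..T}. Zc H (\<theta> - t)) t - (\<lambda>t\<in>{0..T}. Zc H (\<theta> - t)) 0)) {0..t}"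
    using t by (simp add: z_def)
qed simp


lemma compact_S: "compact S"
  unfolding S_def graph_def
  by (intro compact_Un compact_continuous_image continuous_intros gt_cont gb_cont) auto

text \<open>A trajectory may leave the region and return; \<open>t0\<close> is its last time on the
  front. Being outside \<open>R\<close> after \<open>t0\<close> would force another crossing of the
  frontier, which lies in \<open>S\<close>.\<close>

lemma last_hit:
  assumes tr: "trajectory \<alpha> T z u" and z0: "z 0 \<in> S" and zT: "z T \<in> R"
  obtains t0 where "0 \<le> t0" "t0 < T" "z t0 \<in> S" "\<And>t. t0 < t \<Longrightarrow> t \<le> T \<Longrightarrow> z t \<in> R"
proof -
  have T: "0 \<le> T" using tr by (simp add: trajectory_def)
  note zc = trajectory_continuous[OF tr]
  define A where "A = {0..T} \<inter> z -` S"
  have "closed A"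
    unfolding A_def by (rule continuous_closed_preimage[OF zc closed_atLeastAtMost compact_imp_closed[OF compact_S]])
  then have "compact ({0..T} \<inter> A)" by (rule compact_Int_closed[OF compact_Icc])
  moreover have "{0..T} \<inter> A = A" by (auto simp: A_def)
  ultimately have "compact A" by simp
  moreover have "A \<noteq> {}" using z0 T by (auto simp: A_def)
  ultimately obtain t0 where t0: "t0 \<in> A" "\<And>t. t \<in> A \<Longrightarrow> t \<le> t0" using compact_attains_sup by metis
  have RS: "R \<inter> S = {}" unfolding inside_S[symmetric] by (rule inside_no_overlap)
  have 1: "z t \<in> R" if t: "t0 < t" "t \<le> T" for t
  proof (rule ccontr)
    assume "z t \<notin> R"
    have "0 \<le> t0" using t0(1) by (simp add: A_def)
    have "connected (z ` {t..T})"
      using t \<open>0 \<le> t0\<close> by (intro connected_continuous_image continuous_on_subset[OF zc]) auto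
    moreover have "z ` {t..T} \<inter> R \<noteq> {}" "z ` {t..T} - R \<noteq> {}" using t zT \<open>z t \<notin> R\<close> by force+
    ultimately have "z ` {t..T} \<inter> frontier R \<noteq> {}" by (rule connected_Int_frontier)
    then obtain s where s: "t \<le> s" "s \<le> T" "z s \<in> S" using subsetD[OF frontier_R] by fastforce
    then have "s \<in> A" using t \<open>0 \<le> t0\<close> by (simp add: A_def)
    from t0(2)[OF this] s t show False by simp
  qed
  have "t0 \<noteq> T" using t0(1) zT RS by (auto simp: A_def)
  then show ?thesis using that[of t0] t0(1) 1 by (auto simp: A_def)
qed

lemma xi_eq_iff: "xi p = xi q \<longleftrightarrow> Hf \<alpha> p = Hf \<alpha> q"
proof -
  have "\<alpha>\<^sup>2 * sin \<alpha> * a \<noteq> 0" using \<alpha> trig a_pos by auto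
  then show ?thesis unfolding xi_def by auto
qed

lemma foot:
  assumes "z \<in> ell" obtains \<sigma> where "\<sigma> \<in> J" "xi (top \<sigma>) = xi z"
proof -
  have "- 1 \<le> xi z" "xi z \<le> 1" using xi_range(1)[OF assms] by auto
  then obtain \<sigma> where "\<sigma> \<in> J" "xi (top \<sigma>) = xi z" by (rule xt.f_surj)
  then show ?thesis by (rule that)
qed

text \<open>By \<open>V_foot\<close> the initial angle \<open>thf \<alpha> p + V p\<close> is that
  of the point of the upper half at the level of \<open>p\<close>, so this is the rotation from
  there to \<open>p\<close>.\<close>

definition bang :: "real^2 \<Rightarrow> real \<Rightarrow> real^2" where
  "bang p = (\<lambda>t\<in>{0..V p}. Zc (Hf \<alpha> p) (thf \<alpha> p + V p - t))"

lemma V_foot: "\<sigma> \<in> J \<Longrightarrow> xi (top \<sigma>) = xi p \<Longrightarrow> thf \<alpha> p + V p = thf \<alpha> (top \<sigma>)"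
  using Th_top[of \<sigma>] by (simp add: V_def)

lemma bang_ends:
  assumes p: "p \<in> R"
  shows "\<sigma> \<in> J \<Longrightarrow> xi (top \<sigma>) = xi p \<Longrightarrow> bang p 0 = top \<sigma>" "bang p (V p) = p"
proof -
  show "bang p 0 = top \<sigma>" if \<sigma>: "\<sigma> \<in> J" "xi (top \<sigma>) = xi p"
    using V_pos[OF p] Zc_inverse(1)[OF top_ell[OF \<sigma>(1)]] V_foot[OF \<sigma>] \<sigma>(2)
    by (simp add: bang_def xi_eq_iff)
  show "bang p (V p) = p"
    using V_pos[OF p] Zc_inverse(1)[OF R_ell[OF p]] by (simp add: bang_def)
qed

lemma bang_trajectory:
  assumes p: "p \<in> R" shows "trajectory \<alpha> (V p) (bang p) (\<lambda>_. - 1)" "bang p 0 \<in> S"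
proof -
  obtain \<sigma> where \<sigma>: "\<sigma> \<in> J" "xi (top \<sigma>) = xi p" by (rule foot[OF R_ell[OF p]])
  show "bang p 0 \<in> S" unfolding bang_ends(1)[OF p \<sigma>] S_def graph_gt using \<sigma> by blast
  show "trajectory \<alpha> (V p) (bang p) (\<lambda>_. - 1)"
    unfolding bang_def
  proof (rule Zc_trajectory[OF Zc_inverse(2,3)[OF R_ell[OF p]] less_imp_le[OF V_pos[OF p]]])
    fix t assume t: "t \<in> {0..V p}"
    have "- (pi/2) < thf \<alpha> p" "thf \<alpha> (top \<sigma>) < pi/2"
      unfolding thf_def by (rule arctan_lbound arctan_ubound)+
    then show "0 < cos (thf \<alpha> p + V p - t)"
      using t V_foot[OF \<sigma>] by (intro cos_gt_zero_pi) auto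
  qed
qed

lemma optimal_from_top:
  assumes tr: "trajectory \<alpha> T z u" and t0: "0 \<le> t0" "t0 < T" and z0: "z t0 \<in> graph gt {-a..a}"
    and int: "\<And>t. t0 < t \<Longrightarrow> t \<le> T \<Longrightarrow> z t \<in> R"
  shows "V (z T) \<le> T"
    and "T \<le> V (z T) \<Longrightarrow> (AE t in lebesgue_on {0..T}. u t = - 1) \<and> T = V (z T) \<and> z = bang (z T)"
proof -
  obtain w where w: "prim 0 T w (\<lambda>t. 1 + u t)" by (rule prim_control[OF tr])
  have "z t0 \<in> S" using z0 by (simp add: S_def)
  have el: "z t \<in> ell" if "t \<in> {t0..T}" for t
    using that int[of t] R_ell[of "z t"] S_ell[OF \<open>z t0 \<in> S\<close>] by (cases "t = t0") auto
  note ctx = tr t0(1) less_imp_le[OF t0(2)] el w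
  obtain \<sigma> where \<sigma>: "\<sigma> \<in> J" "z t0 = top \<sigma>" using z0 unfolding graph_gt by blast
  have b: "V (z T) + (w T - w t0) / 4 \<le> T - t0"
    by (rule time_bound[OF ctx R_less[OF int] \<sigma>])
  have w0: "w t0 \<le> w T" by (rule w_mono[OF ctx]) (use t0 in auto)
  show "V (z T) \<le> T" using b w0 t0 by (simp add: field_simps)
  assume T: "T \<le> V (z T)"
  \<comment> \<open>Equality leaves no slack: the time spent before \<open>t0\<close> and the
    increase of \<open>w\<close> after it both vanish.\<close>
  then have 0: "t0 = 0" and wT: "w T = w t0" and TV: "T = V (z T)" using b w0 t0 by (auto simp: field_simps)
  have "AE t in lebesgue_on {0..T}. 1 + u t = 0"
    using u_range[OF ctx] t0 wT 0 by (intro prim_nonneg_zero[OF w]) auto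
  then have "AE t in lebesgue_on {0..T}. u t = - 1" by (rule AE_mp) (auto intro!: AE_I2)
  moreover have "z = bang (z T)"
  proof
    fix t
    show "z t = bang (z T) t"
    proof (cases "t \<in> {0..T}")
      case True
      then have t: "t \<in> {t0..T}" using 0 by simp
      have inv: "Hf \<alpha> (z t) = Hf \<alpha> (z T)" "thf \<alpha> (z t) = thf \<alpha> (z T) + (T - t)"
        by (rule bang_invariants[OF ctx wT t]; assumption)+
      have "z t = Zc (Hf \<alpha> (z t)) (thf \<alpha> (z t))" using Zc_inverse(1)[OF el[OF t]] by simp
      also have "\<dots> = Zc (Hf \<alpha> (z T)) (thf \<alpha> (z T) + (T - t))"
        unfolding inv ..
      finally show ?thesis using True TV by (simp add: bang_def algebra_simps)
    next
      case False
      moreover have "z \<in> extensional {0..T}" using tr by (simp add: trajectory_def)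
      ultimately show ?thesis unfolding bang_def TV[symmetric] by (auto simp: extensional_def)
    qed
  qed
  ultimately show "(AE t in lebesgue_on {0..T}. u t = - 1) \<and> T = V (z T) \<and> z = bang (z T)" using TV by simp
qed

definition bang' :: "real^2 \<Rightarrow> real \<Rightarrow> real^2" where
  "bang' p = (\<lambda>t\<in>{0..V (- p)}. - bang (- p) t)"

lemma bang'_trajectory:
  assumes p: "p \<in> R"
  shows "trajectory \<alpha> (V (- p)) (bang' p) (\<lambda>_. 1)" "bang' p 0 \<in> S" "bang' p (V (- p)) = p"
    "\<sigma> \<in> J \<Longrightarrow> xi (top \<sigma>) = xi (- p) \<Longrightarrow> bang' p 0 = - top \<sigma>"
  using trajectory_uminus[OF bang_trajectory(1)[OF R_uminus[OF p]]]
    S_uminus[OF bang_trajectory(2)[OF R_uminus[OF p]]] V_pos[OF R_uminus[OF p]] bang_ends[OF R_uminus[OF p]]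
  by (simp_all add: bang'_def)

text \<open>Only the last contact with the front counts. If it is on the lower half, the mirrored
  trajectory ends at \<open>- p\<close> and has this contact on the upper half.\<close>

lemma arrival:
  assumes tr: "trajectory \<alpha> T z u" and z0: "z 0 \<in> S" and zT: "z T = p" and p: "p \<in> R"
  shows "min (V p) (V (- p)) \<le> T"
    and "T \<le> min (V p) (V (- p)) \<Longrightarrow>
      (AE t in lebesgue_on {0..T}. u t = - 1) \<and> T = V p \<and> z = bang p \<or>
      (AE t in lebesgue_on {0..T}. u t = 1) \<and> T = V (- p) \<and> z = bang' p"
proof -
  obtain t0 where t0: "0 \<le> t0" "t0 < T" "z t0 \<in> S" and int: "\<And>t. t0 < t \<Longrightarrow> t \<le> T \<Longrightarrow> z t \<in> R"
    by (rule last_hit[OF tr z0]) (use zT p in auto)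
  have "(V p \<le> T \<and> (T \<le> V p \<longrightarrow> (AE t in lebesgue_on {0..T}. u t = - 1) \<and> T = V p \<and> z = bang p)) \<or>
    (V (- p) \<le> T \<and> (T \<le> V (- p) \<longrightarrow> (AE t in lebesgue_on {0..T}. u t = 1) \<and> T = V (- p) \<and> z = bang' p))"
  proof (cases "z t0 \<in> graph gt {-a..a}")
    case True
    from optimal_from_top[OF tr t0(1,2) True int] show ?thesis unfolding zT by blast
  next
    case False
    then have g: "- z t0 \<in> graph gt {-a..a}" using t0(3) unfolding S_def graph_gb by auto
    define zm where "zm = (\<lambda>t\<in>{0..T}. - z t)"
    have tm: "trajectory \<alpha> T zm (\<lambda>t. - u t)" unfolding zm_def by (rule trajectory_uminus[OF tr])
    have "zm t0 \<in> graph gt {-a..a}" using g t0 by (simp add: zm_def)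
    moreover have "zm t \<in> R" if "t0 < t" "t \<le> T" for t
      using R_uminus[OF int[OF that]] that t0 by (simp add: zm_def)
    moreover have "zm T = - p" using t0 zT by (simp add: zm_def)
    ultimately have o: "V (- p) \<le> T"
      "T \<le> V (- p) \<Longrightarrow> (AE t in lebesgue_on {0..T}. - u t = - 1) \<and> T = V (- p) \<and> zm = bang (- p)"
      using optimal_from_top[OF tm t0(1,2)] by auto
    have "(AE t in lebesgue_on {0..T}. u t = 1) \<and> T = V (- p) \<and> z = bang' p" if T: "T \<le> V (- p)"
    proof (intro conjI ext)
      show "AE t in lebesgue_on {0..T}. u t = 1" "T = V (- p)" using o(2)[OF T] by simp_all
      fix t
      have "zm t = bang (- p) t" using o(2)[OF T] by simp
      moreover have "z \<in> extensional {0..T}" using tr by (simp add: trajectory_def)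
      moreover have "- zm t = z t" if "t \<in> {0..T}" using that by (simp add: zm_def)
      ultimately show "z t = bang' p t"
        using \<open>T = V (- p)\<close> unfolding bang'_def
        by (cases "t \<in> {0..T}") (auto simp: extensional_def)
    qed
    with o(1) show ?thesis by blast
  qed
  then show "min (V p) (V (- p)) \<le> T"
    and "T \<le> min (V p) (V (- p)) \<Longrightarrow>
      (AE t in lebesgue_on {0..T}. u t = - 1) \<and> T = V p \<and> z = bang p \<or>
      (AE t in lebesgue_on {0..T}. u t = 1) \<and> T = V (- p) \<and> z = bang' p"
    by linarith+
qed

lemma bang_optimal:
  assumes p: "p \<in> R" and le: "V p \<le> V (- p)"
  shows "time_optimal \<alpha> S p (V p) (bang p) (\<lambda>_. - 1)"
  unfolding time_optimal_def
proof (intro conjI allI impI bang_trajectory[OF p] bang_ends(2)[OF p])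
  fix T' z' u' assume "trajectory \<alpha> T' z' u' \<and> z' 0 \<in> S \<and> z' T' = p"
  then show "V p \<le> T'" using arrival(1)[of T' z' u' p] p le by simp
qed

lemma bang'_optimal:
  assumes p: "p \<in> R" and le: "V (- p) \<le> V p"
  shows "time_optimal \<alpha> S p (V (- p)) (bang' p) (\<lambda>_. 1)"
  unfolding time_optimal_def
proof (intro conjI allI impI bang'_trajectory(1-3)[OF p])
  fix T' z' u' assume "trajectory \<alpha> T' z' u' \<and> z' 0 \<in> S \<and> z' T' = p"
  then show "V (- p) \<le> T'" using arrival(1)[of T' z' u' p] p le by simp
qed

lemma time_optimalD:
  assumes "time_optimal \<alpha> S p T z u" and p: "p \<in> R"
  shows "(AE t in lebesgue_on {0..T}. u t = - 1) \<and> T = V p \<and> z = bang p \<and> V p \<le> V (- p) \<or>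
      (AE t in lebesgue_on {0..T}. u t = 1) \<and> T = V (- p) \<and> z = bang' p \<and> V (- p) \<le> V p"
proof -
  have tr: "trajectory \<alpha> T z u" "z 0 \<in> S" "z T = p"
    and opt: "\<And>T' z' u'. trajectory \<alpha> T' z' u' \<Longrightarrow> z' 0 \<in> S \<Longrightarrow> z' T' = p \<Longrightarrow> T \<le> T'"
    using assms(1) unfolding time_optimal_def by blast+
  have "T \<le> V p" by (rule opt[OF bang_trajectory[OF p] bang_ends(2)[OF p]])
  moreover have "T \<le> V (- p)" by (rule opt[OF bang'_trajectory(1-3)[OF p]])
  ultimately have "(AE t in lebesgue_on {0..T}. u t = - 1) \<and> T = V p \<and> z = bang p \<or>
      (AE t in lebesgue_on {0..T}. u t = 1) \<and> T = V (- p) \<and> z = bang' p"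
    by (intro arrival(2)[OF tr p]) simp
  with \<open>T \<le> V p\<close> \<open>T \<le> V (- p)\<close> show ?thesis by blast
qed

lemma optimal_nonempty: "p \<in> R \<Longrightarrow> optimal_trajectories \<alpha> S p \<noteq> {}"
  using bang_optimal[of p] bang'_optimal[of p]
  unfolding optimal_trajectories_def by (cases "V p \<le> V (- p)") auto

text \<open>The two trajectories already differ at their starting points: one of them is strictly
  above the axis, the other is not.\<close>

lemma optimal_trajectories_tie:
  assumes p: "p \<in> R" and eq: "V p = V (- p)"
  shows "optimal_trajectories \<alpha> S p = {(V p, bang p), (V (- p), bang' p)}" "bang p 0 \<noteq> bang' p 0"
proof -
  show "optimal_trajectories \<alpha> S p = {(V p, bang p), (V (- p), bang' p)}"
  proof (intro equalityI subsetI)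
    fix q assume "q \<in> optimal_trajectories \<alpha> S p"
    then obtain T z u where q: "q = (T, z)" and o: "time_optimal \<alpha> S p T z u"
      unfolding optimal_trajectories_def by blast
    from time_optimalD[OF o p] show "q \<in> {(V p, bang p), (V (- p), bang' p)}"
      unfolding q by (elim disjE conjE) simp_all
  next
    fix q assume "q \<in> {(V p, bang p), (V (- p), bang' p)}"
    then show "q \<in> optimal_trajectories \<alpha> S p"
      using bang_optimal[OF p] bang'_optimal[OF p] eq unfolding optimal_trajectories_def by fastforce
  qed
  obtain \<sigma> where \<sigma>: "\<sigma> \<in> J" "xi (top \<sigma>) = xi p" by (rule foot[OF R_ell[OF p]])
  obtain \<tau> where \<tau>: "\<tau> \<in> J" "xi (top \<tau>) = xi (- p)" by (rule foot[OF R_ell[OF R_uminus[OF p]]])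
  have "- 1 < xi p \<and> xi p < 1" by (rule xi_range(2)[OF R_ell[OF p] R_less[OF p]])
  then have "\<sigma> \<noteq> 0" "\<sigma> \<noteq> pi" using \<sigma>(2) xi_ends by auto
  then have "0 < \<sigma>" "\<sigma> < pi" using \<sigma>(1) s1 s2 by auto
  then have "0 < y \<sigma>" by (rule y_J(2)[OF \<sigma>(1)])
  moreover have "0 \<le> y \<tau>" by (rule y_J(1)[OF \<tau>(1)])
  ultimately have "(bang p 0) $ 2 \<noteq> (bang' p 0) $ 2"
    unfolding bang_ends(1)[OF p \<sigma>] bang'_trajectory(4)[OF p \<tau>] by simp
  then show "bang p 0 \<noteq> bang' p 0" by auto
qed

end

section \<open>The overlap curve\<close>

text \<open>The quotient \<open>\<phi>' / f'\<close> at the inverse of \<open>f\<close> is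
  continuous on the image of all of \<open>U\<close>, which may contain an end of the branch. At
  such an end \<open>h\<close> may have a corner, so the derivative is asserted only at inner
  points.\<close>

lemma branch_derivative:
  fixes f \<phi> f' \<phi>' h :: "real \<Rightarrow> real"
  assumes df: "\<And>\<sigma>. \<sigma> \<in> {p..q} \<Longrightarrow> (f has_real_derivative f' \<sigma>) (at \<sigma>)"
    and d\<phi>: "\<And>\<sigma>. \<sigma> \<in> {p..q} \<Longrightarrow> (\<phi> has_real_derivative \<phi>' \<sigma>) (at \<sigma>)"
    and c: "continuous_on {p..q} f'" "continuous_on {p..q} \<phi>'"
    and mono: "\<And>\<sigma> \<tau>. p \<le> \<sigma> \<Longrightarrow> \<sigma> < \<tau> \<Longrightarrow> \<tau> \<le> q \<Longrightarrow> f \<sigma> < f \<tau>"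
    and U: "U \<subseteq> {p..q}" "\<And>\<sigma>. \<sigma> \<in> U \<Longrightarrow> f' \<sigma> \<noteq> 0"
    and h: "\<And>\<sigma>. \<sigma> \<in> {p..q} \<Longrightarrow> h (f \<sigma>) = \<phi> \<sigma>"
  obtains L where "continuous_on (f ` U) L"
    "\<And>\<sigma>. \<sigma> \<in> U \<Longrightarrow> p < \<sigma> \<Longrightarrow> \<sigma> < q \<Longrightarrow> (h has_real_derivative L (f \<sigma>)) (at (f \<sigma>))"
proof -
  define g where "g = the_inv_into {p..q} f"
  have inj: "inj_on f {p..q}"
    by (rule linorder_inj_onI) (use mono in force)+
  have g: "g (f \<sigma>) = \<sigma>" if "\<sigma> \<in> {p..q}" for \<sigma>
    unfolding g_def by (rule the_inv_into_f_f[OF inj that])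
  have cf: "continuous_on {p..q} f"
    by (intro continuous_at_imp_continuous_on ballI DERIV_isCont[OF df])
  have cg: "continuous_on (f ` {p..q}) g"
    by (rule continuous_on_inv[OF cf compact_Icc]) (use g in blast)
  define L where "L v = \<phi>' (g v) / f' (g v)" for v
  have "continuous_on (f ` U) L"
    unfolding L_def
  proof (intro continuous_on_divide continuous_on_compose2[OF c(1), where f=g] continuous_on_compose2[OF c(2), where f=g])
    show "continuous_on (f ` U) g" "continuous_on (f ` U) g"
      by (rule continuous_on_subset[OF cg image_mono[OF U(1)]])+
    show "g ` f ` U \<subseteq> {p..q}" "g ` f ` U \<subseteq> {p..q}" using g U(1) by (auto simp: subset_eq)
    show "\<forall>v\<in>f ` U. f' (g v) \<noteq> 0" using g U by (auto simp: subset_eq)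
  qed
  moreover have "(h has_real_derivative L (f \<sigma>)) (at (f \<sigma>))" if s: "\<sigma> \<in> U" "p < \<sigma>" "\<sigma> < q" for \<sigma>
  proof -
    have pq: "p \<le> q" using s by linarith
    have surj: "\<exists>\<tau>\<in>{p..q}. v = f \<tau>" if "f p < v" "v < f q" for v
      using IVT'[of f p v q] that pq cf by force
    have rng: "f p < f \<sigma>" "f \<sigma> < f q" using mono s by auto
    have sJ: "\<sigma> \<in> {p..q}" using s by simp
    have "continuous_on {f p<..<f q} g"
      by (rule continuous_on_subset[OF cg subsetI]) (use surj in \<open>simp add: image_iff\<close>)
    then have "isCont g (f \<sigma>)" using rng by (simp add: continuous_on_eq_continuous_at)
    moreover have "(f has_real_derivative f' \<sigma>) (at (g (f \<sigma>)))" using df[OF sJ] g[OF sJ] by simp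
    moreover have "f (g v) = v" if "f p < v" "v < f q" for v using surj[OF that] g by auto
    ultimately have dg: "(g has_real_derivative inverse (f' \<sigma>)) (at (f \<sigma>))"
      using U(2)[OF s(1)] rng by (intro DERIV_inverse_function[where f=f and a="f p" and b="f q"])
    have "(\<phi> has_real_derivative \<phi>' \<sigma>) (at (g (f \<sigma>)))" using d\<phi>[OF sJ] g[OF sJ] by simp
    from DERIV_chain2[OF this dg] have D: "((\<lambda>v. \<phi> (g v)) has_real_derivative L (f \<sigma>)) (at (f \<sigma>))"
      using g[OF sJ] by (simp add: L_def field_simps)
    have "(h has_real_derivative L (f \<sigma>)) (at (f \<sigma>)) \<longleftrightarrow> ((\<lambda>v. \<phi> (g v)) has_real_derivative L (f \<sigma>)) (at (f \<sigma>))"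
    proof (rule DERIV_cong_ev[OF refl _ refl])
      have "\<forall>\<^sub>F v in nhds (f \<sigma>). v \<in> {f p<..<f q}"
        using rng by (intro eventually_nhds_in_open) auto
      then show "\<forall>\<^sub>F v in nhds (f \<sigma>). h v = \<phi> (g v)"
      proof (rule eventually_mono)
        fix v assume "v \<in> {f p<..<f q}"
        then obtain \<tau> where "\<tau> \<in> {p..q}" "v = f \<tau>" using surj[of v] by auto
        then show "h v = \<phi> (g v)" using h g by simp
      qed
    qed
    then show ?thesis using D by simp
  qed
  ultimately show ?thesis by (rule that)
qed

context front
begin

definition F :: "real \<Rightarrow> real \<Rightarrow> real" where "F t s = V (pt t s) - V (pt (- t) (- s))"

lemma F_odd: "F (- t) (- s) = - F t s"
  by (simp add: F_def)

lemma minus_pt: "- pt p q = pt (- p) (- q)"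
  by (simp add: vec_eq_iff forall_2)

lemma ell_pt_uminus: "pt t s \<in> ell \<Longrightarrow> pt (- t) (- s) \<in> ell"
  by (simp add: ell_def)

lemma F_decreasing:
  assumes "\<bar>t\<bar> < a" "s \<le> s'" "pt t s \<in> ell" "pt t s' \<in> ell"
  shows "\<alpha> / 2 * (s' - s) \<le> F t s - F t s'"
proof -
  have "\<alpha> / 4 * (s' - s) \<le> V (pt t s) - V (pt t s')" by (rule V_vertical[OF assms])
  moreover have "\<alpha> / 4 * ((- s) - (- s')) \<le> V (pt (- t) (- s')) - V (pt (- t) (- s))"
    using assms by (intro V_vertical ell_pt_uminus) auto
  moreover have "\<alpha> / 4 * (s' - s) + \<alpha> / 4 * ((- s) - (- s')) = \<alpha> / 2 * (s' - s)" by (simp add: algebra_simps)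
  ultimately show ?thesis unfolding F_def by linarith
qed

text \<open>Makes \<open>\<bar>F\<bar>\<close> at any height a measure of the distance to the
  overlap curve. Uniqueness, continuity and size of the curve are all read off from it.\<close>

lemma F_abs:
  assumes "\<bar>t\<bar> < a" "pt t s \<in> ell" "pt t s' \<in> ell" "F t s = 0"
  shows "\<alpha> / 2 * \<bar>s' - s\<bar> \<le> \<bar>F t s'\<bar>"
  using F_decreasing[of t s s'] F_decreasing[of t s' s] assms by (cases "s \<le> s'") (auto simp: abs_minus_commute)

lemma continuous_on_thf: "continuous_on ell (thf \<alpha>)"
proof -
  have "Nf \<alpha> z \<noteq> 0" if "z \<in> ell" for z using ell_bounds(6)[OF that] \<alpha> by (force simp: zero_less_mult_iff)
  then show ?thesis
    unfolding thf_def Nf_def by (intro continuous_intros continuous_on_rr) auto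
qed

lemma continuous_on_xi: "continuous_on A xi"
  unfolding xi_alt[abs_def] using a_pos \<alpha> by (intro continuous_intros continuous_on_rr) auto

lemma continuous_on_V: "continuous_on ell V"
proof -
  have "continuous_on {-1..1} Th" unfolding Th_def by (rule xt.continuous_on_lift)
  then have "continuous_on ell (\<lambda>z. Th (xi z))"
    by (rule continuous_on_compose2[OF _ continuous_on_xi]) (use xi_range(1) in blast)
  then show ?thesis unfolding V_def by (intro continuous_intros continuous_on_thf)
qed

lemma continuous_on_F:
  assumes "continuous_on A f" "continuous_on A g" "\<And>t. t \<in> A \<Longrightarrow> pt (f t) (g t) \<in> ell"
  shows "continuous_on A (\<lambda>t. F (f t) (g t))"
  unfolding F_def using assms ell_pt_uminus
  by (intro continuous_intros continuous_on_compose2[OF continuous_on_V]) auto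

lemma gt_ell: "- a \<le> t \<Longrightarrow> t \<le> a \<Longrightarrow> pt t (gt t) \<in> ell"
  by (rule S_ell) (auto simp: S_def in_graph)

lemma gb_ell: "- a \<le> t \<Longrightarrow> t \<le> a \<Longrightarrow> pt t (gb t) \<in> ell"
  by (rule S_ell) (auto simp: S_def in_graph)

lemma V_gt: "- a \<le> t \<Longrightarrow> t \<le> a \<Longrightarrow> V (pt t (gt t)) = 0"
  by (rule gt_foot) (auto simp: V_top)

text \<open>On the upper half \<open>V\<close> is zero, while at the opposite point, on the lower
  half, it is positive.\<close>

lemma F_gt: "- a < t \<Longrightarrow> t < a \<Longrightarrow> F t (gt t) < 0"
proof -
  assume t: "- a < t" "t < a"
  have l: "gb (- t) < gt (- t)" using gb_less_gt[of "- t"] t by simp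
  have "\<alpha> / 4 * (gt (- t) - gb (- t)) \<le> V (pt (- t) (gb (- t))) - V (pt (- t) (gt (- t)))"
    using t l by (intro V_vertical gt_ell gb_ell) auto
  moreover have "V (pt (- t) (gt (- t))) = 0" "V (pt t (gt t)) = 0" using t by (auto intro!: V_gt)
  moreover have "0 < \<alpha> / 4 * (gt (- t) - gb (- t))" using l \<alpha> by simp
  ultimately show ?thesis unfolding F_def by (simp add: gb_def)
qed

lemma F_gb: "- a < t \<Longrightarrow> t < a \<Longrightarrow> 0 < F t (gb t)"
  using F_gt[of "- t"] F_odd[of t "gb t"] by (simp add: gb_def)

lemma overlap_ex1:
  assumes t: "- a < t" "t < a"
  shows "\<exists>!s. gb t < s \<and> s < gt t \<and> F t s = 0"
proof -
  have el: "pt t s \<in> ell" if "gb t \<le> s" "s \<le> gt t" for s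
    using t that by (intro ell_segment[OF gb_ell gt_ell]) auto
  have "continuous_on {gb t..gt t} (\<lambda>s. F t s)"
    by (intro continuous_on_F continuous_intros) (use el in auto)
  then obtain s where s: "gb t \<le> s" "s \<le> gt t" "F t s = 0"
    using IVT2'[of "\<lambda>s. F t s" "gt t" 0 "gb t"] F_gt[OF t] F_gb[OF t] gb_less_gt[OF t] by force
  moreover have "s \<noteq> gb t" "s \<noteq> gt t" using s(3) F_gt[OF t] F_gb[OF t] by auto
  ultimately have "gb t < s \<and> s < gt t \<and> F t s = 0" by auto
  moreover have "s' = s" if "gb t < s' \<and> s' < gt t \<and> F t s' = 0" for s'
  proof -
    have "\<alpha> / 2 * \<bar>s' - s\<bar> \<le> \<bar>F t s'\<bar>" using t s that by (intro F_abs el) auto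
    then show ?thesis using that \<alpha> by (auto simp: mult_le_0_iff)
  qed
  ultimately show ?thesis by blast
qed

definition gm :: "real \<Rightarrow> real" where "gm t = (THE s. gb t < s \<and> s < gt t \<and> F t s = 0)"

lemma gm:
  assumes "- a < t" "t < a" shows "gb t < gm t" "gm t < gt t" "F t (gm t) = 0"
  using theI'[OF overlap_ex1[OF assms]] unfolding gm_def by auto

lemma gm_unique: "- a < t \<Longrightarrow> t < a \<Longrightarrow> gb t < s \<Longrightarrow> s < gt t \<Longrightarrow> F t s = 0 \<Longrightarrow> gm t = s"
  using overlap_ex1[of t] gm[of t] by blast

lemma gm_R: "- a < t \<Longrightarrow> t < a \<Longrightarrow> pt t (gm t) \<in> R"
  using gm by (simp add: R_def between_def)

lemma gm_odd: "- a < t \<Longrightarrow> t < a \<Longrightarrow> gm (- t) = - gm t"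
  using gm[of t] F_odd[of t "gm t"] by (intro gm_unique) (auto simp: gb_def)

lemma gm_0: "gm 0 = 0"
  using gm_odd[of 0] a_pos by simp

text \<open>By \<open>F_abs\<close> the difference of \<open>gm r\<close> and \<open>gm t\<close> is
  at most \<open>2 / \<alpha> * \<bar>F r (gm t)\<bar>\<close>, and \<open>F r (gm t)\<close> tends
  to \<open>F t (gm t) = 0\<close> as \<open>r\<close> tends to \<open>t\<close>.\<close>

lemma gm_isCont:
  assumes t: "- a < t" "t < a" shows "isCont gm t"
proof -
  have "open {r. pt r (gm t) \<in> R}"
    by (rule open_vimage[OF open_R, of "\<lambda>r. pt r (gm t)", unfolded vimage_def]) (intro continuous_intros)
  then have o: "open {r. - a < r \<and> r < a \<and> pt r (gm t) \<in> R}" (is "open ?U")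
    by (intro open_Collect_conj open_Collect_less continuous_intros) auto
  have "continuous_on ?U (\<lambda>r. F r (gm t))"
    by (intro continuous_on_F continuous_intros) (auto intro: R_ell)
  moreover have tU: "t \<in> ?U" using t gm_R[OF t] by simp
  ultimately have "isCont (\<lambda>r. F r (gm t)) t" using o by (simp add: continuous_on_eq_continuous_at)
  then have "(\<lambda>r. F r (gm t)) \<midarrow>t\<rightarrow> 0" using gm(3)[OF t] by (simp add: isCont_def)
  then have lim: "(\<lambda>r. 2 / \<alpha> * \<bar>F r (gm t)\<bar>) \<midarrow>t\<rightarrow> 0"
    by (intro tendsto_mult_right_zero tendsto_rabs_zero)
  have "\<forall>\<^sub>F r in at t. r \<in> ?U"
    using eventually_nhds_in_open[OF o tU] by (rule eventually_at_filter[THEN iffD2, OF eventually_mono]) simp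
  then have "\<forall>\<^sub>F r in at t. \<bar>gm r - gm t\<bar> \<le> 2 / \<alpha> * \<bar>F r (gm t)\<bar>"
  proof (rule eventually_mono)
    fix r assume r: "r \<in> ?U"
    have "\<alpha> / 2 * \<bar>gm t - gm r\<bar> \<le> \<bar>F r (gm t)\<bar>"
      using r gm_R[of r] gm(3)[of r] by (intro F_abs R_ell) auto
    then show "\<bar>gm r - gm t\<bar> \<le> 2 / \<alpha> * \<bar>F r (gm t)\<bar>" using \<alpha> by (simp add: field_simps abs_minus_commute)
  qed
  then have "(\<lambda>r. gm r - gm t) \<midarrow>t\<rightarrow> 0"
    by (intro Lim_null_comparison[OF _ lim]) simp
  then show ?thesis by (simp add: isCont_def LIM_zero_iff)
qed

lemma gm_cont: "continuous_on {-a<..<a} gm"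
  by (intro continuous_at_imp_continuous_on ballI gm_isCont) auto

end

lemma abs_arctan_diff_le: "\<bar>arctan x - arctan y\<bar> \<le> \<bar>x - y\<bar>" for x y :: real
proof -
  have "norm (arctan x - arctan y) \<le> 1 * norm (x - y)"
  proof (rule field_differentiable_bound[OF convex_UNIV])
    show "(arctan has_field_derivative inverse (1 + z\<^sup>2)) (at z within UNIV)" for z :: real
      by (rule DERIV_arctan)
    fix z :: real
    have "1 \<le> 1 + z\<^sup>2" by simp
    then have "inverse (1 + z\<^sup>2) \<le> 1" by (rule inverse_le_1_iff[THEN iffD2, OF disjI2])
    then show "norm (inverse (1 + z\<^sup>2)) \<le> 1" by (simp add: abs_of_nonneg)
  qed auto
  then show ?thesis by simp
qed

lemma arcsin_lipschitz:
  fixes x y :: real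
  assumes "\<bar>x\<bar> \<le> 3 / 4" "\<bar>y\<bar> \<le> 3 / 4"
  shows "\<bar>arcsin x - arcsin y\<bar> \<le> 2 * \<bar>x - y\<bar>"
proof -
  have "norm (arcsin x - arcsin y) \<le> 2 * norm (x - y)"
  proof (rule field_differentiable_bound[of "{-3/4..3/4}"])
    fix z :: real assume "z \<in> {-3/4..3/4}"
    then have z: "- 1 < z" "z < 1" "\<bar>z\<bar> \<le> 3 / 4" by (auto simp: abs_le_iff)
    show "(arcsin has_field_derivative inverse (sqrt (1 - z\<^sup>2))) (at z within {-3/4..3/4})"
      by (rule has_field_derivative_at_within[OF DERIV_arcsin[OF z(1,2)]])
    have "z\<^sup>2 \<le> (3/4)\<^sup>2" using power_mono[OF z(3), of 2] by simp
    then have "1 / 4 \<le> 1 - z\<^sup>2" by (simp add: power2_eq_square)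
    then have "sqrt (1 / 4) \<le> sqrt (1 - z\<^sup>2)" by (rule real_sqrt_le_mono)
    then have s: "1 / 2 \<le> sqrt (1 - z\<^sup>2)" by (simp add: real_sqrt_divide)
    then have "inverse (sqrt (1 - z\<^sup>2)) \<le> inverse (1 / 2)" by (intro le_imp_inverse_le) auto
    then show "norm (inverse (sqrt (1 - z\<^sup>2))) \<le> 2" using s by (simp del: real_sqrt_ge_0_iff)
  qed (use assms in \<open>auto simp: abs_le_iff\<close>)
  then show ?thesis by simp
qed

section \<open>Size of the overlap curve and its position relative to the level of the
  origin\<close>

context front
begin

lemma axis_ell: "\<bar>t\<bar> \<le> a \<Longrightarrow> pt t 0 \<in> ell"
proof -
  assume t: "\<bar>t\<bar> \<le> a"
  then have "\<bar>t\<bar>\<^sup>2 \<le> a\<^sup>2" by (intro power_mono) auto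
  then have "0 \<le> 4 * K^6 * (a\<^sup>2 - t\<^sup>2)" using K by (intro mult_nonneg_nonneg) auto
  then show ?thesis using t by (simp add: ell_def)
qed

lemma F_axis: "F t 0 = Th (xi (pt t 0)) - Th (xi (pt (- t) 0))"
  by (simp add: F_def V_def thf_def)

lemma xi_axis_diff: "xi (pt t 0) - xi (pt (- t) 0) = 2 * t / a"
  unfolding xi_alt by (simp add: rr_def)

lemma gm_le_F: "- a < t \<Longrightarrow> t < a \<Longrightarrow> \<alpha> / 2 * \<bar>gm t\<bar> \<le> \<bar>F t 0\<bar>"
  using F_abs[of t "gm t" 0] R_ell[OF gm_R[of t]] gm(3)[of t] axis_ell[of t] by (simp add: abs_le_iff abs_minus_commute)

text \<open>On the axis the clock angle is zero, so \<open>F\<close> reduces to the difference of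
  \<open>Th\<close> at the levels of \<open>(t, 0)\<close> and \<open>(- t, 0)\<close>, which are
  \<open>2 t / a\<close> apart. For \<open>\<bar>t\<bar> \<le> a / 2\<close> both levels have
  modulus at most 3/4, where the arcsine is Lipschitz. For larger \<open>\<bar>t\<bar>\<close> the
  two arcsines differ by at most pi, which is already a bounded multiple of
  \<open>\<bar>t\<bar> / a\<close>.\<close>

lemma gm_linear:
  assumes t: "- a < t" "t < a" shows "\<bar>gm t\<bar> \<le> 192 * K^5 * \<bar>t\<bar>"
proof -
  have el: "pt t 0 \<in> ell" "pt (- t) 0 \<in> ell" using t by (auto intro!: axis_ell)
  let ?u = "xi (pt t 0)" and ?v = "xi (pt (- t) 0)"
  have "\<bar>arcsin ?u - arcsin ?v\<bar> \<le> 8 * (\<bar>t\<bar> * (1 / a))"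
  proof (cases "\<bar>t\<bar> \<le> a / 2")
    case True
    then have b: "1 / 4 \<le> (a + t) / (2 * a)" "1 / 4 \<le> (a - t) / (2 * a)"
      using a_pos by (simp_all add: field_simps abs_le_iff)
    have "a + - t = a - t" "a - - t = a + t" by simp_all
    note c = xi_bounds(1,2)[OF el(1), unfolded vector_2] xi_bounds(1,2)[OF el(2), unfolded vector_2 this]
    have "\<bar>?u\<bar> \<le> 3 / 4" "\<bar>?v\<bar> \<le> 3 / 4" using b c by (intro abs_leI; linarith)+
    from arcsin_lipschitz[OF this] have "\<bar>arcsin ?u - arcsin ?v\<bar> \<le> 2 * \<bar>2 * t / a\<bar>"
      unfolding xi_axis_diff .
    also have "\<dots> = 4 * (\<bar>t\<bar> * (1 / a))" using a_pos by (simp add: abs_mult)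
    also have "\<dots> \<le> 8 * (\<bar>t\<bar> * (1 / a))" using a_pos by (intro mult_right_mono) auto
    finally show ?thesis .
  next
    case False
    then have "1 / 2 \<le> \<bar>t\<bar> * (1 / a)" using a_pos by (simp add: field_simps)
    moreover have "\<bar>arcsin ?u\<bar> \<le> pi / 2" "\<bar>arcsin ?v\<bar> \<le> pi / 2"
      using arcsin_bounded[of ?u] arcsin_bounded[of ?v] xi_range(1)[OF el(1)] xi_range(1)[OF el(2)]
      by (auto simp: abs_le_iff)
    ultimately show ?thesis using pi_less_4 by linarith
  qed
  also have "\<dots> \<le> 8 * (\<bar>t\<bar> * K)" using inv_a by (intro mult_left_mono) auto
  finally have as: "\<bar>arcsin ?u - arcsin ?v\<bar> \<le> 8 * (\<bar>t\<bar> * K)" .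
  have "\<bar>F t 0\<bar> \<le> 12 * (K^4 * \<alpha>) * (8 * (\<bar>t\<bar> * K))"
    unfolding F_axis
    by (rule order_trans[OF Th_lipschitz[OF xi_range(1)[OF el(1)] xi_range(1)[OF el(2)]] mult_left_mono[OF as]])
      (use K \<alpha> in simp)
  also have "\<dots> = \<alpha> * (96 * K^5 * \<bar>t\<bar>)" by (simp add: eval_nat_numeral)
  finally have "\<alpha> * (\<bar>gm t\<bar> / 2) \<le> \<alpha> * (96 * K^5 * \<bar>t\<bar>)" using gm_le_F[OF t] by simp
  then show ?thesis using \<alpha> by simp
qed

text \<open>The linear term \<open>\<alpha>^2 * sin \<alpha> * t\<close> of \<open>Hf\<close>
  dominates \<open>1 - rr\<close>, which is quadratic in \<open>t\<close> by
  \<open>gm_linear\<close>. Thus each half of the overlap curve stays on one side of the level of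
  the origin, and the points \<open>z\<close> and \<open>- z\<close> see one fixed branch of the
  upper half each.\<close>

lemma Hf_overlap:
  assumes t: "0 < t" "t < a"
  shows "cos \<alpha> < Hf \<alpha> (pt t (gm t))" "Hf \<alpha> (pt (- t) (- gm t)) < cos \<alpha>"
proof -
  have el: "pt t (gm t) \<in> ell" "pt (- t) (- gm t) \<in> ell"
    using t R_ell[OF gm_R[of t]] by (auto intro: ell_pt_uminus)
  define r where "r = rr \<alpha> (pt t (gm t))"
  have r: "0 \<le> r" "r \<le> 1" "r\<^sup>2 = 1 - \<alpha>^4 * (t\<^sup>2 + (gm t)\<^sup>2)"
    using ell_bounds(3,4)[OF el(1)] rr_sq[OF ell_bounds(5)[OF el(1)]] by (simp_all add: r_def)
  have "rr \<alpha> (pt (- t) (- gm t)) = r" by (simp add: rr_def r_def)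
  then have "Hf \<alpha> (pt (- t) (- gm t)) = - (\<alpha>\<^sup>2 * sin \<alpha> * t) + cos \<alpha> * r" by (simp add: Hf_def)
  moreover have "0 < \<alpha>\<^sup>2 * sin \<alpha> * t" using \<alpha> t trig by simp
  moreover have "cos \<alpha> * r \<le> cos \<alpha> * 1" using r trig by (intro mult_left_mono) auto
  ultimately show "Hf \<alpha> (pt (- t) (- gm t)) < cos \<alpha>" by linarith
  have "r\<^sup>2 \<le> r" using mult_left_le[OF r(2,1)] unfolding power2_eq_square .
  then have d: "1 - r \<le> \<alpha>^4 * (t\<^sup>2 + (gm t)\<^sup>2)" using r(3) by linarith
  have "\<bar>gm t\<bar> \<le> 192 * K^5 * t" using gm_linear[of t] t by simp
  then have "\<bar>gm t\<bar>\<^sup>2 \<le> (192 * K^5 * t)\<^sup>2" by (rule power_mono) simp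
  then have "t\<^sup>2 + (gm t)\<^sup>2 \<le> (1 + 36864 * K^10) * t\<^sup>2"
    by (simp add: power_mult_distrib distrib_right flip: power_mult)
  also have "\<dots> \<le> (36865 * K^10) * t\<^sup>2" using K by (intro mult_right_mono) auto
  finally have g: "t\<^sup>2 + (gm t)\<^sup>2 \<le> 36865 * K^10 * t\<^sup>2" .
  have "\<alpha>^4 * (t\<^sup>2 + (gm t)\<^sup>2) \<le> \<alpha>^4 * (36865 * K^10 * t\<^sup>2)" by (intro mult_left_mono g) auto
  also have "\<dots> = \<alpha>\<^sup>2 * t * (36865 * (K^10 * \<alpha>) * (\<alpha> * t))" by (simp add: eval_nat_numeral)
  also have "\<dots> \<le> \<alpha>\<^sup>2 * t * (36865 * (K^10 * \<alpha>) * (\<alpha> * K))"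
    using t a \<alpha> K by (intro mult_left_mono) auto
  also have "\<dots> = \<alpha>\<^sup>2 * t * (36865 * (K^11 * \<alpha>) * \<alpha>)" by (simp add: eval_nat_numeral)
  also have "\<dots> < \<alpha>\<^sup>2 * t * (99 / 100 * \<alpha>)"
    using small_pow[of 11] \<alpha> t by (intro mult_strict_left_mono mult_strict_right_mono) auto
  also have "\<dots> \<le> \<alpha>\<^sup>2 * t * sin \<alpha>" using trig \<alpha> t by (intro mult_left_mono) auto
  finally have 1: "1 - r < \<alpha>\<^sup>2 * t * sin \<alpha>" using d by linarith
  have "cos \<alpha> - cos \<alpha> * r = cos \<alpha> * (1 - r)" by (simp add: algebra_simps)
  also have "\<dots> \<le> 1 * (1 - r)" using r trig by (intro mult_right_mono) auto
  also have "\<dots> < \<alpha>\<^sup>2 * t * sin \<alpha>" using 1 by simp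
  also have "\<dots> = \<alpha>\<^sup>2 * sin \<alpha> * t" by simp
  finally have "cos \<alpha> < \<alpha>\<^sup>2 * sin \<alpha> * t + cos \<alpha> * r" by simp
  then show "cos \<alpha> < Hf \<alpha> (pt t (gm t))" by (simp add: Hf_def r_def)
qed

text \<open>The two values of \<open>Nf\<close> agree with \<open>sin \<alpha>\<close> up to
  O(\<alpha>^2) and the two heights with each other up to O(\<alpha>); so the quotients under the
  arctangents differ by O(\<alpha>^2), one order less than the angles themselves.\<close>

lemma thf_symmetry:
  assumes \<sigma>: "\<sigma> \<in> J"
  shows "\<bar>thf \<alpha> (top \<sigma>) - thf \<alpha> (top (pi - \<sigma>))\<bar> \<le> 7 * K\<^sup>2 * \<alpha>\<^sup>2"
proof -
  note \<tau> = sym(1)[OF \<sigma>]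
  define y1 y2 N1 N2 where d: "y1 = y \<sigma>" "y2 = y (pi - \<sigma>)" "N1 = Nf \<alpha> (top \<sigma>)" "N2 = Nf \<alpha> (top (pi - \<sigma>))"
  have N: "97 / 100 * \<alpha> \<le> N1" "97 / 100 * \<alpha> \<le> N2" "N1 \<le> 101 / 100 * \<alpha>"
    using ell_bounds(6,7)[OF top_ell[OF \<sigma>]] ell_bounds(6,7)[OF top_ell[OF \<tau>]] by (simp_all add: d)
  have N0: "0 < N1" "0 < N2" using N \<alpha> by (auto simp: less_le_trans[rotated])
  have near: "\<bar>Nf \<alpha> z - sin \<alpha>\<bar> \<le> 2 * K * \<alpha>\<^sup>2" if z: "z \<in> ell" for z
  proof -
    have r: "0 \<le> rr \<alpha> z" "rr \<alpha> z \<le> 1" "(rr \<alpha> z)\<^sup>2 = 1 - \<alpha>^4 * ((z $ 1)\<^sup>2 + (z $ 2)\<^sup>2)"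
      using ell_bounds(3,4)[OF z] rr_sq[OF ell_bounds(5)[OF z]] by simp_all
    have "(rr \<alpha> z)\<^sup>2 \<le> rr \<alpha> z" using mult_left_le[OF r(2,1)] unfolding power2_eq_square .
    moreover have "\<alpha>^4 * ((z $ 1)\<^sup>2 + (z $ 2)\<^sup>2) = (\<alpha>\<^sup>2 * \<bar>z $ 1\<bar>)\<^sup>2 + (\<alpha>\<^sup>2 * z $ 2)\<^sup>2"
      by (simp add: power_mult_distrib distrib_left flip: power_mult)
    moreover have "(\<alpha>\<^sup>2 * \<bar>z $ 1\<bar>)\<^sup>2 \<le> (\<alpha> / 1000000)\<^sup>2" using ell_bounds(1)[OF z] by (intro power_mono) auto
    moreover have "(\<alpha> / 1000000)\<^sup>2 = \<alpha>\<^sup>2 / 1000000000000" by (simp add: power_divide)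
    ultimately have "1 - rr \<alpha> z \<le> \<alpha>\<^sup>2"
      using ell_bounds(2)[OF z] r(3) zero_le_power2[of \<alpha>] by linarith
    then have "sin \<alpha> * (1 - rr \<alpha> z) \<le> 1 * \<alpha>\<^sup>2" using trig r by (intro mult_mono) auto
    moreover have "0 \<le> sin \<alpha> * (1 - rr \<alpha> z)" using trig r by simp
    moreover have "\<bar>\<alpha>\<^sup>2 * cos \<alpha> * z $ 1\<bar> \<le> K * \<alpha>\<^sup>2"
    proof -
      have "\<bar>\<alpha>\<^sup>2 * cos \<alpha> * z $ 1\<bar> = \<alpha>\<^sup>2 * (cos \<alpha> * \<bar>z $ 1\<bar>)" using trig by (simp add: abs_mult)
      also have "\<dots> \<le> \<alpha>\<^sup>2 * (1 * K)"
        using trig z a by (intro mult_left_mono mult_mono) (auto simp: ell_def)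
      finally show ?thesis by (simp add: mult_ac)
    qed
    moreover have "Nf \<alpha> z - sin \<alpha> = - (sin \<alpha> * (1 - rr \<alpha> z)) - \<alpha>\<^sup>2 * cos \<alpha> * z $ 1"
      by (simp add: Nf_def algebra_simps)
    moreover have "1 * \<alpha>\<^sup>2 \<le> K * \<alpha>\<^sup>2" using K by (intro mult_right_mono) auto
    ultimately show ?thesis by linarith
  qed
  have Nd: "\<bar>N2 - N1\<bar> \<le> 4 * K * \<alpha>\<^sup>2"
    using near[OF top_ell[OF \<sigma>]] near[OF top_ell[OF \<tau>]] by (simp add: d abs_le_iff)
  have yd: "\<bar>y1 - y2\<bar> \<le> K * \<alpha>" using sym(3)[OF \<sigma>] by (simp add: d)
  have "K * sin \<sigma> \<le> K * 1" using K by (intro mult_left_mono) auto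
  then have y1: "\<bar>y1\<bar> \<le> K" using yb(3)[OF \<sigma>] y_J(1)[OF \<sigma>] by (simp add: d)
  have "9 / 10 * \<alpha>\<^sup>2 \<le> 97 / 100 * (97 / 100) * \<alpha>\<^sup>2" by (intro mult_right_mono) auto
  also have "\<dots> = 97 / 100 * \<alpha> * (97 / 100 * \<alpha>)" by (simp add: power2_eq_square)
  also have "\<dots> \<le> N1 * N2" using N N0 \<alpha> by (intro mult_mono) auto
  finally have NN: "9 / 10 * \<alpha>\<^sup>2 \<le> N1 * N2" .
  have "\<alpha>\<^sup>2 * y1 / N1 - \<alpha>\<^sup>2 * y2 / N2 = \<alpha>\<^sup>2 * (y1 * (N2 - N1) + (y1 - y2) * N1) / (N1 * N2)"
    using N0 by (simp add: field_simps)
  then have "\<bar>\<alpha>\<^sup>2 * y1 / N1 - \<alpha>\<^sup>2 * y2 / N2\<bar> = \<alpha>\<^sup>2 * \<bar>y1 * (N2 - N1) + (y1 - y2) * N1\<bar> / (N1 * N2)"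
    using N0 by (simp add: abs_mult)
  also have "\<dots> \<le> \<alpha>\<^sup>2 * (6 * K\<^sup>2 * \<alpha>\<^sup>2) / (9 / 10 * \<alpha>\<^sup>2)"
  proof (intro frac_le mult_left_mono)
    have "\<bar>y1 * (N2 - N1)\<bar> \<le> K * (4 * K * \<alpha>\<^sup>2)" "\<bar>(y1 - y2) * N1\<bar> \<le> K * \<alpha> * (101 / 100 * \<alpha>)"
      unfolding abs_mult using y1 Nd yd N N0 K \<alpha> by (intro mult_mono; simp)+
    moreover have "K * \<alpha> * (101 / 100 * \<alpha>) \<le> K * K * \<alpha> * (2 * \<alpha>)"
      using K \<alpha> by (intro mult_mono) auto
    moreover have "K * (4 * K * \<alpha>\<^sup>2) = 4 * (K\<^sup>2 * \<alpha>\<^sup>2)" "K * K * \<alpha> * (2 * \<alpha>) = 2 * (K\<^sup>2 * \<alpha>\<^sup>2)"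
      "6 * K\<^sup>2 * \<alpha>\<^sup>2 = 6 * (K\<^sup>2 * \<alpha>\<^sup>2)"
      by (simp_all add: power2_eq_square)
    moreover note abs_triangle_ineq[of "y1 * (N2 - N1)" "(y1 - y2) * N1"]
    ultimately show "\<bar>y1 * (N2 - N1) + (y1 - y2) * N1\<bar> \<le> 6 * K\<^sup>2 * \<alpha>\<^sup>2"
      by linarith
  qed (use NN \<alpha> K in auto)
  also have "\<dots> \<le> 7 * K\<^sup>2 * \<alpha>\<^sup>2" using \<alpha> K by simp
  finally show ?thesis
    using abs_arctan_diff_le[of "\<alpha>\<^sup>2 * y1 / N1" "\<alpha>\<^sup>2 * y2 / N2"] by (simp add: thf_def d)
qed

text \<open>Let \<sigma> be the foot of \<open>(t, 0)\<close>. The reflected parameter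
  \<open>pi - \<sigma>\<close> has the level of \<open>(- t, 0)\<close> up to O(\<alpha>), which on
  the arcsine scale is O(sqrt \<alpha>), uniformly up to the ends. The clock angles at the two feet
  differ by O(\<alpha>^2). Since \<open>F\<close> varies vertically with a rate of order \<alpha>,
  the factor \<alpha> of \<open>Th_lipschitz\<close> is divided away.\<close>

lemma gm_small:
  assumes t: "- a < t" "t < a" shows "\<bar>gm t\<bar> \<le> 1000 * K^9 * sqrt \<alpha>"
proof -
  have el: "pt t 0 \<in> ell" "pt (- t) 0 \<in> ell" using t by (auto intro!: axis_ell)
  obtain \<sigma> where \<sigma>: "\<sigma> \<in> J" "xi (top \<sigma>) = xi (pt t 0)" by (rule foot[OF el(1)])
  note \<tau> = sym(1)[OF \<sigma>(1)]
  let ?v = "xi (pt (- t) 0)" and ?w = "xi (top (pi - \<sigma>))"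
  define E where "E = K^9 * \<alpha>"
  have "\<bar>xi (pt t 0) - t / a\<bar> \<le> 5 * E" "\<bar>?v - (- t) / a\<bar> \<le> 5 * E"
    using xi_bounds(3)[OF el(1)] xi_bounds(3)[OF el(2)] by (simp_all add: E_def)
  moreover have "\<bar>xi (top \<sigma>) - x \<sigma> / a\<bar> \<le> 5 * E" "\<bar>?w - x (pi - \<sigma>) / a\<bar> \<le> 5 * E"
    using xi_bounds(3)[OF top_ell[OF \<sigma>(1)]] xi_bounds(3)[OF top_ell[OF \<tau>]] by (simp_all add: E_def)
  moreover have "\<bar>x \<sigma> / a + x (pi - \<sigma>) / a\<bar> \<le> E"
  proof -
    have "\<bar>x \<sigma> / a + x (pi - \<sigma>) / a\<bar> = \<bar>x \<sigma> + x (pi - \<sigma>)\<bar> * (1 / a)"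
      using a_pos by (simp add: abs_divide flip: add_divide_distrib)
    also have "\<dots> \<le> K * \<alpha> * K" using sym(2)[OF \<sigma>(1)] inv_a a_pos \<alpha> K by (intro mult_mono) auto
    also have "\<dots> = K^2 * \<alpha>" by (simp add: power2_eq_square)
    also have "\<dots> \<le> E" unfolding E_def using K \<alpha> by (intro mult_right_mono power_increasing) auto
    finally show ?thesis .
  qed
  moreover have "0 \<le> E" using K \<alpha> by (simp add: E_def)
  ultimately have "\<bar>?v - ?w\<bar> \<le> 25 * E" using \<sigma>(2) by (simp add: abs_le_iff)
  also have "\<dots> \<le> (5 * K^5)\<^sup>2 * \<alpha>"
  proof -
    have "K^9 * \<alpha> \<le> K^10 * \<alpha>" using K \<alpha> by (intro mult_right_mono power_increasing) auto
    then show ?thesis by (simp add: E_def power_mult_distrib flip: power_mult)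
  qed
  finally have "sqrt \<bar>?v - ?w\<bar> \<le> sqrt ((5 * K^5)\<^sup>2 * \<alpha>)" by (rule real_sqrt_le_mono)
  also have "\<dots> = 5 * K^5 * sqrt \<alpha>" unfolding real_sqrt_mult real_sqrt_abs using K by simp
  finally have sq: "8 * sqrt \<bar>?v - ?w\<bar> \<le> 8 * (5 * K^5 * sqrt \<alpha>)" by (intro mult_left_mono) auto
  have xr: "?v \<in> {-1..1}" "?w \<in> {-1..1}" by (rule xi_range(1)[OF el(2)] xi_range(1)[OF top_ell[OF \<tau>]])+
  have "\<bar>Th ?v - Th ?w\<bar> \<le> 12 * (K^4 * \<alpha>) * (8 * (5 * K^5 * sqrt \<alpha>))"
    by (rule order_trans[OF Th_lipschitz[OF xr] mult_left_mono[OF order_trans[OF arcsin_holder[OF xr] sq]]])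
      (use K \<alpha> in simp)
  also have "\<dots> = \<alpha> * (480 * K^9 * sqrt \<alpha>)" by (simp add: eval_nat_numeral)
  finally have 1: "\<bar>Th ?v - Th ?w\<bar> \<le> \<alpha> * (480 * K^9 * sqrt \<alpha>)" .
  have 2: "\<bar>Th (xi (pt t 0)) - Th ?w\<bar> \<le> \<alpha> * (7 * K^9 * sqrt \<alpha>)"
  proof -
    have "\<bar>Th (xi (pt t 0)) - Th ?w\<bar> \<le> 7 * K\<^sup>2 * \<alpha>\<^sup>2"
      using thf_symmetry[OF \<sigma>(1)] unfolding Th_top[OF \<tau>] \<sigma>(2)[symmetric] Th_top[OF \<sigma>(1)] .
    also have "\<dots> = 7 * K\<^sup>2 * (\<alpha> * (sqrt \<alpha> * sqrt \<alpha>))" using \<alpha> by (simp add: power2_eq_square)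
    also have "\<dots> \<le> 7 * K^9 * (\<alpha> * (1 * sqrt \<alpha>))"
      using K \<alpha> alpha_small by (intro mult_mono power_increasing mult_left_mono mult_right_mono) auto
    finally show ?thesis by (simp add: mult_ac)
  qed
  have "\<alpha> * (480 * K^9 * sqrt \<alpha>) + \<alpha> * (7 * K^9 * sqrt \<alpha>) = \<alpha> * (487 * K^9 * sqrt \<alpha>)"
    by (simp add: algebra_simps)
  then have "\<bar>F t 0\<bar> \<le> \<alpha> * (487 * K^9 * sqrt \<alpha>)"
    unfolding F_axis using 1 2 by linarith
  then have "\<alpha> * (\<bar>gm t\<bar> / 2) \<le> \<alpha> * (487 * K^9 * sqrt \<alpha>)" using gm_le_F[OF t] by simp
  then have "\<bar>gm t\<bar> / 2 \<le> 487 * K^9 * sqrt \<alpha>" using \<alpha> by simp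
  moreover have "0 \<le> K^9 * sqrt \<alpha>" using K \<alpha> by simp
  ultimately show ?thesis by simp
qed

end

section \<open>Total derivative of the difference of the two times\<close>

lemma rr_has_derivative:
  assumes p: "0 < rr \<alpha> (pt t s)"
  shows "((\<lambda>q. rr \<alpha> (pt (fst q) (snd q))) has_derivative
    (\<lambda>h. - (\<alpha>^4 * (t * fst h + s * snd h)) / rr \<alpha> (pt t s))) (at (t, s))"
proof -
  let ?Q = "\<lambda>q :: real \<times> real. 1 - \<alpha>^4 * (fst q * fst q + snd q * snd q)"
  have pos: "0 < ?Q (t, s)"
    using p unfolding rr_def vector_2 power2_eq_square real_sqrt_gt_0_iff by simp
  have "(?Q has_derivative (\<lambda>h. 0 - \<alpha>^4 * ((fst (t, s) * fst h + fst h * fst (t, s)) + (snd (t, s) * snd h + snd h * snd (t, s))))) (at (t, s))"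
    by (intro has_derivative_diff has_derivative_const has_derivative_mult_right has_derivative_add has_derivative_mult
        has_derivative_fst has_derivative_snd has_derivative_ident)
  from DERIV_compose_FDERIV[OF DERIV_real_sqrt[OF pos] this]
  have d: "((\<lambda>q. sqrt (?Q q)) has_derivative
    (\<lambda>h. (0 - \<alpha>^4 * ((fst (t, s) * fst h + fst h * fst (t, s)) + (snd (t, s) * snd h + snd h * snd (t, s)))) * (inverse (sqrt (?Q (t, s))) / 2))) (at (t, s))" .
  have e: "(0 - c * ((t * u + u * t) + (s * v + v * s))) * (inverse R / 2) = - (c * (t * u + s * v)) / R" for c u v R
    by (cases "R = 0") (simp_all add: field_simps)
  show ?thesis
    unfolding rr_def vector_2 power2_eq_square using d[unfolded fst_conv snd_conv e] .
qed

context front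
begin

text \<open>The derivative of \<open>xi\<close> at \<open>z\<close> in the direction
  \<open>(u, v)\<close>. An explicit formula, as for \<open>dN\<close> and \<open>dthf\<close>,
  makes its continuity in \<open>z\<close> visible.\<close>

definition dxi :: "real^2 \<Rightarrow> real \<Rightarrow> real \<Rightarrow> real" where
  "dxi z u v = u / a - kap * (z $ 1 * u + z $ 2 * v) / rr \<alpha> z"

definition dN :: "real^2 \<Rightarrow> real \<Rightarrow> real \<Rightarrow> real" where
  "dN z u v = - (sin \<alpha> * \<alpha>^4 * (z $ 1 * u + z $ 2 * v) / rr \<alpha> z) - \<alpha>\<^sup>2 * cos \<alpha> * u"

definition dthf :: "real^2 \<Rightarrow> real \<Rightarrow> real \<Rightarrow> real" where
  "dthf z u v = (\<alpha>\<^sup>2 * v * Nf \<alpha> z - \<alpha>\<^sup>2 * z $ 2 * dN z u v) / ((Nf \<alpha> z)\<^sup>2 + (\<alpha>\<^sup>2 * z $ 2)\<^sup>2)"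

lemma linear_two: "dxi z u v = dxi z 1 0 * u + dxi z 0 1 * v" "dthf z u v = dthf z 1 0 * u + dthf z 0 1 * v"
  "dxi z (- u) (- v) = - dxi z u v" "dthf z (- u) (- v) = - dthf z u v"
proof -
  have n: "dN z u v = dN z 1 0 * u + dN z 0 1 * v" for u v
    unfolding dN_def by (simp add: add_divide_distrib algebra_simps)
  show x: "dxi z u v = dxi z 1 0 * u + dxi z 0 1 * v" for u v
    unfolding dxi_def by (simp add: add_divide_distrib algebra_simps)
  show t: "dthf z u v = dthf z 1 0 * u + dthf z 0 1 * v" for u v
    unfolding dthf_def n[of u v] times_divide_eq_left add_divide_distrib[symmetric] by (simp add: algebra_simps)
  show "dxi z (- u) (- v) = - dxi z u v" unfolding x[of "- u" "- v"] x[of u v] by simp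
  show "dthf z (- u) (- v) = - dthf z u v" unfolding t[of "- u" "- v"] t[of u v] by simp
qed

lemma xi_has_derivative:
  assumes "pt t s \<in> ell"
  shows "((\<lambda>q. xi (pt (fst q) (snd q))) has_derivative (\<lambda>h. dxi (pt t s) (fst h) (snd h))) (at (t, s))"
proof -
  have r: "0 < rr \<alpha> (pt t s)" using ell_bounds(3)[OF assms] by linarith
  have "((\<lambda>q. fst q / a + kap / \<alpha>^4 * (rr \<alpha> (pt (fst q) (snd q)) - r0)) has_derivative
    (\<lambda>h. fst h / a + kap / \<alpha>^4 * (- (\<alpha>^4 * (t * fst h + s * snd h)) / rr \<alpha> (pt t s) - 0))) (at (t, s))"
    using a_pos by (intro has_derivative_add has_derivative_mult_right has_derivative_diff has_derivative_const
        rr_has_derivative[OF r] has_derivative_fst has_derivative_ident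
        bounded_linear.has_derivative[OF bounded_linear_divide])
  moreover have "u / a + kap / \<alpha>^4 * (- (\<alpha>^4 * (t * u + s * v)) / rr \<alpha> (pt t s) - 0) = dxi (pt t s) u v" for u v
    using \<alpha> by (simp add: dxi_def)
  ultimately show ?thesis unfolding xi_alt[abs_def] vector_2 by simp
qed

lemma thf_has_derivative:
  assumes "pt t s \<in> ell"
  shows "((\<lambda>q. thf \<alpha> (pt (fst q) (snd q))) has_derivative (\<lambda>h. dthf (pt t s) (fst h) (snd h))) (at (t, s))"
proof -
  have r: "0 < rr \<alpha> (pt t s)" using ell_bounds(3)[OF assms] by linarith
  let ?N = "Nf \<alpha> (pt t s)"
  have N: "0 < ?N" using ell_bounds(6)[OF assms] \<alpha> by (simp add: less_le_trans[rotated])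
  have "((\<lambda>q. sin \<alpha> * rr \<alpha> (pt (fst q) (snd q)) - \<alpha>\<^sup>2 * cos \<alpha> * fst q) has_derivative
    (\<lambda>h. sin \<alpha> * (- (\<alpha>^4 * (t * fst h + s * snd h)) / rr \<alpha> (pt t s)) - \<alpha>\<^sup>2 * cos \<alpha> * fst h)) (at (t, s))"
    by (intro has_derivative_diff has_derivative_mult_right rr_has_derivative[OF r] has_derivative_fst has_derivative_ident)
  then have dN: "((\<lambda>q. Nf \<alpha> (pt (fst q) (snd q))) has_derivative (\<lambda>h. dN (pt t s) (fst h) (snd h))) (at (t, s))"
    unfolding Nf_def[abs_def] dN_def vector_2 by (simp add: mult_ac)
  have "((\<lambda>q. (\<alpha>\<^sup>2 * snd q) / Nf \<alpha> (pt (fst q) (snd q))) has_derivative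
    (\<lambda>h. ((\<alpha>\<^sup>2 * snd h) * Nf \<alpha> (pt (fst (t, s)) (snd (t, s))) - (\<alpha>\<^sup>2 * snd (t, s)) * dN (pt t s) (fst h) (snd h))
      / (Nf \<alpha> (pt (fst (t, s)) (snd (t, s))) * Nf \<alpha> (pt (fst (t, s)) (snd (t, s)))))) (at (t, s))"
    by (rule has_derivative_divide'[OF has_derivative_mult_right[OF has_derivative_snd[OF has_derivative_ident]] dN])
      (use N in simp)
  from DERIV_compose_FDERIV[OF DERIV_arctan this]
  have "((\<lambda>q. arctan ((\<alpha>\<^sup>2 * snd q) / Nf \<alpha> (pt (fst q) (snd q)))) has_derivative
    (\<lambda>h. ((\<alpha>\<^sup>2 * snd h) * ?N - (\<alpha>\<^sup>2 * s) * dN (pt t s) (fst h) (snd h))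
      / (?N * ?N) * inverse (1 + ((\<alpha>\<^sup>2 * s) / ?N)\<^sup>2))) (at (t, s))" by simp
  moreover have "X / (?N * ?N) * inverse (1 + (Y / ?N)\<^sup>2) = X / (?N\<^sup>2 + Y\<^sup>2)" for X Y
  proof -
    have "1 + (Y / ?N)\<^sup>2 = (?N\<^sup>2 + Y\<^sup>2) / ?N\<^sup>2"
      using N by (simp add: power_divide add_divide_distrib)
    then have "inverse (1 + (Y / ?N)\<^sup>2) = ?N\<^sup>2 / (?N\<^sup>2 + Y\<^sup>2)" by simp
    then show ?thesis using N by (simp add: power2_eq_square)
  qed
  ultimately show ?thesis unfolding thf_def[abs_def] dthf_def vector_2 by simp
qed

text \<open>The derivative of \<open>F\<close> in the direction \<open>(u, v)\<close>. The slopes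
  \<open>l\<close> and \<open>r\<close> of \<open>Th\<close> at the levels of \<open>z\<close> and
  \<open>- z\<close> are parameters, since at the origin both levels coincide with that of the
  corner and each slope has to be taken from its own branch.\<close>

definition W1 :: "real \<Rightarrow> real \<Rightarrow> real^2 \<Rightarrow> real \<Rightarrow> real \<Rightarrow> real" where
  "W1 l r z u v = l * dxi z u v - dthf z u v + (r * dxi (- z) u v - dthf (- z) u v)"

lemma F_has_derivative:
  assumes e: "pt t s \<in> ell" and l: "(Th has_real_derivative l) (at (xi (pt t s)))"
    and r: "(Th has_real_derivative r) (at (xi (pt (- t) (- s))))"
  shows "((\<lambda>q. F (fst q) (snd q)) has_derivative
    (\<lambda>h. W1 l r (pt t s) 1 0 * fst h + W1 l r (pt t s) 0 1 * snd h)) (at (t, s))"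
proof -
  have e': "pt (fst (- (t, s))) (snd (- (t, s))) \<in> ell" using ell_pt_uminus[OF e] by simp
  have neg: "((\<lambda>q :: real \<times> real. - q) has_derivative (\<lambda>h. - h)) (at (t, s))"
    by (intro has_derivative_minus has_derivative_ident)
  have V: "((\<lambda>q. V (pt (fst q) (snd q))) has_derivative (\<lambda>h. dxi (pt t s) (fst h) (snd h) * l - dthf (pt t s) (fst h) (snd h))) (at (t, s))"
    if "pt t s \<in> ell" "(Th has_real_derivative l) (at (xi (pt t s)))" for t s l
  proof -
    have "((\<lambda>q. Th (xi (pt (fst q) (snd q)))) has_derivative (\<lambda>h. dxi (pt t s) (fst h) (snd h) * l)) (at (t, s))"
      by (rule DERIV_compose_FDERIV[OF _ xi_has_derivative[OF that(1)]]) (use that(2) in simp)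
    then show ?thesis unfolding V_def by (rule has_derivative_diff[OF _ thf_has_derivative[OF that(1)]])
  qed
  have "((\<lambda>q. V (pt (fst (- q)) (snd (- q)))) has_derivative
    (\<lambda>h. dxi (pt (- t) (- s)) (fst (- h)) (snd (- h)) * r - dthf (pt (- t) (- s)) (fst (- h)) (snd (- h)))) (at (t, s))"
    by (rule has_derivative_compose[OF neg, where g="\<lambda>q. V (pt (fst q) (snd q))"])
      (use V[OF ell_pt_uminus[OF e] r] in simp)
  from has_derivative_diff[OF V[OF e l] this]
  have "((\<lambda>q. F (fst q) (snd q)) has_derivative
    (\<lambda>h. (dxi (pt t s) (fst h) (snd h) * l - dthf (pt t s) (fst h) (snd h)) -
       (dxi (pt (- t) (- s)) (- fst h) (- snd h) * r - dthf (pt (- t) (- s)) (- fst h) (- snd h)))) (at (t, s))"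
    unfolding F_def by simp
  moreover have "(dxi z u v * l - dthf z u v) - (dxi w (- u) (- v) * r - dthf w (- u) (- v))
     = (l * dxi z 1 0 - dthf z 1 0 + (r * dxi w 1 0 - dthf w 1 0)) * u + (l * dxi z 0 1 - dthf z 0 1 + (r * dxi w 0 1 - dthf w 0 1)) * v" for z w u v
    unfolding linear_two(3,4) linear_two(1,2)[of _ u v] by (simp add: algebra_simps)
  ultimately show ?thesis unfolding W1_def minus_pt by simp
qed

text \<open>The sign comes from \<open>F_decreasing\<close>: a larger derivative would make
  \<open>F t v + \<alpha> / 2 * v\<close> increase to the right of \<open>v = s\<close>.\<close>

lemma W1_negative:
  assumes p: "pt t s \<in> R" and l: "(Th has_real_derivative l) (at (xi (pt t s)))"
    and r: "(Th has_real_derivative r) (at (xi (pt (- t) (- s))))"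
  shows "W1 l r (pt t s) 0 1 \<le> - (\<alpha> / 2)"
proof (rule ccontr)
  assume "\<not> ?thesis"
  then have pos: "0 < W1 l r (pt t s) 0 1 + \<alpha> / 2" by simp
  have i: "((\<lambda>v. (t, v)) has_derivative (\<lambda>h. (0, h))) (at s)"
    by (intro has_derivative_Pair has_derivative_const has_derivative_ident)
  have "((\<lambda>v. F (fst (t, v)) (snd (t, v))) has_derivative
      (\<lambda>h. W1 l r (pt t s) 1 0 * fst (0 :: real, h) + W1 l r (pt t s) 0 1 * snd (0 :: real, h))) (at s)"
    by (rule has_derivative_compose[OF i]) (use F_has_derivative[OF R_ell[OF p] l r] in simp)
  then have "((\<lambda>v. F t v) has_real_derivative W1 l r (pt t s) 0 1) (at s)"
    unfolding has_field_derivative_def by simp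
  from DERIV_add[OF this DERIV_cmult[OF DERIV_ident, of "\<alpha> / 2"]]
  have D: "((\<lambda>v. F t v + \<alpha> / 2 * v) has_real_derivative W1 l r (pt t s) 0 1 + \<alpha> / 2) (at s)" by simp
  obtain d where d: "0 < d" "\<And>h. 0 < h \<Longrightarrow> h < d \<Longrightarrow> F t s + \<alpha> / 2 * s < F t (s + h) + \<alpha> / 2 * (s + h)"
    using DERIV_pos_inc_right[OF D pos] by auto
  have "open {v. pt t v \<in> R}"
    by (rule open_vimage[OF open_R, of "\<lambda>v. pt t v", unfolded vimage_def]) (intro continuous_intros)
  then obtain e where e: "0 < e" "\<And>v. dist v s < e \<Longrightarrow> pt t v \<in> R"
    using p unfolding open_dist by auto
  define h where "h = min d e / 2"
  have h: "0 < h" "h < d" "h < e" using d(1) e(1) by (auto simp: h_def)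
  have "pt t (s + h) \<in> R" using h by (intro e(2)) (simp add: dist_real_def)
  then have "\<alpha> / 2 * ((s + h) - s) \<le> F t s - F t (s + h)"
    using R_less[OF p] R_ell[OF p] R_ell[OF \<open>pt t (s + h) \<in> R\<close>] h(1) by (intro F_decreasing) auto
  moreover have "\<alpha> / 2 * ((s + h) - s) = \<alpha> / 2 * (s + h) - \<alpha> / 2 * s" by (simp add: algebra_simps)
  ultimately show False using d(2)[OF h(1,2)] by linarith
qed

lemma continuous_on_W1:
  assumes "continuous_on A l" "continuous_on A r" "continuous_on A z" "\<And>t. t \<in> A \<Longrightarrow> z t \<in> ell"
  shows "continuous_on A (\<lambda>t. W1 (l t) (r t) (z t) u v)"
proof -
  have x: "continuous_on A (\<lambda>t. dxi (z t) u v)" and th: "continuous_on A (\<lambda>t. dthf (z t) u v)"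
    if z: "continuous_on A z" "\<And>t. t \<in> A \<Longrightarrow> z t \<in> ell" for z
  proof -
    have r: "rr \<alpha> (z t) \<noteq> 0" if "t \<in> A" for t using ell_bounds(3)[OF z(2)[OF that]] by auto
    have n: "(Nf \<alpha> (z t))\<^sup>2 + (\<alpha>\<^sup>2 * z t $ 2)\<^sup>2 \<noteq> 0" if "t \<in> A" for t
      using ell_bounds(6)[OF z(2)[OF that]] \<alpha> by (simp add: add_nonneg_eq_0_iff zero_less_mult_iff)
    show "continuous_on A (\<lambda>t. dxi (z t) u v)"
      unfolding dxi_def using r a_pos by (intro continuous_intros continuous_on_rr z) auto
    show "continuous_on A (\<lambda>t. dthf (z t) u v)"
      unfolding dthf_def dN_def Nf_def
      by (intro continuous_intros continuous_on_rr z) (use r n[unfolded Nf_def] in auto)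
  qed
  show ?thesis
    unfolding W1_def using assms
    by (intro continuous_on_add continuous_on_diff continuous_on_mult x th continuous_on_minus)
      (auto intro: ell_uminus)
qed

end

text \<open>The conclusion for one value of \<alpha>. The argument \<open>p\<close> is the starting
  point of one of the optimal trajectories to the origin; within the bounded quantifiers the same
  letter denotes a target.\<close>

definition synthesis :: "real \<Rightarrow> (real^2) set \<Rightarrow> real^2 \<Rightarrow> (real^2) set \<Rightarrow> bool" where
  "synthesis \<alpha> S p M \<longleftrightarrow> overlap_curve \<alpha> S M \<and>
     (\<forall>p\<in>inside S. optimal_trajectories \<alpha> S p \<noteq> {}) \<and>
     (\<exists>A B. above_below S M A B \<and>
        (\<forall>p\<in>A. \<forall>T z u. time_optimal \<alpha> S p T z u \<longrightarrow> (AE t in lebesgue_on {0..T}. u t = - 1)) \<and>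
        (\<forall>p\<in>B. \<forall>T z u. time_optimal \<alpha> S p T z u \<longrightarrow> (AE t in lebesgue_on {0..T}. u t = 1))) \<and>
     0 \<in> inside S \<and> card (optimal_trajectories \<alpha> S 0) = 2 \<and>
     (\<exists>x y. optimal_trajectories \<alpha> S 0 = {x, y} \<and> snd x 0 = p \<and> snd y 0 = - p)"

context front
begin

lemma xi_less_iff: "xi p < xi q \<longleftrightarrow> Hf \<alpha> p < Hf \<alpha> q"
proof -
  have c: "0 < \<alpha>\<^sup>2 * sin \<alpha> * a" using \<alpha> trig a_pos by simp
  show ?thesis unfolding xi_def divide_less_cancel using c order.asym[OF c] by force
qed

lemma junction: "top s1 = top s2" "s1 \<in> J" "s2 \<in> J"
  using ends s1 s2 by auto

text \<open>The junction has the level of the origin, so higher levels occur on the right branch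
  only. The junction itself belongs to both branches; it counts as \<open>s2\<close> here and as
  \<open>s1\<close> in \<open>left_foot\<close>.\<close>

lemma right_foot:
  assumes z: "z \<in> ell" "\<bar>z $ 1\<bar> < a" and H: "cos \<alpha> \<le> Hf \<alpha> z"
  obtains \<sigma> where "\<sigma> \<in> {s2..<pi}" "xi (top \<sigma>) = xi z" "cos \<alpha> < Hf \<alpha> z \<Longrightarrow> s2 < \<sigma>"
proof -
  obtain \<sigma> where \<sigma>: "\<sigma> \<in> J" "xi (top \<sigma>) = xi z" by (rule foot[OF z(1)])
  have le: "\<not> xi z < xi (top s1)" using H unfolding xi_less_iff lev by simp
  have st: "cos \<alpha> < Hf \<alpha> z \<Longrightarrow> xi (top s2) < xi z"
    unfolding xi_less_iff junction(1)[symmetric] lev .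
  show ?thesis
  proof (cases "\<sigma> \<le> s1")
    case True
    then have "xi (top \<sigma>) \<le> xi (top s1)" using xt.f_le[of \<sigma>] \<sigma>(1) s2 by auto
    then have "xi (top s2) = xi z" using le \<sigma>(2) junction(1) by simp
    then show ?thesis using st s2 by (intro that[of s2]) auto
  next
    case False
    then have s: "s2 \<le> \<sigma>" "\<sigma> \<le> pi" using \<sigma>(1) by auto
    moreover have "\<sigma> \<noteq> pi" using xi_range(2)[OF z] \<sigma>(2) xi_ends(2) by auto
    ultimately show ?thesis using st \<sigma>(2) by (intro that[of \<sigma>]) (auto simp: less_le)
  qed
qed

lemma left_foot:
  assumes z: "z \<in> ell" "\<bar>z $ 1\<bar> < a" and H: "Hf \<alpha> z \<le> cos \<alpha>"
  obtains \<sigma> where "\<sigma> \<in> {0<..s1}" "xi (top \<sigma>) = xi z" "Hf \<alpha> z < cos \<alpha> \<Longrightarrow> \<sigma> < s1"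
proof -
  obtain \<sigma> where \<sigma>: "\<sigma> \<in> J" "xi (top \<sigma>) = xi z" by (rule foot[OF z(1)])
  have le: "\<not> xi (top s1) < xi z" using H unfolding xi_less_iff lev by simp
  have st: "Hf \<alpha> z < cos \<alpha> \<Longrightarrow> xi z < xi (top s1)"
    unfolding xi_less_iff lev .
  show ?thesis
  proof (cases "\<sigma> \<le> s1")
    case True
    then have s: "0 \<le> \<sigma>" using \<sigma>(1) s2 by auto
    moreover have "\<sigma> \<noteq> 0" using xi_range(2)[OF z] \<sigma>(2) xi_ends(1) by auto
    ultimately show ?thesis using st \<sigma>(2) True by (intro that[of \<sigma>]) (auto simp: less_le)
  next
    case False
    then have "xi (top s1) \<le> xi (top \<sigma>)" using xt.f_ge[of \<sigma>] \<sigma>(1) by auto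
    then have "xi (top s1) = xi z" using le \<sigma>(2) by simp
    then show ?thesis using st s1 by (intro that[of s1]) auto
  qed
qed

lemma continuous_on_tops: "continuous_on J xit'" "continuous_on J tht'"
proof -
  have c: "continuous_on J x" "continuous_on J y"
    by (intro continuous_at_imp_continuous_on ballI DERIV_isCont[OF dx] DERIV_isCont[OF dy])+
  have c': "continuous_on J x'" "continuous_on J y'"
    by (rule continuous_on_subset[OF cx' subset_UNIV] continuous_on_subset[OF cy' subset_UNIV])+
  have r: "rr \<alpha> (top \<sigma>) \<noteq> 0" if "\<sigma> \<in> J" for \<sigma> using top_pos(1)[OF that] by simp
  have n: "(Nf \<alpha> (top \<sigma>))\<^sup>2 + (\<alpha>\<^sup>2 * y \<sigma>)\<^sup>2 \<noteq> 0" if "\<sigma> \<in> J" for \<sigma>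
    using top_pos(2)[OF that] by (simp add: add_nonneg_eq_0_iff)
  show "continuous_on J xit'"
    unfolding xit'_def using r a_pos by (intro continuous_intros continuous_on_rr c c') auto
  show "continuous_on J tht'"
    unfolding tht'_def Nt'_def Nf_def
    by (intro continuous_intros continuous_on_rr c c') (use r n[unfolded Nf_def] in auto)
qed

text \<open>The slope of \<open>Th\<close> along the right branch, extended continuously to the
  junction, where \<open>Th\<close> may have a corner. The end \<open>pi\<close> is left out,
  because the speed of the level vanishes there.\<close>

lemma right_branch:
  obtains L where "continuous_on ((\<lambda>\<sigma>. xi (top \<sigma>)) ` {s2..<pi}) L"
    "\<And>\<sigma>. s2 < \<sigma> \<Longrightarrow> \<sigma> < pi \<Longrightarrow> (Th has_real_derivative L (xi (top \<sigma>))) (at (xi (top \<sigma>)))"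
proof -
  have J: "\<sigma> \<in> J" if "\<sigma> \<in> {s2..pi}" for \<sigma> using that by simp
  have nz: "xit' \<sigma> \<noteq> 0" if "\<sigma> \<in> {s2..<pi}" for \<sigma>
  proof -
    have "0 < 1 / (2 * K\<^sup>2) * sin \<sigma>" using that s2 K by (simp add: sin_gt_zero)
    then show ?thesis using xt.bnd(1)[of \<sigma>] that by auto
  qed
  obtain L where "continuous_on ((\<lambda>\<sigma>. xi (top \<sigma>)) ` {s2..<pi}) L"
    "\<And>\<sigma>. \<sigma> \<in> {s2..<pi} \<Longrightarrow> s2 < \<sigma> \<Longrightarrow> \<sigma> < pi \<Longrightarrow> (Th has_real_derivative L (xi (top \<sigma>))) (at (xi (top \<sigma>)))"
    by (rule branch_derivative[where p=s2 and q=pi and U="{s2..<pi}", OF DERIV_xi_top[OF J] DERIV_thf_top[OF J]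
          continuous_on_subset[OF continuous_on_tops(1)] continuous_on_subset[OF continuous_on_tops(2)]
          xt.right(1) _ nz Th_top[OF J]]) auto
  then show ?thesis using that by force
qed

lemma left_branch:
  obtains L where "continuous_on ((\<lambda>\<sigma>. xi (top \<sigma>)) ` {0<..s1}) L"
    "\<And>\<sigma>. 0 < \<sigma> \<Longrightarrow> \<sigma> < s1 \<Longrightarrow> (Th has_real_derivative L (xi (top \<sigma>))) (at (xi (top \<sigma>)))"
proof -
  have J: "\<sigma> \<in> J" if "\<sigma> \<in> {0..s1}" for \<sigma> using that by simp
  have nz: "xit' \<sigma> \<noteq> 0" if "\<sigma> \<in> {0<..s1}" for \<sigma>
  proof -
    have "0 < 1 / (2 * K\<^sup>2) * sin \<sigma>" using that s1 K by (simp add: sin_gt_zero)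
    then show ?thesis using xt.bnd(1)[of \<sigma>] that by auto
  qed
  obtain L where "continuous_on ((\<lambda>\<sigma>. xi (top \<sigma>)) ` {0<..s1}) L"
    "\<And>\<sigma>. \<sigma> \<in> {0<..s1} \<Longrightarrow> 0 < \<sigma> \<Longrightarrow> \<sigma> < s1 \<Longrightarrow> (Th has_real_derivative L (xi (top \<sigma>))) (at (xi (top \<sigma>)))"
    by (rule branch_derivative[where p=0 and q=s1 and U="{0<..s1}", OF DERIV_xi_top[OF J] DERIV_thf_top[OF J]
          continuous_on_subset[OF continuous_on_tops(1)] continuous_on_subset[OF continuous_on_tops(2)]
          xt.left(1) _ nz Th_top[OF J]]) auto
  then show ?thesis using that by force
qed

lemma Hf_0: "Hf \<alpha> 0 = cos \<alpha>"
  by (simp add: Hf_def rr_def)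

lemma pt_0: "pt 0 0 = 0"
  by (simp add: vec_eq_iff forall_2)

text \<open>For \<open>t > 0\<close> the curve meets the right branch at \<open>z\<close> and the
  left branch at \<open>- z\<close>, by \<open>Hf_overlap\<close>, so that \<open>F\<close> is
  differentiable there. With the branchwise slopes all ingredients of the derivative extend
  continuously to \<open>t = 0\<close>.\<close>

lemma gm_right_derivative:
  obtains G where "continuous_on {0..<a} G" "\<And>t. 0 < t \<Longrightarrow> t < a \<Longrightarrow> (gm has_real_derivative G t) (at t)"
proof -
  obtain LR where LR: "continuous_on ((\<lambda>\<sigma>. xi (top \<sigma>)) ` {s2..<pi}) LR"
    "\<And>\<sigma>. s2 < \<sigma> \<Longrightarrow> \<sigma> < pi \<Longrightarrow> (Th has_real_derivative LR (xi (top \<sigma>))) (at (xi (top \<sigma>)))"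
    by (rule right_branch) blast
  obtain LL where LL: "continuous_on ((\<lambda>\<sigma>. xi (top \<sigma>)) ` {0<..s1}) LL"
    "\<And>\<sigma>. 0 < \<sigma> \<Longrightarrow> \<sigma> < s1 \<Longrightarrow> (Th has_real_derivative LL (xi (top \<sigma>))) (at (xi (top \<sigma>)))"
    by (rule left_branch) blast
  define p where "p t = pt t (gm t)" for t
  have p: "p t \<in> ell" "\<bar>p t $ 1\<bar> < a" "- p t \<in> ell" "\<bar>(- p t) $ 1\<bar> < a" "p t \<in> R" if "0 \<le> t" "t < a" for t
    using that gm_R[of t] R_ell[OF gm_R[of t]] ell_uminus[OF R_ell[OF gm_R[of t]]] by (auto simp: p_def)
  have H': "cos \<alpha> < Hf \<alpha> (p t)" "Hf \<alpha> (- p t) < cos \<alpha>" if "0 < t" "t < a" for t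
    using Hf_overlap[OF that] by (simp_all add: p_def minus_pt)
  have H: "cos \<alpha> \<le> Hf \<alpha> (p t)" "Hf \<alpha> (- p t) \<le> cos \<alpha>" if "0 \<le> t" "t < a" for t
    using H'[of t] that by (cases "t = 0"; simp add: p_def gm_0 pt_0 Hf_0)+
  have imR: "xi (p t) \<in> (\<lambda>\<sigma>. xi (top \<sigma>)) ` {s2..<pi}" if t: "0 \<le> t" "t < a" for t
  proof -
    obtain \<sigma> where "\<sigma> \<in> {s2..<pi}" "xi (top \<sigma>) = xi (p t)" by (rule right_foot[OF p(1,2)[OF t] H(1)[OF t]])
    then show ?thesis by (intro image_eqI[of _ _ \<sigma>]) auto
  qed
  have imL: "xi (- p t) \<in> (\<lambda>\<sigma>. xi (top \<sigma>)) ` {0<..s1}" if t: "0 \<le> t" "t < a" for t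
  proof -
    obtain \<sigma> where "\<sigma> \<in> {0<..s1}" "xi (top \<sigma>) = xi (- p t)" by (rule left_foot[OF p(3,4)[OF t] H(2)[OF t]])
    then show ?thesis by (intro image_eqI[of _ _ \<sigma>]) auto
  qed
  define l r where "l t = LR (xi (p t))" and "r t = LL (xi (- p t))" for t
  have cp: "continuous_on {0..<a} p"
    unfolding p_def by (intro continuous_intros continuous_on_subset[OF gm_cont]) (use a_pos in auto)
  have cl: "continuous_on {0..<a} l"
    unfolding l_def by (rule continuous_on_compose2[OF LR(1) continuous_on_compose2[OF continuous_on_xi[of UNIV] cp]]) (use imR in auto)
  have cr: "continuous_on {0..<a} r"
    unfolding r_def by (rule continuous_on_compose2[OF LL(1) continuous_on_compose2[OF continuous_on_xi[of UNIV] continuous_on_minus[OF cp]]]) (use imL in auto)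
  have cW: "continuous_on {0..<a} (\<lambda>t. W1 (l t) (r t) (p t) u v)" for u v
    by (intro continuous_on_W1 cl cr cp) (use p(1) in auto)
  have dl: "(Th has_real_derivative l t) (at (xi (p t)))" and dr: "(Th has_real_derivative r t) (at (xi (- p t)))"
    if t: "0 < t" "t < a" for t
  proof -
    have t0: "0 \<le> t" using t by simp
    obtain \<sigma> where s: "\<sigma> \<in> {s2..<pi}" "xi (top \<sigma>) = xi (p t)" "cos \<alpha> < Hf \<alpha> (p t) \<Longrightarrow> s2 < \<sigma>"
      by (rule right_foot[OF p(1,2)[OF t0 t(2)] H(1)[OF t0 t(2)]]) blast
    show "(Th has_real_derivative l t) (at (xi (p t)))"
      using LR(2)[of \<sigma>] s H'(1)[OF t] unfolding l_def by simp
    obtain \<tau> where s: "\<tau> \<in> {0<..s1}" "xi (top \<tau>) = xi (- p t)" "Hf \<alpha> (- p t) < cos \<alpha> \<Longrightarrow> \<tau> < s1"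
      by (rule left_foot[OF p(3,4)[OF t0 t(2)] H(2)[OF t0 t(2)]]) blast
    show "(Th has_real_derivative r t) (at (xi (- p t)))"
      using LL(2)[of \<tau>] s H'(2)[OF t] unfolding r_def by simp
  qed
  have neg: "W1 (l t) (r t) (p t) 0 1 \<le> - (\<alpha> / 2)" if t: "0 < t" "t < a" for t
    using W1_negative[of t "gm t" "l t" "r t"] dl[OF t] dr[OF t] gm_R[of t] t by (simp add: p_def minus_pt)
  \<comment> \<open>At \<open>t = 0\<close> the function \<open>Th\<close> need not be
    differentiable; the bound is inherited from \<open>t > 0\<close> by continuity of the extended
    slopes.\<close>
  have neg0: "W1 (l t) (r t) (p t) 0 1 \<le> - (\<alpha> / 2)" if t: "0 \<le> t" "t < a" for t
  proof (cases "t = 0")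
    case True
    have cl: "closure {0<..a/2} = {0..a/2}" using a_pos by simp
    have "W1 (l 0) (r 0) (p 0) 0 1 \<le> - (\<alpha> / 2)"
    proof (rule continuous_le_on_closure[where f="\<lambda>t. W1 (l t) (r t) (p t) 0 1" and S="{0<..a/2}"])
      show "continuous_on (closure {0<..a/2}) (\<lambda>t. W1 (l t) (r t) (p t) 0 1)"
        unfolding cl by (rule continuous_on_subset[OF cW]) (use a_pos in auto)
      show "0 \<in> closure {0<..a/2}" unfolding cl using a_pos by simp
    qed (use neg a_pos in auto)
    then show ?thesis using True by simp
  qed (use neg t in auto)
  define G where "G t = - W1 (l t) (r t) (p t) 1 0 / W1 (l t) (r t) (p t) 0 1" for t
  have "continuous_on {0..<a} G"
    unfolding G_def by (intro continuous_on_divide continuous_on_minus cW) (use neg0 \<alpha> in force)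
  moreover have "(gm has_real_derivative G t) (at t)" if t: "0 < t" "t < a" for t
  proof -
    have t': "- a < t" using t by simp
    have "((\<lambda>q. F (fst q) (snd q)) has_derivative
      (\<lambda>h. W1 (l t) (r t) (p t) 1 0 * fst h + W1 (l t) (r t) (p t) 0 1 * snd h)) (at (t, gm t))"
      using F_has_derivative[of t "gm t" "l t" "r t"] dl[OF t] dr[OF t] p(1)[of t] t by (simp add: p_def minus_pt)
    moreover have "W1 (l t) (r t) (p t) 0 1 \<noteq> 0" using neg[OF t] \<alpha> by linarith
    moreover have "isCont gm t" by (rule gm_isCont[OF t' t(2)])
    moreover have "\<forall>\<^sub>F s in nhds t. F (fst (s, gm s)) (snd (s, gm s)) = 0"
    proof (rule eventually_mono[OF eventually_nhds_in_open[of "{-a<..<a}"]])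
      show "F (fst (s, gm s)) (snd (s, gm s)) = 0" if "s \<in> {-a<..<a}" for s
        using gm(3)[of s] that by simp
    qed (use t in auto)
    ultimately show ?thesis unfolding G_def by (rule implicit_deriv)
  qed
  ultimately show ?thesis by (rule that)
qed

text \<open>Negative \<open>t\<close> are covered by oddness, which makes the derivative even. At 0
  the one-sided limits of the derivative therefore coincide, and the rule of l'Hospital turns them
  into the derivative.\<close>

lemma gm_C1:
  obtains G where "continuous_on {-a<..<a} G" "\<And>t. - a < t \<Longrightarrow> t < a \<Longrightarrow> (gm has_real_derivative G t) (at t)"
proof -
  obtain G where G: "continuous_on {0..<a} G" "\<And>t. 0 < t \<Longrightarrow> t < a \<Longrightarrow> (gm has_real_derivative G t) (at t)"
    by (rule gm_right_derivative) blast
  have c: "continuous_on {-a<..<a} (\<lambda>t. G \<bar>t\<bar>)"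
    by (rule continuous_on_compose2[OF G(1)]) (auto intro!: continuous_intros)
  have nz: "(gm has_real_derivative G \<bar>t\<bar>) (at t)" if t: "- a < t" "t < a" "t \<noteq> 0" for t
  proof (cases "0 < t")
    case False
    have "((\<lambda>s. - s) has_real_derivative - 1) (at t)" by (rule DERIV_minus[OF DERIV_ident])
    moreover have "(gm has_real_derivative G (- t)) (at (- t))" using False t by (intro G(2)) auto
    ultimately have "((\<lambda>s. gm (- s)) has_real_derivative G (- t) * - 1) (at t)"
      by (rule DERIV_chain2[rotated])
    from DERIV_minus[OF this] have d: "((\<lambda>s. - gm (- s)) has_real_derivative G \<bar>t\<bar>) (at t)" using False by simp
    have "(gm has_real_derivative G \<bar>t\<bar>) (at t) \<longleftrightarrow> ((\<lambda>s. - gm (- s)) has_real_derivative G \<bar>t\<bar>) (at t)"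
    proof (rule DERIV_cong_ev[OF refl _ refl])
      show "\<forall>\<^sub>F s in nhds t. gm s = - gm (- s)"
      proof (rule eventually_mono[OF eventually_nhds_in_open[of "{-a<..<a}"]])
        show "gm s = - gm (- s)" if "s \<in> {-a<..<a}" for s using gm_odd[of s] that by simp
      qed (use t in auto)
    qed
    then show ?thesis using d by simp
  qed (use G(2) t in simp)
  have ev: "\<forall>\<^sub>F t in at 0. - a < t \<and> t < a \<and> t \<noteq> 0"
    using a_pos by (auto simp: eventually_at dist_real_def intro!: exI[of _ a])
  have "isCont (\<lambda>t. G \<bar>t\<bar>) 0" using c a_pos by (simp add: continuous_on_eq_continuous_at)
  then have lim: "((\<lambda>t. G \<bar>t\<bar> / 1) \<longlongrightarrow> G \<bar>0\<bar>) (at 0)" by (simp add: isCont_def)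
  have "((\<lambda>t. gm t / t) \<longlongrightarrow> G \<bar>0\<bar>) (at 0)"
  proof (rule lhopital[where f'="\<lambda>t. G \<bar>t\<bar>" and g'="\<lambda>_. 1"])
    show "(gm \<longlongrightarrow> 0) (at 0)" using gm_isCont[of 0] a_pos gm_0 by (simp add: isCont_def)
    show "((\<lambda>t :: real. t) \<longlongrightarrow> 0) (at 0)" by (rule tendsto_ident_at)
    show "\<forall>\<^sub>F t in at 0. (gm has_real_derivative G \<bar>t\<bar>) (at t)" using ev by (rule eventually_mono) (use nz in auto)
    show "((\<lambda>t. G \<bar>t\<bar> / 1) \<longlongrightarrow> G \<bar>0\<bar>) (at 0)" by (rule lim)
  qed (use ev in \<open>auto elim: eventually_mono\<close>)
  then have "(gm has_real_derivative G \<bar>0\<bar>) (at 0)" by (simp add: DERIV_def gm_0)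
  then have "(gm has_real_derivative G \<bar>t\<bar>) (at t)" if "- a < t" "t < a" for t using nz that by (cases "t = 0") auto
  then show ?thesis using that c by blast
qed

section \<open>The synthesis for a single front\<close>

definition M :: "(real^2) set" where "M = graph gm {-a<..<a}"

lemma C1_curve_M: "C1_curve M"
  unfolding C1_curve_def
proof (intro ballI)
  fix p assume p: "p \<in> M"
  obtain G where G: "continuous_on {-a<..<a} G" "\<And>t. - a < t \<Longrightarrow> t < a \<Longrightarrow> (gm has_real_derivative G t) (at t)"
    by (rule gm_C1) blast
  let ?\<phi> = "\<lambda>t. pt t (gm t)" and ?\<phi>' = "\<lambda>t. pt 1 (G t)" and ?\<psi> = "\<lambda>z :: real^2. z $ 1"
  have "homeomorphism {-a<..<a} (M \<inter> UNIV) ?\<phi> ?\<psi>"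
    by (rule homeomorphismI) (auto simp: M_def graph_def intro!: continuous_intros gm_cont)
  moreover have "(?\<phi> has_vector_derivative ?\<phi>' t) (at t) \<and> ?\<phi>' t \<noteq> 0" if "t \<in> {-a<..<a}" for t
  proof
    show "(?\<phi> has_vector_derivative ?\<phi>' t) (at t)"
      by (rule has_vector_derivative_pt[OF DERIV_ident G(2)]) (use that in auto)
    show "?\<phi>' t \<noteq> 0" unfolding pt_0[symmetric] by simp
  qed
  moreover have "continuous_on {-a<..<a} ?\<phi>'" by (intro continuous_intros G(1))
  ultimately show "\<exists>U a b \<phi> \<phi>' \<psi>. open U \<and> p \<in> U \<and> a < b \<and> homeomorphism {a<..<b} (M \<inter> U) \<phi> \<psi> \<and>
      (\<forall>t\<in>{a<..<b}. (\<phi> has_vector_derivative \<phi>' t) (at t) \<and> \<phi>' t \<noteq> 0) \<and> continuous_on {a<..<b} \<phi>'"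
    using a_pos by (intro exI[of _ UNIV] exI[of _ "-a"] exI[of _ a] exI[of _ ?\<phi>] exI[of _ ?\<phi>'] exI[of _ ?\<psi>]) auto
qed

lemma V_M: "p \<in> M \<Longrightarrow> p \<in> R \<and> V p = V (- p)"
  using gm_R gm(3) by (auto simp: M_def graph_def F_def minus_pt)

lemma overlap_curve_M: "overlap_curve \<alpha> S M"
  unfolding overlap_curve_def
proof (intro conjI C1_curve_M)
  show "connected M"
    unfolding M_def graph_def by (intro connected_continuous_image continuous_intros gm_cont) auto
  show "M \<subseteq> {p \<in> inside S. \<exists>x\<in>optimal_trajectories \<alpha> S p. \<exists>y\<in>optimal_trajectories \<alpha> S p. x \<noteq> y}"
  proof
    fix p assume "p \<in> M"
    then have p: "p \<in> R" "V p = V (- p)" using V_M by auto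
    have "bang p \<noteq> bang' p" using optimal_trajectories_tie(2)[OF p] by auto
    then have "\<exists>x\<in>optimal_trajectories \<alpha> S p. \<exists>y\<in>optimal_trajectories \<alpha> S p. x \<noteq> y"
      unfolding optimal_trajectories_tie(1)[OF p] by auto
    then show "p \<in> {p \<in> inside S. \<exists>x\<in>optimal_trajectories \<alpha> S p. \<exists>y\<in>optimal_trajectories \<alpha> S p. x \<noteq> y}"
      unfolding inside_S using p(1) by simp
  qed
qed

lemma above_control:
  assumes p: "p \<in> between a gm gt" and o: "time_optimal \<alpha> S p T z u"
  shows "AE t in lebesgue_on {0..T}. u t = - 1"
proof -
  have t: "- a < p $ 1" "p $ 1 < a" and g: "gm (p $ 1) < p $ 2" "p $ 2 < gt (p $ 1)" using p by (auto simp: between_def)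
  have R: "p \<in> R" using t g gm(1)[OF t] by (simp add: R_def between_def)
  have "\<alpha> / 2 * (p $ 2 - gm (p $ 1)) \<le> F (p $ 1) (gm (p $ 1)) - F (p $ 1) (p $ 2)"
    using t g R_ell[OF gm_R[OF t]] R_ell[OF R] by (intro F_decreasing) auto
  moreover have "0 < \<alpha> / 2 * (p $ 2 - gm (p $ 1))" using \<alpha> g by simp
  moreover have "F (p $ 1) (p $ 2) = V p - V (- p)" by (simp add: F_def flip: minus_pt)
  ultimately have "V p < V (- p)" using gm(3)[OF t] by linarith
  then show ?thesis using time_optimalD[OF o R] by auto
qed

lemma below_control:
  assumes p: "p \<in> between a gb gm" and o: "time_optimal \<alpha> S p T z u"
  shows "AE t in lebesgue_on {0..T}. u t = 1"
proof -
  have t: "- a < p $ 1" "p $ 1 < a" and g: "gb (p $ 1) < p $ 2" "p $ 2 < gm (p $ 1)" using p by (auto simp: between_def)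
  have R: "p \<in> R" using t g gm(2)[OF t] by (simp add: R_def between_def)
  have "\<alpha> / 2 * (gm (p $ 1) - p $ 2) \<le> F (p $ 1) (p $ 2) - F (p $ 1) (gm (p $ 1))"
    using t g R_ell[OF gm_R[OF t]] R_ell[OF R] by (intro F_decreasing) auto
  moreover have "0 < \<alpha> / 2 * (gm (p $ 1) - p $ 2)" using \<alpha> g by simp
  moreover have "F (p $ 1) (p $ 2) = V p - V (- p)" by (simp add: F_def flip: minus_pt)
  ultimately have "V (- p) < V p" using gm(3)[OF t] by linarith
  then show ?thesis using time_optimalD[OF o R] by auto
qed

text \<open>Leaves room between the overlap curve and the junction point, whose height is at least
  \<open>1 / (2 * K\<^sup>2)\<close>. The thirtieth power in \<open>small\<close> is spent here: its
  square root bounds \<open>K^15 * sqrt \<alpha>\<close> by 1/1000, and \<open>16 \<le> K^4\<close>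
  absorbs the numerical factors.\<close>

lemma gm_below_top:
  assumes "2 \<le> K" obtains h where "0 < h" "h < y s1" "\<And>t. - a < t \<Longrightarrow> t < a \<Longrightarrow> \<bar>gm t\<bar> < h"
proof -
  define b where "b = 1000 * K^9 * sqrt \<alpha>"
  have b0: "0 < b" using K \<alpha> by (simp add: b_def)
  have "(K^15 * sqrt \<alpha>)\<^sup>2 \<le> (1 / 1000)\<^sup>2"
    using small \<alpha> by (simp add: power_mult_distrib power_divide flip: power_mult)
  then have k: "K^15 * sqrt \<alpha> \<le> 1 / 1000" by (rule power2_le_imp_le) simp
  have "2^4 \<le> K^4" using assms by (intro power_mono) auto
  then have "K^11 * sqrt \<alpha> * 16 \<le> K^11 * sqrt \<alpha> * K^4" using K \<alpha> by (intro mult_left_mono) auto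
  also have "\<dots> = K^15 * sqrt \<alpha>" by (simp add: eval_nat_numeral)
  finally have "2 * K\<^sup>2 * b \<le> 1 / 8" using k by (simp add: b_def eval_nat_numeral)
  then have bK: "b < 1 / (2 * K\<^sup>2)" using K by (simp add: field_simps)
  have "1 / K * (1 / 2) \<le> (1 - cos s1) * (1 + cos s1)" using far(1) s1(3) K by (intro mult_mono) auto
  then have q: "1 / (2 * K) \<le> (sin s1)\<^sup>2" unfolding sin_squared_eq by (simp add: power2_eq_square algebra_simps)
  have "(1 / (2 * K))\<^sup>2 \<le> 1 / (2 * K)" using K by (simp add: power2_eq_square field_simps)
  then have "(1 / (2 * K))\<^sup>2 \<le> (sin s1)\<^sup>2" using q by linarith
  then have "1 / (2 * K) \<le> sin s1" by (rule power2_le_imp_le) (use s1 in \<open>simp add: sin_ge_zero\<close>)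
  then have "1 / K * (1 / (2 * K)) \<le> 1 / K * sin s1" using K by (intro mult_left_mono) auto
  then have "1 / (2 * K\<^sup>2) \<le> y s1" using yb(2)[OF junction(2)] by (simp add: power2_eq_square)
  then have bs: "b < y s1" using bK by linarith
  show ?thesis
  proof (rule that[of "(b + y s1) / 2"])
    show "0 < (b + y s1) / 2" "(b + y s1) / 2 < y s1" using bs b0 by auto
    fix t assume "- a < t" "t < a"
    from gm_small[OF this] have "\<bar>gm t\<bar> \<le> b" unfolding b_def .
    also have "b < (b + y s1) / 2" using bs by simp
    finally show "\<bar>gm t\<bar> < (b + y s1) / 2" .
  qed
qed

lemma above_below_M:
  assumes K2: "2 \<le> K" shows "above_below S M (between a gm gt) (between a gb gm)"
proof -
  note c = components_between[OF a_pos gb_cont gt_cont _ _ gb_less_gt gm_cont gm(1,2)]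
  have e: "gb (- a) = gt (- a)" "gb a = gt a" by (simp_all add: gb_def gt_ends)
  obtain h where h: "0 < h" "h < y s1" "\<And>t. - a < t \<Longrightarrow> t < a \<Longrightarrow> \<bar>gm t\<bar> < h"
    by (rule gm_below_top[OF K2]) blast
  have xs: "- a < x s1" "x s1 < a" using xy.f_interior[OF junction(2)] s1 by auto
  \<comment> \<open>A point of the region that is higher than the whole curve: straight below the
    junction point, at the height \<open>h\<close> above all values of \<open>gm\<close>. Its mirror
    image \<open>- p\<close> serves for the other side.\<close>
  define p where "p = pt (x s1) h"
  have "gb (x s1) < 0" using gt_pos[of "- x s1"] xs by (simp add: gb_def)
  then have p: "p \<in> R" using xs h gt_x[OF junction(2)] by (simp add: p_def R_def between_def)
  have q: "\<bar>q $ 2\<bar> < h" if "q \<in> M" for q using that h(3) by (auto simp: M_def graph_def)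
  have "p \<in> {p \<in> R. \<forall>q\<in>M. q $ 2 < p $ 2}" using p q by (force simp: p_def)
  moreover have "- p \<in> {p \<in> R. \<forall>q\<in>M. p $ 2 < q $ 2}" using R_uminus[OF p] q by (force simp: p_def)
  moreover have "{p \<in> R. \<forall>q\<in>M. q $ 2 < p $ 2} \<subseteq> between a gm gt" "{p \<in> R. \<forall>q\<in>M. p $ 2 < q $ 2} \<subseteq> between a gb gm"
    by (auto simp: R_def between_def M_def graph_def)
  ultimately show ?thesis
    unfolding above_below_def inside_S
    using c(2)[OF e] c(1)[OF e, folded R_def M_def] by (intro conjI) (assumption | blast)+
qed

text \<open>The origin is its own mirror image, so that the two candidates tie; by
  \<open>lev\<close> its foot is the junction point.\<close>

lemma origin:
  "0 \<in> R" "0 \<in> M" "bang 0 0 = top s1" "bang' 0 0 = - top s1"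
  "optimal_trajectories \<alpha> S 0 = {(V 0, bang 0), (V 0, bang' 0)}" "card (optimal_trajectories \<alpha> S 0) = 2"
proof -
  show R: "0 \<in> R" using gm_R[of 0] a_pos by (simp add: gm_0 pt_0)
  show "0 \<in> M" using a_pos by (simp add: M_def in_graph gm_0)
  have f: "xi (top s1) = xi 0" unfolding xi_eq_iff lev Hf_0 ..
  show "bang 0 0 = top s1" by (rule bang_ends(1)[OF R junction(2) f])
  show "bang' 0 0 = - top s1" using bang'_trajectory(4)[OF R junction(2)] f by simp
  note t = optimal_trajectories_tie[OF R, simplified]
  show o: "optimal_trajectories \<alpha> S 0 = {(V 0, bang 0), (V 0, bang' 0)}" by (rule t(1))
  have "bang 0 \<noteq> bang' 0" using t(2) by auto
  then show "card (optimal_trajectories \<alpha> S 0) = 2" unfolding o by simp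
qed

lemma S_top: "S = top ` J \<union> uminus ` top ` J"
  unfolding S_def graph_gb graph_gt by blast

theorem front_synthesis:
  assumes "2 \<le> K"
  shows "synthesis \<alpha> (top ` J \<union> uminus ` top ` J) (top s1) (graph gm {-a<..<a})"
  unfolding synthesis_def S_top[symmetric] M_def[symmetric]
proof (intro conjI overlap_curve_M)
  show "\<forall>p\<in>inside S. optimal_trajectories \<alpha> S p \<noteq> {}" "0 \<in> inside S"
    unfolding inside_S using optimal_nonempty origin(1) by blast+
  show "card (optimal_trajectories \<alpha> S 0) = 2" by (rule origin(6))
  show "\<exists>x y. optimal_trajectories \<alpha> S 0 = {x, y} \<and> snd x 0 = top s1 \<and> snd y 0 = - top s1"
    using origin(3-5) by (intro exI[of _ "(V 0, bang 0)"] exI[of _ "(V 0, bang' 0)"]) simp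
  show "\<exists>A B. above_below S M A B \<and>
        (\<forall>p\<in>A. \<forall>T z u. time_optimal \<alpha> S p T z u \<longrightarrow> (AE t in lebesgue_on {0..T}. u t = - 1)) \<and>
        (\<forall>p\<in>B. \<forall>T z u. time_optimal \<alpha> S p T z u \<longrightarrow> (AE t in lebesgue_on {0..T}. u t = 1))"
    using above_below_M[OF assms] above_control below_control by blast
qed

end

section \<open>The front for small \<open>\<alpha>\<close>\<close>

lemma half_le_sin: "0 \<le> \<sigma> \<Longrightarrow> \<sigma> \<le> pi / 2 \<Longrightarrow> \<sigma> / 2 \<le> sin \<sigma>"
proof -
  assume s: "0 \<le> \<sigma>" "\<sigma> \<le> pi / 2"
  show ?thesis
  proof (cases "\<sigma> \<le> pi / 3")
    case True
    have "sin 0 - 0 / 2 \<le> sin \<sigma> - \<sigma> / 2"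
    proof (rule DERIV_nonneg_imp_nondecreasing[OF s(1)])
      fix r assume r: "0 \<le> r" "r \<le> \<sigma>"
      have "cos (pi / 3) \<le> cos r" using r True by (intro cos_monotone_0_pi_le) auto
      then show "\<exists>y. ((\<lambda>\<sigma>. sin \<sigma> - \<sigma> / 2) has_real_derivative y) (at r) \<and> 0 \<le> y"
        by (intro exI[of _ "cos r - 1 / 2"]) (auto intro!: derivative_eq_intros simp: cos_60)
    qed
    then show ?thesis by simp
  next
    case False
    then have "sin (pi / 3) \<le> sin \<sigma>" using s by (intro sin_monotone_2pi_le) auto
    moreover have "sqrt ((17/10)\<^sup>2) \<le> sqrt 3" by (intro real_sqrt_le_mono) (simp add: power2_eq_square)
    then have "17 / 20 \<le> sin (pi / 3)" by (simp add: sin_60)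
    moreover have "\<sigma> / 2 \<le> 8 / 10" using s pi_approx(2) by simp
    ultimately show ?thesis by linarith
  qed
qed

text \<open>The mean value theorem is applied from the nearer end, whose distance is at most
  \<open>2 * sin \<sigma>\<close>.\<close>

lemma bounded_by_sin:
  fixes f :: "real \<Rightarrow> real"
  assumes df: "\<And>\<sigma>. (f has_real_derivative f' \<sigma>) (at \<sigma>)" and e: "\<And>\<sigma>. 0 \<le> \<sigma> \<Longrightarrow> \<sigma> \<le> pi \<Longrightarrow> \<bar>f' \<sigma>\<bar> \<le> e"
    and 0: "f 0 = 0" "f pi = 0" and \<sigma>: "0 \<le> \<sigma>" "\<sigma> \<le> pi"
  shows "\<bar>f \<sigma>\<bar> \<le> 2 * e * sin \<sigma>"
proof -
  have mvt: "norm (f s - f t) \<le> e * norm (s - t)" if "s \<in> {0..pi}" "t \<in> {0..pi}" for s t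
    by (rule field_differentiable_bound[of "{0..pi}" f f'])
      (use that e in \<open>auto intro: has_field_derivative_at_within[OF df]\<close>)
  have e0: "0 \<le> e" using e[of 0] by simp
  show ?thesis
  proof (cases "\<sigma> \<le> pi / 2")
    case True
    have "\<bar>f \<sigma>\<bar> \<le> e * \<sigma>" using mvt[of \<sigma> 0] \<sigma> 0 by simp
    also have "\<dots> \<le> e * (2 * sin \<sigma>)" using half_le_sin[OF \<sigma>(1) True] e0 by (intro mult_left_mono) auto
    finally show ?thesis by simp
  next
    case False
    have "\<bar>f \<sigma>\<bar> \<le> e * (pi - \<sigma>)" using mvt[of \<sigma> pi] \<sigma> 0 by (simp add: abs_minus_commute)
    also have "\<dots> \<le> e * (2 * sin \<sigma>)" using half_le_sin[of "pi - \<sigma>"] False \<sigma> e0 by (intro mult_left_mono) auto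
    finally show ?thesis by simp
  qed
qed

section \<open>Continuity of the speeds, ends and fold of the front\<close>

context
  fixes C \<alpha> :: real
  assumes \<alpha>: "0 < \<alpha>" "\<alpha> < pi / 4"
begin

lemma continuous_on_atoms:
  "continuous_on UNIV (dil \<alpha>)" "continuous_on UNIV (eps \<alpha>)" "continuous_on UNIV (mu (Nfun C \<alpha>) \<alpha>)"
  "continuous_on UNIV (psi (Nfun C \<alpha>) \<alpha>)"
  by (intro continuous_at_imp_continuous_on ballI
      DERIV_isCont[OF DERIV_dil[OF \<alpha>]] DERIV_isCont[OF DERIV_eps[OF \<alpha>]] DERIV_isCont[OF DERIV_mu'[OF \<alpha>]]
      DERIV_isCont[OF DERIV_psi[OF \<alpha>]])+

lemma atoms_nonzero: "dil \<alpha> \<sigma> \<noteq> 0" "cos (eps \<alpha> \<sigma>) \<noteq> 0" "cos \<alpha> \<noteq> 0" "\<alpha> \<noteq> 0"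
  using dil_ge_1[OF \<alpha>, of \<sigma>] cos_eps_pos[OF \<alpha>, of \<sigma>] sin_cos_pos[OF \<alpha>] \<alpha> by auto

lemma continuous_on_normalised:
  "continuous_on UNIV (nQ C \<alpha>)" "continuous_on UNIV (nP C \<alpha>)" "continuous_on UNIV (nS C \<alpha>)" "continuous_on UNIV (nSd C \<alpha>)"
  "continuous_on UNIV (nPd C \<alpha>)" "continuous_on UNIV (nW C \<alpha>)" "continuous_on UNIV (nWd C \<alpha>)"
proof -
  note i = continuous_intros continuous_on_atoms
  show Q: "continuous_on UNIV (nQ C \<alpha>)" unfolding nQ_def by (intro i) (use atoms_nonzero in auto)
  show P: "continuous_on UNIV (nP C \<alpha>)" unfolding nP_def by (intro i) (use atoms_nonzero in auto)
  show S: "continuous_on UNIV (nS C \<alpha>)" unfolding nS_def by (intro i Q) (use atoms_nonzero in auto)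
  show Sd: "continuous_on UNIV (nSd C \<alpha>)" unfolding nSd_def by (intro i P Q) (use atoms_nonzero in auto)
  show "continuous_on UNIV (nPd C \<alpha>)" unfolding nPd_def by (intro i) (use atoms_nonzero in auto)
  show "continuous_on UNIV (nW C \<alpha>)" unfolding nW_def by (intro i S) (use atoms_nonzero in auto)
  show "continuous_on UNIV (nWd C \<alpha>)" unfolding nWd_def by (intro i S Sd P Q) (use atoms_nonzero in auto)
qed

text \<open>As a quotient by \<open>sin \<sigma>\<close> with a conventional value at the zeros,
  \<open>nZ\<close> may jump there, and \<open>nX\<close> with it. The factor
  \<open>sin \<sigma>\<close> restores \<open>sin psi\<close>, which is continuous.\<close>

lemma continuous_on_topx': "continuous_on UNIV (\<lambda>\<sigma>. sin \<sigma> * nX C \<alpha> \<sigma>)"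
proof -
  have "sin \<sigma> * nX C \<alpha> \<sigma> = sin \<sigma> * (nS C \<alpha> \<sigma> - cos \<sigma> * nSd C \<alpha> \<sigma> + \<alpha> * (cos (psi (Nfun C \<alpha>) \<alpha> \<sigma>) * nPd C \<alpha> \<sigma> * nS C \<alpha> \<sigma>)
      + (1 - cos (psi (Nfun C \<alpha>) \<alpha> \<sigma>)) * (cos \<alpha> * nWd C \<alpha> \<sigma>))
    + sin (psi (Nfun C \<alpha>) \<alpha> \<sigma>) * (cos \<sigma> * nS C \<alpha> \<sigma> + sin \<sigma> * (sin \<sigma> * nSd C \<alpha> \<sigma>) + nPd C \<alpha> \<sigma> * cos \<alpha> * nW C \<alpha> \<sigma>)" for \<sigma>
    unfolding sin_psi_nZ[OF \<alpha>] nX_def by (simp add: algebra_simps)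
  then show ?thesis
    by (simp only:) (intro continuous_intros continuous_on_atoms continuous_on_normalised)
qed

lemma continuous_on_topy': "continuous_on UNIV (nY C \<alpha>)"
proof -
  have eq: "nY C \<alpha> = (\<lambda>\<sigma>. (1 / cos \<alpha>) * (cos (psi (Nfun C \<alpha>) \<alpha> \<sigma>) * (cos \<sigma> * nS C \<alpha> \<sigma> + sin \<sigma> * (sin \<sigma> * nSd C \<alpha> \<sigma>))
       - \<alpha> * (sin (psi (Nfun C \<alpha>) \<alpha> \<sigma>) * (nPd C \<alpha> \<sigma> * (sin \<sigma> * nS C \<alpha> \<sigma>))))
     + cos (psi (Nfun C \<alpha>) \<alpha> \<sigma>) * nPd C \<alpha> \<sigma> * nW C \<alpha> \<sigma>
     + sin (psi (Nfun C \<alpha>) \<alpha> \<sigma>) * (sin \<sigma> * nWd C \<alpha> \<sigma>))"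
    by (rule ext, unfold sin_psi_nZ[OF \<alpha>] nY_def) (simp add: algebra_simps)
  show ?thesis
    unfolding eq by (intro continuous_intros continuous_on_atoms continuous_on_normalised) (use atoms_nonzero in auto)
qed

lemma top_ends:
  "topx (Nfun C \<alpha>) \<alpha> 0 = - (sin (2 * C * \<alpha>\<^sup>2) / \<alpha>\<^sup>2)" "topx (Nfun C \<alpha>) \<alpha> pi = sin (2 * C * \<alpha>\<^sup>2) / \<alpha>\<^sup>2"
  "topy (Nfun C \<alpha>) \<alpha> 0 = 0" "topy (Nfun C \<alpha>) \<alpha> pi = 0"
proof -
  have d: "dil \<alpha> 0 = 1" "dil \<alpha> pi = 1" "eps \<alpha> 0 = 0" "eps \<alpha> pi = 0" by (simp_all add: dil_def eps_def)
  have m: "mu (Nfun C \<alpha>) \<alpha> 0 = 2 * C * \<alpha>\<^sup>2" "mu (Nfun C \<alpha>) \<alpha> pi = 2 * C * \<alpha>\<^sup>2"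
    using mu_0[OF \<alpha>, of C] by (simp_all add: mu_def bet_def d)
  show "topx (Nfun C \<alpha>) \<alpha> 0 = - (sin (2 * C * \<alpha>\<^sup>2) / \<alpha>\<^sup>2)" "topx (Nfun C \<alpha>) \<alpha> pi = sin (2 * C * \<alpha>\<^sup>2) / \<alpha>\<^sup>2"
    "topy (Nfun C \<alpha>) \<alpha> 0 = 0" "topy (Nfun C \<alpha>) \<alpha> pi = 0"
    by (simp_all add: topx_def topy_def Sfac_def psi_def d m)
qed

text \<open>Where \<open>mu\<close> vanishes, the front passes through the level of the origin.\<close>

lemma top_level:
  assumes "mu n \<alpha> \<sigma> = 0"
  shows "Hf \<alpha> (pt (topx n \<alpha> \<sigma>) (topy n \<alpha> \<sigma>)) = cos \<alpha>"
    "topx n \<alpha> (pi - \<sigma>) = topx n \<alpha> \<sigma>" "topy n \<alpha> (pi - \<sigma>) = topy n \<alpha> \<sigma>"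
proof -
  have e: "eps \<alpha> (pi - \<sigma>) = eps \<alpha> \<sigma>" "dil \<alpha> (pi - \<sigma>) = dil \<alpha> \<sigma>" by (simp_all add: eps_def dil_def)
  have m: "mu n \<alpha> (pi - \<sigma>) = mu n \<alpha> \<sigma>" "psi n \<alpha> (pi - \<sigma>) = psi n \<alpha> \<sigma>" by (simp_all add: mu_def bet_def psi_def e)
  define c s where "c = cos (psi n \<alpha> \<sigma>)" and "s = sin (psi n \<alpha> \<sigma>)"
  have X: "topx n \<alpha> \<sigma> = (1 - c) * cos \<alpha> * sin \<alpha> / \<alpha>\<^sup>2" "topy n \<alpha> \<sigma> = s * sin \<alpha> / \<alpha>\<^sup>2"
    "topx n \<alpha> (pi - \<sigma>) = (1 - c) * cos \<alpha> * sin \<alpha> / \<alpha>\<^sup>2" "topy n \<alpha> (pi - \<sigma>) = s * sin \<alpha> / \<alpha>\<^sup>2"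
    using assms by (simp_all add: topx_def topy_def Sfac_def Wfac_def m e c_def s_def)
  show "topx n \<alpha> (pi - \<sigma>) = topx n \<alpha> \<sigma>" "topy n \<alpha> (pi - \<sigma>) = topy n \<alpha> \<sigma>" unfolding X by simp_all
  have cs: "s\<^sup>2 = 1 - c\<^sup>2" "- 1 \<le> c" "c \<le> 1" by (simp_all add: c_def s_def sin_squared_eq)
  have "sin \<alpha> < sin (pi / 4)" using \<alpha> by (intro sin_monotone_2pi) auto
  then have "(sin \<alpha>)\<^sup>2 \<le> (sin (pi / 4))\<^sup>2" using sin_cos_pos[OF \<alpha>] by (intro power_mono) auto
  also have "\<dots> = 1 / 2" by (simp add: sin_45 power_divide)
  finally have s2: "(sin \<alpha>)\<^sup>2 \<le> 1 / 2" .
  have "(sin \<alpha>)\<^sup>2 * (1 - c) \<le> 1 / 2 * 2" using s2 cs by (intro mult_mono) auto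
  then have q: "0 \<le> 1 - (sin \<alpha>)\<^sup>2 * (1 - c)" by simp
  have "\<alpha>^4 * ((A / \<alpha>\<^sup>2)\<^sup>2 + (B / \<alpha>\<^sup>2)\<^sup>2) = A\<^sup>2 + B\<^sup>2" for A B
    using \<alpha> by (simp add: power_divide distrib_left flip: power_mult)
  then have "rr \<alpha> (pt (topx n \<alpha> \<sigma>) (topy n \<alpha> \<sigma>)) = sqrt (1 - (((1 - c) * cos \<alpha> * sin \<alpha>)\<^sup>2 + (s * sin \<alpha>)\<^sup>2))"
    unfolding rr_def vector_2 X by simp
  also have "1 - (((1 - c) * cos \<alpha> * sin \<alpha>)\<^sup>2 + (s * sin \<alpha>)\<^sup>2) = (1 - (sin \<alpha>)\<^sup>2 * (1 - c))\<^sup>2"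
    unfolding power_mult_distrib cs(1) cos_squared_eq by (simp add: power2_eq_square algebra_simps)
  also have "sqrt \<dots> = 1 - (sin \<alpha>)\<^sup>2 * (1 - c)" using q by simp
  finally have r: "rr \<alpha> (pt (topx n \<alpha> \<sigma>) (topy n \<alpha> \<sigma>)) = 1 - (sin \<alpha>)\<^sup>2 * (1 - c)" .
  show "Hf \<alpha> (pt (topx n \<alpha> \<sigma>) (topy n \<alpha> \<sigma>)) = cos \<alpha>"
  proof -
    have *: "\<alpha>\<^sup>2 * sin \<alpha> * (D / \<alpha>\<^sup>2) = sin \<alpha> * D" for D using \<alpha> by simp
    show ?thesis unfolding Hf_def r vector_2 unfolding X(1) * by (simp add: power2_eq_square algebra_simps)
  qed
qed

end

context
  fixes C :: real
begin

text \<open>In the limit \<open>\<alpha> \<rightarrow> 0\<close> the front has speed \<open>(sin \<sigma> * slope \<sigma>, cos \<sigma> * slope \<sigma>)\<close>.\<close>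

definition slope :: "real \<Rightarrow> real" where "slope \<sigma> = 2 * C + pi - 3 * pi / 2 * (sin \<sigma>)\<^sup>2"

text \<open>The second coordinate of the limit curve.\<close>

definition Ly :: "real \<Rightarrow> real" where "Ly \<sigma> = sin \<sigma> * (pi + 2 * C - pi / 2 * (sin \<sigma>)\<^sup>2)"

lemma DERIV_Ly: "(Ly has_real_derivative cos \<sigma> * slope \<sigma>) (at \<sigma>)"
proof -
  have "(Ly has_real_derivative cos \<sigma> * (pi + 2 * C - pi / 2 * (sin \<sigma>)\<^sup>2) + sin \<sigma> * (- (pi / 2 * (2 * sin \<sigma> * cos \<sigma>)))) (at \<sigma>)"
    unfolding Ly_def[abs_def] by (auto intro!: derivative_eq_intros)
  then show ?thesis
    by (rule DERIV_cong) (simp add: slope_def power2_eq_square algebra_simps)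
qed

end

abbreviation front_of :: "real \<Rightarrow> real \<Rightarrow> real \<Rightarrow> real \<Rightarrow> real \<Rightarrow> bool" where
  "front_of C \<alpha> K s1 s2 \<equiv> front \<alpha> (sin (2 * C * \<alpha>\<^sup>2) / \<alpha>\<^sup>2) K s1 s2
     (topx (Nfun C \<alpha>) \<alpha>) (topy (Nfun C \<alpha>) \<alpha>) (\<lambda>\<sigma>. sin \<sigma> * nX C \<alpha> \<sigma>) (nY C \<alpha>)"

section \<open>Verification of the assumptions on the front for small \<alpha>\<close>

context
  fixes C \<alpha> K L \<delta> :: real
  assumes \<alpha>: "0 < \<alpha>" "\<alpha> < pi / 4" and C: "0 < C"
    and hX: "\<And>\<sigma>. 0 \<le> \<sigma> \<Longrightarrow> \<sigma> \<le> pi \<Longrightarrow> \<bar>nX C \<alpha> \<sigma> - slope C \<sigma>\<bar> \<le> L * \<alpha>"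
    and hY: "\<And>\<sigma>. 0 \<le> \<sigma> \<Longrightarrow> \<sigma> \<le> pi \<Longrightarrow> \<bar>nY C \<alpha> \<sigma> - cos \<sigma> * slope C \<sigma>\<bar> \<le> L * \<alpha>"
    and hM: "\<And>\<sigma>. 0 \<le> \<sigma> \<Longrightarrow> \<sigma> \<le> pi \<Longrightarrow> \<bar>mu (Nfun C \<alpha>) \<alpha> \<sigma> / \<alpha>\<^sup>2 - (2 * C - pi / 2 * (sin \<sigma>)\<^sup>2)\<bar> \<le> L * \<alpha>"
    and L: "0 \<le> L" "8 * L \<le> K" and \<delta>: "\<delta> = \<bar>pi - 4 * C\<bar> / 2" "0 < \<delta>" "2 / \<delta> \<le> K"
    and K: "2 * C + pi + 2 \<le> K" "4 / C \<le> K" and small: "1000000 * (K^30 * \<alpha>) \<le> 1"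
begin

lemma K5: "5 \<le> K" using K(1) C pi_gt3 by linarith

lemma K_small: "i \<le> 30 \<Longrightarrow> K^i * \<alpha> \<le> 1 / 1000000"
proof -
  assume "i \<le> 30"
  then have "K^i * \<alpha> \<le> K^30 * \<alpha>" using K5 \<alpha> by (intro mult_right_mono power_increasing) auto
  then show ?thesis using small by simp
qed

lemma \<delta>_K: "2 / K \<le> \<delta>"
  using \<delta>(2,3) K5 by (simp add: field_simps)

lemma L\<alpha>: "L * \<alpha> \<le> \<delta> / 1000" "L * \<alpha> \<le> 1 / 1000"
proof -
  have "K * (L * \<alpha>) \<le> K * (K * \<alpha>)" using L K5 \<alpha> by (intro mult_left_mono mult_right_mono) auto
  also have "\<dots> \<le> 2 / 1000" using K_small[of 2] by (simp add: power2_eq_square)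
  finally have "L * \<alpha> \<le> 2 / K / 1000" using K5 by (simp add: field_simps)
  then show "L * \<alpha> \<le> \<delta> / 1000" using \<delta>_K by simp
  have "L * \<alpha> \<le> K * \<alpha>" using L K5 \<alpha> by (intro mult_right_mono) auto
  then show "L * \<alpha> \<le> 1 / 1000" using K_small[of 1] by simp
qed

lemma slope_le: "slope C \<sigma> \<le> 2 * C + pi" "- (pi / 2) \<le> slope C \<sigma>"
proof -
  have "(sin \<sigma>)\<^sup>2 \<le> 1" by (simp add: abs_square_le_1)
  then have "3 * pi / 2 * (sin \<sigma>)\<^sup>2 \<le> 3 * pi / 2 * 1" by (intro mult_left_mono) auto
  moreover have "0 \<le> 3 * pi / 2 * (sin \<sigma>)\<^sup>2" by simp
  ultimately show "slope C \<sigma> \<le> 2 * C + pi" "- (pi / 2) \<le> slope C \<sigma>" unfolding slope_def using C by linarith+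
qed

lemma width: "1 / K \<le> sin (2 * C * \<alpha>\<^sup>2) / \<alpha>\<^sup>2" "sin (2 * C * \<alpha>\<^sup>2) / \<alpha>\<^sup>2 \<le> K"
proof -
  have a1: "\<alpha> \<le> 1" using K_small[of 0] by simp
  have "2 * C * \<alpha>\<^sup>2 \<le> K * \<alpha>" unfolding power2_eq_square mult.assoc[symmetric]
    using K C \<alpha> a1 pi_gt3 mult_mono[of "2 * C * \<alpha>" "K * 1" \<alpha> \<alpha>] mult_mono[of "2 * C" K \<alpha> 1] by simp
  then have u: "0 \<le> 2 * C * \<alpha>\<^sup>2" "2 * C * \<alpha>\<^sup>2 \<le> 1" using K_small[of 1] C by auto
  have "sin (2 * C * \<alpha>\<^sup>2) \<le> 2 * C * \<alpha>\<^sup>2" by (rule sin_x_le_x[OF u(1)])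
  then have "sin (2 * C * \<alpha>\<^sup>2) / \<alpha>\<^sup>2 \<le> 2 * C" using \<alpha> by (simp add: divide_le_eq)
  then show "sin (2 * C * \<alpha>\<^sup>2) / \<alpha>\<^sup>2 \<le> K" using K C pi_gt3 by linarith
  have "2 * C * \<alpha>\<^sup>2 / 2 \<le> sin (2 * C * \<alpha>\<^sup>2)" using u pi_gt3 by (intro half_le_sin) auto
  then have 1: "C \<le> sin (2 * C * \<alpha>\<^sup>2) / \<alpha>\<^sup>2" using \<alpha> by (simp add: le_divide_eq)
  have "1 / K \<le> 4 / K" using K5 by (simp add: divide_right_mono)
  also have "4 / K \<le> C" using K(2) C K5 by (simp add: field_simps)
  finally show "1 / K \<le> sin (2 * C * \<alpha>\<^sup>2) / \<alpha>\<^sup>2" using 1 by linarith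
qed

text \<open>In the limit the symmetry is exact, so the two combinations have derivatives of size
  O(\<alpha>), and both vanish at the ends.\<close>

lemma top_sym:
  assumes \<sigma>: "0 \<le> \<sigma>" "\<sigma> \<le> pi"
  shows "\<bar>topx (Nfun C \<alpha>) \<alpha> \<sigma> + topx (Nfun C \<alpha>) \<alpha> (pi - \<sigma>)\<bar> \<le> K * \<alpha>"
    "\<bar>topy (Nfun C \<alpha>) \<alpha> \<sigma> - topy (Nfun C \<alpha>) \<alpha> (pi - \<sigma>)\<bar> \<le> K * \<alpha>"
proof -
  let ?x = "topx (Nfun C \<alpha>) \<alpha>" and ?y = "topy (Nfun C \<alpha>) \<alpha>"
  have r: "((\<lambda>\<sigma>. pi - \<sigma>) has_real_derivative - 1) (at \<sigma>)" for \<sigma>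
    using DERIV_diff[OF DERIV_const DERIV_ident, of pi \<sigma>] by simp
  have s: "slope C (pi - \<sigma>) = slope C \<sigma>" for \<sigma> by (simp add: slope_def)
  have "\<bar>?x \<sigma> + ?x (pi - \<sigma>)\<bar> \<le> 2 * (2 * (L * \<alpha>)) * sin \<sigma>"
  proof (rule bounded_by_sin[OF _ _ _ _ \<sigma>])
    show "((\<lambda>\<sigma>. ?x \<sigma> + ?x (pi - \<sigma>)) has_real_derivative sin \<sigma> * nX C \<alpha> \<sigma> + sin (pi - \<sigma>) * nX C \<alpha> (pi - \<sigma>) * - 1) (at \<sigma>)" for \<sigma>
      by (rule DERIV_add[OF DERIV_topx[OF \<alpha>] DERIV_chain2[OF DERIV_topx[OF \<alpha>] r]])
    fix \<sigma> :: real assume \<sigma>: "0 \<le> \<sigma>" "\<sigma> \<le> pi"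
    have "\<bar>nX C \<alpha> \<sigma> - nX C \<alpha> (pi - \<sigma>)\<bar> \<le> 2 * (L * \<alpha>)"
      using hX[OF \<sigma>] hX[of "pi - \<sigma>", unfolded s] \<sigma> by simp
    then have "\<bar>sin \<sigma>\<bar> * \<bar>nX C \<alpha> \<sigma> - nX C \<alpha> (pi - \<sigma>)\<bar> \<le> 1 * (2 * (L * \<alpha>))" by (intro mult_mono) auto
    then show "\<bar>sin \<sigma> * nX C \<alpha> \<sigma> + sin (pi - \<sigma>) * nX C \<alpha> (pi - \<sigma>) * - 1\<bar> \<le> 2 * (L * \<alpha>)"
      by (simp add: right_diff_distrib flip: abs_mult)
  qed (simp_all add: top_ends[OF \<alpha>])
  also have "\<dots> \<le> 2 * (2 * (L * \<alpha>)) * 1" using L \<alpha> by (intro mult_left_mono) auto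
  also have "\<dots> \<le> K * \<alpha>" using L \<alpha> K5 by simp
  finally show "\<bar>?x \<sigma> + ?x (pi - \<sigma>)\<bar> \<le> K * \<alpha>" .
  have "\<bar>?y \<sigma> - ?y (pi - \<sigma>)\<bar> \<le> 2 * (2 * (L * \<alpha>)) * sin \<sigma>"
  proof (rule bounded_by_sin[OF _ _ _ _ \<sigma>])
    show "((\<lambda>\<sigma>. ?y \<sigma> - ?y (pi - \<sigma>)) has_real_derivative nY C \<alpha> \<sigma> - nY C \<alpha> (pi - \<sigma>) * - 1) (at \<sigma>)" for \<sigma>
      by (rule DERIV_diff[OF DERIV_topy[OF \<alpha>] DERIV_chain2[OF DERIV_topy[OF \<alpha>] r]])
    fix \<sigma> :: real assume \<sigma>: "0 \<le> \<sigma>" "\<sigma> \<le> pi"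
    have *: "cos (pi - \<sigma>) * slope C (pi - \<sigma>) = - (cos \<sigma> * slope C \<sigma>)" unfolding s by simp
    show "\<bar>nY C \<alpha> \<sigma> - nY C \<alpha> (pi - \<sigma>) * - 1\<bar> \<le> 2 * (L * \<alpha>)"
      using hY[OF \<sigma>] hY[of "pi - \<sigma>", unfolded *] \<sigma> by simp
  qed (simp_all add: top_ends[OF \<alpha>])
  also have "\<dots> \<le> 2 * (2 * (L * \<alpha>)) * 1" using L \<alpha> by (intro mult_left_mono) auto
  also have "\<dots> \<le> K * \<alpha>" using L \<alpha> K5 by simp
  finally show "\<bar>?y \<sigma> - ?y (pi - \<sigma>)\<bar> \<le> K * \<alpha>" .
qed

lemma topy_bounds:
  assumes \<sigma>: "0 \<le> \<sigma>" "\<sigma> \<le> pi"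
  shows "1 / K * sin \<sigma> \<le> topy (Nfun C \<alpha>) \<alpha> \<sigma>" "topy (Nfun C \<alpha>) \<alpha> \<sigma> \<le> K * sin \<sigma>"
proof -
  have s0: "0 \<le> sin \<sigma>" using \<sigma> by (rule sin_ge_zero)
  have e: "\<bar>topy (Nfun C \<alpha>) \<alpha> \<sigma> - Ly C \<sigma>\<bar> \<le> 2 * (L * \<alpha>) * sin \<sigma>"
    by (rule bounded_by_sin[OF DERIV_diff[OF DERIV_topy[OF \<alpha>] DERIV_Ly] hY _ _ \<sigma>])
      (simp_all add: top_ends[OF \<alpha>] Ly_def)
  have "2 * (L * \<alpha>) * sin \<sigma> \<le> 1 * sin \<sigma>" using L\<alpha>(2) s0 by (intro mult_right_mono) auto
  then have e': "\<bar>topy (Nfun C \<alpha>) \<alpha> \<sigma> - Ly C \<sigma>\<bar> \<le> sin \<sigma>" using e by linarith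
  have q: "0 \<le> (sin \<sigma>)\<^sup>2" "(sin \<sigma>)\<^sup>2 \<le> 1" by (simp_all add: abs_square_le_1)
  have "pi / 2 * (sin \<sigma>)\<^sup>2 \<le> pi / 2" "0 \<le> pi / 2 * (sin \<sigma>)\<^sup>2" using q by simp_all
  then have u: "pi / 2 \<le> pi + 2 * C - pi / 2 * (sin \<sigma>)\<^sup>2" "pi + 2 * C - pi / 2 * (sin \<sigma>)\<^sup>2 \<le> pi + 2 * C"
    using C by linarith+
  have "sin \<sigma> * (pi / 2) \<le> Ly C \<sigma>" "Ly C \<sigma> \<le> sin \<sigma> * (pi + 2 * C)"
    unfolding Ly_def by (rule mult_left_mono[OF u(1) s0] mult_left_mono[OF u(2) s0])+
  moreover have "sin \<sigma> * (pi + 2 * C) \<le> sin \<sigma> * (K - 1)" using K s0 by (intro mult_left_mono) auto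
  moreover have "sin \<sigma> * (6 / 5) \<le> sin \<sigma> * (pi / 2)" using pi_gt3 s0 by (intro mult_left_mono) auto
  moreover have "1 / K * sin \<sigma> \<le> 1 / 5 * sin \<sigma>" using K5 s0 by (intro mult_right_mono) (auto simp: field_simps)
  moreover have "sin \<sigma> * (K - 1) = K * sin \<sigma> - sin \<sigma>" by (simp add: algebra_simps)
  ultimately show "1 / K * sin \<sigma> \<le> topy (Nfun C \<alpha>) \<alpha> \<sigma>" "topy (Nfun C \<alpha>) \<alpha> \<sigma> \<le> K * sin \<sigma>"
    using e' by linarith+
qed

text \<open>The origin of \<delta>: at the fold of the limit the slope is \<open>pi - 4 * C\<close>,
  which is twice \<delta>; without a fold it is everywhere at least \<open>2 * C - pi / 2\<close>,
  which is \<delta>. So \<delta> bounds the slope from below on the part of the front that is kept,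
  with enough margin for the error.\<close>

lemma topx'_bounds:
  assumes \<sigma>: "0 \<le> \<sigma>" "\<sigma> \<le> pi" and sl: "\<delta> \<le> slope C \<sigma>"
  shows "1 / K * sin \<sigma> \<le> sin \<sigma> * nX C \<alpha> \<sigma>" "sin \<sigma> * nX C \<alpha> \<sigma> \<le> K * sin \<sigma>"
proof -
  have "\<delta> / 2 \<le> nX C \<alpha> \<sigma>" "nX C \<alpha> \<sigma> \<le> K"
    using hX[OF \<sigma>] sl L\<alpha> slope_le[of \<sigma>] K \<delta>(2) by linarith+
  moreover have "1 / K \<le> \<delta> / 2" using \<delta>_K by simp
  ultimately show "1 / K * sin \<sigma> \<le> sin \<sigma> * nX C \<alpha> \<sigma>" "sin \<sigma> * nX C \<alpha> \<sigma> \<le> K * sin \<sigma>"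
    unfolding mult.commute[of "sin \<sigma>"] using sin_ge_zero[OF \<sigma>] by (intro mult_right_mono; linarith)+
qed

lemma topy'_bound:
  assumes \<sigma>: "0 \<le> \<sigma>" "\<sigma> \<le> pi" shows "\<bar>nY C \<alpha> \<sigma>\<bar> \<le> K"
proof -
  have "\<bar>slope C \<sigma>\<bar> \<le> 2 * C + pi" using slope_le[of \<sigma>] C pi_gt3 by (simp add: abs_le_iff)
  then have "\<bar>cos \<sigma> * slope C \<sigma>\<bar> \<le> 1 * (2 * C + pi)" unfolding abs_mult by (intro mult_mono) auto
  then have "\<bar>cos \<sigma> * slope C \<sigma>\<bar> \<le> 2 * C + pi" by simp
  then show ?thesis using hY[OF \<sigma>] L\<alpha> K by linarith
qed

lemma front_intro:
  assumes s1: "0 < s1" "s1 < pi" "- 1 / 2 \<le> cos s1" and s2: "0 < s2" "s2 < pi" "cos s2 \<le> 1 / 2"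
    and far: "1 / K \<le> 1 - cos s1" "1 / K \<le> 1 + cos s2"
    and ends: "topx (Nfun C \<alpha>) \<alpha> s1 = topx (Nfun C \<alpha>) \<alpha> s2" "topy (Nfun C \<alpha>) \<alpha> s1 = topy (Nfun C \<alpha>) \<alpha> s2"
    and J: "\<And>\<sigma>. \<sigma> \<in> {0..s1} \<union> {s2..pi} \<Longrightarrow> pi - \<sigma> \<in> {0..s1} \<union> {s2..pi}"
    and sl: "\<And>\<sigma>. \<sigma> \<in> {0..s1} \<union> {s2..pi} \<Longrightarrow> \<delta> \<le> slope C \<sigma>"
    and lev: "Hf \<alpha> (pt (topx (Nfun C \<alpha>) \<alpha> s1) (topy (Nfun C \<alpha>) \<alpha> s1)) = cos \<alpha>"
  shows "front_of C \<alpha> K s1 s2"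
proof -
  have I: "0 \<le> \<sigma>" "\<sigma> \<le> pi" if "\<sigma> \<in> {0..s1} \<union> {s2..pi}" for \<sigma> using that s1 s2 by auto
  have K1: "1 \<le> K" using K5 by simp
  show ?thesis
    by (rule front.intro[OF K1 \<alpha>(1) small width DERIV_topx[OF \<alpha>] DERIV_topy[OF \<alpha>]
          continuous_on_topx'[OF \<alpha>] continuous_on_topy'[OF \<alpha>] s1 s2 far
          topx'_bounds(1)[OF I sl] topx'_bounds(2)[OF I sl] topy'_bound[OF I] topy_bounds(1)[OF I] topy_bounds(2)[OF I]
          top_ends(1,2)[OF \<alpha>] ends J top_sym(1)[OF I] top_sym(2)[OF I] lev])
qed

text \<open>The fold is a zero of \<open>mu\<close>, which is positive at 0 and negative at
  \<open>pi / 2\<close> because \<open>2 * C < pi / 2\<close>. By \<open>top_level\<close>,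
  \<open>\<sigma>d\<close> and \<open>pi - \<sigma>d\<close> give the same point, and it has the
  level of the origin.\<close>

lemma front_fold:
  assumes "C < pi / 4"
  obtains \<sigma>d where "0 < \<sigma>d" "\<sigma>d < pi / 2" "\<bar>(sin \<sigma>d)\<^sup>2 - 4 * C / pi\<bar> \<le> K * \<alpha>"
    "mu (Nfun C \<alpha>) \<alpha> \<sigma>d = 0" "front_of C \<alpha> K \<sigma>d (pi - \<sigma>d)"
proof -
  let ?m = "mu (Nfun C \<alpha>) \<alpha>"
  have d: "\<delta> = pi / 2 - 2 * C" using assms \<delta>(1) by simp
  have "?m (pi / 2) / \<alpha>\<^sup>2 < 0" using hM[of "pi / 2"] L\<alpha> \<delta>(2) d pi_gt_zero by (simp add: abs_le_iff)
  then have m2: "?m (pi / 2) < 0" using \<alpha> by (simp add: divide_less_0_iff)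
  have m0: "0 < ?m 0" using mu_0[OF \<alpha>] C \<alpha> by simp
  obtain \<sigma>d where s: "0 \<le> \<sigma>d" "\<sigma>d \<le> pi / 2" "?m \<sigma>d = 0"
    using IVT2'[of ?m "pi / 2" 0 0] m0 m2 continuous_on_subset[OF continuous_on_atoms(3)[OF \<alpha>] subset_UNIV] by force
  have "\<sigma>d \<noteq> 0" using s m0 by auto
  moreover have "\<sigma>d \<noteq> pi / 2" by (rule notI) (use s(3) m2 in \<open>simp only: less_irrefl\<close>)
  ultimately have sd: "0 < \<sigma>d" "\<sigma>d < pi / 2" using s by auto
  define q where "q = (sin \<sigma>d)\<^sup>2"
  have b: "\<bar>2 * C - pi / 2 * q\<bar> \<le> L * \<alpha>" using hM[of \<sigma>d] s unfolding q_def by simp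
  have "pi / 2 * \<bar>q - 4 * C / pi\<bar> = \<bar>pi / 2 * (q - 4 * C / pi)\<bar>" by (simp add: abs_mult)
  also have "pi / 2 * (q - 4 * C / pi) = pi / 2 * q - 2 * C" by (simp add: field_simps)
  finally have qb: "pi / 2 * \<bar>q - 4 * C / pi\<bar> \<le> L * \<alpha>" using b by (simp add: abs_minus_commute)
  have "\<bar>q - 4 * C / pi\<bar> = 1 * \<bar>q - 4 * C / pi\<bar>" by simp
  also have "\<dots> \<le> pi / 2 * \<bar>q - 4 * C / pi\<bar>" using pi_gt3 by (intro mult_right_mono) auto
  also note qb
  also have "L * \<alpha> \<le> K * \<alpha>" using L K5 \<alpha> by (intro mult_right_mono) auto
  finally have q: "\<bar>q - 4 * C / pi\<bar> \<le> K * \<alpha>" .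
  have c: "0 < cos \<sigma>d" "cos \<sigma>d \<le> 1" using sd by (auto intro: cos_gt_zero)
  \<comment> \<open>The parameter \<open>\<sigma>d\<close> has to stay away from 0, as
    \<open>far\<close> requires; for this \<open>sin\<^sup>2 \<sigma>d\<close> is bounded below by a
    multiple of \<open>C\<close>, the error being small compared with \<open>C\<close>.\<close>
  have "2 * C \<le> pi / 2 * q + 1 / 1000 * (2 * C)"
  proof -
    have "L * \<alpha> * K \<le> K * \<alpha> * K" using L K5 \<alpha> by (intro mult_right_mono) auto
    also have "\<dots> \<le> 1 / 1000" using K_small[of 2] by (simp add: power2_eq_square mult_ac)
    finally have "L * \<alpha> \<le> 1 / 1000 * (1 / K)" using K5 by (simp add: field_simps)
    also have "\<dots> \<le> 1 / 1000 * (2 * C)" using K(2) C K5 by (intro mult_left_mono) (auto simp: field_simps)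
    finally show ?thesis using b by linarith
  qed
  then have "C \<le> pi / 2 * q" using C by linarith
  also have "\<dots> \<le> 2 * q" using pi_less_4 by (intro mult_right_mono) (auto simp: q_def)
  finally have "C / 2 \<le> q" by simp
  also have "q = (1 - cos \<sigma>d) * (1 + cos \<sigma>d)" unfolding q_def sin_squared_eq by (simp add: power2_eq_square algebra_simps)
  also have "\<dots> \<le> (1 - cos \<sigma>d) * 2" using c by (intro mult_left_mono) auto
  finally have "C / 4 \<le> 1 - cos \<sigma>d" by simp
  moreover have "1 / K \<le> C / 4" using K(2) C K5 by (simp add: field_simps)
  ultimately have far: "1 / K \<le> 1 - cos \<sigma>d" by linarith
  have sl: "\<delta> \<le> slope C \<sigma>" if "\<sigma> \<in> {0..\<sigma>d} \<union> {pi - \<sigma>d..pi}" for \<sigma>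
  proof -
    have "sin \<tau> \<le> sin \<sigma>d \<and> 0 \<le> sin \<tau>" if "0 \<le> \<tau>" "\<tau> \<le> \<sigma>d" for \<tau>
      using that sd by (auto intro!: sin_monotone_2pi_le sin_ge_zero)
    from this[of \<sigma>] this[of "pi - \<sigma>"] have "0 \<le> sin \<sigma>" "sin \<sigma> \<le> sin \<sigma>d" using that by auto
    then have "(sin \<sigma>)\<^sup>2 \<le> q" unfolding q_def by (intro power_mono)
    then have "pi / 2 * (sin \<sigma>)\<^sup>2 \<le> pi / 2 * q" by (intro mult_left_mono) auto
    then have "pi / 2 * (sin \<sigma>)\<^sup>2 \<le> 2 * C + L * \<alpha>" using b by linarith
    then show ?thesis unfolding slope_def using d L\<alpha>(1) \<delta>(2) by simp
  qed
  note t = top_level[OF \<alpha> s(3)]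
  have "front_of C \<alpha> K \<sigma>d (pi - \<sigma>d)"
  proof (rule front_intro)
    show "1 / K \<le> 1 + cos (pi - \<sigma>d)" using far by simp
    show "- 1 / 2 \<le> cos \<sigma>d" "cos (pi - \<sigma>d) \<le> 1 / 2" using c by simp_all
    show "pi - \<sigma> \<in> {0..\<sigma>d} \<union> {pi - \<sigma>d..pi}" if "\<sigma> \<in> {0..\<sigma>d} \<union> {pi - \<sigma>d..pi}" for \<sigma> using that by auto
  qed (use sd far sl t in auto)
  then show ?thesis using that sd s(3) q unfolding q_def by blast
qed

text \<open>The artificial cut is a point at the level of the origin, found by the intermediate
  value theorem between \<open>pi / 3\<close> and \<open>2 * pi / 3\<close>, the range that the
  conditions on the cosine allow. At \<open>pi / 2\<close> the first coordinate is O(\<alpha>), and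
  it grows at a rate controlled by \<delta>.\<close>

lemma front_full:
  assumes C4: "pi / 4 < C"
  obtains s where "0 < s" "s < pi" "front_of C \<alpha> K s s"
proof -
  let ?x = "topx (Nfun C \<alpha>) \<alpha>" and ?y = "topy (Nfun C \<alpha>) \<alpha>"
  have sl: "\<delta> \<le> slope C \<sigma>" for \<sigma>
  proof -
    have "(sin \<sigma>)\<^sup>2 \<le> 1" by (simp add: abs_square_le_1)
    then have "3 * pi / 2 * (sin \<sigma>)\<^sup>2 \<le> 3 * pi / 2 * 1" by (intro mult_left_mono) auto
    moreover have "\<delta> = 2 * C - pi / 2" using C4 \<delta>(1) by simp
    ultimately show ?thesis unfolding slope_def by linarith
  qed
  have mono: "?x \<sigma> + \<delta> / 2 * cos \<sigma> \<le> ?x \<tau> + \<delta> / 2 * cos \<tau>" if st: "0 \<le> \<sigma>" "\<sigma> \<le> \<tau>" "\<tau> \<le> pi" for \<sigma> \<tau>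
  proof (rule DERIV_nonneg_imp_nondecreasing[OF st(2)])
    fix r assume r: "\<sigma> \<le> r" "r \<le> \<tau>"
    have "\<delta> / 2 \<le> nX C \<alpha> r" using hX[of r] sl[of r] L\<alpha>(1) \<delta>(2) r st by (simp add: abs_le_iff)
    then have "0 \<le> sin r * (nX C \<alpha> r - \<delta> / 2)" using r st by (intro mult_nonneg_nonneg sin_ge_zero) auto
    moreover have "((\<lambda>\<sigma>. ?x \<sigma> + \<delta> / 2 * cos \<sigma>) has_real_derivative sin r * nX C \<alpha> r + \<delta> / 2 * (- sin r)) (at r)"
      by (rule DERIV_add[OF DERIV_topx[OF \<alpha>] DERIV_cmult[OF DERIV_cos]])
    ultimately show "\<exists>y. ((\<lambda>\<sigma>. ?x \<sigma> + \<delta> / 2 * cos \<sigma>) has_real_derivative y) (at r) \<and> 0 \<le> y"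
      by (intro exI[of _ "sin r * nX C \<alpha> r + \<delta> / 2 * (- sin r)"]) (simp add: algebra_simps)
  qed
  have c: "cos (pi / 3) = 1 / 2" "cos (2 * pi / 3) = - 1 / 2" by (simp_all add: cos_60 cos_120)
  have mid: "\<bar>?x (pi / 2)\<bar> \<le> K * \<alpha>" using top_sym(1)[of "pi / 2"] by simp
  have "K * (K * \<alpha>) \<le> 1 / 1000000" using K_small[of 2] by (simp add: power2_eq_square mult_ac)
  then have "K * \<alpha> \<le> 2 / K / 1000" using K5 by (simp add: field_simps)
  then have Ka: "K * \<alpha> \<le> \<delta> / 1000" using \<delta>_K by simp
  have x1: "?x (pi / 3) < 0" using mono[of "pi / 3" "pi / 2"] c mid Ka \<delta>(2) by simp
  have x2: "\<delta> / 8 \<le> ?x (2 * pi / 3)" using mono[of "pi / 2" "2 * pi / 3"] c mid Ka \<delta>(2) by simp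
  have cont: "continuous_on A ?x" "continuous_on A ?y" for A
    by (intro continuous_at_imp_continuous_on ballI DERIV_isCont[OF DERIV_topx[OF \<alpha>]] DERIV_isCont[OF DERIV_topy[OF \<alpha>]])+
  have ca: "0 < cos \<alpha>" "cos \<alpha> \<le> 1" "0 < sin \<alpha>" using sin_cos_pos[OF \<alpha>] by auto
  have h1: "Hf \<alpha> (pt (?x (pi / 3)) (?y (pi / 3))) \<le> cos \<alpha>"
  proof -
    have "rr \<alpha> (pt (?x (pi / 3)) (?y (pi / 3))) \<le> 1" by (simp add: rr_def)
    then have "cos \<alpha> * rr \<alpha> (pt (?x (pi / 3)) (?y (pi / 3))) \<le> cos \<alpha> * 1" using ca by (intro mult_left_mono) auto
    moreover have "\<alpha>\<^sup>2 * sin \<alpha> * ?x (pi / 3) \<le> 0" using x1 ca by (intro mult_nonneg_nonpos) auto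
    ultimately show ?thesis unfolding Hf_def vector_2 by linarith
  qed
  \<comment> \<open>The first coordinate is at least \<open>\<delta> / 8\<close> here, so the linear
    term of \<open>Hf\<close>, of order \<alpha>^3, outweighs the loss \<open>p\<close> in
    \<open>rr\<close>, which is of order \<alpha>^4.\<close>
  have h2: "cos \<alpha> \<le> Hf \<alpha> (pt (?x (2 * pi / 3)) (?y (2 * pi / 3)))"
  proof -
    define X Y where "X = ?x (2 * pi / 3)" and "Y = ?y (2 * pi / 3)"
    have X: "\<delta> / 8 \<le> X" using x2 by (simp add: X_def)
    have "X + \<delta> / 2 * (- 1 / 2) \<le> sin (2 * C * \<alpha>\<^sup>2) / \<alpha>\<^sup>2 + \<delta> / 2 * (- 1)"
      using mono[of "2 * pi / 3" pi] c(2) top_ends(2)[OF \<alpha>, of C] by (simp add: X_def)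
    then have "X \<le> K" using width(2) \<delta>(2) by linarith
    moreover have "0 \<le> X" using X \<delta>(2) by linarith
    ultimately have X2: "X\<^sup>2 \<le> K\<^sup>2" by (intro power_mono)
    have s0: "0 \<le> sin (2 * pi / 3)" by (intro sin_ge_zero) auto
    then have "0 \<le> 1 / K * sin (2 * pi / 3)" using K5 by simp
    then have "0 \<le> Y" using topy_bounds(1)[of "2 * pi / 3"] by (simp add: Y_def)
    moreover have "K * sin (2 * pi / 3) \<le> K * 1" using K5 by (intro mult_left_mono) auto
    then have "Y \<le> K" using topy_bounds(2)[of "2 * pi / 3"] by (simp add: Y_def)
    ultimately have Y2: "Y\<^sup>2 \<le> K\<^sup>2" by (intro power_mono)
    define p where "p = \<alpha>^4 * (X\<^sup>2 + Y\<^sup>2)"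
    have "p \<le> \<alpha>^4 * (2 * K\<^sup>2)" unfolding p_def using X2 Y2 by (intro mult_left_mono) auto
    also have "\<dots> = 2 * (K\<^sup>2 * \<alpha>) * \<alpha>^3" by (simp add: eval_nat_numeral)
    finally have p1: "p \<le> 2 * (K\<^sup>2 * \<alpha>) * \<alpha>^3" .
    have k2: "K\<^sup>2 * \<alpha> \<le> \<delta> / 1000"
    proof -
      have "K * (K\<^sup>2 * \<alpha>) \<le> 1 / 1000000" using K_small[of 3] by (simp add: eval_nat_numeral mult_ac)
      then have "K\<^sup>2 * \<alpha> \<le> 2 / K / 1000" using K5 by (simp add: field_simps)
      then show ?thesis using \<delta>_K by simp
    qed
    have a1: "\<alpha> \<le> 1" using K_small[of 0] by simp
    have "2 * (K\<^sup>2 * \<alpha>) * \<alpha>^3 \<le> 2 * (1 / 1000000) * 1"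
      using K_small[of 2] \<alpha> a1 by (intro mult_mono power_le_one) auto
    then have p01: "0 \<le> p" "p \<le> 1" using p1 by (auto simp: p_def)
    then have "1 - p \<le> sqrt (1 - p)"
      by (intro real_le_rsqrt) (simp add: power2_eq_square mult_left_le)
    then have r: "1 - p \<le> rr \<alpha> (pt X Y)" by (simp add: rr_def p_def)
    have "cos \<alpha> * (1 - p) \<le> cos \<alpha> * rr \<alpha> (pt X Y)" using r ca by (intro mult_left_mono) auto
    moreover have "cos \<alpha> * p \<le> 1 * p" using ca p01 by (intro mult_right_mono) auto
    moreover have "cos \<alpha> * (1 - p) = cos \<alpha> - cos \<alpha> * p" by (simp add: algebra_simps)
    moreover have "p \<le> \<alpha>\<^sup>2 * sin \<alpha> * X"
    proof -
      have "2 * (K\<^sup>2 * \<alpha>) * \<alpha>^3 \<le> 2 * (\<delta> / 1000) * \<alpha>^3" using k2 \<alpha> by (intro mult_right_mono) auto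
      also have "\<dots> \<le> \<alpha>\<^sup>2 * (\<alpha> / 2) * (\<delta> / 8)" using \<delta>(2) \<alpha> by (simp add: power2_eq_square power3_eq_cube)
      also have "\<dots> \<le> \<alpha>\<^sup>2 * sin \<alpha> * X"
        using half_le_sin[of \<alpha>] \<alpha> X \<delta>(2) by (intro mult_mono) auto
      finally show ?thesis using p1 by linarith
    qed
    ultimately show ?thesis unfolding Hf_def vector_2 X_def[symmetric] Y_def[symmetric] by linarith
  qed
  have "continuous_on {pi / 3..2 * pi / 3} (\<lambda>\<sigma>. Hf \<alpha> (pt (?x \<sigma>) (?y \<sigma>)))"
    unfolding Hf_def by (intro continuous_intros continuous_on_rr cont)
  then obtain s where s: "pi / 3 \<le> s" "s \<le> 2 * pi / 3" "Hf \<alpha> (pt (?x s) (?y s)) = cos \<alpha>"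
    using IVT'[of "\<lambda>\<sigma>. Hf \<alpha> (pt (?x \<sigma>) (?y \<sigma>))" "pi / 3" "cos \<alpha>" "2 * pi / 3"] h1 h2 by auto
  have sp: "0 < s" "s < pi" using s pi_gt_zero by linarith+
  have cs: "cos s \<le> 1 / 2" "- 1 / 2 \<le> cos s"
    using cos_monotone_0_pi_le[of "pi / 3" s] cos_monotone_0_pi_le[of s "2 * pi / 3"] s c sp by auto
  have K2: "1 / K \<le> 1 / 2" using K5 by (simp add: field_simps)
  have "front_of C \<alpha> K s s"
  proof (rule front_intro)
    show "pi - \<sigma> \<in> {0..s} \<union> {s..pi}" if "\<sigma> \<in> {0..s} \<union> {s..pi}" for \<sigma> using that sp by auto
    show "1 / K \<le> 1 - cos s" "1 / K \<le> 1 + cos s" using cs K2 by linarith+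
  qed (use sp cs s(3) sl in auto)
  then show ?thesis using that sp by blast
qed

end

text \<open>The constants are summed up to a single \<open>K\<close> that depends on
  \<open>C\<close> only. Through \<open>2 / \<delta>\<close> it blows up as \<open>C\<close>
  approaches \<open>pi / 4\<close>.\<close>

lemma eventually_approximation:
  assumes C: "0 < C" "C \<noteq> pi / 4"
  obtains K where "2 \<le> K" "\<forall>\<^sub>F \<alpha> in at_right 0. 0 < \<alpha> \<and> \<alpha> < pi / 4 \<and>
    (\<forall>\<sigma>\<in>{0..pi}. \<bar>nX C \<alpha> \<sigma> - slope C \<sigma>\<bar> \<le> K * \<alpha> \<and> \<bar>nY C \<alpha> \<sigma> - cos \<sigma> * slope C \<sigma>\<bar> \<le> K * \<alpha>) \<and>
    (C < pi / 4 \<longrightarrow> (\<exists>\<sigma>d. 0 < \<sigma>d \<and> \<sigma>d < pi / 2 \<and> \<bar>(sin \<sigma>d)\<^sup>2 - 4 * C / pi\<bar> \<le> K * \<alpha> \<and>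
       mu (Nfun C \<alpha>) \<alpha> \<sigma>d = 0 \<and> front_of C \<alpha> K \<sigma>d (pi - \<sigma>d))) \<and>
    (pi / 4 < C \<longrightarrow> (\<exists>s. 0 < s \<and> s < pi \<and> front_of C \<alpha> K s s))"
proof -
  obtain L1 where L1: "0 \<le> L1" "\<forall>\<^sub>F \<alpha> in at_right 0. \<forall>\<sigma>\<in>{0..pi}. \<bar>nX C \<alpha> \<sigma> - slope C \<sigma>\<bar> \<le> L1 * \<alpha>"
    using apx_nX[of C] unfolding slope_def by (rule apxE)
  obtain L2 where L2: "0 \<le> L2" "\<forall>\<^sub>F \<alpha> in at_right 0. \<forall>\<sigma>\<in>{0..pi}. \<bar>nY C \<alpha> \<sigma> - cos \<sigma> * slope C \<sigma>\<bar> \<le> L2 * \<alpha>"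
    using apx_nY[of C] unfolding slope_def by (rule apxE)
  obtain L3 where L3: "0 \<le> L3" "\<forall>\<^sub>F \<alpha> in at_right 0. \<forall>\<sigma>\<in>{0..pi}. \<bar>mu (Nfun C \<alpha>) \<alpha> \<sigma> / \<alpha>\<^sup>2 - (2 * C - pi / 2 * (sin \<sigma>)\<^sup>2)\<bar> \<le> L3 * \<alpha>"
    using apx_mu[of C] by (rule apxE)
  define L where "L = L1 + L2 + L3"
  define \<delta> where "\<delta> = \<bar>pi - 4 * C\<bar> / 2"
  define K where "K = 8 * L + 2 / \<delta> + (2 * C + pi + 2) + 4 / C"
  have L0: "0 \<le> L" "L1 \<le> L" "L2 \<le> L" "L3 \<le> L" using L1 L2 L3 by (auto simp: L_def)
  have d0: "0 < \<delta>" using C by (simp add: \<delta>_def)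
  have KK: "8 * L \<le> K" "2 / \<delta> \<le> K" "2 * C + pi + 2 \<le> K" "4 / C \<le> K"
    using L0 d0 C pi_gt_zero unfolding K_def by simp_all
  have K2: "2 \<le> K" using KK(3) C pi_gt_zero by linarith
  define c where "c = 1 / (1000000 * K^30)"
  have c: "0 < c" using K2 by (simp add: c_def)
  have "\<forall>\<^sub>F \<alpha> in at_right (0::real). 0 < \<alpha> \<and> \<alpha> < c" by (rule at_right_0_lt[OF c])
  moreover have "\<forall>\<^sub>F \<alpha> in at_right (0::real). 0 < \<alpha> \<and> \<alpha> < pi / 4" by (rule at_right_0_lt[OF pi_quarter])
  ultimately have "\<forall>\<^sub>F \<alpha> in at_right 0. 0 < \<alpha> \<and> \<alpha> < pi / 4 \<and>
    (\<forall>\<sigma>\<in>{0..pi}. \<bar>nX C \<alpha> \<sigma> - slope C \<sigma>\<bar> \<le> K * \<alpha> \<and> \<bar>nY C \<alpha> \<sigma> - cos \<sigma> * slope C \<sigma>\<bar> \<le> K * \<alpha>) \<and>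
    (C < pi / 4 \<longrightarrow> (\<exists>\<sigma>d. 0 < \<sigma>d \<and> \<sigma>d < pi / 2 \<and> \<bar>(sin \<sigma>d)\<^sup>2 - 4 * C / pi\<bar> \<le> K * \<alpha> \<and>
       mu (Nfun C \<alpha>) \<alpha> \<sigma>d = 0 \<and> front_of C \<alpha> K \<sigma>d (pi - \<sigma>d))) \<and>
    (pi / 4 < C \<longrightarrow> (\<exists>s. 0 < s \<and> s < pi \<and> front_of C \<alpha> K s s))"
    using L1(2) L2(2) L3(2)
  proof eventually_elim
    case (elim \<alpha>)
    then have a: "0 < \<alpha>" "\<alpha> < pi / 4" by auto
    have Li: "M * \<alpha> \<le> L * \<alpha>" if "M \<le> L" for M using that a by (intro mult_right_mono) auto
    have h: "\<bar>nX C \<alpha> \<sigma> - slope C \<sigma>\<bar> \<le> L * \<alpha>" "\<bar>nY C \<alpha> \<sigma> - cos \<sigma> * slope C \<sigma>\<bar> \<le> L * \<alpha>"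
      "\<bar>mu (Nfun C \<alpha>) \<alpha> \<sigma> / \<alpha>\<^sup>2 - (2 * C - pi / 2 * (sin \<sigma>)\<^sup>2)\<bar> \<le> L * \<alpha>" if "0 \<le> \<sigma>" "\<sigma> \<le> pi" for \<sigma>
      using elim(3-5) that Li[OF L0(2)] Li[OF L0(3)] Li[OF L0(4)] by (meson atLeastAtMost_iff order_trans)+
    have "K^30 * \<alpha> \<le> K^30 * c" using elim K2 by (intro mult_left_mono) auto
    also have "\<dots> = 1 / 1000000" using K2 by (simp add: c_def)
    finally have sm: "1000000 * (K^30 * \<alpha>) \<le> 1" by simp
    have "L * \<alpha> \<le> K * \<alpha>" using KK(1) L0 a by (intro mult_right_mono) auto
    note ctx = a C(1) h(1,2,3) L0(1) KK(1) \<delta>_def d0 KK(2-4) sm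
    have "\<exists>\<sigma>d. 0 < \<sigma>d \<and> \<sigma>d < pi / 2 \<and> \<bar>(sin \<sigma>d)\<^sup>2 - 4 * C / pi\<bar> \<le> K * \<alpha> \<and>
       mu (Nfun C \<alpha>) \<alpha> \<sigma>d = 0 \<and> front_of C \<alpha> K \<sigma>d (pi - \<sigma>d)" if "C < pi / 4"
      by (rule front_fold[OF ctx that]; blast?)
    moreover have "\<exists>s. 0 < s \<and> s < pi \<and> front_of C \<alpha> K s s" if "pi / 4 < C"
      by (rule front_full[OF ctx that]; blast?)
    moreover have "\<bar>nX C \<alpha> \<sigma> - slope C \<sigma>\<bar> \<le> K * \<alpha> \<and> \<bar>nY C \<alpha> \<sigma> - cos \<sigma> * slope C \<sigma>\<bar> \<le> K * \<alpha>"
      if "\<sigma> \<in> {0..pi}" for \<sigma>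
      using h(1,2)[of \<sigma>] that \<open>L * \<alpha> \<le> K * \<alpha>\<close> by auto
    ultimately show ?case using a by blast
  qed
  then show ?thesis by (rule that[OF K2])
qed

section \<open>Return to the original parameter of the front\<close>

definition wpar :: "real \<Rightarrow> real \<Rightarrow> real" where "wpar \<alpha> \<sigma> = \<sigma> + eps \<alpha> \<sigma>"

abbreviation topc :: "real \<Rightarrow> real \<Rightarrow> real \<Rightarrow> real^2" where
  "topc C \<alpha> \<sigma> \<equiv> pt (topx (Nfun C \<alpha>) \<alpha> \<sigma>) (topy (Nfun C \<alpha>) \<alpha> \<sigma>)"

context
  fixes C \<alpha> :: real
  assumes \<alpha>: "0 < \<alpha>" "\<alpha> < pi / 4" and k: "odd (kM \<alpha>)" "r_frac \<alpha> = C * \<alpha>"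
begin

text \<open>The derivative of \<open>eps\<close> has modulus less than 1: with
  \<open>t = tan^2 \<alpha> < 1\<close>, it is \<open>t cos r / cos eps\<close>, and
  \<open>(t cos r)^2 + (t sin r)^2 = t^2 < 1\<close> while
  \<open>cos^2 eps = 1 - (t sin r)^2\<close>.\<close>

lemma wpar_less: "\<sigma> < \<tau> \<Longrightarrow> wpar \<alpha> \<sigma> < wpar \<alpha> \<tau>"
proof (rule DERIV_pos_imp_increasing[where f="wpar \<alpha>"])
  fix r
  have t: "(tan \<alpha>)\<^sup>2 < 1" using abs_sin_eps[OF \<alpha>, of "pi / 2"] by simp
  have c: "0 < cos (eps \<alpha> r)" by (rule cos_eps_pos[OF \<alpha>])
  have "(tan \<alpha>)\<^sup>2 * (tan \<alpha>)\<^sup>2 < 1 * 1" using t by (intro mult_strict_mono') auto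
  then have "((tan \<alpha>)\<^sup>2)\<^sup>2 < 1" by (simp add: power2_eq_square)
  moreover have "((tan \<alpha>)\<^sup>2)\<^sup>2 = ((tan \<alpha>)\<^sup>2 * cos r)\<^sup>2 + ((tan \<alpha>)\<^sup>2 * sin r)\<^sup>2"
    by (simp add: power_mult_distrib cos_squared_eq algebra_simps)
  moreover have "(cos (eps \<alpha> r))\<^sup>2 = 1 - ((tan \<alpha>)\<^sup>2 * sin r)\<^sup>2"
    unfolding cos_squared_eq sin_eps[OF \<alpha>] ..
  ultimately have "((tan \<alpha>)\<^sup>2 * cos r)\<^sup>2 < (cos (eps \<alpha> r))\<^sup>2" by linarith
  then have "\<bar>(tan \<alpha>)\<^sup>2 * cos r\<bar> < \<bar>cos (eps \<alpha> r)\<bar>" 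
    by (intro power2_less_imp_less[of "\<bar>(tan \<alpha>)\<^sup>2 * cos r\<bar>" "\<bar>cos (eps \<alpha> r)\<bar>"]) simp_all
  then have "0 < 1 + (tan \<alpha>)\<^sup>2 * cos r / cos (eps \<alpha> r)" using c by (simp add: field_simps abs_less_iff)
  moreover have "(wpar \<alpha> has_real_derivative 1 + (tan \<alpha>)\<^sup>2 * cos r / cos (eps \<alpha> r)) (at r)"
    unfolding wpar_def[abs_def] by (rule DERIV_add[OF DERIV_ident DERIV_eps[OF \<alpha>]])
  ultimately show "\<exists>y. (wpar \<alpha> has_real_derivative y) (at r) \<and> 0 < y" by blast
qed

lemma wpar_ends: "wpar \<alpha> 0 = 0" "wpar \<alpha> pi = pi"
  by (simp_all add: wpar_def eps_def)

lemma wpar_le_iff: "wpar \<alpha> \<sigma> \<le> wpar \<alpha> \<tau> \<longleftrightarrow> \<sigma> \<le> \<tau>"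
  using wpar_less[of \<sigma> \<tau>] wpar_less[of \<tau> \<sigma>] by (cases \<sigma> \<tau> rule: linorder_cases) auto

lemma wpar_surj:
  assumes "0 \<le> s" "s \<le> pi" obtains \<sigma> where "0 \<le> \<sigma>" "\<sigma> \<le> pi" "wpar \<alpha> \<sigma> = s"
proof -
  have "continuous_on {0..pi} (wpar \<alpha>)"
    unfolding wpar_def[abs_def]
    by (intro continuous_intros continuous_on_subset[OF continuous_on_atoms(2)[OF \<alpha>]]) auto
  then show ?thesis using IVT'[of "wpar \<alpha>" 0 s pi] assms that by (auto simp: wpar_ends)
qed

lemma kM_eq: "real (kM \<alpha>) = Nfun C \<alpha>"
  using k(2) by (simp add: r_frac_def Nfun_def)

lemma Lcurve_upper: "0 \<le> \<sigma> \<Longrightarrow> \<sigma> \<le> pi \<Longrightarrow> Lcurve \<alpha> (wpar \<alpha> \<sigma>) = topc C \<alpha> \<sigma>"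
  using Nproj_Eplus[OF \<alpha> k(1), of \<sigma>] wpar_le_iff[of \<sigma> pi] wpar_ends
  by (simp add: Lcurve_def wpar_def kM_eq)

lemma Nproj_Eminus: "Nproj \<alpha> (Eminus \<alpha> s) = - Nproj \<alpha> (Eplus \<alpha> s)"
  by (simp add: Nproj_def Eminus_def vec_eq_iff forall_2 matrix_vector_mult_def sum_3)

lemma Lcurve_lower: "0 < \<sigma> \<Longrightarrow> \<sigma> \<le> pi \<Longrightarrow> Lcurve \<alpha> (pi + wpar \<alpha> \<sigma>) = - topc C \<alpha> \<sigma>"
  using Nproj_Eplus[OF \<alpha> k(1), of \<sigma>] wpar_less[of 0 \<sigma>] wpar_ends
  by (simp add: Lcurve_def wpar_def kM_eq Nproj_Eminus)

lemma Lcurve_image: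
  assumes s: "0 < s1" "s1 < pi" "0 < s2" "s2 < pi" and J: "J = {0..s1} \<union> {s2..pi}"
  shows "Lcurve \<alpha> ` ({0..wpar \<alpha> s1} \<union> {wpar \<alpha> s2..pi + wpar \<alpha> s1} \<union> {pi + wpar \<alpha> s2..2 * pi})
    = topc C \<alpha> ` J \<union> uminus ` topc C \<alpha> ` J" (is "?L = ?R")
proof (intro equalityI subsetI)
  have w: "wpar \<alpha> s1 \<le> pi" "0 < wpar \<alpha> s1" "0 < wpar \<alpha> s2" "wpar \<alpha> s2 \<le> pi"
    using wpar_le_iff[of s1 pi] wpar_less[of 0 s1] wpar_less[of 0 s2] wpar_le_iff[of s2 pi] s wpar_ends by auto
  {
    fix z assume "z \<in> ?L"
    then obtain s where z: "z = Lcurve \<alpha> s"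
      and s: "s \<in> {0..wpar \<alpha> s1} \<union> {wpar \<alpha> s2..pi + wpar \<alpha> s1} \<union> {pi + wpar \<alpha> s2..2 * pi}" by blast
    show "z \<in> ?R"
    proof (cases "s \<le> pi")
      case True
      then have "0 \<le> s" "s \<le> wpar \<alpha> s1 \<or> wpar \<alpha> s2 \<le> s" using s w by auto
      moreover obtain \<sigma> where \<sigma>: "0 \<le> \<sigma>" "\<sigma> \<le> pi" "wpar \<alpha> \<sigma> = s" by (rule wpar_surj[OF \<open>0 \<le> s\<close> True])
      ultimately have "\<sigma> \<in> J" unfolding J using wpar_le_iff[of \<sigma> s1] wpar_le_iff[of s2 \<sigma>] by auto
      moreover have "z = topc C \<alpha> \<sigma>" unfolding z \<sigma>(3)[symmetric] by (rule Lcurve_upper[OF \<sigma>(1,2)])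
      ultimately show ?thesis by blast
    next
      case False
      then have p: "0 \<le> s - pi" "s - pi \<le> pi" "s - pi \<noteq> 0" "s - pi \<le> wpar \<alpha> s1 \<or> wpar \<alpha> s2 \<le> s - pi" using s w by auto
      obtain \<sigma> where \<sigma>: "0 \<le> \<sigma>" "\<sigma> \<le> pi" "wpar \<alpha> \<sigma> = s - pi" by (rule wpar_surj[OF p(1,2)])
      have "\<sigma> \<in> J" unfolding J using p(4) \<sigma> wpar_le_iff[of \<sigma> s1] wpar_le_iff[of s2 \<sigma>] by auto
      moreover have "0 < \<sigma>" using \<sigma>(1,3) p(3) wpar_ends by (cases "\<sigma> = 0") auto
      then have "z = - topc C \<alpha> \<sigma>" using Lcurve_lower[of \<sigma>] \<sigma> unfolding z by simp
      ultimately show ?thesis by blast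
    qed
  next
    fix z assume "z \<in> ?R"
    then consider \<sigma> where "\<sigma> \<in> J" "z = topc C \<alpha> \<sigma>" | \<sigma> where "\<sigma> \<in> J" "z = - topc C \<alpha> \<sigma>" by blast
    then show "z \<in> ?L"
    proof cases
      case (1 \<sigma>)
      then have "0 \<le> \<sigma>" "\<sigma> \<le> pi" "\<sigma> \<le> s1 \<or> s2 \<le> \<sigma>" using s unfolding J by auto
      then show ?thesis
        using Lcurve_upper[of \<sigma>] 1(2) wpar_le_iff[of \<sigma> s1] wpar_le_iff[of s2 \<sigma>] wpar_le_iff[of 0 \<sigma>] wpar_le_iff[of \<sigma> pi] wpar_ends w
        by (intro image_eqI[of _ _ "wpar \<alpha> \<sigma>"]) auto
    next
      case (2 \<sigma>)
      show ?thesis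
      proof (cases "\<sigma> = 0")
        case True
        \<comment> \<open>At \<open>s = pi\<close> the definition of \<open>Lcurve\<close> uses the
          upper branch; its value there is the starting point of the lower branch.\<close>
        have "z = Lcurve \<alpha> pi"
          using Lcurve_upper[of pi] wpar_ends unfolding 2 True by (simp add: top_ends[OF \<alpha>] vec_eq_iff forall_2)
        then show ?thesis using w by (intro image_eqI[of _ _ pi]) auto
      next
        case False
        then have "0 < \<sigma>" "\<sigma> \<le> pi" "\<sigma> \<le> s1 \<or> s2 \<le> \<sigma>" using s 2(1) unfolding J by auto
        then show ?thesis
          using Lcurve_lower[of \<sigma>] 2(2) wpar_le_iff[of \<sigma> s1] wpar_le_iff[of s2 \<sigma>] wpar_le_iff[of 0 \<sigma>] wpar_le_iff[of \<sigma> pi] wpar_ends w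
          by (intro image_eqI[of _ _ "pi + wpar \<alpha> \<sigma>"]) auto
      qed
    qed
  }
qed

end

text \<open>Near the fold both coordinates of the front are monotone, with opposite behaviour of the second
  one on the two branches; hence the double point is unique.\<close>

lemma fold_unique:
  assumes \<alpha>: "0 < \<alpha>" "\<alpha> < pi / 4"
    and pos: "\<And>\<sigma>. \<bar>\<sigma> - \<theta>\<bar> < \<rho> \<Longrightarrow> 0 < \<sigma> \<and> \<sigma> < pi / 2 \<and> 0 < nX C \<alpha> \<sigma> \<and> 0 < nY C \<alpha> \<sigma>
      \<and> 0 < nX C \<alpha> (pi - \<sigma>) \<and> nY C \<alpha> (pi - \<sigma>) < 0"
    and d: "\<bar>\<sigma>d - \<theta>\<bar> < \<rho>" "mu (Nfun C \<alpha>) \<alpha> \<sigma>d = 0"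
    and s: "\<bar>\<sigma> - \<theta>\<bar> < \<rho>" "\<bar>\<tau> - (pi - \<theta>)\<bar> < \<rho>" "topc C \<alpha> \<sigma> = topc C \<alpha> \<tau>"
  shows "\<sigma> = \<sigma>d" "\<tau> = pi - \<sigma>d"
proof -
  let ?x = "topx (Nfun C \<alpha>) \<alpha>" and ?y = "topy (Nfun C \<alpha>) \<alpha>"
  have seg: "\<bar>r - \<theta>\<bar> < \<rho>" if "\<bar>p - \<theta>\<bar> < \<rho>" "\<bar>q - \<theta>\<bar> < \<rho>" "p \<le> r" "r \<le> q" for p q r
    using that by (simp add: abs_less_iff)
  have up: "?x p < ?x q \<and> ?y p < ?y q" if pq: "\<bar>p - \<theta>\<bar> < \<rho>" "\<bar>q - \<theta>\<bar> < \<rho>" "p < q" for p q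
  proof
    show "?x p < ?x q"
    proof (rule DERIV_pos_imp_increasing[OF pq(3)])
      fix r assume "p \<le> r" "r \<le> q"
      from pos[OF seg[OF pq(1,2) this]] have "0 < sin r * nX C \<alpha> r" by (intro mult_pos_pos sin_gt_zero) auto
      then show "\<exists>y. (?x has_real_derivative y) (at r) \<and> 0 < y" using DERIV_topx[OF \<alpha>] by blast
    qed
    show "?y p < ?y q"
    proof (rule DERIV_pos_imp_increasing[OF pq(3)])
      fix r assume "p \<le> r" "r \<le> q"
      from pos[OF seg[OF pq(1,2) this]] show "\<exists>y. (?y has_real_derivative y) (at r) \<and> 0 < y"
        using DERIV_topy[OF \<alpha>] by blast
    qed
  qed
  have down: "?x p < ?x q \<and> ?y q < ?y p"
    if pq: "\<bar>(pi - p) - \<theta>\<bar> < \<rho>" "\<bar>(pi - q) - \<theta>\<bar> < \<rho>" "p < q" for p q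
  proof
    have r: "\<bar>(pi - r) - \<theta>\<bar> < \<rho>" if "p \<le> r" "r \<le> q" for r
      by (rule seg[OF pq(2,1)]) (use that in auto)
    show "?x p < ?x q"
    proof (rule DERIV_pos_imp_increasing[OF pq(3)])
      fix r assume "p \<le> r" "r \<le> q"
      from pos[OF r[OF this]] have "0 < sin r * nX C \<alpha> r" by (intro mult_pos_pos sin_gt_zero) auto
      then show "\<exists>y. (?x has_real_derivative y) (at r) \<and> 0 < y" using DERIV_topx[OF \<alpha>] by blast
    qed
    show "?y q < ?y p"
    proof (rule DERIV_neg_imp_decreasing[OF pq(3)])
      fix r assume "p \<le> r" "r \<le> q"
      from pos[OF r[OF this]] have "nY C \<alpha> r < 0" by simp
      then show "\<exists>y. (?y has_real_derivative y) (at r) \<and> y < 0"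
        using DERIV_topy[OF \<alpha>] by blast
    qed
  qed
  note t = top_level(2,3)[OF \<alpha> d(2)]
  have b: "\<bar>(pi - \<tau>) - \<theta>\<bar> < \<rho>" "\<bar>(pi - (pi - \<sigma>d)) - \<theta>\<bar> < \<rho>"
    using s(2) d(1) by (simp_all add: abs_less_iff)
  have e: "?x \<sigma> = ?x \<tau>" "?y \<sigma> = ?y \<tau>" using s(3) by auto
  show 1: "\<sigma> = \<sigma>d"
  proof (rule ccontr)
    assume "\<sigma> \<noteq> \<sigma>d"
    then consider "\<sigma> < \<sigma>d" | "\<sigma>d < \<sigma>" by linarith
    then show False
    proof cases
      case 1
      from up[OF s(1) d(1) 1] have u: "?x \<tau> < ?x (pi - \<sigma>d)" "?y \<tau> < ?y (pi - \<sigma>d)" using e t by simp_all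
      then show False using down[OF b(2,1)] by (cases "pi - \<sigma>d" \<tau> rule: linorder_cases) (use down[OF b(1,2)] in auto)
    next
      case 2
      from up[OF d(1) s(1) 2] have u: "?x (pi - \<sigma>d) < ?x \<tau>" "?y (pi - \<sigma>d) < ?y \<tau>" using e t by simp_all
      then show False using down[OF b(2,1)] by (cases "pi - \<sigma>d" \<tau> rule: linorder_cases) (use down[OF b(1,2)] in auto)
    qed
  qed
  have "?x \<tau> = ?x (pi - \<sigma>d)" using e t 1 by simp
  then show "\<tau> = pi - \<sigma>d"
    using down[OF b] down[OF b(2,1)] by (cases "pi - \<sigma>d" \<tau> rule: linorder_cases) auto
qed

section \<open>Identification of the double points and passage to the limit\<close>

definition overlap_graph :: "real \<Rightarrow> (real^2) set \<Rightarrow> real^2 \<Rightarrow> real \<Rightarrow> real \<Rightarrow> (real \<Rightarrow> real) \<Rightarrow> bool" where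
  "overlap_graph \<alpha> S p a b g \<longleftrightarrow> 0 < a \<and> synthesis \<alpha> S p (graph g {-a<..<a}) \<and>
     continuous_on {-a<..<a} g \<and> (\<forall>t\<in>{-a<..<a}. \<bar>g t\<bar> \<le> b)"

lemma overlap_graph_exists:
  assumes K: "2 \<le> K" and f: "front_of C \<alpha> K s1 s2"
  shows "\<exists>g. overlap_graph \<alpha> (topc C \<alpha> ` ({0..s1} \<union> {s2..pi}) \<union> uminus ` topc C \<alpha> ` ({0..s1} \<union> {s2..pi}))
     (topc C \<alpha> s1) (sin (2 * C * \<alpha>\<^sup>2) / \<alpha>\<^sup>2) (1000 * K^9 * sqrt \<alpha>) g"
proof -
  interpret front \<alpha> "sin (2 * C * \<alpha>\<^sup>2) / \<alpha>\<^sup>2" K s1 s2 "topx (Nfun C \<alpha>) \<alpha>" "topy (Nfun C \<alpha>) \<alpha>"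
    "\<lambda>\<sigma>. sin \<sigma> * nX C \<alpha> \<sigma>" "nY C \<alpha>" by (rule f)
  show ?thesis
    unfolding overlap_graph_def
    using a_pos front_synthesis[OF assms(1)] gm_cont gm_small by (intro exI[of _ gm]) auto
qed

text \<open>At the limit fold the slope is \<open>pi - 4 * C > 0\<close>. An error below \<kappa>
  cannot change the signs of the speeds in the neighbourhood, and \<eta> tells how precisely
  \<open>sin\<^sup>2\<close> must be known for a parameter to lie in it.\<close>

lemma fold_neighbourhood:
  assumes C: "0 < C" "C < pi / 4"
  obtains \<rho> \<kappa> \<eta> where "0 < \<rho>" "0 < \<kappa>" "0 < \<eta>"
    "\<And>\<sigma>. \<bar>\<sigma> - theta_d C\<bar> < \<rho> \<Longrightarrow> 0 < \<sigma> \<and> \<sigma> < pi / 2 \<and> \<kappa> < slope C \<sigma> \<and> \<kappa> < cos \<sigma> * slope C \<sigma>"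
    "\<And>\<sigma>. 0 < \<sigma> \<Longrightarrow> \<sigma> < pi / 2 \<Longrightarrow> \<bar>(sin \<sigma>)\<^sup>2 - 4 * C / pi\<bar> < \<eta> \<Longrightarrow> \<bar>\<sigma> - theta_d C\<bar> < \<rho>"
proof -
  define \<theta> v where "\<theta> = theta_d C" and "v = 2 * sqrt (C / pi)"
  have v2: "v\<^sup>2 = 4 * C / pi" using C by (simp add: v_def power_mult_distrib)
  have v0: "0 < v" using C by (simp add: v_def)
  have "v\<^sup>2 < 1\<^sup>2" unfolding v2 using C by simp
  then have v1: "v < 1" by (rule power2_less_imp_less) simp
  have "\<theta> = arcsin v" by (simp add: \<theta>_def theta_d_def v_def)
  then have \<theta>: "\<theta> = arcsin v" "sin \<theta> = v" using v0 v1 by simp_all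
  have "\<theta> < pi / 2" "0 < \<theta>" using arcsin_lt_bounded[of v] arcsin_less_arcsin[of 0 v] v0 v1 by (auto simp: \<theta>)
  note th = this
  have sl: "slope C \<theta> = pi - 4 * C" by (simp add: slope_def \<theta>(2) v2)
  have c: "0 < cos \<theta>" using th by (intro cos_gt_zero) auto
  define \<kappa> where "\<kappa> = min (slope C \<theta>) (cos \<theta> * slope C \<theta>) / 2"
  have "0 < slope C \<theta>" "0 < cos \<theta> * slope C \<theta>" using sl c C by auto
  moreover have "0 < min A B / 2 \<and> min A B / 2 < A \<and> min A B / 2 < B" if "0 < A" "0 < B" for A B :: real
    using that by (simp add: min_def)
  ultimately have k0: "0 < \<kappa>" "\<kappa> < slope C \<theta>" "\<kappa> < cos \<theta> * slope C \<theta>" unfolding \<kappa>_def by blast+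
  have "open {\<sigma>. 0 < \<sigma> \<and> \<sigma> < pi / 2 \<and> \<kappa> < slope C \<sigma> \<and> \<kappa> < cos \<sigma> * slope C \<sigma>}"
    unfolding slope_def by (intro open_Collect_conj open_Collect_less continuous_intros)
  moreover have "\<theta> \<in> {\<sigma>. 0 < \<sigma> \<and> \<sigma> < pi / 2 \<and> \<kappa> < slope C \<sigma> \<and> \<kappa> < cos \<sigma> * slope C \<sigma>}" using th k0 by simp
  ultimately obtain \<rho> where \<rho>: "0 < \<rho>" "\<And>\<sigma>. dist \<sigma> \<theta> < \<rho> \<Longrightarrow> 0 < \<sigma> \<and> \<sigma> < pi / 2 \<and> \<kappa> < slope C \<sigma> \<and> \<kappa> < cos \<sigma> * slope C \<sigma>"
    unfolding open_dist by blast
  have "isCont (\<lambda>q. arcsin (sqrt q)) (v\<^sup>2)"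
    using v0 v1 by (intro isCont_o2[OF isCont_real_sqrt isCont_arcsin]) auto
  then obtain \<eta> where \<eta>: "0 < \<eta>" "\<And>q. dist q (v\<^sup>2) < \<eta> \<Longrightarrow> dist (arcsin (sqrt q)) (arcsin (sqrt (v\<^sup>2))) < \<rho>"
    using \<rho>(1) unfolding continuous_at_eps_delta by blast
  show ?thesis
  proof (rule that[OF \<rho>(1) k0(1) \<eta>(1)])
    show "0 < \<sigma> \<and> \<sigma> < pi / 2 \<and> \<kappa> < slope C \<sigma> \<and> \<kappa> < cos \<sigma> * slope C \<sigma>" if "\<bar>\<sigma> - theta_d C\<bar> < \<rho>" for \<sigma>
      using \<rho>(2)[of \<sigma>] that by (simp add: dist_real_def \<theta>_def)
    fix \<sigma> assume s: "0 < \<sigma>" "\<sigma> < pi / 2" "\<bar>(sin \<sigma>)\<^sup>2 - 4 * C / pi\<bar> < \<eta>"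
    have "0 < sin \<sigma>" using s by (intro sin_gt_zero) auto
    then have "arcsin (sqrt ((sin \<sigma>)\<^sup>2)) = \<sigma>" using s by (simp add: arcsin_sin)
    then show "\<bar>\<sigma> - theta_d C\<bar> < \<rho>"
      using \<eta>(2)[of "(sin \<sigma>)\<^sup>2"] s(3) v0 by (simp add: dist_real_def v2[symmetric] \<theta>(1)[symmetric]) (simp add: \<theta>_def)
  qed
qed

lemma tan_sq_tendsto: "((\<lambda>\<alpha>. 5 * (tan \<alpha>)\<^sup>2) \<longlongrightarrow> 0) (at_right (0::real))"
  by real_asymp

lemma width_tendsto: "((\<lambda>\<alpha>. sin (2 * C * \<alpha>\<^sup>2) / \<alpha>\<^sup>2) \<longlongrightarrow> 2 * C) (at_right (0::real))"
proof (rule LIM_zero_cancel, rule Lim_null_comparison)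
  show "\<forall>\<^sub>F \<alpha> in at_right 0. norm (sin (2 * C * \<alpha>\<^sup>2) / \<alpha>\<^sup>2 - 2 * C) \<le> 2 * C\<^sup>2 * \<alpha>\<^sup>2"
    using at_right_0_lt[OF zero_less_one]
  proof eventually_elim
    case (elim \<alpha>)
    have "norm (sin (2 * C * \<alpha>\<^sup>2) / \<alpha>\<^sup>2 - 2 * C) = \<bar>sin (2 * C * \<alpha>\<^sup>2) - 2 * C * \<alpha>\<^sup>2\<bar> / \<alpha>\<^sup>2"
    proof -
      have "sin (2 * C * \<alpha>\<^sup>2) / \<alpha>\<^sup>2 - 2 * C = (sin (2 * C * \<alpha>\<^sup>2) - 2 * C * \<alpha>\<^sup>2) / \<alpha>\<^sup>2"
        using elim by (simp add: diff_divide_distrib)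
      then show ?thesis by simp
    qed
    also have "\<dots> \<le> (2 * C * \<alpha>\<^sup>2)\<^sup>2 / 2 / \<alpha>\<^sup>2" by (intro divide_right_mono sin_diff_self_le) simp
    also have "\<dots> = 2 * C\<^sup>2 * \<alpha>\<^sup>2" using elim by (simp add: power_mult_distrib power2_eq_square)
    finally show ?case .
  qed
  have "((\<lambda>\<alpha>. 2 * C\<^sup>2 * \<alpha>\<^sup>2) \<longlongrightarrow> 2 * C\<^sup>2 * 0\<^sup>2) (at_right (0::real))" by (intro tendsto_intros)
  then show "((\<lambda>\<alpha>. 2 * C\<^sup>2 * \<alpha>\<^sup>2) \<longlongrightarrow> 0) (at_right (0::real))" by simp
qed

text \<open>The parameters of the double points are known only through their limits. Expressed in
  \<sigma> they fall into the neighbourhood of the fold, where \<open>fold_unique\<close> leaves one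
  candidate. Half of \<rho> is reserved for the convergence, the other half for the shift by
  \<open>eps\<close>.\<close>

lemma fold_params:
  assumes \<alpha>: "0 < \<alpha>" "\<alpha> < pi / 4" and k: "odd (kM \<alpha>)" "r_frac \<alpha> = C * \<alpha>"
    and pos: "\<And>\<sigma>. \<bar>\<sigma> - \<theta>\<bar> < \<rho> \<Longrightarrow> 0 < \<sigma> \<and> \<sigma> < pi / 2 \<and> 0 < nX C \<alpha> \<sigma> \<and> 0 < nY C \<alpha> \<sigma>
      \<and> 0 < nX C \<alpha> (pi - \<sigma>) \<and> nY C \<alpha> (pi - \<sigma>) < 0"
    and d: "\<bar>\<sigma>d - \<theta>\<bar> < \<rho>" "mu (Nfun C \<alpha>) \<alpha> \<sigma>d = 0" and t: "5 * (tan \<alpha>)\<^sup>2 < \<rho> / 2"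
    and s: "\<bar>s - \<theta>\<bar> < \<rho> / 2" "\<bar>s' - (pi - \<theta>)\<bar> < \<rho> / 2"
    and L: "Lcurve \<alpha> s = Lcurve \<alpha> s' \<or> Lcurve \<alpha> (pi + s) = Lcurve \<alpha> (pi + s')"
  shows "s = wpar \<alpha> \<sigma>d" "s' = wpar \<alpha> (pi - \<sigma>d)"
proof -
  have near: "\<bar>wpar \<alpha> \<sigma> - \<sigma>\<bar> < \<rho> / 2" if "0 \<le> \<sigma>" "\<sigma> \<le> pi" for \<sigma>
  proof -
    have "(tan \<alpha>)\<^sup>2 * sin \<sigma> \<le> (tan \<alpha>)\<^sup>2 * 1" by (intro mult_left_mono) auto
    then show ?thesis using eps_le[OF \<alpha> that] t by (simp add: wpar_def)
  qed
  have \<rho>: "0 < \<rho>" using d(1) abs_ge_zero[of "\<sigma>d - \<theta>"] by linarith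
  have "0 < s \<and> s < pi / 2" using pos[of s] s(1) \<rho> by auto
  then have "0 \<le> s" "s \<le> pi" by auto
  then obtain \<sigma> where \<sigma>: "0 \<le> \<sigma>" "\<sigma> \<le> pi" "wpar \<alpha> \<sigma> = s" by (rule wpar_surj[OF \<alpha> k])
  have "\<bar>(pi - s') - \<theta>\<bar> < \<rho>" using s(2) \<rho> by linarith
  then have "0 \<le> s'" "s' \<le> pi" using pos[of "pi - s'"] by auto
  then obtain \<tau> where \<tau>: "0 \<le> \<tau>" "\<tau> \<le> pi" "wpar \<alpha> \<tau> = s'" by (rule wpar_surj[OF \<alpha> k])
  have n: "\<bar>\<sigma> - \<theta>\<bar> < \<rho>" "\<bar>\<tau> - (pi - \<theta>)\<bar> < \<rho>" "\<bar>(pi - \<tau>) - \<theta>\<bar> < \<rho>"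
    using near[OF \<sigma>(1,2)] near[OF \<tau>(1,2)] s unfolding \<sigma>(3) \<tau>(3) by linarith+
  have p: "0 < \<sigma>" "0 < \<tau>" using pos[OF n(1)] pos[OF n(3)] by auto
  have "topc C \<alpha> \<sigma> = topc C \<alpha> \<tau>"
    using L
  proof
    assume "Lcurve \<alpha> s = Lcurve \<alpha> s'"
    then show ?thesis
      unfolding \<sigma>(3)[symmetric] \<tau>(3)[symmetric] Lcurve_upper[OF \<alpha> k \<sigma>(1,2)] Lcurve_upper[OF \<alpha> k \<tau>(1,2)] .
  next
    assume "Lcurve \<alpha> (pi + s) = Lcurve \<alpha> (pi + s')"
    then have "- topc C \<alpha> \<sigma> = - topc C \<alpha> \<tau>"
      unfolding \<sigma>(3)[symmetric] \<tau>(3)[symmetric] Lcurve_lower[OF \<alpha> k p(1) \<sigma>(2)] Lcurve_lower[OF \<alpha> k p(2) \<tau>(2)] .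
    then show ?thesis by (simp only: neg_equal_iff_equal)
  qed
  from fold_unique[OF \<alpha> pos d n(1,2) this] have "\<sigma> = \<sigma>d" "\<tau> = pi - \<sigma>d" by blast+
  then show "s = wpar \<alpha> \<sigma>d" "s' = wpar \<alpha> (pi - \<sigma>d)" using \<sigma>(3) \<tau>(3) by auto
qed

text \<open>Rescaling by the half widths \<open>a k\<close> puts all curves over the same open
  interval.\<close>

lemma uniform_limit_graph:
  assumes a: "a \<longlonglongrightarrow> c" and b: "b \<longlonglongrightarrow> 0"
    and g: "\<forall>\<^sub>F k in sequentially. 0 < a k \<and> (\<forall>t\<in>{- a k<..<a k}. \<bar>g k t\<bar> \<le> b k)"
  shows "uniform_limit {-1<..<1} (\<lambda>k t. pt (a k * t) (g k (a k * t))) (\<lambda>t. pt (c * t) 0) sequentially"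
proof (rule uniform_limitI)
  fix e :: real assume e: "0 < e"
  have "\<forall>\<^sub>F k in sequentially. dist (a k) c < e / 2" by (rule tendstoD[OF a]) (use e in simp)
  moreover have "\<forall>\<^sub>F k in sequentially. dist (b k) 0 < e / 2" by (rule tendstoD[OF b]) (use e in simp)
  ultimately show "\<forall>\<^sub>F k in sequentially. \<forall>t\<in>{-1<..<1}. dist (pt (a k * t) (g k (a k * t))) (pt (c * t) 0) < e"
    using g
  proof eventually_elim
    case (elim k)
    show ?case
    proof
      fix t :: real assume t: "t \<in> {-1<..<1}"
      have "a k * t < a k * 1" "a k * (- 1) < a k * t" by (rule mult_strict_left_mono; use elim t in simp)+
      then have 1: "\<bar>g k (a k * t)\<bar> \<le> b k" using elim by simp
      have "\<bar>(a k - c) * t\<bar> \<le> \<bar>a k - c\<bar> * 1" unfolding abs_mult using t by (intro mult_left_mono) auto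
      then have 2: "\<bar>a k * t - c * t\<bar> \<le> \<bar>a k - c\<bar>" by (simp add: left_diff_distrib)
      have "dist (pt (a k * t) (g k (a k * t))) (pt (c * t) 0) \<le> \<bar>a k * t - c * t\<bar> + \<bar>g k (a k * t)\<bar>"
        using norm_le_l1_cart[of "pt (a k * t) (g k (a k * t)) - pt (c * t) 0"] by (simp add: dist_norm sum_2)
      also have "\<dots> < e" using 1 2 elim by (simp add: dist_real_def)
      finally show "dist (pt (a k * t) (g k (a k * t))) (pt (c * t) 0) < e" .
    qed
  qed
qed

theorem theorem2:
  fixes C :: real and \<alpha> :: "nat \<Rightarrow> real" and s1p s2p s1m s2m :: "nat \<Rightarrow> real"
    and \<sigma> :: "nat \<Rightarrow> (real^2) set"
  assumes "C > 0" and "C \<noteq> pi / 4"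
    and "\<And>k. 0 < \<alpha> k \<and> \<alpha> k < pi / 4"
    and "\<alpha> \<longlonglongrightarrow> 0"
    and "\<And>k. odd (kM (\<alpha> k))"
    and "\<And>k. r_frac (\<alpha> k) = C * \<alpha> k"
    and "C < pi / 4 \<Longrightarrow> s1p \<longlonglongrightarrow> theta_d C"
    and "C < pi / 4 \<Longrightarrow> s2p \<longlonglongrightarrow> pi - theta_d C"
    and "C < pi / 4 \<Longrightarrow> s1m \<longlonglongrightarrow> pi + theta_d C"
    and "C < pi / 4 \<Longrightarrow> s2m \<longlonglongrightarrow> 2 * pi - theta_d C"
    and "C < pi / 4 \<Longrightarrow> \<forall>\<^sub>F k in sequentially. Lcurve (\<alpha> k) (s1p k) = Lcurve (\<alpha> k) (s2p k)"
    and "C < pi / 4 \<Longrightarrow> \<forall>\<^sub>F k in sequentially. Lcurve (\<alpha> k) (s1m k) = Lcurve (\<alpha> k) (s2m k)"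
    and "\<And>k. \<sigma> k = sigma_curve C (\<alpha> k) (s1p k) (s2p k) (s1m k) (s2m k)"
  shows "\<exists>Seg. converges_C0 Seg (seg_param C) \<and>
    (\<forall>\<^sub>F k in sequentially.
       overlap_curve (\<alpha> k) (\<sigma> k) (Seg k) \<and>
       (\<forall>p\<in>inside (\<sigma> k). optimal_trajectories (\<alpha> k) (\<sigma> k) p \<noteq> {}) \<and>
       (\<exists>A B. above_below (\<sigma> k) (Seg k) A B \<and>
          (\<forall>p\<in>A. \<forall>T z u. time_optimal (\<alpha> k) (\<sigma> k) p T z u \<longrightarrow>
             (AE t in lebesgue_on {0..T}. u t = - 1)) \<and>
          (\<forall>p\<in>B. \<forall>T z u. time_optimal (\<alpha> k) (\<sigma> k) p T z u \<longrightarrow>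
             (AE t in lebesgue_on {0..T}. u t = 1))) \<and>
       0 \<in> inside (\<sigma> k) \<and>
       card (optimal_trajectories (\<alpha> k) (\<sigma> k) 0) = 2 \<and>
       (C < pi / 4 \<longrightarrow>
          (\<exists>x y. optimal_trajectories (\<alpha> k) (\<sigma> k) 0 = {x, y} \<and>
             snd x 0 = Lcurve (\<alpha> k) (s1p k) \<and> snd y 0 = Lcurve (\<alpha> k) (s1m k))))"
proof -
  have \<alpha>: "0 < \<alpha> k" "\<alpha> k < pi / 4" for k using assms(3) by auto
  note kM = assms(5,6)
  obtain K where K: "2 \<le> K" and E: "\<forall>\<^sub>F \<alpha> in at_right 0. 0 < \<alpha> \<and> \<alpha> < pi / 4 \<and>
    (\<forall>\<sigma>\<in>{0..pi}. \<bar>nX C \<alpha> \<sigma> - slope C \<sigma>\<bar> \<le> K * \<alpha> \<and> \<bar>nY C \<alpha> \<sigma> - cos \<sigma> * slope C \<sigma>\<bar> \<le> K * \<alpha>) \<and>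
    (C < pi / 4 \<longrightarrow> (\<exists>\<sigma>d. 0 < \<sigma>d \<and> \<sigma>d < pi / 2 \<and> \<bar>(sin \<sigma>d)\<^sup>2 - 4 * C / pi\<bar> \<le> K * \<alpha> \<and>
       mu (Nfun C \<alpha>) \<alpha> \<sigma>d = 0 \<and> front_of C \<alpha> K \<sigma>d (pi - \<sigma>d))) \<and>
    (pi / 4 < C \<longrightarrow> (\<exists>s. 0 < s \<and> s < pi \<and> front_of C \<alpha> K s s))"
    by (rule eventually_approximation[OF assms(1,2)])
  have lim: "filterlim \<alpha> (at_right 0) sequentially"
    by (rule tendsto_imp_filterlim_at_right[OF assms(4)]) (simp add: \<alpha>)
  note E' = eventually_compose_filterlim[OF E lim]
  define a b where "a k = sin (2 * C * (\<alpha> k)\<^sup>2) / (\<alpha> k)\<^sup>2" and "b k = 1000 * K^9 * sqrt (\<alpha> k)" for k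
  have a: "a \<longlonglongrightarrow> 2 * C" unfolding a_def by (rule filterlim_compose[OF width_tendsto lim])
  have "b \<longlonglongrightarrow> 1000 * K^9 * sqrt 0" unfolding b_def by (intro tendsto_intros assms(4))
  then have b: "b \<longlonglongrightarrow> 0" by simp
  have "\<forall>\<^sub>F k in sequentially. \<exists>g p. overlap_graph (\<alpha> k) (\<sigma> k) p (a k) (b k) g \<and>
    (C < pi / 4 \<longrightarrow> p = Lcurve (\<alpha> k) (s1p k) \<and> - p = Lcurve (\<alpha> k) (s1m k))"
  proof (cases "C < pi / 4")
    case True
    obtain \<rho> \<kappa> \<eta> where pos: "0 < \<rho>" "0 < \<kappa>" "0 < \<eta>"
      and N: "\<And>\<sigma>. \<bar>\<sigma> - theta_d C\<bar> < \<rho> \<Longrightarrow> 0 < \<sigma> \<and> \<sigma> < pi / 2 \<and> \<kappa> < slope C \<sigma> \<and> \<kappa> < cos \<sigma> * slope C \<sigma>"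
      and near: "\<And>\<sigma>. 0 < \<sigma> \<Longrightarrow> \<sigma> < pi / 2 \<Longrightarrow> \<bar>(sin \<sigma>)\<^sup>2 - 4 * C / pi\<bar> < \<eta> \<Longrightarrow> \<bar>\<sigma> - theta_d C\<bar> < \<rho>"
      by (rule fold_neighbourhood[OF assms(1) True]) blast
    have "(\<lambda>k. K * \<alpha> k) \<longlonglongrightarrow> K * 0" by (intro tendsto_intros assms(4))
    \<comment> \<open>The bound by \<kappa> transfers the signs of the limit speeds to the speeds
      for \<open>\<alpha> k\<close>; the bound by \<eta> puts the fold for \<open>\<alpha> k\<close>
      into the neighbourhood of the limit fold.\<close>
    then have "\<forall>\<^sub>F k in sequentially. K * \<alpha> k < min \<kappa> \<eta>" by (rule order_tendstoD(2)) (use pos in simp)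
    moreover have "\<forall>\<^sub>F k in sequentially. 5 * (tan (\<alpha> k))\<^sup>2 < \<rho> / 2"
      by (rule order_tendstoD(2)[OF filterlim_compose[OF tan_sq_tendsto lim]]) (use pos in simp)
    moreover have "\<forall>\<^sub>F k in sequentially. dist (s1p k) (theta_d C) < \<rho> / 2"
      "\<forall>\<^sub>F k in sequentially. dist (s2p k) (pi - theta_d C) < \<rho> / 2"
      "\<forall>\<^sub>F k in sequentially. dist (s1m k) (pi + theta_d C) < \<rho> / 2"
      "\<forall>\<^sub>F k in sequentially. dist (s2m k) (2 * pi - theta_d C) < \<rho> / 2"
      by (rule tendstoD[OF assms(7)[OF True]] tendstoD[OF assms(8)[OF True]] tendstoD[OF assms(9)[OF True]]
          tendstoD[OF assms(10)[OF True]], use pos in simp)+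
    ultimately show ?thesis
      using E' assms(11,12)[OF True]
    proof eventually_elim
      case (elim k)
      from elim(7) True obtain \<sigma>d where \<sigma>d: "0 < \<sigma>d" "\<sigma>d < pi / 2" "\<bar>(sin \<sigma>d)\<^sup>2 - 4 * C / pi\<bar> \<le> K * \<alpha> k"
        "mu (Nfun C (\<alpha> k)) (\<alpha> k) \<sigma>d = 0" "front_of C (\<alpha> k) K \<sigma>d (pi - \<sigma>d)" by blast
      have d: "\<bar>\<sigma>d - theta_d C\<bar> < \<rho>" using near[OF \<sigma>d(1,2)] \<sigma>d(3) elim(1) by simp
      have P: "0 < \<sigma> \<and> \<sigma> < pi / 2 \<and> 0 < nX C (\<alpha> k) \<sigma> \<and> 0 < nY C (\<alpha> k) \<sigma>
        \<and> 0 < nX C (\<alpha> k) (pi - \<sigma>) \<and> nY C (\<alpha> k) (pi - \<sigma>) < 0" if "\<bar>\<sigma> - theta_d C\<bar> < \<rho>" for \<sigma>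
      proof -
        have n: "0 < \<sigma>" "\<sigma> < pi / 2" "\<kappa> < slope C \<sigma>" "\<kappa> < cos \<sigma> * slope C \<sigma>" using N[OF that] by auto
        have r: "slope C (pi - \<sigma>) = slope C \<sigma>" "cos (pi - \<sigma>) * slope C (pi - \<sigma>) = - (cos \<sigma> * slope C \<sigma>)"
          by (simp_all add: slope_def)
        have j: "\<sigma> \<in> {0..pi}" "pi - \<sigma> \<in> {0..pi}" using n by auto
        have A: "\<bar>nX C (\<alpha> k) \<tau> - slope C \<tau>\<bar> < \<kappa>" "\<bar>nY C (\<alpha> k) \<tau> - cos \<tau> * slope C \<tau>\<bar> < \<kappa>" if "\<tau> \<in> {0..pi}" for \<tau>
          using elim(1,7) that by fastforce+
        show ?thesis using A[OF j(1)] A[OF j(2), unfolded r] n by (simp add: abs_less_iff)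
      qed
      note fp = fold_params[OF \<alpha> kM P d \<sigma>d(4) elim(2)]
      have s: "s1p k = wpar (\<alpha> k) \<sigma>d" "s2p k = wpar (\<alpha> k) (pi - \<sigma>d)"
        by (rule fp[of "s1p k" "s2p k"]; use elim(3,4,8) in \<open>simp add: dist_real_def\<close>)+
      \<comment> \<open>The lower half is the mirrored upper half with its parameter shifted by
        \<open>pi\<close>, so the same uniqueness applies after subtracting
        \<open>pi\<close>.\<close>
      have "s1m k - pi = wpar (\<alpha> k) \<sigma>d" "s2m k - pi = wpar (\<alpha> k) (pi - \<sigma>d)"
        by (rule fp[of "s1m k - pi" "s2m k - pi"]; use elim(5,6,9) in \<open>simp add: dist_real_def algebra_simps\<close>)+
      then have m: "s1m k = pi + wpar (\<alpha> k) \<sigma>d" "s2m k = pi + wpar (\<alpha> k) (pi - \<sigma>d)" by simp_all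
      have \<sigma>: "\<sigma> k = topc C (\<alpha> k) ` ({0..\<sigma>d} \<union> {pi - \<sigma>d..pi}) \<union> uminus ` topc C (\<alpha> k) ` ({0..\<sigma>d} \<union> {pi - \<sigma>d..pi})"
        unfolding assms(13) sigma_curve_def s m using True \<sigma>d(1,2)
        by (simp only: if_True, intro Lcurve_image[OF \<alpha> kM]) auto
      have "topc C (\<alpha> k) \<sigma>d = Lcurve (\<alpha> k) (s1p k)" "- topc C (\<alpha> k) \<sigma>d = Lcurve (\<alpha> k) (s1m k)"
        unfolding s m using Lcurve_upper[OF \<alpha> kM, of \<sigma>d k] Lcurve_lower[OF \<alpha> kM, of \<sigma>d k] \<sigma>d(1,2) by simp_all
      then show ?case
        using overlap_graph_exists[OF K \<sigma>d(5)] unfolding \<sigma> a_def b_def by blast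
    qed
  next
    case False
    then have C4: "pi / 4 < C" using assms(2) by simp
    show ?thesis
      using E'
    proof eventually_elim
      case (elim k)
      with C4 obtain s where s: "0 < s" "s < pi" "front_of C (\<alpha> k) K s s" by blast
      have w: "0 < wpar (\<alpha> k) s" "wpar (\<alpha> k) s < pi"
        using wpar_less[OF \<alpha> kM s(1)] wpar_less[OF \<alpha> kM s(2)] wpar_ends[OF \<alpha> kM] by simp_all
      \<comment> \<open>The complete parameter interval is written with the artificial cut, to match
        \<open>Lcurve_image\<close>.\<close>
      then have "{0..2 * pi} = {0..wpar (\<alpha> k) s} \<union> {wpar (\<alpha> k) s..pi + wpar (\<alpha> k) s} \<union> {pi + wpar (\<alpha> k) s..2 * pi}"
        by auto
      then have \<sigma>: "\<sigma> k = topc C (\<alpha> k) ` ({0..s} \<union> {s..pi}) \<union> uminus ` topc C (\<alpha> k) ` ({0..s} \<union> {s..pi})"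
        unfolding assms(13) sigma_curve_def using False Lcurve_image[OF \<alpha> kM s(1,2) s(1,2) refl] by simp
      show ?case
        using overlap_graph_exists[OF K s(3)] False unfolding \<sigma> a_def b_def by blast
    qed
  qed
  \<comment> \<open>\<open>eventually_ex\<close> chooses one graph for each large index, so that the
    graphs form a sequence.\<close>
  then obtain g where g: "\<forall>\<^sub>F k in sequentially. \<exists>p. overlap_graph (\<alpha> k) (\<sigma> k) p (a k) (b k) (g k) \<and>
    (C < pi / 4 \<longrightarrow> p = Lcurve (\<alpha> k) (s1p k) \<and> - p = Lcurve (\<alpha> k) (s1m k))"
    unfolding eventually_ex by blast
  define Seg where "Seg k = graph (g k) {- a k<..<a k}" for k
  have "converges_C0 Seg (seg_param C)"
    unfolding converges_C0_def
  proof (intro exI conjI)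
    show "uniform_limit {-1<..<1} (\<lambda>k t. pt (a k * t) (g k (a k * t))) (seg_param C) sequentially"
      unfolding seg_param_def[abs_def] using g
      by (intro uniform_limit_graph[OF a b]) (auto simp: overlap_graph_def elim!: eventually_mono)
    show "\<forall>\<^sub>F k in sequentially. continuous_on {-1<..<1} (\<lambda>t. pt (a k * t) (g k (a k * t))) \<and>
      inj_on (\<lambda>t. pt (a k * t) (g k (a k * t))) {-1<..<1} \<and> (\<lambda>t. pt (a k * t) (g k (a k * t))) ` {-1<..<1} = Seg k"
      using g
    proof eventually_elim
      case (elim k)
      then have ak: "0 < a k" and c: "continuous_on {- a k<..<a k} (g k)" by (auto simp: overlap_graph_def)
      have im: "(\<lambda>t. a k * t) ` {-1<..<1} = {- a k<..<a k}"
      proof (intro equalityI subsetI)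
        fix t assume "t \<in> {- a k<..<a k}"
        then have "t / a k \<in> {-1<..<1}" "t = a k * (t / a k)" using ak by (auto simp: field_simps)
        then show "t \<in> (\<lambda>t. a k * t) ` {-1<..<1}" by blast
      next
        fix t assume "t \<in> (\<lambda>t. a k * t) ` {-1<..<1}"
        then obtain r where r: "- 1 < r" "r < 1" "t = a k * r" by auto
        have "a k * r < a k * 1" "a k * (- 1) < a k * r" by (rule mult_strict_left_mono; use ak r in simp)+
        then show "t \<in> {- a k<..<a k}" using r(3) by simp
      qed
      have "continuous_on {-1<..<1} (\<lambda>t. pt (a k * t) (g k (a k * t)))"
        by (intro continuous_intros continuous_on_compose2[OF c]) (use im in auto)
      moreover have "inj_on (\<lambda>t. pt (a k * t) (g k (a k * t))) {-1<..<1}" using ak by (auto simp: inj_on_def)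
      moreover have "(\<lambda>t. pt (a k * t) (g k (a k * t))) ` {-1<..<1} = Seg k"
        unfolding Seg_def graph_def im[symmetric] image_image ..
      ultimately show ?case by blast
    qed
  qed
  moreover have "\<forall>\<^sub>F k in sequentially.
       overlap_curve (\<alpha> k) (\<sigma> k) (Seg k) \<and>
       (\<forall>p\<in>inside (\<sigma> k). optimal_trajectories (\<alpha> k) (\<sigma> k) p \<noteq> {}) \<and>
       (\<exists>A B. above_below (\<sigma> k) (Seg k) A B \<and>
          (\<forall>p\<in>A. \<forall>T z u. time_optimal (\<alpha> k) (\<sigma> k) p T z u \<longrightarrow>
             (AE t in lebesgue_on {0..T}. u t = - 1)) \<and>
          (\<forall>p\<in>B. \<forall>T z u. time_optimal (\<alpha> k) (\<sigma> k) p T z u \<longrightarrow>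
             (AE t in lebesgue_on {0..T}. u t = 1))) \<and>
       0 \<in> inside (\<sigma> k) \<and>
       card (optimal_trajectories (\<alpha> k) (\<sigma> k) 0) = 2 \<and>
       (C < pi / 4 \<longrightarrow>
          (\<exists>x y. optimal_trajectories (\<alpha> k) (\<sigma> k) 0 = {x, y} \<and>
             snd x 0 = Lcurve (\<alpha> k) (s1p k) \<and> snd y 0 = Lcurve (\<alpha> k) (s1m k)))"
    using g
  proof eventually_elim
    case (elim k)
    then obtain p where p: "synthesis (\<alpha> k) (\<sigma> k) p (Seg k)"
      "C < pi / 4 \<Longrightarrow> p = Lcurve (\<alpha> k) (s1p k)" "C < pi / 4 \<Longrightarrow> - p = Lcurve (\<alpha> k) (s1m k)"
      unfolding overlap_graph_def Seg_def by blast
    then show ?case unfolding synthesis_def by metis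
  qed
  ultimately show ?thesis by blast
qed

end
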